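(* Let $A$ be a finite-dimensional $\mathbb{C}$-algebra of finite global dimension. For any $\mathbf d\in K_0(\mathcal D^b(A))$, let $\phi_A:\mathcal P^b(A,\mathbf d)\to\mathcal C^b(A,\mathbf d)$ be the natural embedding. Then there exists a map $\phi'_A:\mathcal C^b(A,\mathbf d)\to\mathcal P^b(A,\mathbf d)$ such that for any dimension vector sequence $\underline{\mathbf d}\in\underline{\dim}^{-1}(\mathbf d)$ the restriction $\phi'_A|_{\mathcal C^b(A,\underline{\mathbf d})}$ is a constructible map, and the quotient maps induced by $\phi_A$ and $\phi'_A$ between $\mathcal Q^b(A,\mathbf d)$ and $\mathcal{QP}^b(A,\mathbf d)$ are inverse to each other.
   Context: Write $A=\mathbb{C}Q/J$ with $Q$ a finite quiver and $J$ an admissible ideal generated by a set $R$ of relations; modules are finite-dimensional. For a dimension vector $\underline d$, $\mathbb{E}_{\underline d}(Q,R)$ is the affine variety of representations $x$ of $Q$ on $\mathbb{C}^{\underline d}=\bigoplus_{i\in Q_0}\mathbb{C}^{d_i}$ satisfying $R$, and $M(x)=(\mathbb{C}^{\underline d},x)$ is the corresponding $A$-module. Varieties of complexes. For a sequence $\underline{\mathbf d}=(\underline d_i)_{i\in\mathbb{Z}}$ of dimension vectors with finitely many non-zero entries, $\mathcal C^b(A,\underline{\mathbf d})$ is the closed subset of $\prod_i\mathbb{E}_{\underline d_i}(Q,R)\times\prod_i\mathrm{Hom}_{\mathbb{C}}(\mathbb{C}^{\underline d_i},\mathbb{C}^{\underline d_{i+1}})$ of all $(x_i,\partial_i)_i$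 with $\partial_i:M(x_i)\to M(x_{i+1})$ an $A$-module map and $\partial_{i+1}\partial_i=0$. The canonical map $\underline{\dim}$ sends $\underline{\mathbf d}$ to the class in $K_0(\mathcal D^b(A))$ of complexes with dimension vector sequence $\underline{\mathbf d}$. Fix a complete set $P_1,\dots,P_l$ of indecomposable projective $A$-modules. A projective dimension sequence is $\underline{\mathbf e}=(\underline e_i)_{i\in\mathbb Z}$, $\underline e_i=(e^i_1,\dots,e^i_l)\in\mathbb{N}^l$, with finitely many non-zero entries; put $\underline{\mathbf d}(\underline{\mathbf e})=(\underline\dim \bigoplus_j e^i_jP_j)_i$. $\mathcal P^b(A,\underline{\mathbf e})$ is the locally closed subset of $\mathcal C^b(A,\underline{\mathbf d}(\underline{\mathbf e}))$ of those $(x_i,\partial_i)_i$ with $M(x_i)\cong\bigoplus_je^i_jP_j$ for all $i$. Direct limits. Write $\underline{\mathbf d}_1\le\underline{\mathbf d}_2$ in $\underline{\dim}^{-1}(\mathbf d)$ if there is a complex $M^\bullet(\underline{\mathbf d}_1,\underline{\mathbf d}_2)\in\mathcal C^b(A,\underline{\mathbf d}_2-\underline{\mathbf d}_1)$ that is a direct sum of shifted copies of complexes $\cdots\to0\to S\xrightarrow{1}S\to0\to\cdots$ with $S$ simple; fix such complexes compatibly, $M^\bullet(\underline{\mathbf d}_1,\underline{\mathbf d}_2)\oplus M^\bullet(\underline{\mathbf d}_2,\underline{\mathbf d}_3)=M^\bullet(\underline{\mathbf d}_1,\underline{\mathbf d}_3)$. Put $\mathcal C^b(A,\mathbf d)=\varinjlim_{\underline{\mathbf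 d}\in\underline\dim^{-1}(\mathbf d)}\mathcal C^b(A,\underline{\mathbf d})$ with transition maps $X^\bullet\mapsto X^\bullet\oplus M^\bullet(\underline{\mathbf d}_1,\underline{\mathbf d}_2)$. Similarly, for projective dimension sequences with $\underline{\mathbf d}(\underline{\mathbf e})\in\underline\dim^{-1}(\mathbf d)$, write $\underline{\mathbf e}_1\le\underline{\mathbf e}_2$ if there is a contractible (i.e. acyclic) projective complex $P^\bullet(\underline{\mathbf e}_1,\underline{\mathbf e}_2)\in\mathcal P^b(A,\underline{\mathbf e}_2-\underline{\mathbf e}_1)$; fix such complexes compatibly with direct sums, $P^\bullet(\underline{\mathbf e}_1,\underline{\mathbf e}_2)\oplus P^\bullet(\underline{\mathbf e}_2,\underline{\mathbf e}_3)=P^\bullet(\underline{\mathbf e}_1,\underline{\mathbf e}_3)$, and put $\mathcal P^b(A,\mathbf d)=\varinjlim\mathcal P^b(A,\underline{\mathbf e})$ with transition maps $X^\bullet\mapsto X^\bullet\oplus P^\bullet(\underline{\mathbf e}_1,\underline{\mathbf e}_2)$. The natural embedding $\phi_A$ regards a bounded complex of projective modules as a bounded complex of modules (induced by $\mathcal P^b(A,\underline{\mathbf e})\subset\mathcal C^b(A,\underline{\mathbf d}(\underline{\mathbf e}))$). Quotients. $\mathcal Q^b(A,\mathbf d)=\mathcal C^b(A,\mathbf d)/\sim$ and $\mathcal{QP}^b(A,\mathbf d)=\mathcal P^b(A,\mathbf d)/\sim$, where $x\sim y$ iff the corresponding complexes are quasi-isomorphic (isomorphic in $\mathcal D^b(A)$).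 Constructible map. A map $f:X\to Y$ of varieties is constructible if there is a finite stratification $X=\bigsqcup_i\mathcal O_i$ into constructible subsets with each $f|_{\mathcal O_i}$ a morphism of varieties; a map from a variety into $\mathcal P^b(A,\mathbf d)$ is constructible if it is a constructible map into some $\mathcal P^b(A,\underline{\mathbf e})$ followed by the canonical map to the direct limit. $\phi'_A|_{\mathcal C^b(A,\underline{\mathbf d})}$ means the composite of $\phi'_A$ with the canonical map $\mathcal C^b(A,\underline{\mathbf d})\to\mathcal C^b(A,\mathbf d)$.
   Formalization: Compatibility of the chosen complexes is read up to isomorphism, with identifications making the transition maps a strict direct system; since the natural embedding is not single-valued on the limit, the result is proved for every map sending a point to the class of one of its representing complexes. *)

theory Defs
  imports
    Complex_Main
    "HOL-Algebra.Ideal"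
    "HOL-Algebra.Coset"
    "HOL-Algebra.Generated_Groups"
    "HOL-Algebra.Free_Abelian_Groups"
    "Graph_Theory.Arc_Walk"
    "Jordan_Normal_Form.Matrix_Kernel"
begin

section \<open>Bound quivers\<close>

text \<open>
  A path is a pair of its starting vertex and its list of arcs; the vertex is needed for the
  trivial paths.  Paths are read from left to right, so the path algebra below is the opposite
  of the one in which arrows compose like maps; its two-sided ideals are the same.
\<close>

definition quiver_paths :: "('v, 'a) pre_digraph \<Rightarrow> ('v \<times> 'a list) set" where
  "quiver_paths Q = {(u, p). \<exists>v. pre_digraph.awalk Q u p v}"

definition path_algebra :: "('v, 'a) pre_digraph \<Rightarrow> ('v \<times> 'a list \<Rightarrow> complex) ring" where
  "path_algebra Q =
    \<lparr> carrier = {f. finite {p. f p \<noteq> 0} \<and> {p. f p \<noteq> 0} \<subseteq> quiver_paths Q},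
      monoid.mult = (\<lambda>f g (u, p). \<Sum>k\<le>length p.
         f (u, take k p) * g (pre_digraph.awlast Q u (take k p), drop k p)),
      monoid.one = (\<lambda>(u, p). if u \<in> verts Q \<and> p = [] then 1 else 0),
      ring.zero = (\<lambda>_. 0),
      ring.add = (\<lambda>f g p. f p + g p) \<rparr>"

text \<open>The \<open>m\<close>-th power of the arrow ideal is spanned by the paths of length at least \<open>m\<close>.\<close>

definition arrow_ideal_power ::
  "('v, 'a) pre_digraph \<Rightarrow> nat \<Rightarrow> ('v \<times> 'a list \<Rightarrow> complex) set" where
  "arrow_ideal_power Q m =
    {f \<in> carrier (path_algebra Q). \<forall>p. f p \<noteq> 0 \<longrightarrow> m \<le> length (snd p)}"

definition admissible_ideal ::
  "('v, 'a) pre_digraph \<Rightarrow> ('v \<times> 'a list \<Rightarrow> complex) set \<Rightarrow> bool" where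
  "admissible_ideal Q J \<longleftrightarrow> ideal J (path_algebra Q) \<and> J \<subseteq> arrow_ideal_power Q 2 \<and>
     (\<exists>m\<ge>2. arrow_ideal_power Q m \<subseteq> J)"

definition quiver_relation ::
  "('v, 'a) pre_digraph \<Rightarrow> ('v \<times> 'a list \<Rightarrow> complex) \<Rightarrow> bool" where
  "quiver_relation Q \<rho> \<longleftrightarrow> \<rho> \<in> carrier (path_algebra Q) \<and>
     (\<exists>u v. \<forall>w p. \<rho> (w, p) \<noteq> 0 \<longrightarrow> w = u \<and> pre_digraph.awalk Q u p v)"

locale bound_quiver = fin_digraph Q
  for Q :: "('v, 'a) pre_digraph" +
  fixes R :: "('v \<times> 'a list \<Rightarrow> complex) set"
  assumes relations: "\<rho> \<in> R \<Longrightarrow> quiver_relation Q \<rho>"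
    and admissible: "admissible_ideal Q (Idl\<^bsub>path_algebra Q\<^esub> R)"

section \<open>Modules as representations\<close>

text \<open>
  Outside the quiver, spaces and matrices are required to be zero, so that a representation is
  determined by its values on the quiver.
\<close>

record ('v, 'a) rep =
  rdim :: "'v \<Rightarrow> nat"
  rmap :: "'a \<Rightarrow> complex mat"

primrec path_mat ::
  "('v, 'a) pre_digraph \<Rightarrow> ('v, 'a) rep \<Rightarrow> 'v \<Rightarrow> 'a list \<Rightarrow> complex mat" where
  "path_mat Q V u [] = 1\<^sub>m (rdim V u)"
| "path_mat Q V u (a # p) = path_mat Q V (head Q a) p * rmap V a"

definition relation_mat :: "('v, 'a) pre_digraph \<Rightarrow> ('v, 'a) rep \<Rightarrow>
    ('v \<times> 'a list \<Rightarrow> complex) \<Rightarrow> 'v \<Rightarrow> 'v \<Rightarrow> complex mat" where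
  "relation_mat Q V \<rho> u v = mat (rdim V v) (rdim V u) (\<lambda>rc.
     \<Sum>p\<in>{p. \<rho> (u, p) \<noteq> 0 \<and> pre_digraph.awalk Q u p v}. \<rho> (u, p) * (path_mat Q V u p $$ rc))"

definition is_rep ::
  "('v, 'a) pre_digraph \<Rightarrow> ('v \<times> 'a list \<Rightarrow> complex) set \<Rightarrow> ('v, 'a) rep \<Rightarrow> bool" where
  "is_rep Q R V \<longleftrightarrow>
     (\<forall>v. v \<notin> verts Q \<longrightarrow> rdim V v = 0) \<and>
     (\<forall>a\<in>arcs Q. rmap V a \<in> carrier_mat (rdim V (head Q a)) (rdim V (tail Q a))) \<and>
     (\<forall>a. a \<notin> arcs Q \<longrightarrow> rmap V a = 0\<^sub>m 0 0) \<and>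
     (\<forall>\<rho>\<in>R. \<forall>u\<in>verts Q. \<forall>v\<in>verts Q. relation_mat Q V \<rho> u v = 0\<^sub>m (rdim V v) (rdim V u))"

definition rep_hom :: "('v, 'a) pre_digraph \<Rightarrow> ('v, 'a) rep \<Rightarrow> ('v, 'a) rep \<Rightarrow>
    ('v \<Rightarrow> complex mat) \<Rightarrow> bool" where
  "rep_hom Q V W f \<longleftrightarrow> (\<forall>v. f v \<in> carrier_mat (rdim W v) (rdim V v)) \<and>
     (\<forall>a\<in>arcs Q. f (head Q a) * rmap V a = rmap W a * f (tail Q a))"

definition mat_image :: "complex mat \<Rightarrow> complex vec set" where
  "mat_image A = (\<lambda>z. A *\<^sub>v z) ` carrier_vec (dim_col A)"

definition rep_surj :: "('v, 'a) pre_digraph \<Rightarrow> ('v, 'a) rep \<Rightarrow> ('v, 'a) rep \<Rightarrow>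
    ('v \<Rightarrow> complex mat) \<Rightarrow> bool" where
  "rep_surj Q V W f \<longleftrightarrow> rep_hom Q V W f \<and> (\<forall>v. mat_image (f v) = carrier_vec (rdim W v))"

definition rep_inj :: "('v, 'a) pre_digraph \<Rightarrow> ('v, 'a) rep \<Rightarrow> ('v, 'a) rep \<Rightarrow>
    ('v \<Rightarrow> complex mat) \<Rightarrow> bool" where
  "rep_inj Q V W f \<longleftrightarrow> rep_hom Q V W f \<and> (\<forall>v. mat_kernel (f v) = {0\<^sub>v (rdim V v)})"

definition rep_iso :: "('v, 'a) pre_digraph \<Rightarrow> ('v, 'a) rep \<Rightarrow> ('v, 'a) rep \<Rightarrow> bool" where
  "rep_iso Q V W \<longleftrightarrow> (\<exists>f. rep_hom Q V W f \<and> (\<forall>v. invertible_mat (f v)))"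

definition rep_is_zero :: "('v, 'a) rep \<Rightarrow> bool" where
  "rep_is_zero V \<longleftrightarrow> (\<forall>v. rdim V v = 0)"

definition zero_rep :: "('v, 'a) rep" where
  "zero_rep = \<lparr> rdim = (\<lambda>_. 0), rmap = (\<lambda>_. 0\<^sub>m 0 0) \<rparr>"

definition rep_dsum :: "('v, 'a) rep \<Rightarrow> ('v, 'a) rep \<Rightarrow> ('v, 'a) rep" where
  "rep_dsum V W = \<lparr> rdim = (\<lambda>v. rdim V v + rdim W v),
                    rmap = (\<lambda>a. diag_block_mat [rmap V a, rmap W a]) \<rparr>"

definition simple_rep ::
  "('v, 'a) pre_digraph \<Rightarrow> ('v \<times> 'a list \<Rightarrow> complex) set \<Rightarrow> ('v, 'a) rep \<Rightarrow> bool" where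
  "simple_rep Q R S \<longleftrightarrow> is_rep Q R S \<and> \<not> rep_is_zero S \<and>
     (\<forall>U f. is_rep Q R U \<and> rep_inj Q U S f \<longrightarrow> rep_is_zero U \<or> rep_surj Q U S f)"

definition indecomposable_rep ::
  "('v, 'a) pre_digraph \<Rightarrow> ('v \<times> 'a list \<Rightarrow> complex) set \<Rightarrow> ('v, 'a) rep \<Rightarrow> bool" where
  "indecomposable_rep Q R V \<longleftrightarrow> is_rep Q R V \<and> \<not> rep_is_zero V \<and>
     (\<forall>U W. is_rep Q R U \<and> is_rep Q R W \<and> rep_iso Q V (rep_dsum U W) \<longrightarrow>
        rep_is_zero U \<or> rep_is_zero W)"

definition projective_rep ::
  "('v, 'a) pre_digraph \<Rightarrow> ('v \<times> 'a list \<Rightarrow> complex) set \<Rightarrow> ('v, 'a) rep \<Rightarrow> bool" where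
  "projective_rep Q R P \<longleftrightarrow> is_rep Q R P \<and>
     (\<forall>V W f g. is_rep Q R V \<and> is_rep Q R W \<and> rep_surj Q V W f \<and> rep_hom Q P W g \<longrightarrow>
        (\<exists>h. rep_hom Q P V h \<and> (\<forall>v. f v * h v = g v)))"

definition complete_indec_projectives ::
  "('v, 'a) pre_digraph \<Rightarrow> ('v \<times> 'a list \<Rightarrow> complex) set \<Rightarrow> ('v, 'a) rep list \<Rightarrow> bool" where
  "complete_indec_projectives Q R Ps \<longleftrightarrow>
     (\<forall>P\<in>set Ps. projective_rep Q R P \<and> indecomposable_rep Q R P) \<and>
     (\<forall>P. projective_rep Q R P \<and> indecomposable_rep Q R P \<longrightarrow>
        (\<exists>!j. j < length Ps \<and> rep_iso Q P (Ps ! j)))"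

definition proj_sum :: "('v, 'a) rep list \<Rightarrow> (nat \<Rightarrow> nat) \<Rightarrow> ('v, 'a) rep" where
  "proj_sum Ps n =
     foldr rep_dsum (concat (map (\<lambda>j. replicate (n j) (Ps ! j)) [0..<length Ps])) zero_rep"

section \<open>Bounded complexes\<close>

record ('v, 'a) cplx =
  cdim :: "int \<Rightarrow> 'v \<Rightarrow> nat"
  cmap :: "int \<Rightarrow> 'a \<Rightarrow> complex mat"
  cdiff :: "int \<Rightarrow> 'v \<Rightarrow> complex mat"

definition degree_rep :: "('v, 'a) cplx \<Rightarrow> int \<Rightarrow> ('v, 'a) rep" where
  "degree_rep X i = \<lparr> rdim = cdim X i, rmap = cmap X i \<rparr>"

definition bounded_cplx ::
  "('v, 'a) pre_digraph \<Rightarrow> ('v \<times> 'a list \<Rightarrow> complex) set \<Rightarrow> ('v, 'a) cplx \<Rightarrow> bool" where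
  "bounded_cplx Q R X \<longleftrightarrow>
     finite {i. \<exists>v. cdim X i v \<noteq> 0} \<and>
     (\<forall>i. is_rep Q R (degree_rep X i)) \<and>
     (\<forall>i. rep_hom Q (degree_rep X i) (degree_rep X (i + 1)) (cdiff X i)) \<and>
     (\<forall>i v. cdiff X (i + 1) v * cdiff X i v = 0\<^sub>m (cdim X (i + 2) v) (cdim X i v))"

definition cycles :: "('v, 'a) cplx \<Rightarrow> int \<Rightarrow> 'v \<Rightarrow> complex vec set" where
  "cycles X i v = mat_kernel (cdiff X i v)"

definition boundaries :: "('v, 'a) cplx \<Rightarrow> int \<Rightarrow> 'v \<Rightarrow> complex vec set" where
  "boundaries X i v = mat_image (cdiff X (i - 1) v)"

definition acyclic_cplx :: "('v, 'a) cplx \<Rightarrow> bool" where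
  "acyclic_cplx X \<longleftrightarrow> (\<forall>i v. cycles X i v = boundaries X i v)"

definition chain_map :: "('v, 'a) pre_digraph \<Rightarrow> ('v, 'a) cplx \<Rightarrow> ('v, 'a) cplx \<Rightarrow>
    (int \<Rightarrow> 'v \<Rightarrow> complex mat) \<Rightarrow> bool" where
  "chain_map Q X Y f \<longleftrightarrow> (\<forall>i. rep_hom Q (degree_rep X i) (degree_rep Y i) (f i)) \<and>
     (\<forall>i v. f (i + 1) v * cdiff X i v = cdiff Y i v * f i v)"

definition cplx_iso_via :: "('v, 'a) pre_digraph \<Rightarrow> (int \<Rightarrow> 'v \<Rightarrow> complex mat) \<Rightarrow>
    ('v, 'a) cplx \<Rightarrow> ('v, 'a) cplx \<Rightarrow> bool" where
  "cplx_iso_via Q g X Y \<longleftrightarrow> chain_map Q X Y g \<and> (\<forall>i v. invertible_mat (g i v))"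

definition cplx_iso :: "('v, 'a) pre_digraph \<Rightarrow> ('v, 'a) cplx \<Rightarrow> ('v, 'a) cplx \<Rightarrow> bool" where
  "cplx_iso Q X Y \<longleftrightarrow> (\<exists>g. cplx_iso_via Q g X Y)"

text \<open>The two conjuncts say that the map induced on homology is injective and surjective.\<close>

definition quasi_iso_map :: "('v, 'a) pre_digraph \<Rightarrow> ('v, 'a) cplx \<Rightarrow> ('v, 'a) cplx \<Rightarrow>
    (int \<Rightarrow> 'v \<Rightarrow> complex mat) \<Rightarrow> bool" where
  "quasi_iso_map Q X Y f \<longleftrightarrow> chain_map Q X Y f \<and>
     (\<forall>i v. \<forall>z\<in>cycles X i v. f i v *\<^sub>v z \<in> boundaries Y i v \<longrightarrow> z \<in> boundaries X i v) \<and>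
     (\<forall>i v. \<forall>y\<in>cycles Y i v. \<exists>z\<in>cycles X i v. y - f i v *\<^sub>v z \<in> boundaries Y i v)"

text \<open>
  Isomorphism in the bounded derived category: two complexes are isomorphic there iff they are
  connected by a zigzag of quasi-isomorphisms.
\<close>

definition quasi_isomorphic :: "('v, 'a) pre_digraph \<Rightarrow> ('v \<times> 'a list \<Rightarrow> complex) set \<Rightarrow>
    ('v, 'a) cplx \<Rightarrow> ('v, 'a) cplx \<Rightarrow> bool" where
  "quasi_isomorphic Q R =
     equivclp (\<lambda>X Y. bounded_cplx Q R X \<and> bounded_cplx Q R Y \<and> (\<exists>f. quasi_iso_map Q X Y f))"

definition cplx_dsum :: "('v, 'a) cplx \<Rightarrow> ('v, 'a) cplx \<Rightarrow> ('v, 'a) cplx" where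
  "cplx_dsum X Y = \<lparr> cdim = (\<lambda>i v. cdim X i v + cdim Y i v),
                     cmap = (\<lambda>i a. diag_block_mat [cmap X i a, cmap Y i a]),
                     cdiff = (\<lambda>i v. diag_block_mat [cdiff X i v, cdiff Y i v]) \<rparr>"

definition zero_cplx :: "('v, 'a) cplx" where
  "zero_cplx = \<lparr> cdim = (\<lambda>_ _. 0), cmap = (\<lambda>_ _. 0\<^sub>m 0 0), cdiff = (\<lambda>_ _. 0\<^sub>m 0 0) \<rparr>"

definition mapping_cone ::
  "('v, 'a) cplx \<Rightarrow> ('v, 'a) cplx \<Rightarrow> (int \<Rightarrow> 'v \<Rightarrow> complex mat) \<Rightarrow> ('v, 'a) cplx" where
  "mapping_cone X Y f =
    \<lparr> cdim = (\<lambda>i v. cdim X (i + 1) v + cdim Y i v),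
      cmap = (\<lambda>i a. diag_block_mat [cmap X (i + 1) a, cmap Y i a]),
      cdiff = (\<lambda>i v. four_block_mat
        (- cdiff X (i + 1) v) (0\<^sub>m (cdim X (i + 2) v) (cdim Y i v))
        (f (i + 1) v)         (cdiff Y i v)) \<rparr>"

text \<open>The complex \<open>S \<longrightarrow> S\<close> with identity differential, placed in degrees \<open>k\<close> and \<open>k + 1\<close>.\<close>

definition disk_cplx :: "int \<Rightarrow> ('v, 'a) rep \<Rightarrow> ('v, 'a) cplx" where
  "disk_cplx k S =
    \<lparr> cdim = (\<lambda>i. if i = k \<or> i = k + 1 then rdim S else (\<lambda>_. 0)),
      cmap = (\<lambda>i. if i = k \<or> i = k + 1 then rmap S else (\<lambda>_. 0\<^sub>m 0 0)),
      cdiff = (\<lambda>i v. if i = k then 1\<^sub>m (rdim S v)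
                     else if i = k - 1 then 0\<^sub>m (rdim S v) 0
                     else if i = k + 1 then 0\<^sub>m 0 (rdim S v)
                     else 0\<^sub>m 0 0) \<rparr>"

definition simple_disk_sum ::
  "('v, 'a) pre_digraph \<Rightarrow> ('v \<times> 'a list \<Rightarrow> complex) set \<Rightarrow> ('v, 'a) cplx \<Rightarrow> bool" where
  "simple_disk_sum Q R X \<longleftrightarrow> (\<exists>ds. (\<forall>(k, S)\<in>set ds. simple_rep Q R S) \<and>
     cplx_iso Q X (foldr cplx_dsum (map (\<lambda>(k, S). disk_cplx k S) ds) zero_cplx))"

section \<open>Finite global dimension\<close>

definition proj_dim_le :: "('v, 'a) pre_digraph \<Rightarrow> ('v \<times> 'a list \<Rightarrow> complex) set \<Rightarrow>
    ('v, 'a) rep \<Rightarrow> nat \<Rightarrow> bool" where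
  "proj_dim_le Q R V n \<longleftrightarrow> (\<exists>X \<epsilon>. bounded_cplx Q R X \<and>
     (\<forall>i. projective_rep Q R (degree_rep X i)) \<and>
     (\<forall>i. i < - int n \<or> 0 < i \<longrightarrow> rep_is_zero (degree_rep X i)) \<and>
     (\<forall>i<0. \<forall>v. cycles X i v = boundaries X i v) \<and>
     rep_surj Q (degree_rep X 0) V \<epsilon> \<and> (\<forall>v. mat_kernel (\<epsilon> v) = boundaries X 0 v))"

definition finite_global_dimension ::
  "('v, 'a) pre_digraph \<Rightarrow> ('v \<times> 'a list \<Rightarrow> complex) set \<Rightarrow> bool" where
  "finite_global_dimension Q R \<longleftrightarrow> (\<exists>n. \<forall>V. is_rep Q R V \<longrightarrow> proj_dim_le Q R V n)"

section \<open>Varieties of complexes\<close>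

definition dim_seq :: "('v, 'a) pre_digraph \<Rightarrow> (int \<Rightarrow> 'v \<Rightarrow> nat) \<Rightarrow> bool" where
  "dim_seq Q dd \<longleftrightarrow> finite {i. \<exists>v. dd i v \<noteq> 0} \<and> (\<forall>i v. v \<notin> verts Q \<longrightarrow> dd i v = 0)"

definition Cb :: "('v, 'a) pre_digraph \<Rightarrow> ('v \<times> 'a list \<Rightarrow> complex) set \<Rightarrow>
    (int \<Rightarrow> 'v \<Rightarrow> nat) \<Rightarrow> ('v, 'a) cplx set" where
  "Cb Q R dd = {X. bounded_cplx Q R X \<and> cdim X = dd}"

definition proj_dim_seq :: "('v, 'a) rep list \<Rightarrow> (int \<Rightarrow> nat \<Rightarrow> nat) \<Rightarrow> bool" where
  "proj_dim_seq Ps e \<longleftrightarrow> finite {i. \<exists>j. e i j \<noteq> 0} \<and> (\<forall>i j. length Ps \<le> j \<longrightarrow> e i j = 0)"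

definition dims_of :: "('v, 'a) rep list \<Rightarrow> (int \<Rightarrow> nat \<Rightarrow> nat) \<Rightarrow> int \<Rightarrow> 'v \<Rightarrow> nat" where
  "dims_of Ps e = (\<lambda>i. rdim (proj_sum Ps (e i)))"

definition Pb :: "('v, 'a) pre_digraph \<Rightarrow> ('v \<times> 'a list \<Rightarrow> complex) set \<Rightarrow>
    ('v, 'a) rep list \<Rightarrow> (int \<Rightarrow> nat \<Rightarrow> nat) \<Rightarrow> ('v, 'a) cplx set" where
  "Pb Q R Ps e = {X \<in> Cb Q R (dims_of Ps e). \<forall>i. rep_iso Q (degree_rep X i) (proj_sum Ps (e i))}"

section \<open>The Grothendieck group of the bounded derived category\<close>

text \<open>
  Three complexes are the vertices of a distinguished triangle iff, up to isomorphism in the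
  derived category, they are the source, the target and the mapping cone of a chain map.
\<close>

definition triangle_vertices :: "('v, 'a) pre_digraph \<Rightarrow> ('v \<times> 'a list \<Rightarrow> complex) set \<Rightarrow>
    ('v, 'a) cplx \<Rightarrow> ('v, 'a) cplx \<Rightarrow> ('v, 'a) cplx \<Rightarrow> bool" where
  "triangle_vertices Q R X Y Z \<longleftrightarrow> (\<exists>X' Y' f. bounded_cplx Q R X' \<and> bounded_cplx Q R Y' \<and>
     chain_map Q X' Y' f \<and> quasi_isomorphic Q R X X' \<and> quasi_isomorphic Q R Y Y' \<and>
     quasi_isomorphic Q R Z (mapping_cone X' Y' f))"

definition K0_relations :: "('v, 'a) pre_digraph \<Rightarrow> ('v \<times> 'a list \<Rightarrow> complex) set \<Rightarrow>
    (('v, 'a) cplx \<Rightarrow>\<^sub>0 int) set" where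
  "K0_relations Q R = generate (free_Abelian_group (Collect (bounded_cplx Q R)))
     {frag_of Y - frag_of X - frag_of Z | X Y Z.
        bounded_cplx Q R X \<and> bounded_cplx Q R Y \<and> bounded_cplx Q R Z \<and>
        triangle_vertices Q R X Y Z}"

definition K0 :: "('v, 'a) pre_digraph \<Rightarrow> ('v \<times> 'a list \<Rightarrow> complex) set \<Rightarrow>
    (('v, 'a) cplx \<Rightarrow>\<^sub>0 int) set monoid" where
  "K0 Q R = free_Abelian_group (Collect (bounded_cplx Q R)) Mod K0_relations Q R"

definition K0_class :: "('v, 'a) pre_digraph \<Rightarrow> ('v \<times> 'a list \<Rightarrow> complex) set \<Rightarrow>
    ('v, 'a) cplx \<Rightarrow> (('v, 'a) cplx \<Rightarrow>\<^sub>0 int) set" where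
  "K0_class Q R X =
     K0_relations Q R #>\<^bsub>free_Abelian_group (Collect (bounded_cplx Q R))\<^esub> frag_of X"

text \<open>
  Well defined: every dimension sequence is that of some complex, and complexes with the same
  dimension sequence have the same class.
\<close>

definition dim_class :: "('v, 'a) pre_digraph \<Rightarrow> ('v \<times> 'a list \<Rightarrow> complex) set \<Rightarrow>
    (int \<Rightarrow> 'v \<Rightarrow> nat) \<Rightarrow> (('v, 'a) cplx \<Rightarrow>\<^sub>0 int) set" where
  "dim_class Q R dd = (THE c. \<exists>X\<in>Cb Q R dd. c = K0_class Q R X)"

definition dim_fibre :: "('v, 'a) pre_digraph \<Rightarrow> ('v \<times> 'a list \<Rightarrow> complex) set \<Rightarrow>
    (('v, 'a) cplx \<Rightarrow>\<^sub>0 int) set \<Rightarrow> (int \<Rightarrow> 'v \<Rightarrow> nat) set" where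
  "dim_fibre Q R d = {dd. dim_seq Q dd \<and> dim_class Q R dd = d}"

definition proj_fibre :: "('v, 'a) pre_digraph \<Rightarrow> ('v \<times> 'a list \<Rightarrow> complex) set \<Rightarrow>
    ('v, 'a) rep list \<Rightarrow> (('v, 'a) cplx \<Rightarrow>\<^sub>0 int) set \<Rightarrow> (int \<Rightarrow> nat \<Rightarrow> nat) set" where
  "proj_fibre Q R Ps d = {e. proj_dim_seq Ps e \<and> dims_of Ps e \<in> dim_fibre Q R d}"

section \<open>Direct limits\<close>

definition direct_limit_rel :: "'i set \<Rightarrow> ('i \<Rightarrow> 'i \<Rightarrow> bool) \<Rightarrow> ('i \<Rightarrow> 'x set) \<Rightarrow>
    ('i \<Rightarrow> 'i \<Rightarrow> 'x \<Rightarrow> 'x) \<Rightarrow> (('i \<times> 'x) \<times> ('i \<times> 'x)) set" where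
  "direct_limit_rel I lq F T = {((i, x), (j, y)). (i, x) \<in> Sigma I F \<and> (j, y) \<in> Sigma I F \<and>
     (\<exists>k\<in>I. lq i k \<and> lq j k \<and> T i k x = T j k y)}"

definition direct_limit :: "'i set \<Rightarrow> ('i \<Rightarrow> 'i \<Rightarrow> bool) \<Rightarrow> ('i \<Rightarrow> 'x set) \<Rightarrow>
    ('i \<Rightarrow> 'i \<Rightarrow> 'x \<Rightarrow> 'x) \<Rightarrow> ('i \<times> 'x) set set" where
  "direct_limit I lq F T = Sigma I F // direct_limit_rel I lq F T"

definition to_limit :: "'i set \<Rightarrow> ('i \<Rightarrow> 'i \<Rightarrow> bool) \<Rightarrow> ('i \<Rightarrow> 'x set) \<Rightarrow>
    ('i \<Rightarrow> 'i \<Rightarrow> 'x \<Rightarrow> 'x) \<Rightarrow> 'i \<Rightarrow> 'x \<Rightarrow> ('i \<times> 'x) set" where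
  "to_limit I lq F T i x = direct_limit_rel I lq F T `` {(i, x)}"

text \<open>
  The order on (projective) dimension sequences determined by a class \<open>ok\<close> of complexes, and
  the transition data.  The complexes \<open>M i j\<close> are the chosen summands.  An equality
  \<open>M i j \<oplus> M j k = M i k\<close> cannot hold literally for block sums of matrices, for all
  \<open>i \<le> j \<le> k\<close> (adding the same two summands in either order gives different block
  matrices), so it is read up to identification of vector spaces: the equality is an isomorphism,
  and \<open>T i j\<close> is \<open>X \<mapsto> X \<oplus> M i j\<close> followed by an identification \<open>g\<close> of the
  graded space of \<open>X \<oplus> M i j\<close> with the one of index \<open>j\<close>, the same for all \<open>X\<close>, such that
  the \<open>T i j\<close> form a direct system.
\<close>

definition seq_diff :: "(int \<Rightarrow> 'c \<Rightarrow> nat) \<Rightarrow> (int \<Rightarrow> 'c \<Rightarrow> nat) \<Rightarrow> int \<Rightarrow> 'c \<Rightarrow> nat" where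
  "seq_diff j i = (\<lambda>n c. j n c - i n c)"

definition seq_le :: "((int \<Rightarrow> 'c \<Rightarrow> nat) \<Rightarrow> ('v, 'a) cplx set) \<Rightarrow> (('v, 'a) cplx \<Rightarrow> bool) \<Rightarrow>
    (int \<Rightarrow> 'c \<Rightarrow> nat) \<Rightarrow> (int \<Rightarrow> 'c \<Rightarrow> nat) \<Rightarrow> bool" where
  "seq_le F ok i j \<longleftrightarrow> (\<forall>n c. i n c \<le> j n c) \<and> (\<exists>M\<in>F (seq_diff j i). ok M)"

definition transition_system :: "('v, 'a) pre_digraph \<Rightarrow> (int \<Rightarrow> 'c \<Rightarrow> nat) set \<Rightarrow>
    ((int \<Rightarrow> 'c \<Rightarrow> nat) \<Rightarrow> ('v, 'a) cplx set) \<Rightarrow> (('v, 'a) cplx \<Rightarrow> bool) \<Rightarrow>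
    ((int \<Rightarrow> 'c \<Rightarrow> nat) \<Rightarrow> (int \<Rightarrow> 'c \<Rightarrow> nat) \<Rightarrow> ('v, 'a) cplx) \<Rightarrow>
    ((int \<Rightarrow> 'c \<Rightarrow> nat) \<Rightarrow> (int \<Rightarrow> 'c \<Rightarrow> nat) \<Rightarrow> ('v, 'a) cplx \<Rightarrow> ('v, 'a) cplx) \<Rightarrow> bool" where
  "transition_system Q I F ok M T \<longleftrightarrow>
     (\<forall>i\<in>I. \<forall>j\<in>I. seq_le F ok i j \<longrightarrow>
        M i j \<in> F (seq_diff j i) \<and> ok (M i j) \<and>
        (\<exists>g. \<forall>X\<in>F i. T i j X \<in> F j \<and> cplx_iso_via Q g (cplx_dsum X (M i j)) (T i j X))) \<and>
     (\<forall>i\<in>I. \<forall>j\<in>I. \<forall>k\<in>I. seq_le F ok i j \<and> seq_le F ok j k \<longrightarrow>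
        cplx_iso Q (cplx_dsum (M i j) (M j k)) (M i k) \<and>
        (\<forall>X\<in>F i. T j k (T i j X) = T i k X))"

text \<open>Quasi-isomorphism of points of a direct limit, via their representing complexes.\<close>

definition limit_qis :: "('v, 'a) pre_digraph \<Rightarrow> ('v \<times> 'a list \<Rightarrow> complex) set \<Rightarrow>
    ('i \<times> ('v, 'a) cplx) set set \<Rightarrow>
    (('i \<times> ('v, 'a) cplx) set \<times> ('i \<times> ('v, 'a) cplx) set) set" where
  "limit_qis Q R L =
     {(p, q). p \<in> L \<and> q \<in> L \<and> (\<exists>(i, X)\<in>p. \<exists>(j, Y)\<in>q. quasi_isomorphic Q R X Y)}"

definition Cb_limit where
  "Cb_limit Q R d T =
     direct_limit (dim_fibre Q R d) (seq_le (Cb Q R) (simple_disk_sum Q R)) (Cb Q R) T"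

definition to_Cb_limit where
  "to_Cb_limit Q R d T =
     to_limit (dim_fibre Q R d) (seq_le (Cb Q R) (simple_disk_sum Q R)) (Cb Q R) T"

definition Pb_limit where
  "Pb_limit Q R Ps d U =
     direct_limit (proj_fibre Q R Ps d) (seq_le (Pb Q R Ps) acyclic_cplx) (Pb Q R Ps) U"

definition to_Pb_limit where
  "to_Pb_limit Q R Ps d U =
     to_limit (proj_fibre Q R Ps d) (seq_le (Pb Q R Ps) acyclic_cplx) (Pb Q R Ps) U"

text \<open>
  The inclusions of \<open>Pb\<close> into \<open>Cb\<close> send the summands \<open>P \<longrightarrow> P\<close> used on one side to
  complexes that need not be sums of the \<open>S \<longrightarrow> S\<close> used on the other side.  Hence regarding
  a complex of projectives as a complex of modules determines a point of the limit only after a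
  representing complex is chosen; all choices are quasi-isomorphic.
\<close>

definition natural_embedding where
  "natural_embedding Q R Ps d T U \<phi> \<longleftrightarrow>
     (\<forall>p\<in>Pb_limit Q R Ps d U. \<exists>(e, X)\<in>p. \<phi> p = to_Cb_limit Q R d T (dims_of Ps e) X)"

text \<open>The map induced on classes by a map that respects the equivalence relations.\<close>

definition induced_map :: "('y \<times> 'y) set \<Rightarrow> ('x \<Rightarrow> 'y) \<Rightarrow> 'x set \<Rightarrow> 'y set" where
  "induced_map s f c = (\<Union>x\<in>c. s `` {f x})"

definition inverse_on_quotients ::
  "'x set \<Rightarrow> ('x \<times> 'x) set \<Rightarrow> 'y set \<Rightarrow> ('y \<times> 'y) set \<Rightarrow> ('x \<Rightarrow> 'y) \<Rightarrow> ('y \<Rightarrow> 'x) \<Rightarrow> bool" where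
  "inverse_on_quotients A r B s f g \<longleftrightarrow>
     equiv A r \<and> equiv B s \<and> f \<in> A \<rightarrow> B \<and> g \<in> B \<rightarrow> A \<and>
     (\<forall>(x, x')\<in>r. (f x, f x') \<in> s) \<and> (\<forall>(y, y')\<in>s. (g y, g y') \<in> r) \<and>
     (\<forall>c\<in>A // r. induced_map r g (induced_map s f c) = c) \<and>
     (\<forall>c\<in>B // s. induced_map s f (induced_map r g c) = c)"

section \<open>Constructible maps\<close>

text \<open>
  Subsets of affine spaces are given together with the set \<open>K\<close> of coordinate functions.
  A function on a stratum is regular if it is locally a quotient of polynomials; a map into a
  subset of an affine space is a morphism if its coordinates are regular.
\<close>

inductive polynomial_in :: "('x \<Rightarrow> complex) set \<Rightarrow> ('x \<Rightarrow> complex) \<Rightarrow> bool"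
  for K :: "('x \<Rightarrow> complex) set" where
  "k \<in> K \<Longrightarrow> polynomial_in K k"
| "polynomial_in K (\<lambda>_. c)"
| "polynomial_in K p \<Longrightarrow> polynomial_in K q \<Longrightarrow> polynomial_in K (\<lambda>x. p x + q x)"
| "polynomial_in K p \<Longrightarrow> polynomial_in K q \<Longrightarrow> polynomial_in K (\<lambda>x. p x * q x)"

definition zariski_closed_in :: "('x \<Rightarrow> complex) set \<Rightarrow> 'x set \<Rightarrow> 'x set \<Rightarrow> bool" where
  "zariski_closed_in K S Z \<longleftrightarrow>
     (\<exists>F. (\<forall>p\<in>F. polynomial_in K p) \<and> Z = {x \<in> S. \<forall>p\<in>F. p x = 0})"

definition constructible_in :: "('x \<Rightarrow> complex) set \<Rightarrow> 'x set \<Rightarrow> 'x set \<Rightarrow> bool" where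
  "constructible_in K S O' \<longleftrightarrow> (\<exists>\<A>. finite \<A> \<and>
     (\<forall>(Z, W)\<in>\<A>. zariski_closed_in K S Z \<and> zariski_closed_in K S W) \<and>
     O' = (\<Union>(Z, W)\<in>\<A>. Z - W))"

definition regular_on :: "('x \<Rightarrow> complex) set \<Rightarrow> 'x set \<Rightarrow> ('x \<Rightarrow> complex) \<Rightarrow> bool" where
  "regular_on K S f \<longleftrightarrow> (\<forall>x\<in>S. \<exists>p q. polynomial_in K p \<and> polynomial_in K q \<and> q x \<noteq> 0 \<and>
     (\<forall>y\<in>S. q y \<noteq> 0 \<longrightarrow> f y = p y / q y))"

definition constructible_map :: "('x \<Rightarrow> complex) set \<Rightarrow> 'x set \<Rightarrow> ('y \<Rightarrow> complex) set \<Rightarrow> 'y set \<Rightarrow>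
    ('x \<Rightarrow> 'y) \<Rightarrow> bool" where
  "constructible_map K S K' S' f \<longleftrightarrow> f \<in> S \<rightarrow> S' \<and>
     (\<exists>\<O>. finite \<O> \<and> disjoint \<O> \<and> \<Union>\<O> = S \<and>
        (\<forall>O'\<in>\<O>. constructible_in K S O' \<and> (\<forall>k\<in>K'. regular_on K O' (\<lambda>x. k (f x)))))"

definition cplx_coords ::
  "('v, 'a) pre_digraph \<Rightarrow> (int \<Rightarrow> 'v \<Rightarrow> nat) \<Rightarrow> (('v, 'a) cplx \<Rightarrow> complex) set" where
  "cplx_coords Q dd =
     {\<lambda>X. cmap X i a $$ (r, c) | i a r c. a \<in> arcs Q \<and> r < dd i (head Q a) \<and> c < dd i (tail Q a)} \<union>
     {\<lambda>X. cdiff X i v $$ (r, c) | i v r c. v \<in> verts Q \<and> r < dd (i + 1) v \<and> c < dd i v}"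

definition constructible_into_Pb_limit where
  "constructible_into_Pb_limit Q R Ps d U dd F \<longleftrightarrow>
     (\<exists>e\<in>proj_fibre Q R Ps d. \<exists>h.
        constructible_map (cplx_coords Q dd) (Cb Q R dd)
          (cplx_coords Q (dims_of Ps e)) (Pb Q R Ps e) h \<and>
        (\<forall>X\<in>Cb Q R dd. F X = to_Pb_limit Q R Ps d U e (h X)))"

end

theory Submission
  imports Defs "HOL-Library.Multiset"
begin

text \<open>
  Put \<open>Fr d = \<Sum>\<^sub>v P\<^sub>v\<^sup>d\<^sup>v\<close>.  Every module \<open>V\<close> receives a canonical surjection \<open>Fr (dim V) \<rightarrow> V\<close> whose
  entries, and those of a basis of its kernel \<open>K V\<close>, are polynomials in the entries of \<open>V\<close>.  In
  each degree of a complex \<open>X\<close> this gives \<open>0 \<rightarrow> K X \<rightarrow> Fr X \<rightarrow> X \<rightarrow> 0\<close>; put \<open>RR 0 X = X\<close> and let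
  \<open>RR (n + 1) X\<close> be the cone of \<open>RR n (K X) \<rightarrow> K X \<rightarrow> Fr X\<close>, which is quasi-isomorphic to \<open>X\<close>.  If
  \<open>n\<close> is the global dimension, then \<open>RR n X\<close> consists of projectives by Schanuel's lemma, and its type
  is an additive function of the dimension sequence of \<open>X\<close>, because the Cartan matrix is invertible.

  Enumerate the dimension sequences and resolve, for each point of the limit, its representative in the
  first dimension sequence in which it has one.  Transition maps are injective with closed image and
  polynomial inverse, so on each variety of complexes this choice is a polynomial map on each of
  finitely many differences of closed sets.
\<close>

text \<open>The resolution of \<open>X\<close> plus a disk complex need not be the resolution of
  \<open>X\<close> plus a contractible complex on the nose, so the resolutions on the single
  varieties do not induce a map of direct limits. Only quasi-isomorphism classes have to match,
  however; one may therefore resolve a single representative of each point, provided that its choice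
  stays constructible on each variety. Additivity of the types is needed because the finitely many
  strata of a variety are resolved in different types: the order on dimension sequences, which is
  given by acyclic complexes, has to pass to the types before all strata can be moved into a common
  target. Kernels in general vary polynomially only after a stratification by rank; here they do so
  at once, because the surjection from \<open>Fr\<close> has a linear section that does not depend
  on the module. That the result lies over the same class in the Grothendieck group requires this
  class to depend on dimensions alone, which is shown by splitting off simple modules.\<close>

lemma mat_assoc:
  "dim_col A = dim_row B \<Longrightarrow> dim_col B = dim_row C \<Longrightarrow> (A * B) * C = A * (B * (C :: complex mat))"
  by (rule assoc_mult_mat[of _ "dim_row A" "dim_col A" _ "dim_col B" _ "dim_col C"]) auto

lemma mat_left_one: "dim_row A = n \<Longrightarrow> 1\<^sub>m n * (A :: complex mat) = A"
  by (rule left_mult_one_mat[of _ n "dim_col A"]) auto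

lemma mat_right_one: "dim_col A = n \<Longrightarrow> (A :: complex mat) * 1\<^sub>m n = A"
  by (rule right_mult_one_mat[of _ "dim_row A" n]) auto

lemma mat_left_zero: "dim_row A = n \<Longrightarrow> 0\<^sub>m m n * (A :: complex mat) = 0\<^sub>m m (dim_col A)"
  by (rule left_mult_zero_mat[of _ n "dim_col A"]) auto

lemma mat_right_zero: "dim_col A = n \<Longrightarrow> (A :: complex mat) * 0\<^sub>m n m = 0\<^sub>m (dim_row A) m"
  by (rule right_mult_zero_mat[of _ "dim_row A" n]) auto

lemma mat_distrib_right:
  "dim_row A = dim_row B \<Longrightarrow> dim_col A = dim_col B \<Longrightarrow> dim_col A = dim_row C \<Longrightarrow>
   (A + B) * C = A * C + B * (C :: complex mat)"
  by (rule add_mult_distrib_mat[of _ "dim_row A" "dim_col A" _ _ "dim_col C"]) auto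

lemma mat_distrib_left:
  "dim_row B = dim_row C \<Longrightarrow> dim_col B = dim_col C \<Longrightarrow> dim_col A = dim_row B \<Longrightarrow>
   A * (B + C) = A * B + A * (C :: complex mat)"
  by (rule mult_add_distrib_mat[of _ "dim_row A" "dim_col A" _ "dim_col C"]) auto

lemma mat_diff_right:
  "dim_row A = dim_row B \<Longrightarrow> dim_col A = dim_col B \<Longrightarrow> dim_col A = dim_row C \<Longrightarrow>
   (A - B) * C = A * C - B * (C :: complex mat)"
  by (rule minus_mult_distrib_mat[of _ "dim_row A" "dim_col A" _ _ "dim_col C"]) auto

lemma mat_diff_left:
  "dim_row B = dim_row C \<Longrightarrow> dim_col B = dim_col C \<Longrightarrow> dim_col A = dim_row B \<Longrightarrow>
   A * (B - C) = A * B - A * (C :: complex mat)"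
  by (rule mult_minus_distrib_mat[of _ "dim_row A" "dim_col A" _ "dim_col C"]) auto

lemma mat_neg_left: "dim_col A = dim_row B \<Longrightarrow> (- A) * B = - (A * (B :: complex mat))"
  by (rule uminus_mult_left_mat) auto

lemma mat_neg_right: "dim_col A = dim_row B \<Longrightarrow> A * (- B) = - (A * (B :: complex mat))"
  by (rule uminus_mult_right_mat) auto

lemma mat_add_zero: "dim_row A = m \<Longrightarrow> dim_col A = n \<Longrightarrow> A + 0\<^sub>m m n = (A :: complex mat)"
  "dim_row A = m \<Longrightarrow> dim_col A = n \<Longrightarrow> 0\<^sub>m m n + A = (A :: complex mat)"
  "dim_row A = m \<Longrightarrow> dim_col A = n \<Longrightarrow> A - 0\<^sub>m m n = (A :: complex mat)"
  "dim_row A = m \<Longrightarrow> dim_col A = n \<Longrightarrow> 0\<^sub>m m n - A = - (A :: complex mat)"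
  by (auto intro!: eq_matI)

lemma mat_mult_vec_assoc:
  "dim_col A = dim_row B \<Longrightarrow> dim_col B = dim_vec v \<Longrightarrow> A *\<^sub>v (B *\<^sub>v v) = (A * B) *\<^sub>v (v :: complex vec)"
  by (rule assoc_mult_mat_vec[symmetric, of _ "dim_row A" "dim_col A" _ "dim_col B"]) (auto intro: carrier_vecI)

lemmas mat_ring0 = mat_left_one mat_right_one mat_left_zero mat_right_zero
  mat_distrib_right mat_distrib_left mat_diff_right mat_diff_left mat_neg_left mat_neg_right mat_add_zero
lemmas mat_ring = mat_assoc mat_ring0

lemma mat_cancel_left:
  assumes "L * K = 1\<^sub>m n" "dim_col L = dim_row K" "dim_col K = n" "dim_row A = n" "dim_row B = n" "K * A = K * (B :: complex mat)"
  shows "A = B"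
proof -
  have "A = (L * K) * A" using assms by (simp add: mat_ring)
  also have "\<dots> = L * (K * A)" using assms(2-5) by (intro mat_assoc) auto
  also have "\<dots> = (L * K) * B" using assms(2-6) by (subst mat_assoc) auto
  finally show ?thesis using assms by (simp add: mat_ring)
qed

lemma mat_mult_index:
  "i < dim_row A \<Longrightarrow> j < dim_col B \<Longrightarrow> dim_col A = dim_row B \<Longrightarrow>
   (A * B) $$ (i, j) = (\<Sum>l<dim_row B. A $$ (i, l) * B $$ (l, j :: nat) :: complex)"
  by (auto simp: scalar_prod_def lessThan_atLeast0)

subsection \<open>Block inclusions and projections\<close>

text \<open>These are the structure maps of the block sum, viewed as a biproduct. Identities between
  block matrices then reduce to the relations in \<open>prj_inc\<close>, without computing with
  entries.\<close>

definition inc1 :: "nat \<Rightarrow> nat \<Rightarrow> complex mat" where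
  "inc1 n m = mat (n + m) n (\<lambda>(i, j). if i = j then 1 else 0)"
definition inc2 :: "nat \<Rightarrow> nat \<Rightarrow> complex mat" where
  "inc2 n m = mat (n + m) m (\<lambda>(i, j). if i = n + j then 1 else 0)"
definition prj1 :: "nat \<Rightarrow> nat \<Rightarrow> complex mat" where
  "prj1 n m = mat n (n + m) (\<lambda>(i, j). if i = j then 1 else 0)"
definition prj2 :: "nat \<Rightarrow> nat \<Rightarrow> complex mat" where
  "prj2 n m = mat m (n + m) (\<lambda>(i, j). if j = n + i then 1 else 0)"

lemma inc_prj_dims[simp]:
  "dim_row (inc1 n m) = n + m" "dim_col (inc1 n m) = n"
  "dim_row (inc2 n m) = n + m" "dim_col (inc2 n m) = m"
  "dim_row (prj1 n m) = n" "dim_col (prj1 n m) = n + m"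
  "dim_row (prj2 n m) = m" "dim_col (prj2 n m) = n + m"
  by (auto simp: inc1_def inc2_def prj1_def prj2_def)

lemma mult_inc1: "dim_col A = n + m \<Longrightarrow> A * inc1 n m = mat (dim_row A) n (\<lambda>(i, j). A $$ (i, j))"
  by (rule eq_matI) (auto simp: mat_mult_index simp del: index_mult_mat(1), auto simp: inc1_def if_distrib cong: if_cong)

lemma mult_inc2: "dim_col A = n + m \<Longrightarrow> A * inc2 n m = mat (dim_row A) m (\<lambda>(i, j). A $$ (i, n + j))"
  by (rule eq_matI) (auto simp: mat_mult_index simp del: index_mult_mat(1), auto simp: inc2_def if_distrib cong: if_cong)

lemma prj1_mult: "dim_row A = n + m \<Longrightarrow> prj1 n m * A = mat n (dim_col A) (\<lambda>(i, j). A $$ (i, j))"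
  by (rule eq_matI) (auto simp: mat_mult_index simp del: index_mult_mat(1), auto simp: prj1_def if_distrib if_distribR cong: if_cong)

lemma prj2_mult: "dim_row A = n + m \<Longrightarrow> prj2 n m * A = mat m (dim_col A) (\<lambda>(i, j). A $$ (n + i, j))"
  by (rule eq_matI) (auto simp: mat_mult_index simp del: index_mult_mat(1), auto simp: prj2_def if_distrib if_distribR cong: if_cong)

lemma inc1_mult: "dim_row A = n \<Longrightarrow> inc1 n m * A = mat (n + m) (dim_col A) (\<lambda>(i, j). if i < n then A $$ (i, j) else 0)"
  by (rule eq_matI) (auto simp: mat_mult_index simp del: index_mult_mat(1), auto simp: inc1_def if_distrib if_distribR cong: if_cong)

lemma sum_shift_delta: "(\<Sum>l<m. if i = n + l then f l else 0) = (if n \<le> i \<and> i < n + m then f (i - n) else (0 :: complex))"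
  for i n m :: nat
proof -
  have "(\<Sum>l<m. if i = n + l then f l else 0) = (\<Sum>l<m. if l = i - n then (if n \<le> i then f l else 0) else 0)"
    by (rule sum.cong) auto
  also have "\<dots> = (if n \<le> i \<and> i < n + m then f (i - n) else 0)" by auto
  finally show ?thesis .
qed

lemma inc2_mult: "dim_row A = m \<Longrightarrow> inc2 n m * A = mat (n + m) (dim_col A) (\<lambda>(i, j). if n \<le> i then A $$ (i - n, j) else 0)"
  by (rule eq_matI) (auto simp: mat_mult_index simp del: index_mult_mat(1), auto simp: inc2_def if_distrib if_distribR sum_shift_delta cong: if_cong)

lemma prj_inc:
  "prj1 n m * inc1 n m = 1\<^sub>m n" "prj2 n m * inc2 n m = 1\<^sub>m m"
  "prj1 n m * inc2 n m = 0\<^sub>m n m" "prj2 n m * inc1 n m = 0\<^sub>m m n"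
  "inc1 n m * prj1 n m + inc2 n m * prj2 n m = 1\<^sub>m (n + m)"
  by (simp_all add: mult_inc1 mult_inc2 prj1_mult prj2_mult inc1_mult inc2_mult)
    (auto intro!: eq_matI simp: prj1_def inc1_def inc2_def prj2_def)

lemma prj_inc_mult:
  assumes "dim_row A = n"
  shows "prj1 n m * (inc1 n m * A) = A" "prj2 n m * (inc1 n m * A) = 0\<^sub>m m (dim_col A)"
  using assms by (simp_all add: mat_assoc[symmetric] prj_inc mat_ring0)

lemma prj_inc_mult2:
  assumes "dim_row A = m"
  shows "prj2 n m * (inc2 n m * A) = A" "prj1 n m * (inc2 n m * A) = 0\<^sub>m n (dim_col A)"
  using assms by (simp_all add: mat_assoc[symmetric] prj_inc mat_ring0)

lemma mult_prj1: "dim_col A = n \<Longrightarrow> A * prj1 n m = mat (dim_row A) (n + m) (\<lambda>(i, j). if j < n then A $$ (i, j) else 0)"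
  by (rule eq_matI) (auto simp: mat_mult_index simp del: index_mult_mat(1), auto simp: prj1_def if_distrib cong: if_cong)

lemma mult_prj2: "dim_col A = m \<Longrightarrow> A * prj2 n m = mat (dim_row A) (n + m) (\<lambda>(i, j). if n \<le> j then A $$ (i, j - n) else 0)"
  by (rule eq_matI) (auto simp: mat_mult_index simp del: index_mult_mat(1), auto simp: prj2_def if_distrib sum_shift_delta cong: if_cong)

lemma four_block_inc:
  assumes "A \<in> carrier_mat a b" "B \<in> carrier_mat a d" "C \<in> carrier_mat c b" "D \<in> carrier_mat c d"
  shows "four_block_mat A B C D * inc1 b d = inc1 a c * A + inc2 a c * C"
    and "four_block_mat A B C D * inc2 b d = inc1 a c * B + inc2 a c * D"
    and "prj1 a c * four_block_mat A B C D = A * prj1 b d + B * prj2 b d"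
    and "prj2 a c * four_block_mat A B C D = C * prj1 b d + D * prj2 b d"
  using assms
  by (simp_all add: mult_inc1 mult_inc2 inc1_mult inc2_mult prj1_mult prj2_mult mult_prj1 mult_prj2)
    (auto intro!: eq_matI)

lemma diag_block2: "diag_block_mat [A, B] = four_block_mat A (0\<^sub>m (dim_row A) (dim_col B)) (0\<^sub>m (dim_row B) (dim_col A)) (B :: complex mat)"
  by (auto simp: diag_block_mat.simps Let_def intro!: eq_matI)

lemma diag_dims[simp]: "dim_row (diag_block_mat [A, B]) = dim_row A + dim_row B" "dim_col (diag_block_mat [A, B]) = dim_col A + dim_col (B :: complex mat)"
  by (auto simp: diag_block2)

declare diag_block_mat.simps[simp del]

lemma diag_inc:
  "diag_block_mat [A, B] * inc1 (dim_col A) (dim_col B) = inc1 (dim_row A) (dim_row B) * A"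
  "diag_block_mat [A, B] * inc2 (dim_col A) (dim_col B) = inc2 (dim_row A) (dim_row B) * B"
  "prj1 (dim_row A) (dim_row B) * diag_block_mat [A, B] = A * prj1 (dim_col A) (dim_col B)"
  "prj2 (dim_row A) (dim_row B) * diag_block_mat [A, B] = B * prj2 (dim_col A) (dim_col (B :: complex mat))"
proof -
  note * = four_block_inc[of A "dim_row A" "dim_col A" "0\<^sub>m (dim_row A) (dim_col B)" "dim_col B" "0\<^sub>m (dim_row B) (dim_col A)" "dim_row B" B, OF carrier_matI[OF refl refl] zero_carrier_mat zero_carrier_mat carrier_matI[OF refl refl]]
  show "diag_block_mat [A, B] * inc1 (dim_col A) (dim_col B) = inc1 (dim_row A) (dim_row B) * A"
    "diag_block_mat [A, B] * inc2 (dim_col A) (dim_col B) = inc2 (dim_row A) (dim_row B) * B"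
    "prj1 (dim_row A) (dim_row B) * diag_block_mat [A, B] = A * prj1 (dim_col A) (dim_col B)"
    "prj2 (dim_row A) (dim_row B) * diag_block_mat [A, B] = B * prj2 (dim_col A) (dim_col B)"
    unfolding diag_block2 * by (simp_all add: mat_ring0)
qed

lemma diag_assoc: "diag_block_mat [A, diag_block_mat [B, C]] = diag_block_mat [diag_block_mat [A, B], C :: complex mat]"
  unfolding diag_block2 using assoc_four_block_mat[of A B C] by simp

lemma diag_zero: "diag_block_mat [A, 0\<^sub>m 0 0] = A" "diag_block_mat [0\<^sub>m 0 0, A] = (A :: complex mat)"
  unfolding diag_block2 by (auto intro!: eq_matI)

subsection \<open>Linear algebra\<close>

lemma mat_mult_zero_vec: "dim_col A = n \<Longrightarrow> (A :: complex mat) *\<^sub>v 0\<^sub>v n = 0\<^sub>v (dim_row A)"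
  by (rule eq_vecI) (auto simp: scalar_prod_def)

text \<open>Take traces: \<open>k * r\<close> and \<open>r * k\<close> have the same trace, likewise
  \<open>s * p\<close> and \<open>p * s\<close>, and over the complex numbers the trace of an
  identity matrix determines its size.\<close>

lemma split_dims:
  fixes k r p s :: "complex mat"
  assumes "r * k = 1\<^sub>m a" "p * s = 1\<^sub>m c" "k * r + s * p = 1\<^sub>m n"
    and "k \<in> carrier_mat n a" "r \<in> carrier_mat a n" "p \<in> carrier_mat c n" "s \<in> carrier_mat n c"
  shows "n = a + c"
proof -
  define tr where "tr \<equiv> \<lambda>A :: complex mat. \<Sum>i<dim_row A. A $$ (i, i)"
  have comm: "tr (A * B) = tr (B * A)" if "dim_row A = dim_col B" "dim_col A = dim_row B" for A B :: "complex mat"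
  proof -
    have "tr (A * B) = (\<Sum>i<dim_row A. \<Sum>l<dim_row B. A $$ (i, l) * B $$ (l, i))"
      unfolding tr_def using that by (intro sum.cong) (auto simp: mat_mult_index simp del: index_mult_mat(1))
    also have "\<dots> = (\<Sum>l<dim_row B. \<Sum>i<dim_row A. B $$ (l, i) * A $$ (i, l))"
      by (subst sum.swap) (simp add: mult.commute)
    also have "\<dots> = tr (B * A)"
      unfolding tr_def using that by (intro sum.cong) (auto simp: mat_mult_index simp del: index_mult_mat(1))
    finally show ?thesis .
  qed
  have tr1: "tr (1\<^sub>m m) = of_nat m" for m by (simp add: tr_def)
  have "of_nat n = tr (k * r + s * p)" by (simp add: assms tr1)
  also have "\<dots> = tr (k * r) + tr (s * p)"
    using assms(4-7) by (simp add: tr_def sum.distrib)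
  also have "\<dots> = tr (r * k) + tr (p * s)"
    using assms(4-7) by (simp add: comm[of k r] comm[of s p])
  also have "\<dots> = of_nat (a + c)" using assms(1,2) by (simp add: tr1)
  finally show ?thesis by (metis of_nat_eq_iff)
qed

text \<open>If \<open>a\<close> exceeded \<open>n\<close>, zero rows below \<open>k\<close> and zero
  columns beside \<open>r\<close> would make both square without changing \<open>r * k\<close>. For
  square matrices a one-sided inverse is two-sided, but the product in the other order has a zero
  row.\<close>

lemma left_inverse_dims:
  fixes k r :: "complex mat"
  assumes "r * k = 1\<^sub>m a" "k \<in> carrier_mat n a" "r \<in> carrier_mat a n"
  shows "a \<le> n"
proof (rule ccontr)
  assume "\<not> a \<le> n"
  then obtain m where a: "a = n + Suc m" by (metis add_Suc_right less_imp_Suc_add not_le)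
  let ?k = "inc1 n (Suc m) * k" and ?r = "r * prj1 n (Suc m)"
  have c: "?k \<in> carrier_mat a a" "?r \<in> carrier_mat a a" using assms a by auto
  have "?r * ?k = 1\<^sub>m a"
    using assms by (simp add: mat_assoc prj_inc_mult)
  then have "?k * ?r = 1\<^sub>m a" using mat_mult_left_right_inverse c by blast
  then have "(?k * ?r) $$ (n, n) = 1" using a by simp
  moreover have "(?k * ?r) $$ (n, n) = 0"
    using c a assms by (subst mat_mult_index) (auto simp: inc1_mult)
  ultimately show False by simp
qed

text \<open>Among the pairs \<open>k\<close>, \<open>r\<close> that are fixed by \<open>e\<close>
  and satisfy \<open>r * k = 1\<close>, take one with \<open>a\<close> maximal, which exists by
  \<open>left_inverse_dims\<close>. The rest \<open>f = e - k * r\<close> is an idempotent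
  orthogonal to \<open>k\<close> and \<open>r\<close>; a non-zero entry of it would split off one
  more dimension.\<close>

lemma idem_split:
  assumes e: "e \<in> carrier_mat n n" "e * e = (e :: complex mat)"
  shows "\<exists>a k r. k \<in> carrier_mat n a \<and> r \<in> carrier_mat a n \<and> r * k = 1\<^sub>m a \<and> k * r = e"
proof -
  define P where "P a \<longleftrightarrow> (\<exists>k r. k \<in> carrier_mat n a \<and> r \<in> carrier_mat a n \<and> r * k = 1\<^sub>m a \<and> e * k = k \<and> r * e = r)" for a
  have P0: "P 0" unfolding P_def
    by (rule exI[of _ "0\<^sub>m n 0"], rule exI[of _ "0\<^sub>m 0 n"]) (use e in \<open>auto intro!: eq_matI\<close>)
  have bound: "\<And>a. P a \<Longrightarrow> a \<le> n" unfolding P_def using left_inverse_dims by blast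
  obtain a where a: "P a" "\<And>b. P b \<Longrightarrow> b \<le> a"
    using GreatestI_nat[of P 0 n] Greatest_le_nat[of P _ n] P0 bound by blast
  obtain k r where kr: "k \<in> carrier_mat n a" "r \<in> carrier_mat a n" "r * k = 1\<^sub>m a" "e * k = k" "r * e = r"
    using a(1) unfolding P_def by blast
  define f where "f = e - k * r"
  have f: "f \<in> carrier_mat n n" unfolding f_def using e kr by auto
  have rke: "e * (k * r) = k * r" using e kr by (simp add: mat_assoc[symmetric])
  have ekr: "k * r * e = k * r" using e kr by (simp add: mat_assoc)
  have krkr: "k * r * (k * r) = k * r"
  proof -
    have "k * r * (k * r) = k * (r * k) * r" using kr(1,2) by (simp add: mat_assoc)
    then show ?thesis using kr by (simp add: mat_ring)
  qed
  have rf: "r * f = 0\<^sub>m a n"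
  proof -
    have "r * (k * r) = (r * k) * r" using kr(1,2) by (simp add: mat_assoc)
    then show ?thesis using e kr by (simp add: f_def mat_ring)
  qed
  have fk: "f * k = 0\<^sub>m n a" using e kr by (simp add: f_def mat_ring)
  have ef: "e * f = f" using e kr rke by (simp add: f_def mat_diff_left)
  have fe: "f * e = f" using e kr ekr by (simp add: f_def mat_diff_right)
  have ff: "f * f = f"
  proof -
    have "f * f = f * e - f * k * r" using f e kr by (subst (2) f_def) (simp add: mat_diff_left mat_assoc)
    then show ?thesis using fk fe f kr by (simp add: mat_ring)
  qed
  have "f = 0\<^sub>m n n"
  proof (rule ccontr)
    assume "f \<noteq> 0\<^sub>m n n"
    then obtain i j where ij: "i < n" "j < n" "f $$ (i, j) \<noteq> 0"
      using f by (metis carrier_matD eq_matI index_zero_mat)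
    \<comment> \<open>Column \<open>j\<close> of \<open>f\<close>, and row \<open>i\<close> of
      \<open>f\<close> divided by the entry at \<open>(i, j)\<close>: since \<open>f\<close> is
      idempotent, \<open>y * x\<close> is the identity of size one.\<close>
    define x where "x = f * mat n 1 (\<lambda>(i, _). if i = j then 1 else 0)"
    define y where "y = mat 1 n (\<lambda>(_, l). if l = i then inverse (f $$ (i, j)) else 0) * f"
    have xi: "x $$ (i, 0) = f $$ (i, j)"
      using ij f unfolding x_def by (subst mat_mult_index) (auto simp: if_distrib cong: if_cong)
    have x: "x \<in> carrier_mat n 1" and y: "y \<in> carrier_mat 1 n" using f by (auto simp: x_def y_def)
    have fx: "f * x = x" using ff f unfolding x_def by (simp add: mat_assoc[symmetric])
    have yf: "y * f = y" using ff f unfolding y_def by (simp add: mat_assoc)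
    have "y * x = mat 1 n (\<lambda>(_, l). if l = i then inverse (f $$ (i, j)) else 0) * x"
      unfolding y_def using f x fx by (simp add: mat_assoc)
    also have "\<dots> = 1\<^sub>m 1"
      using x xi ij by (intro eq_matI) (auto simp: mat_mult_index if_distrib if_distribR simp del: index_mult_mat(1) cong: if_cong)
    finally have yx: "y * x = 1\<^sub>m 1" .
    have rx: "r * x = 0\<^sub>m a 1"
    proof -
      have "r * x = (r * f) * x" using fx f kr x by (simp add: mat_assoc)
      then show ?thesis using rf x by (simp add: mat_ring)
    qed
    have yk: "y * k = 0\<^sub>m 1 a"
    proof -
      have "y * k = y * (f * k)" using yf f kr y by (simp add: mat_assoc[symmetric])
      then show ?thesis using fk y by (simp add: mat_ring)
    qed
    have ex: "e * x = x" using fx ef x f e by (metis carrier_matD mat_assoc)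
    have ye: "y * e = y" using yf fe y f e by (metis carrier_matD mat_assoc)
    let ?k = "k * prj1 a 1 + x * prj2 a 1" and ?r = "inc1 a 1 * r + inc2 a 1 * y"
    have "P (a + 1)" unfolding P_def
    proof (intro exI conjI)
      show "?k \<in> carrier_mat n (a + 1)" "?r \<in> carrier_mat (a + 1) n" using kr x y by auto
      have A: "(r * (k * B)) = B" if "dim_row B = a" for B
        using kr that by (simp add: mat_assoc[symmetric] mat_ring0)
      have B: "(y * (x * B)) = B" if "dim_row B = 1" for B
        using yx x y that by (simp add: mat_assoc[symmetric] mat_ring0)
      have C: "(r * (x * B)) = 0\<^sub>m a (dim_col B)" if "dim_row B = 1" for B
        using rx x kr that by (simp add: mat_assoc[symmetric] mat_ring0)
      have D: "(y * (k * B)) = 0\<^sub>m 1 (dim_col B)" if "dim_row B = a" for B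
        using yk y kr that by (simp add: mat_assoc[symmetric] mat_ring0)
      show "?r * ?k = 1\<^sub>m (a + 1)"
        using kr x y A B C D by (simp add: mat_ring prj_inc)
      have A: "(e * (k * B)) = k * B" if "dim_row B = a" for B
        using kr that e by (simp add: mat_assoc[symmetric])
      have B: "(e * (x * B)) = x * B" if "dim_row B = 1" for B
        using ex x e that by (simp add: mat_assoc[symmetric])
      show "e * ?k = ?k" using kr x e A B by (simp add: mat_ring)
      show "?r * e = ?r" using kr y e ye by (simp add: mat_ring)
    qed
    then show False using a(2)[of "a + 1"] by simp
  qed
  then have "k * r = e"
  proof -
    assume f0: "f = 0\<^sub>m n n"
    have "e = f + k * r" unfolding f_def using e kr by (intro eq_matI) auto
    then show ?thesis using f0 kr by (simp add: mat_ring0)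
  qed
  then show ?thesis using kr by blast
qed

lemma mat_image_right_inverse:
  assumes "A \<in> carrier_mat m n" "mat_image A = carrier_vec m"
  shows "\<exists>s\<in>carrier_mat n m. A * s = 1\<^sub>m m"
proof -
  have "\<exists>z\<in>carrier_vec n. A *\<^sub>v z = unit_vec m i" for i
  proof -
    have "unit_vec m i \<in> mat_image A" using assms by simp
    then show ?thesis using assms(1) unfolding mat_image_def by auto
  qed
  then obtain z where z: "\<And>i. z i \<in> carrier_vec n" "\<And>i. A *\<^sub>v z i = unit_vec m i" by metis
  let ?s = "mat_of_cols n (map z [0..<m])"
  have s: "?s \<in> carrier_mat n m" by auto
  have "A * ?s = 1\<^sub>m m"
  proof (rule mat_col_eqI)
    fix i assume i: "i < dim_col (1\<^sub>m m :: complex mat)"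
    have "col (A * ?s) i = A *\<^sub>v col ?s i" using i assms s by (intro col_mult2) auto
    also have "\<dots> = A *\<^sub>v z i" using i z by (subst col_mat_of_cols) auto
    finally show "col (A * ?s) i = col (1\<^sub>m m) i" using i z by simp
  qed (use assms in auto)
  then show ?thesis using s by blast
qed

lemma right_inverse_mat_image:
  assumes "A \<in> carrier_mat m n" "s \<in> carrier_mat n m" "A * s = 1\<^sub>m m"
  shows "mat_image A = carrier_vec m"
proof
  show "mat_image A \<subseteq> carrier_vec m" using assms(1) unfolding mat_image_def by auto
  show "carrier_vec m \<subseteq> mat_image A"
  proof
    fix x :: "complex vec" assume x: "x \<in> carrier_vec m"
    have "A *\<^sub>v (s *\<^sub>v x) = x" using assms x by (simp add: mat_mult_vec_assoc)
    then show "x \<in> mat_image A" using assms x unfolding mat_image_def by (intro image_eqI[of _ _ "s *\<^sub>v x"]) auto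
  qed
qed

text \<open>\<open>invertible_mat\<close> asks for a square matrix, whereas the sizes of a
  homomorphism are given by two dimension functions whose equality is not known beforehand. A
  two-sided inverse forces it, by \<open>left_inverse_dims\<close> in both directions.\<close>

lemma invertible_iff:
  fixes A :: "complex mat"
  assumes "A \<in> carrier_mat m n"
  shows "invertible_mat A \<longleftrightarrow> (\<exists>B\<in>carrier_mat n m. A * B = 1\<^sub>m m \<and> B * A = 1\<^sub>m n)"
proof
  assume "invertible_mat A"
  then obtain B where sq: "dim_row A = dim_col A" and B: "A * B = 1\<^sub>m (dim_row A)" "B * A = 1\<^sub>m (dim_row B)"
    unfolding invertible_mat_def inverts_mat_def by auto
  have "dim_col B = m" "dim_row B = n"
    using B assms sq by (metis carrier_matD index_mult_mat(2,3) index_one_mat(2,3))+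
  then show "\<exists>B\<in>carrier_mat n m. A * B = 1\<^sub>m m \<and> B * A = 1\<^sub>m n"
    using B assms by (intro bexI[of _ B]) auto
next
  assume "\<exists>B\<in>carrier_mat n m. A * B = 1\<^sub>m m \<and> B * A = 1\<^sub>m n"
  then obtain B where B: "B \<in> carrier_mat n m" "A * B = 1\<^sub>m m" "B * A = 1\<^sub>m n" by blast
  have "m \<le> n" using left_inverse_dims[OF B(2)] B(1) assms by blast
  moreover have "n \<le> m" using left_inverse_dims[OF B(3)] B(1) assms by blast
  ultimately show "invertible_mat A"
    using B assms unfolding invertible_mat_def inverts_mat_def by auto
qed

text \<open>A zero determinant gives a non-zero vector killed by the transpose, that is, a row that
  kills \<open>A\<close>. The criterion speaks of rows because these are the functionals that
  \<open>top_functional\<close> pulls back to the top of a module.\<close>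

lemma square_no_functional_invertible:
  assumes A: "A \<in> carrier_mat n n"
    and "\<And>\<xi>. \<xi> \<in> carrier_mat 1 n \<Longrightarrow> \<xi> * A = 0\<^sub>m 1 n \<Longrightarrow> \<xi> = 0\<^sub>m 1 n"
  shows "\<exists>B\<in>carrier_mat n n. A * B = 1\<^sub>m n \<and> B * A = (1\<^sub>m n :: complex mat)"
proof -
  have "det (transpose_mat A) \<noteq> 0"
  proof
    assume "det (transpose_mat A) = 0"
    then obtain v where v: "v \<in> carrier_vec n" "v \<noteq> 0\<^sub>v n" "transpose_mat A *\<^sub>v v = 0\<^sub>v n"
      using det_0_iff_vec_prod_zero[of "transpose_mat A" n] A by auto
    have "mat_of_row v * A = 0\<^sub>m 1 n"
    proof (rule eq_matI)
      fix i j assume ij: "i < dim_row (0\<^sub>m 1 n :: complex mat)" "j < dim_col (0\<^sub>m 1 n :: complex mat)"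
      have "(mat_of_row v * A) $$ (i, j) = v \<bullet> col A j" using ij A v by auto
      also have "\<dots> = (transpose_mat A *\<^sub>v v) $ j" using ij A v(1) comm_scalar_prod[of v n "col A j"] by auto
      finally show "(mat_of_row v * A) $$ (i, j) = 0\<^sub>m 1 n $$ (i, j)" using ij unfolding v(3) by simp
    qed (use A v in auto)
    then have "mat_of_row v = 0\<^sub>m 1 n" using assms(2)[of "mat_of_row v"] v by auto
    then have "\<And>i. i < n \<Longrightarrow> v $ i = 0" using v by (metis carrier_vecD index_zero_mat(1) mat_of_row_index less_numeral_extra(1))
    then show False using v by auto
  qed
  then have "det A \<noteq> 0" using det_transpose[OF A] by simp
  then obtain B where "B \<in> carrier_mat n n" "A * B = 1\<^sub>m n"
    using det_non_zero_imp_unit[OF A, of "()"] unfolding Units_def by (auto simp: ring_mat_simps)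
  then show ?thesis using mat_mult_left_right_inverse[OF A] by blast
qed

section \<open>Representations and their homomorphisms\<close>

definition hom_shape :: "('v, 'a) pre_digraph \<Rightarrow> ('v, 'a) rep \<Rightarrow> bool" where
  "hom_shape Q V \<longleftrightarrow> (\<forall>v. v \<notin> verts Q \<longrightarrow> rdim V v = 0) \<and>
     (\<forall>a\<in>arcs Q. rmap V a \<in> carrier_mat (rdim V (head Q a)) (rdim V (tail Q a))) \<and>
     (\<forall>a. a \<notin> arcs Q \<longrightarrow> rmap V a = 0\<^sub>m 0 0)"

lemma is_rep_shape: "is_rep Q R V \<Longrightarrow> hom_shape Q V"
  unfolding is_rep_def hom_shape_def by blast

text \<open>Separating the sizes from the relations allows maps to be composed before the relations
  are known, as is needed for kernels and direct sums, which inherit the relations along such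
  maps.\<close>

lemma is_rep_iff: "is_rep Q R V \<longleftrightarrow> hom_shape Q V \<and>
  (\<forall>\<rho>\<in>R. \<forall>u\<in>verts Q. \<forall>v\<in>verts Q. relation_mat Q V \<rho> u v = 0\<^sub>m (rdim V v) (rdim V u))"
  unfolding is_rep_def hom_shape_def by blast

lemma shape_dims:
  assumes "hom_shape Q V" "a \<in> arcs Q"
  shows "dim_row (rmap V a) = rdim V (head Q a)" "dim_col (rmap V a) = rdim V (tail Q a)"
  using assms unfolding hom_shape_def by auto

lemma hom_dims:
  assumes "rep_hom Q V W f"
  shows "dim_row (f v) = rdim W v" "dim_col (f v) = rdim V v"
  using assms unfolding rep_hom_def by auto

lemma hom_carrier: "rep_hom Q V W f \<Longrightarrow> f v \<in> carrier_mat (rdim W v) (rdim V v)"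
  unfolding rep_hom_def by auto

lemma hom_comm: "rep_hom Q V W f \<Longrightarrow> a \<in> arcs Q \<Longrightarrow> f (head Q a) * rmap V a = rmap W a * f (tail Q a)"
  unfolding rep_hom_def by auto

lemma hom_comp:
  assumes "hom_shape Q V" "hom_shape Q W" "hom_shape Q Z" "rep_hom Q V W f" "rep_hom Q W Z g"
  shows "rep_hom Q V Z (\<lambda>v. g v * f v)"
  unfolding rep_hom_def
proof safe
  fix v show "g v * f v \<in> carrier_mat (rdim Z v) (rdim V v)"
    using assms by (auto dest!: hom_carrier[of _ _ _ _ v])
next
  fix a assume a: "a \<in> arcs Q"
  note d = shape_dims[OF assms(1) a] shape_dims[OF assms(2) a] shape_dims[OF assms(3) a] hom_dims[OF assms(4)] hom_dims[OF assms(5)]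
  have "g (head Q a) * f (head Q a) * rmap V a = g (head Q a) * (f (head Q a) * rmap V a)" by (simp add: mat_assoc d)
  also have "\<dots> = (g (head Q a) * rmap W a) * f (tail Q a)" by (simp add: mat_assoc d hom_comm[OF assms(4) a])
  also have "\<dots> = rmap Z a * (g (tail Q a) * f (tail Q a))" by (simp add: mat_assoc d hom_comm[OF assms(5) a])
  finally show "g (head Q a) * f (head Q a) * rmap V a = rmap Z a * (g (tail Q a) * f (tail Q a))" .
qed

lemma hom_id: "hom_shape Q V \<Longrightarrow> rep_hom Q V V (\<lambda>v. 1\<^sub>m (rdim V v))"
  unfolding rep_hom_def by (auto simp: shape_dims mat_ring0)

lemma hom_add:
  assumes "hom_shape Q V" "hom_shape Q W" "rep_hom Q V W f" "rep_hom Q V W g"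
  shows "rep_hom Q V W (\<lambda>v. f v + g v)"
  unfolding rep_hom_def
proof safe
  fix v show "f v + g v \<in> carrier_mat (rdim W v) (rdim V v)"
    using assms by (auto dest!: hom_carrier[of _ _ _ _ v])
next
  fix a assume a: "a \<in> arcs Q"
  show "(f (head Q a) + g (head Q a)) * rmap V a = rmap W a * (f (tail Q a) + g (tail Q a))"
    using a by (simp add: mat_ring0 shape_dims[OF assms(1) a] shape_dims[OF assms(2) a] hom_dims[OF assms(3)] hom_dims[OF assms(4)] hom_comm[OF assms(3) a] hom_comm[OF assms(4) a])
qed

lemma hom_diff:
  assumes "hom_shape Q V" "hom_shape Q W" "rep_hom Q V W f" "rep_hom Q V W g"
  shows "rep_hom Q V W (\<lambda>v. f v - g v)"
  unfolding rep_hom_def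
proof safe
  fix v show "f v - g v \<in> carrier_mat (rdim W v) (rdim V v)"
    using assms by (auto dest!: hom_carrier[of _ _ _ _ v] simp: minus_carrier_mat)
next
  fix a assume a: "a \<in> arcs Q"
  show "(f (head Q a) - g (head Q a)) * rmap V a = rmap W a * (f (tail Q a) - g (tail Q a))"
    using a by (simp add: mat_ring0 shape_dims[OF assms(1) a] shape_dims[OF assms(2) a] hom_dims[OF assms(3)] hom_dims[OF assms(4)] hom_comm[OF assms(3) a] hom_comm[OF assms(4) a])
qed

lemma hom_zero: "hom_shape Q V \<Longrightarrow> hom_shape Q W \<Longrightarrow> rep_hom Q V W (\<lambda>v. 0\<^sub>m (rdim W v) (rdim V v))"
  unfolding rep_hom_def by (auto simp: shape_dims mat_ring0)

lemma hom_uminus: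
  assumes "hom_shape Q V" "hom_shape Q W" "rep_hom Q V W f"
  shows "rep_hom Q V W (\<lambda>v. - f v)"
  unfolding rep_hom_def
proof safe
  fix v show "- f v \<in> carrier_mat (rdim W v) (rdim V v)"
    using hom_carrier[OF assms(3), of v] by simp
next
  fix a assume a: "a \<in> arcs Q"
  show "- f (head Q a) * rmap V a = rmap W a * - f (tail Q a)"
    using a by (simp add: mat_ring0 shape_dims[OF assms(1) a] shape_dims[OF assms(2) a] hom_dims[OF assms(3)] hom_comm[OF assms(3) a])
qed

subsection \<open>Path matrices and relations under homomorphisms\<close>

context fin_digraph begin

lemma path_mat_carrier:
  assumes "hom_shape G V" "awalk u p w"
  shows "path_mat G V u p \<in> carrier_mat (rdim V w) (rdim V u)"
  using assms(2)
proof (induction p arbitrary: u)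
  case Nil then show ?case by (auto simp: awalk_def)
next
  case (Cons a p)
  then have a: "a \<in> arcs G" "tail G a = u" "awalk (head G a) p w" by (auto simp: awalk_Cons_iff)
  have "rmap V a \<in> carrier_mat (rdim V (head G a)) (rdim V u)" using assms(1) a unfolding hom_shape_def by auto
  then show ?case using Cons.IH[OF a(3)] by auto
qed

lemma path_mat_hom:
  assumes "hom_shape G V" "hom_shape G W" "rep_hom G V W f" "awalk u p w"
  shows "f w * path_mat G V u p = path_mat G W u p * f u"
  using assms(4)
proof (induction p arbitrary: u)
  case Nil then show ?case by (auto simp: awalk_def mat_ring0 hom_dims[OF assms(3)])
next
  case (Cons a p)
  then have a: "a \<in> arcs G" "tail G a = u" "awalk (head G a) p w" by (auto simp: awalk_Cons_iff)
  note c = path_mat_carrier[OF assms(1) a(3)] path_mat_carrier[OF assms(2) a(3)]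
  note d = carrier_matD[OF c(1)] carrier_matD[OF c(2)] shape_dims[OF assms(1) a(1)] shape_dims[OF assms(2) a(1)] hom_dims[OF assms(3)] a(2)
  have "f w * path_mat G V u (a # p) = (f w * path_mat G V (head G a) p) * rmap V a" by (simp add: mat_assoc d)
  also have "\<dots> = path_mat G W (head G a) p * (f (head G a) * rmap V a)" by (simp add: mat_assoc d Cons.IH[OF a(3)])
  also have "\<dots> = path_mat G W u (a # p) * f u" by (simp add: mat_assoc d hom_comm[OF assms(3) a(1)])
  finally show ?case .
qed

lemma relation_mat_hom:
  assumes "hom_shape G V" "hom_shape G W" "rep_hom G V W f"
  shows "f w * relation_mat G V \<rho> u w = relation_mat G W \<rho> u w * f u"
proof -
  let ?S = "{p. \<rho> (u, p) \<noteq> 0 \<and> awalk u p w}"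
  note d = hom_dims[OF assms(3)]
  have dr: "dim_row (relation_mat G V \<rho> u w) = rdim V w" "dim_col (relation_mat G V \<rho> u w) = rdim V u" for V :: "('a, 'b) rep" by (auto simp: relation_mat_def)
  show ?thesis
  proof (rule eq_matI)
    fix i j assume "i < dim_row (relation_mat G W \<rho> u w * f u)" "j < dim_col (relation_mat G W \<rho> u w * f u)"
    then have ij: "i < rdim W w" "j < rdim V u" by (auto simp: dr d)
    have "(f w * relation_mat G V \<rho> u w) $$ (i, j) = (\<Sum>l<rdim V w. f w $$ (i, l) * (\<Sum>p\<in>?S. \<rho> (u, p) * path_mat G V u p $$ (l, j)))"
      using ij by (subst mat_mult_index) (auto simp: dr d relation_mat_def intro!: sum.cong)
    also have "\<dots> = (\<Sum>p\<in>?S. \<rho> (u, p) * (\<Sum>l<rdim V w. f w $$ (i, l) * path_mat G V u p $$ (l, j)))"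
      unfolding sum_distrib_left by (subst sum.swap) (simp add: algebra_simps)
    also have "\<dots> = (\<Sum>p\<in>?S. \<rho> (u, p) * (f w * path_mat G V u p) $$ (i, j))"
      using ij by (intro sum.cong refl, subst mat_mult_index) (auto simp: d dest!: path_mat_carrier[OF assms(1)])
    also have "\<dots> = (\<Sum>p\<in>?S. \<rho> (u, p) * (path_mat G W u p * f u) $$ (i, j))"
      using path_mat_hom[OF assms] by (intro sum.cong refl) auto
    also have "\<dots> = (\<Sum>p\<in>?S. \<rho> (u, p) * (\<Sum>l<rdim W u. path_mat G W u p $$ (i, l) * f u $$ (l, j)))"
      using ij by (intro sum.cong refl, subst mat_mult_index) (auto simp: d dest!: path_mat_carrier[OF assms(2)])
    also have "\<dots> = (\<Sum>l<rdim W u. (\<Sum>p\<in>?S. \<rho> (u, p) * path_mat G W u p $$ (i, l)) * f u $$ (l, j))"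
      unfolding sum_distrib_left sum_distrib_right by (subst sum.swap) (simp add: algebra_simps)
    also have "\<dots> = (relation_mat G W \<rho> u w * f u) $$ (i, j)"
      using ij by (subst mat_mult_index) (auto simp: dr d relation_mat_def intro!: sum.cong)
    finally show "(f w * relation_mat G V \<rho> u w) $$ (i, j) = (relation_mat G W \<rho> u w * f u) $$ (i, j)" .
  qed (auto simp: dr d)
qed

text \<open>After \<open>k\<close>, a relation matrix of \<open>K\<close> becomes one of
  \<open>V\<close>, hence zero, and \<open>k\<close> can be cancelled; its left inverse
  \<open>r\<close> is only linear.\<close>

lemma sub_rep:
  assumes "hom_shape G K" "is_rep G R V" "rep_hom G K V k" "\<And>v. r v \<in> carrier_mat (rdim K v) (rdim V v)" "\<And>v. r v * k v = 1\<^sub>m (rdim K v)"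
  shows "is_rep G R K"
  unfolding is_rep_iff
proof safe
  fix \<rho> u w assume *: "\<rho> \<in> R" "u \<in> verts G" "w \<in> verts G"
  note hs = assms(1) is_rep_shape[OF assms(2)]
  have "k w * relation_mat G K \<rho> u w = relation_mat G V \<rho> u w * k u"
    by (rule relation_mat_hom[OF hs assms(3)])
  also have "relation_mat G V \<rho> u w = 0\<^sub>m (rdim V w) (rdim V u)" using * assms(2) unfolding is_rep_def by blast
  also have "0\<^sub>m (rdim V w) (rdim V u) * k u = k w * 0\<^sub>m (rdim K w) (rdim K u)"
    by (simp add: mat_ring0 hom_dims[OF assms(3)])
  finally have e: "k w * relation_mat G K \<rho> u w = k w * 0\<^sub>m (rdim K w) (rdim K u)" .
  show "relation_mat G K \<rho> u w = 0\<^sub>m (rdim K w) (rdim K u)"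
    by (rule mat_cancel_left[OF assms(5) _ _ _ _ e])
      (simp_all add: hom_dims[OF assms(3)] carrier_matD[OF assms(4)], simp add: relation_mat_def)
qed (rule assms)

text \<open>The relations hold after \<open>p\<close> and after \<open>q\<close>, and these two are
  jointly injective: \<open>i\<close> and \<open>j\<close>, which are only linear, recover the
  identity from them.\<close>

lemma joint_sub_rep:
  assumes "hom_shape G V" "is_rep G R A" "is_rep G R B" "rep_hom G V A p" "rep_hom G V B q"
    and "\<And>v. i v \<in> carrier_mat (rdim V v) (rdim A v)" "\<And>v. j v \<in> carrier_mat (rdim V v) (rdim B v)"
    and "\<And>v. i v * p v + j v * q v = 1\<^sub>m (rdim V v)"
  shows "is_rep G R V"
  unfolding is_rep_iff
proof safe
  fix \<rho> u w assume *: "\<rho> \<in> R" "u \<in> verts G" "w \<in> verts G"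
  let ?r = "relation_mat G V \<rho> u w"
  note d = hom_dims[OF assms(4)] hom_dims[OF assms(5)] carrier_matD[OF assms(6)] carrier_matD[OF assms(7)]
  have dr: "dim_row ?r = rdim V w" "dim_col ?r = rdim V u" by (auto simp: relation_mat_def)
  have "?r = (i w * p w + j w * q w) * ?r" by (simp add: assms(8) mat_ring0 dr)
  also have "\<dots> = i w * (p w * ?r) + j w * (q w * ?r)" by (simp add: mat_ring d dr)
  also have "p w * ?r = 0\<^sub>m (rdim A w) (rdim V u)"
  proof -
    have "relation_mat G A \<rho> u w = 0\<^sub>m (rdim A w) (rdim A u)" using assms(2) * unfolding is_rep_def by blast
    then show ?thesis by (simp add: mat_ring0 d relation_mat_hom[OF assms(1) is_rep_shape[OF assms(2)] assms(4)])
  qed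
  also have "q w * ?r = 0\<^sub>m (rdim B w) (rdim V u)"
  proof -
    have "relation_mat G B \<rho> u w = 0\<^sub>m (rdim B w) (rdim B u)" using assms(3) * unfolding is_rep_def by blast
    then show ?thesis by (simp add: mat_ring0 d relation_mat_hom[OF assms(1) is_rep_shape[OF assms(3)] assms(5)])
  qed
  finally show "?r = 0\<^sub>m (rdim V w) (rdim V u)" by (simp add: mat_ring0 d)
qed (rule assms)

end

subsection \<open>Direct sums of representations\<close>

lemma rdim_dsum[simp]: "rdim (rep_dsum V W) v = rdim V v + rdim W v"
  by (simp add: rep_dsum_def)

lemma dsum_shape:
  assumes "hom_shape Q V" "hom_shape Q W"
  shows "hom_shape Q (rep_dsum V W)"
proof -
  have "rmap V a \<in> carrier_mat (rdim V (head Q a)) (rdim V (tail Q a))" "rmap W a \<in> carrier_mat (rdim W (head Q a)) (rdim W (tail Q a))"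
    if "a \<in> arcs Q" for a using assms that unfolding hom_shape_def by auto
  then have "diag_block_mat [rmap V a, rmap W a] \<in> carrier_mat (rdim V (head Q a) + rdim W (head Q a)) (rdim V (tail Q a) + rdim W (tail Q a))"
    if "a \<in> arcs Q" for a using that by (intro carrier_matI) force+
  then show ?thesis using assms unfolding hom_shape_def rep_dsum_def by (auto simp: diag_zero)
qed

lemma dsum_homs:
  assumes "hom_shape Q V" "hom_shape Q W"
  shows "rep_hom Q V (rep_dsum V W) (\<lambda>v. inc1 (rdim V v) (rdim W v))"
    "rep_hom Q W (rep_dsum V W) (\<lambda>v. inc2 (rdim V v) (rdim W v))"
    "rep_hom Q (rep_dsum V W) V (\<lambda>v. prj1 (rdim V v) (rdim W v))"
    "rep_hom Q (rep_dsum V W) W (\<lambda>v. prj2 (rdim V v) (rdim W v))"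
proof -
  have *: "diag_block_mat [rmap V a, rmap W a] * inc1 (rdim V (tail Q a)) (rdim W (tail Q a)) = inc1 (rdim V (head Q a)) (rdim W (head Q a)) * rmap V a"
     "diag_block_mat [rmap V a, rmap W a] * inc2 (rdim V (tail Q a)) (rdim W (tail Q a)) = inc2 (rdim V (head Q a)) (rdim W (head Q a)) * rmap W a"
     "prj1 (rdim V (head Q a)) (rdim W (head Q a)) * diag_block_mat [rmap V a, rmap W a] = rmap V a * prj1 (rdim V (tail Q a)) (rdim W (tail Q a))"
     "prj2 (rdim V (head Q a)) (rdim W (head Q a)) * diag_block_mat [rmap V a, rmap W a] = rmap W a * prj2 (rdim V (tail Q a)) (rdim W (tail Q a))"
    if "a \<in> arcs Q" for a
    using diag_inc[of "rmap V a" "rmap W a"] by (simp_all add: shape_dims[OF assms(1) that] shape_dims[OF assms(2) that])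
  have c: "inc1 n m \<in> carrier_mat (n + m) n" "inc2 n m \<in> carrier_mat (n + m) m" "prj1 n m \<in> carrier_mat n (n + m)" "prj2 n m \<in> carrier_mat m (n + m)" for n m by auto
  show "rep_hom Q V (rep_dsum V W) (\<lambda>v. inc1 (rdim V v) (rdim W v))"
    "rep_hom Q W (rep_dsum V W) (\<lambda>v. inc2 (rdim V v) (rdim W v))"
    "rep_hom Q (rep_dsum V W) V (\<lambda>v. prj1 (rdim V v) (rdim W v))"
    "rep_hom Q (rep_dsum V W) W (\<lambda>v. prj2 (rdim V v) (rdim W v))"
    unfolding rep_hom_def rdim_dsum using c * by (simp_all add: rep_dsum_def)
qed

lemma (in fin_digraph) dsum_rep:
  assumes "is_rep G R V" "is_rep G R W"
  shows "is_rep G R (rep_dsum V W)"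
proof -
  note hs = is_rep_shape[OF assms(1)] is_rep_shape[OF assms(2)]
  show ?thesis
    by (rule joint_sub_rep[OF dsum_shape[OF hs] assms dsum_homs(3,4)[OF hs], where i = "\<lambda>v. inc1 (rdim V v) (rdim W v)" and j = "\<lambda>v. inc2 (rdim V v) (rdim W v)"]) (auto simp: prj_inc)
qed

lemma rep_dsum_assoc: "rep_dsum U (rep_dsum V W) = rep_dsum (rep_dsum U V) W"
  by (simp add: rep_dsum_def diag_assoc add.assoc)

lemma rep_dsum_zero: "rep_dsum zero_rep V = V" "rep_dsum V zero_rep = V"
  by (simp_all add: rep_dsum_def zero_rep_def diag_zero)

lemma zero_rep_rep: "is_rep Q R zero_rep"
  unfolding is_rep_def zero_rep_def by (auto simp: relation_mat_def)

subsection \<open>Isomorphisms\<close>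

lemma rep_isoI:
  assumes "rep_hom Q V W f" "\<And>v. g v \<in> carrier_mat (rdim V v) (rdim W v)"
    "\<And>v. g v * f v = 1\<^sub>m (rdim V v)" "\<And>v. f v * g v = 1\<^sub>m (rdim W v)"
  shows "rep_iso Q V W"
  unfolding rep_iso_def using assms hom_carrier[OF assms(1)] by (metis invertible_iff)

lemma inverse_hom:
  assumes "hom_shape Q V" "hom_shape Q W" "rep_hom Q V W f" "\<And>v. g v \<in> carrier_mat (rdim V v) (rdim W v)"
    "\<And>v. g v * f v = 1\<^sub>m (rdim V v)" "\<And>v. f v * g v = 1\<^sub>m (rdim W v)"
  shows "rep_hom Q W V g"
  unfolding rep_hom_def
proof safe
  fix v show "g v \<in> carrier_mat (rdim V v) (rdim W v)" by (rule assms)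
next
  fix a assume a: "a \<in> arcs Q"
  note d = shape_dims[OF assms(1) a] shape_dims[OF assms(2) a] hom_dims[OF assms(3)] carrier_matD[OF assms(4)]
  have "g (head Q a) * rmap W a = g (head Q a) * rmap W a * (f (tail Q a) * g (tail Q a))"
    by (simp add: assms d mat_ring0)
  also have "\<dots> = g (head Q a) * (rmap W a * f (tail Q a)) * g (tail Q a)" by (simp add: mat_assoc d)
  also have "\<dots> = (g (head Q a) * f (head Q a)) * rmap V a * g (tail Q a)"
    unfolding hom_comm[OF assms(3) a, symmetric] by (simp add: mat_assoc d)
  also have "\<dots> = rmap V a * g (tail Q a)" unfolding assms(5) by (simp add: mat_ring0 d)
  finally show "g (head Q a) * rmap W a = rmap V a * g (tail Q a)" .
qed

lemma rep_isoE:
  assumes "rep_iso Q V W" "hom_shape Q V" "hom_shape Q W"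
  obtains f g where "rep_hom Q V W f" "rep_hom Q W V g" "\<And>v. g v * f v = 1\<^sub>m (rdim V v)" "\<And>v. f v * g v = 1\<^sub>m (rdim W v)"
proof -
  obtain f where f: "rep_hom Q V W f" "\<And>v. invertible_mat (f v)" using assms(1) unfolding rep_iso_def by auto
  have "\<exists>B\<in>carrier_mat (rdim V v) (rdim W v). f v * B = 1\<^sub>m (rdim W v) \<and> B * f v = 1\<^sub>m (rdim V v)" for v
    using invertible_iff[OF hom_carrier[OF f(1)]] f(2) by blast
  then obtain g where g: "\<And>v. g v \<in> carrier_mat (rdim V v) (rdim W v)" "\<And>v. g v * f v = 1\<^sub>m (rdim V v)" "\<And>v. f v * g v = 1\<^sub>m (rdim W v)"
    by metis
  show ?thesis using that[OF f(1) inverse_hom[OF assms(2,3) f(1) g] g(2,3)] .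
qed

lemma rep_iso_refl: "hom_shape Q V \<Longrightarrow> rep_iso Q V V"
  by (rule rep_isoI[OF hom_id, where g = "\<lambda>v. 1\<^sub>m (rdim V v)"]) (auto simp: mat_ring0)

lemma rep_iso_sym: "rep_iso Q V W \<Longrightarrow> hom_shape Q V \<Longrightarrow> hom_shape Q W \<Longrightarrow> rep_iso Q W V"
  by (elim rep_isoE) (auto intro: rep_isoI dest: hom_carrier)

lemma rep_iso_dims: "rep_iso Q V W \<Longrightarrow> rdim V = rdim W"
  unfolding rep_iso_def rep_hom_def invertible_mat_def by (metis carrier_matD square_mat.simps ext)

lemma rep_iso_trans:
  assumes "rep_iso Q V W" "rep_iso Q W Z" "hom_shape Q V" "hom_shape Q W" "hom_shape Q Z"
  shows "rep_iso Q V Z"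
proof -
  obtain f g where fg: "rep_hom Q V W f" "rep_hom Q W V g" "\<And>v. g v * f v = 1\<^sub>m (rdim V v)" "\<And>v. f v * g v = 1\<^sub>m (rdim W v)"
    using rep_isoE[OF assms(1,3,4)] by metis
  obtain f' g' where fg': "rep_hom Q W Z f'" "rep_hom Q Z W g'" "\<And>v. g' v * f' v = 1\<^sub>m (rdim W v)" "\<And>v. f' v * g' v = 1\<^sub>m (rdim Z v)"
    using rep_isoE[OF assms(2,4,5)] by metis
  note d = hom_dims[OF fg(1)] hom_dims[OF fg(2)] hom_dims[OF fg'(1)] hom_dims[OF fg'(2)]
  show ?thesis
  proof (rule rep_isoI[OF hom_comp[OF assms(3,4,5) fg(1) fg'(1)], where g = "\<lambda>v. g v * g' v"])
    fix v
    show "g v * g' v \<in> carrier_mat (rdim V v) (rdim Z v)" by (auto simp: d)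
    have "g v * g' v * (f' v * f v) = g v * (g' v * f' v) * f v" by (simp add: mat_assoc d)
    then show "g v * g' v * (f' v * f v) = 1\<^sub>m (rdim V v)" using fg fg' by (simp add: mat_ring0 d)
    have "f' v * f v * (g v * g' v) = f' v * (f v * g v) * g' v" by (simp add: mat_assoc d)
    then show "f' v * f v * (g v * g' v) = 1\<^sub>m (rdim Z v)" using fg fg' by (simp add: mat_ring0 d)
  qed
qed

text \<open>Orthogonality is a consequence: multiplying the last identity by \<open>p\<close> on the
  left gives \<open>p = p + (p * j) * q\<close>, and \<open>q\<close> can be cancelled on the right
  by \<open>j\<close>. The product \<open>q * i\<close> is treated in the same way.\<close>

lemma rep_iso_biproduct:
  assumes hs: "hom_shape Q V" "hom_shape Q A" "hom_shape Q B"
    and h: "rep_hom Q A V i" "rep_hom Q B V j" "rep_hom Q V A p" "rep_hom Q V B q"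
    and "\<And>v. p v * i v = 1\<^sub>m (rdim A v)" "\<And>v. q v * j v = 1\<^sub>m (rdim B v)"
    "\<And>v. i v * p v + j v * q v = 1\<^sub>m (rdim V v)"
  shows "rep_iso Q (rep_dsum A B) V"
proof -
  note d = hom_dims[OF h(1)] hom_dims[OF h(2)] hom_dims[OF h(3)] hom_dims[OF h(4)]
  have pj: "p v * j v = 0\<^sub>m (rdim A v) (rdim B v)" for v
  proof -
    have "p v = p v * (i v * p v + j v * q v)" by (simp add: assms d mat_ring0)
    also have "\<dots> = (p v * i v) * p v + (p v * j v) * q v" by (simp add: mat_assoc mat_distrib_left d)
    finally have e: "p v = p v + (p v * j v) * q v" by (simp add: assms mat_ring0 d)
    have "(p v * j v) * q v = 0\<^sub>m (rdim A v) (rdim V v)"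
    proof (rule eq_matI)
      fix a b assume "a < dim_row (0\<^sub>m (rdim A v) (rdim V v) :: complex mat)" "b < dim_col (0\<^sub>m (rdim A v) (rdim V v) :: complex mat)"
      then have ab: "a < rdim A v" "b < rdim V v" by auto
      have "p v $$ (a, b) = (p v + (p v * j v) * q v) $$ (a, b)" using e by simp
      also have "\<dots> = p v $$ (a, b) + ((p v * j v) * q v) $$ (a, b)" using ab by (intro index_add_mat) (auto simp: d)
      finally show "((p v * j v) * q v) $$ (a, b) = 0\<^sub>m (rdim A v) (rdim V v) $$ (a, b)" using ab by simp
    qed (auto simp: d)
    then have "(p v * j v) * (q v * j v) = 0\<^sub>m (rdim A v) (rdim V v) * j v" by (subst mat_assoc[symmetric]) (auto simp: d)
    then show ?thesis by (simp add: assms mat_ring0 d)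
  qed
  have qi: "q v * i v = 0\<^sub>m (rdim B v) (rdim A v)" for v
  proof -
    have "q v = q v * (i v * p v + j v * q v)" by (simp add: assms d mat_ring0)
    also have "\<dots> = (q v * i v) * p v + (q v * j v) * q v" by (simp add: mat_assoc mat_distrib_left d)
    finally have e: "q v = (q v * i v) * p v + q v" by (simp add: assms mat_ring0 d)
    have "(q v * i v) * p v = 0\<^sub>m (rdim B v) (rdim V v)"
    proof (rule eq_matI)
      fix a b assume "a < dim_row (0\<^sub>m (rdim B v) (rdim V v) :: complex mat)" "b < dim_col (0\<^sub>m (rdim B v) (rdim V v) :: complex mat)"
      then have ab: "a < rdim B v" "b < rdim V v" by auto
      have "q v $$ (a, b) = ((q v * i v) * p v + q v) $$ (a, b)" using e by simp
      also have "\<dots> = ((q v * i v) * p v) $$ (a, b) + q v $$ (a, b)" using ab by (intro index_add_mat) (auto simp: d)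
      finally show "((q v * i v) * p v) $$ (a, b) = 0\<^sub>m (rdim B v) (rdim V v) $$ (a, b)" using ab by simp
    qed (auto simp: d)
    then have "(q v * i v) * (p v * i v) = 0\<^sub>m (rdim B v) (rdim V v) * i v" by (subst mat_assoc[symmetric]) (auto simp: d)
    then show ?thesis by (simp add: assms mat_ring0 d)
  qed
  let ?S = "rep_dsum A B"
  note hS = dsum_shape[OF hs(2,3)] and hh = dsum_homs[OF hs(2,3)]
  have F: "rep_hom Q ?S V (\<lambda>v. i v * prj1 (rdim A v) (rdim B v) + j v * prj2 (rdim A v) (rdim B v))"
    by (intro hom_add hom_comp[OF hS hs(2,1)] hom_comp[OF hS hs(3,1)] hS hs h hh)
  show ?thesis
  proof (rule rep_isoI[OF F, where g = "\<lambda>v. inc1 (rdim A v) (rdim B v) * p v + inc2 (rdim A v) (rdim B v) * q v"])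
    fix v
    let ?n = "rdim A v" and ?m = "rdim B v"
    show "inc1 ?n ?m * p v + inc2 ?n ?m * q v \<in> carrier_mat (rdim ?S v) (rdim V v)" by (auto simp: d)
    have 1: "p v * (i v * X) = X" "q v * (i v * X) = 0\<^sub>m ?m (dim_col X)" if "dim_row X = ?n" for X
      using that by (simp_all add: mat_assoc[symmetric] d assms qi mat_ring0)
    have 2: "q v * (j v * X) = X" "p v * (j v * X) = 0\<^sub>m ?n (dim_col X)" if "dim_row X = ?m" for X
      using that by (simp_all add: mat_assoc[symmetric] d assms pj mat_ring0)
    show "(inc1 ?n ?m * p v + inc2 ?n ?m * q v) * (i v * prj1 ?n ?m + j v * prj2 ?n ?m) = 1\<^sub>m (rdim ?S v)"
      by (simp add: mat_ring d 1 2 prj_inc)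
    show "(i v * prj1 ?n ?m + j v * prj2 ?n ?m) * (inc1 ?n ?m * p v + inc2 ?n ?m * q v) = 1\<^sub>m (rdim V v)"
      by (simp add: mat_ring d prj_inc_mult prj_inc_mult2 assms)
  qed
qed

section \<open>Short exact sequences of representations\<close>

context fin_digraph begin

text \<open>Short exact sequences are split as sequences of vector spaces, and carry a linear retraction
  \<open>r\<close> of \<open>k\<close> and a linear section \<open>s\<close> of \<open>p\<close>.\<close>

definition sses :: "('a \<times> 'b list \<Rightarrow> complex) set \<Rightarrow> ('a, 'b) rep \<Rightarrow> ('a, 'b) rep \<Rightarrow> ('a, 'b) rep \<Rightarrow>
    ('a \<Rightarrow> complex mat) \<Rightarrow> ('a \<Rightarrow> complex mat) \<Rightarrow> ('a \<Rightarrow> complex mat) \<Rightarrow> ('a \<Rightarrow> complex mat) \<Rightarrow> bool" where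
  "sses R A B C k p r s \<longleftrightarrow> is_rep G R A \<and> is_rep G R B \<and> is_rep G R C \<and> rep_hom G A B k \<and> rep_hom G B C p \<and>
     (\<forall>v. r v \<in> carrier_mat (rdim A v) (rdim B v)) \<and> (\<forall>v. s v \<in> carrier_mat (rdim B v) (rdim C v)) \<and>
     (\<forall>v. r v * k v = 1\<^sub>m (rdim A v)) \<and> (\<forall>v. p v * s v = 1\<^sub>m (rdim C v)) \<and>
     (\<forall>v. k v * r v + s v * p v = 1\<^sub>m (rdim B v))"

lemma ssesD:
  assumes "sses R A B C k p r s"
  shows "is_rep G R A" "is_rep G R B" "is_rep G R C" "rep_hom G A B k" "rep_hom G B C p"
    "r v \<in> carrier_mat (rdim A v) (rdim B v)" "s v \<in> carrier_mat (rdim B v) (rdim C v)"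
    "r v * k v = 1\<^sub>m (rdim A v)" "p v * s v = 1\<^sub>m (rdim C v)" "k v * r v + s v * p v = 1\<^sub>m (rdim B v)"
  using assms unfolding sses_def by auto

text \<open>Inserting \<open>k * r + s * p\<close> between \<open>p\<close> and \<open>k\<close>
  gives \<open>p * k = p * k + p * k\<close>.\<close>

lemma split_pk:
  fixes k r p s :: "complex mat"
  assumes "r * k = 1\<^sub>m a" "p * s = 1\<^sub>m c" "k * r + s * p = 1\<^sub>m n"
    and "k \<in> carrier_mat n a" "r \<in> carrier_mat a n" "p \<in> carrier_mat c n" "s \<in> carrier_mat n c"
  shows "p * k = 0\<^sub>m c a"
proof -
  note d = carrier_matD[OF assms(4)] carrier_matD[OF assms(5)] carrier_matD[OF assms(6)] carrier_matD[OF assms(7)]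
  have "p * k = p * (k * r + s * p) * k" by (simp add: assms(3) mat_ring0 d)
  also have "\<dots> = (p * k) * (r * k) + (p * s) * (p * k)" by (simp add: mat_ring d)
  also have "\<dots> = p * k + p * k" unfolding assms(1,2) by (simp add: mat_ring0 d)
  finally have e: "p * k = p * k + p * k" .
  show ?thesis
  proof (rule eq_matI)
    fix i j assume ij: "i < dim_row (0\<^sub>m c a :: complex mat)" "j < dim_col (0\<^sub>m c a :: complex mat)"
    have "(p * k) $$ (i, j) = (p * k) $$ (i, j) + (p * k) $$ (i, j)"
      using ij by (subst e, subst index_add_mat) (auto simp: d)
    then show "(p * k) $$ (i, j) = 0\<^sub>m c a $$ (i, j)" using ij by simp
  qed (auto simp: d)
qed

lemma sses_pk:
  assumes "sses R A B C k p r s"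
  shows "p v * k v = 0\<^sub>m (rdim C v) (rdim A v)"
  by (rule split_pk[OF ssesD(8,9,10)[OF assms] hom_carrier[OF ssesD(4)[OF assms]] ssesD(6)[OF assms] hom_carrier[OF ssesD(5)[OF assms]] ssesD(7)[OF assms]])

lemma sses_rdim:
  assumes "sses R A B C k p r s"
  shows "rdim B v = rdim A v + rdim C v"
  by (rule split_dims[OF ssesD(8,9,10)[OF assms] hom_carrier[OF ssesD(4)[OF assms]] ssesD(6)[OF assms] hom_carrier[OF ssesD(5)[OF assms]] ssesD(7)[OF assms]])

text \<open>The arrows of the kernel are those of \<open>V\<close> read through the inclusion
  \<open>k\<close> and its linear retraction \<open>r\<close>. Being explicit products of matrices,
  they remain polynomial in families.\<close>

definition ker_rep :: "('a, 'b) rep \<Rightarrow> ('a \<Rightarrow> nat) \<Rightarrow> ('a \<Rightarrow> complex mat) \<Rightarrow> ('a \<Rightarrow> complex mat) \<Rightarrow> ('a, 'b) rep" where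
  "ker_rep V n k r = \<lparr>rdim = n, rmap = \<lambda>a. if a \<in> arcs G then r (head G a) * rmap V a * k (tail G a) else 0\<^sub>m 0 0\<rparr>"

lemma ker_rep_simps[simp]: "rdim (ker_rep V n k r) = n"
  "a \<in> arcs G \<Longrightarrow> rmap (ker_rep V n k r) a = r (head G a) * rmap V a * k (tail G a)"
  by (auto simp: ker_rep_def)

lemma kr_absorb:
  fixes k r p s :: "complex mat"
  assumes "k * r + s * p = 1\<^sub>m n" "p * X = 0\<^sub>m c m"
    and "k \<in> carrier_mat n a" "r \<in> carrier_mat a n" "p \<in> carrier_mat c n" "s \<in> carrier_mat n c" "X \<in> carrier_mat n m"
  shows "k * (r * X) = X"
proof -
  note d = carrier_matD[OF assms(3)] carrier_matD[OF assms(4)] carrier_matD[OF assms(5)] carrier_matD[OF assms(6)] carrier_matD[OF assms(7)]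
  have "X = (k * r + s * p) * X" by (simp add: assms(1) mat_ring0 d)
  also have "\<dots> = k * (r * X) + s * (p * X)" by (simp add: mat_ring d)
  finally show ?thesis by (simp add: assms(2) mat_ring0 d)
qed

text \<open>An arrow of \<open>B\<close> maps the image of \<open>k\<close> into the kernel of
  \<open>p\<close>, on which \<open>k * r\<close> is the identity. So \<open>k\<close> commutes with
  the arrows, and the relations descend by \<open>sub_rep\<close>.\<close>

lemma ker_rep_sses:
  assumes "is_rep G R B" "is_rep G R C" "rep_hom G B C p"
    and k: "\<And>v. k v \<in> carrier_mat (rdim B v) (n v)" and r: "\<And>v. r v \<in> carrier_mat (n v) (rdim B v)"
    and s: "\<And>v. s v \<in> carrier_mat (rdim B v) (rdim C v)"
    and "\<And>v. r v * k v = 1\<^sub>m (n v)" "\<And>v. p v * s v = 1\<^sub>m (rdim C v)" "\<And>v. k v * r v + s v * p v = 1\<^sub>m (rdim B v)"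
  shows "sses R (ker_rep B n k r) B C k p r s"
proof -
  note hs = is_rep_shape[OF assms(1)] is_rep_shape[OF assms(2)]
  have p: "\<And>v. p v \<in> carrier_mat (rdim C v) (rdim B v)" using assms(3) by (rule hom_carrier)
  have pk: "p v * k v = 0\<^sub>m (rdim C v) (n v)" for v by (rule split_pk[OF assms(7-9) k r p s])
  have n0: "n v = 0" if "v \<notin> verts G" for v
    using split_dims[OF assms(7-9) k r p s, of v] that hs(1) unfolding hom_shape_def by auto
  have rm: "rmap B a \<in> carrier_mat (rdim B (head G a)) (rdim B (tail G a))" if "a \<in> arcs G" for a
    using hs(1) that unfolding hom_shape_def by auto
  have sh: "hom_shape G (ker_rep B n k r)"
    unfolding hom_shape_def
  proof safe
    fix a assume a: "a \<in> arcs G"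
    show "rmap (ker_rep B n k r) a \<in> carrier_mat (rdim (ker_rep B n k r) (head G a)) (rdim (ker_rep B n k r) (tail G a))"
      using a rm[OF a] r[of "head G a"] k[of "tail G a"] by auto
  qed (auto simp: ker_rep_def n0)
  have hk: "rep_hom G (ker_rep B n k r) B k"
    unfolding rep_hom_def
  proof safe
    fix a assume a: "a \<in> arcs G"
    note d = shape_dims[OF hs(1) a] shape_dims[OF hs(2) a] carrier_matD[OF k] carrier_matD[OF r] hom_dims[OF assms(3)]
    have "p (head G a) * (rmap B a * k (tail G a)) = rmap C a * (p (tail G a) * k (tail G a))"
      by (simp add: mat_assoc[symmetric] d hom_comm[OF assms(3) a])
    also have "\<dots> = 0\<^sub>m (rdim C (head G a)) (n (tail G a))" by (simp add: pk mat_ring0 d)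
    finally have "k (head G a) * (r (head G a) * (rmap B a * k (tail G a))) = rmap B a * k (tail G a)"
      using rm[OF a] k by (intro kr_absorb[OF assms(9) _ k r p s]) auto
    then show "k (head G a) * rmap (ker_rep B n k r) a = rmap B a * k (tail G a)"
      using a by (simp add: mat_assoc d)
  qed (use k in auto)
  have "is_rep G R (ker_rep B n k r)"
    by (rule sub_rep[OF sh assms(1) hk, of r]) (auto simp: assms)
  then show ?thesis unfolding sses_def using assms hk by auto
qed

lemma rep_surj_right_inverse:
  assumes "rep_surj G V W f"
  obtains s where "\<And>v. s v \<in> carrier_mat (rdim V v) (rdim W v)" "\<And>v. f v * s v = 1\<^sub>m (rdim W v)"
proof -
  have "\<exists>s\<in>carrier_mat (rdim V v) (rdim W v). f v * s = 1\<^sub>m (rdim W v)" for v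
    using assms unfolding rep_surj_def by (intro mat_image_right_inverse hom_carrier) auto
  then show ?thesis using that by metis
qed

lemma rep_surjI:
  assumes "rep_hom G V W f" "\<And>v. s v \<in> carrier_mat (rdim V v) (rdim W v)" "\<And>v. f v * s v = 1\<^sub>m (rdim W v)"
  shows "rep_surj G V W f"
  unfolding rep_surj_def using assms right_inverse_mat_image hom_carrier by metis

text \<open>The idempotent \<open>1 - s * p\<close> is split at every index. The index type is
  arbitrary so that the lemma serves vertices, pairs of a degree and a vertex, and a single
  matrix.\<close>

lemma complement_exists:
  fixes p s :: "'x \<Rightarrow> complex mat"
  assumes p: "\<And>v. p v \<in> carrier_mat (c v) (b v)" and s: "\<And>v. s v \<in> carrier_mat (b v) (c v)"
    and "\<And>v. p v * s v = 1\<^sub>m (c v)"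
  obtains n k r where "\<And>v. k v \<in> carrier_mat (b v) (n v)" "\<And>v. r v \<in> carrier_mat (n v) (b v)"
    "\<And>v. r v * k v = 1\<^sub>m (n v)" "\<And>v. k v * r v + s v * p v = 1\<^sub>m (b v)"
proof -
  have "\<exists>n k r. k \<in> carrier_mat (b v) n \<and> r \<in> carrier_mat n (b v) \<and> r * k = 1\<^sub>m n \<and> k * r + s v * p v = 1\<^sub>m (b v)" for v
  proof -
    let ?e = "1\<^sub>m (b v) - s v * p v"
    note d = carrier_matD[OF p] carrier_matD[OF s]
    have "s v * p v * (s v * p v) = s v * (p v * s v) * p v" by (simp add: mat_assoc d)
    then have "s v * p v * (s v * p v) = s v * p v" by (simp add: assms(3) mat_ring0 d)
    then have "?e * ?e = ?e" by (simp add: mat_ring0 d) (rule eq_matI, auto simp: d)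
    then obtain n k r where kr: "k \<in> carrier_mat (b v) n" "r \<in> carrier_mat n (b v)" "r * k = 1\<^sub>m n" "k * r = ?e"
      using idem_split[of ?e "b v"] by (metis carrier_matI d(2,3) index_minus_mat(2,3) index_mult_mat(2,3))
    moreover have "k * r + s v * p v = 1\<^sub>m (b v)" unfolding kr(4) by (rule eq_matI) (auto simp: d)
    ultimately show ?thesis by blast
  qed
  then show ?thesis using that by metis
qed

lemma kernel_exists:
  assumes "is_rep G R B" "is_rep G R C" "rep_hom G B C p"
    "\<And>v. s v \<in> carrier_mat (rdim B v) (rdim C v)" "\<And>v. p v * s v = 1\<^sub>m (rdim C v)"
  obtains A k r where "sses R A B C k p r s"
proof -
  obtain n k r where "\<And>v. k v \<in> carrier_mat (rdim B v) (n v)" "\<And>v. r v \<in> carrier_mat (n v) (rdim B v)"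
    "\<And>v. r v * k v = 1\<^sub>m (n v)" "\<And>v. k v * r v + s v * p v = 1\<^sub>m (rdim B v)"
    by (rule complement_exists[of p "rdim C" "rdim B" s, OF hom_carrier[OF assms(3)] assms(4,5)]) blast+
  then show ?thesis using ker_rep_sses[OF assms(1-3)] assms(4,5) that by blast
qed

text \<open>The retraction \<open>r\<close> is only linear, yet \<open>r * f\<close> is a
  homomorphism: \<open>k * (r * f) = f\<close> is one, and the injective homomorphism
  \<open>k\<close> can be cancelled.\<close>

lemma sses_factor:
  assumes "sses R A B C k p r s" "hom_shape G X" "rep_hom G X B f" "\<And>v. p v * f v = 0\<^sub>m (rdim C v) (rdim X v)"
  shows "rep_hom G X A (\<lambda>v. r v * f v)" "\<And>v. k v * (r v * f v) = f v"
proof -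
  have sv: "is_rep G R A" "is_rep G R B" "is_rep G R C" "rep_hom G A B k" "rep_hom G B C p"
    and r: "\<And>v. r v \<in> carrier_mat (rdim A v) (rdim B v)" and s: "\<And>v. s v \<in> carrier_mat (rdim B v) (rdim C v)"
    and e: "\<And>v. r v * k v = 1\<^sub>m (rdim A v)" "\<And>v. k v * r v + s v * p v = 1\<^sub>m (rdim B v)"
    using assms(1) unfolding sses_def by auto
  show kr: "k v * (r v * f v) = f v" for v
    by (rule kr_absorb[OF e(2) assms(4) hom_carrier[OF sv(4)] r hom_carrier[OF sv(5)] s hom_carrier[OF assms(3)]])
  show "rep_hom G X A (\<lambda>v. r v * f v)" unfolding rep_hom_def
  proof safe
    fix v show "r v * f v \<in> carrier_mat (rdim A v) (rdim X v)" using r[of v] hom_carrier[OF assms(3), of v] by auto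
  next
    fix a assume a: "a \<in> arcs G"
    note d = shape_dims[OF is_rep_shape[OF sv(1)] a] shape_dims[OF is_rep_shape[OF sv(2)] a] shape_dims[OF assms(2) a]
      carrier_matD[OF r] hom_dims[OF sv(4)] hom_dims[OF assms(3)]
    have "k (head G a) * (r (head G a) * f (head G a) * rmap X a) = (k (head G a) * (r (head G a) * f (head G a))) * rmap X a"
      by (simp add: mat_assoc d)
    also have "\<dots> = rmap B a * (k (tail G a) * (r (tail G a) * f (tail G a)))"
      unfolding kr using hom_comm[OF assms(3) a] by simp
    also have "\<dots> = k (head G a) * rmap A a * (r (tail G a) * f (tail G a))"
      unfolding hom_comm[OF sv(4) a] by (simp add: mat_assoc d)
    also have "\<dots> = k (head G a) * (rmap A a * (r (tail G a) * f (tail G a)))"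
      by (simp add: mat_assoc d)
    finally have eq: "k (head G a) * (r (head G a) * f (head G a) * rmap X a) = k (head G a) * (rmap A a * (r (tail G a) * f (tail G a)))" .
    show "r (head G a) * f (head G a) * rmap X a = rmap A a * (r (tail G a) * f (tail G a))"
      by (rule mat_cancel_left[OF e(1) _ _ _ _ eq]) (simp_all add: d)
  qed
qed

subsection \<open>Projectivity\<close>

lemma projectiveD:
  assumes "projective_rep G R P" "is_rep G R V" "is_rep G R W" "rep_hom G V W f"
    "\<And>v. s v \<in> carrier_mat (rdim V v) (rdim W v)" "\<And>v. f v * s v = 1\<^sub>m (rdim W v)" "rep_hom G P W g"
  obtains h where "rep_hom G P V h" "\<And>v. f v * h v = g v"
  using assms rep_surjI[OF assms(4-6)] unfolding projective_rep_def by metis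

lemma projectiveI:
  assumes "is_rep G R P"
    "\<And>V W f g s. is_rep G R V \<Longrightarrow> is_rep G R W \<Longrightarrow> rep_hom G V W f \<Longrightarrow> (\<And>v. s v \<in> carrier_mat (rdim V v) (rdim W v)) \<Longrightarrow>
       (\<And>v. f v * s v = 1\<^sub>m (rdim W v)) \<Longrightarrow> rep_hom G P W g \<Longrightarrow> \<exists>h. rep_hom G P V h \<and> (\<forall>v. f v * h v = g v)"
  shows "projective_rep G R P"
  unfolding projective_rep_def
proof (intro conjI allI impI)
  fix V W f g assume *: "is_rep G R V \<and> is_rep G R W \<and> rep_surj G V W f \<and> rep_hom G P W g"
  then obtain s where "\<And>v. s v \<in> carrier_mat (rdim V v) (rdim W v)" "\<And>v. f v * s v = 1\<^sub>m (rdim W v)"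
    using rep_surj_right_inverse by metis
  moreover have "rep_hom G V W f" using * unfolding rep_surj_def by blast
  ultimately show "\<exists>h. rep_hom G P V h \<and> (\<forall>v. f v * h v = g v)" using assms(2) * by blast
qed (rule assms)

lemma projective_is_rep: "projective_rep G R P \<Longrightarrow> is_rep G R P"
  unfolding projective_rep_def by blast

text \<open>\<open>W\<close> is a direct summand of \<open>A\<close> plus \<open>P\<close>,
  expressed without forming the sum: lift \<open>g * q1\<close> and \<open>g * q2\<close>
  separately, and add the lifts after \<open>i1\<close> and \<open>i2\<close>. The lemma
  \<open>schanuel\<close> delivers summands in exactly this form.\<close>

lemma projective_sum_retract:
  assumes "projective_rep G R A" "projective_rep G R P" "is_rep G R W"
    and h: "rep_hom G W A i1" "rep_hom G W P i2" "rep_hom G A W q1" "rep_hom G P W q2"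
    and e: "\<And>v. q1 v * i1 v + q2 v * i2 v = 1\<^sub>m (rdim W v)"
  shows "projective_rep G R W"
proof (rule projectiveI[OF assms(3)])
  fix V Z f g s assume *: "is_rep G R V" "is_rep G R Z" "rep_hom G V Z f" "\<And>v. s v \<in> carrier_mat (rdim V v) (rdim Z v)"
    "\<And>v. f v * s v = 1\<^sub>m (rdim Z v)" "rep_hom G W Z g"
  note A = projective_is_rep[OF assms(1)] and P = projective_is_rep[OF assms(2)]
  note sh = is_rep_shape[OF A] is_rep_shape[OF P] is_rep_shape[OF assms(3)] is_rep_shape[OF *(1)] is_rep_shape[OF *(2)]
  obtain h1 where h1: "rep_hom G A V h1" "\<And>v. f v * h1 v = g v * q1 v"
    using projectiveD[OF assms(1) *(1-5) hom_comp[OF sh(1,3,5) h(3) *(6)]] by metis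
  obtain h2 where h2: "rep_hom G P V h2" "\<And>v. f v * h2 v = g v * q2 v"
    using projectiveD[OF assms(2) *(1-5) hom_comp[OF sh(2,3,5) h(4) *(6)]] by metis
  have hh: "rep_hom G W V (\<lambda>v. h1 v * i1 v + h2 v * i2 v)"
    by (intro hom_add hom_comp[OF sh(3,1,4)] hom_comp[OF sh(3,2,4)] sh h h1 h2)
  have "f v * (h1 v * i1 v + h2 v * i2 v) = g v" for v
  proof -
    note d = hom_dims[OF h(1)] hom_dims[OF h(2)] hom_dims[OF h(3)] hom_dims[OF h(4)] hom_dims[OF h1(1)] hom_dims[OF h2(1)] hom_dims[OF *(3)] hom_dims[OF *(6)]
    have "f v * (h1 v * i1 v + h2 v * i2 v) = (f v * h1 v) * i1 v + (f v * h2 v) * i2 v" by (simp add: mat_ring d)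
    also have "\<dots> = g v * (q1 v * i1 v + q2 v * i2 v)" unfolding h1 h2 by (simp add: mat_ring d)
    finally show ?thesis by (simp add: e mat_ring0 d)
  qed
  then show "\<exists>h. rep_hom G W V h \<and> (\<forall>v. f v * h v = g v)" using hh by blast
qed

lemma projective_retract:
  assumes "projective_rep G R A" "is_rep G R W" "rep_hom G W A i" "rep_hom G A W q" "\<And>v. q v * i v = 1\<^sub>m (rdim W v)"
  shows "projective_rep G R W"
proof -
  note sh = is_rep_shape[OF projective_is_rep[OF assms(1)]] is_rep_shape[OF assms(2)]
  show ?thesis
    by (rule projective_sum_retract[OF assms(1,1,2,3) hom_zero[OF sh(2,1)] assms(4,4)])
      (simp add: assms(5) mat_ring0 hom_dims[OF assms(3)] hom_dims[OF assms(4)])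
qed

lemma projective_iso: "projective_rep G R A \<Longrightarrow> rep_iso G A W \<Longrightarrow> is_rep G R W \<Longrightarrow> projective_rep G R W"
  by (erule rep_isoE) (auto intro: projective_retract dest: projective_is_rep is_rep_shape)

lemma projective_dsum:
  assumes "projective_rep G R A" "projective_rep G R B"
  shows "projective_rep G R (rep_dsum A B)"
proof -
  note r = projective_is_rep[OF assms(1)] projective_is_rep[OF assms(2)]
  note sh = is_rep_shape[OF r(1)] is_rep_shape[OF r(2)]
  show ?thesis
    by (rule projective_sum_retract[OF assms dsum_rep[OF r] dsum_homs(3,4,1,2)[OF sh]]) (simp add: prj_inc)
qed

lemma projective_dsumD:
  assumes "projective_rep G R (rep_dsum A B)" "is_rep G R A" "is_rep G R B"
  shows "projective_rep G R A" "projective_rep G R B"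
proof -
  note sh = is_rep_shape[OF assms(2)] is_rep_shape[OF assms(3)]
  show "projective_rep G R A"
    by (rule projective_retract[OF assms(1,2) dsum_homs(1,3)[OF sh]]) (simp add: prj_inc)
  show "projective_rep G R B"
    by (rule projective_retract[OF assms(1,3) dsum_homs(2,4)[OF sh]]) (simp add: prj_inc)
qed

lemma projective_zero:
  assumes "is_rep G R V" "\<And>v. rdim V v = 0"
  shows "projective_rep G R V"
proof (rule projectiveI[OF assms(1)])
  fix A W f g s assume *: "is_rep G R A" "is_rep G R W" "rep_hom G A W f" "rep_hom G V W g"
  have "f v * 0\<^sub>m (rdim A v) (rdim V v) = g v" for v
    by (rule eq_matI) (auto simp: hom_dims[OF *(3)] hom_dims[OF *(4)] assms(2))
  then show "\<exists>h. rep_hom G V A h \<and> (\<forall>v. f v * h v = g v)"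
    using hom_zero[OF is_rep_shape[OF assms(1)] is_rep_shape[OF *(1)]] by blast
qed

text \<open>Lift the two surjections along each other to \<open>\<phi>\<close> from \<open>P\<close>
  to \<open>B\<close> and \<open>\<psi>\<close> back. Then \<open>\<psi>\<close> induces
  \<open>q1\<close> on the kernels, \<open>1 - \<psi> * \<phi>\<close> maps \<open>P\<close> into
  \<open>K\<close> and gives \<open>q2\<close>, and in the sum the contributions of
  \<open>\<psi> * \<phi>\<close> cancel. So \<open>K\<close> is a summand of \<open>A\<close> plus
  \<open>P\<close>.\<close>

lemma schanuel:
  assumes 1: "sses R A B V k p r s" and 2: "sses R K P V k' p' r' s'"
    and proj: "projective_rep G R B" "projective_rep G R P"
  obtains i1 i2 q1 q2 where "rep_hom G K A i1" "rep_hom G K P i2" "rep_hom G A K q1" "rep_hom G P K q2"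
    "\<And>v. q1 v * i1 v + q2 v * i2 v = 1\<^sub>m (rdim K v)"
proof -
  have u: "is_rep G R A" "is_rep G R B" "is_rep G R V" "rep_hom G A B k" "rep_hom G B V p"
    "\<And>v. r v \<in> carrier_mat (rdim A v) (rdim B v)" "\<And>v. s v \<in> carrier_mat (rdim B v) (rdim V v)"
    "\<And>v. p v * s v = 1\<^sub>m (rdim V v)" using 1 unfolding sses_def by auto
  have u': "is_rep G R K" "is_rep G R P" "rep_hom G K P k'" "rep_hom G P V p'"
    "\<And>v. r' v \<in> carrier_mat (rdim K v) (rdim P v)" "\<And>v. s' v \<in> carrier_mat (rdim P v) (rdim V v)"
    "\<And>v. p' v * s' v = 1\<^sub>m (rdim V v)" "\<And>v. r' v * k' v = 1\<^sub>m (rdim K v)" using 2 unfolding sses_def by auto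
  note sh = is_rep_shape[OF u(1)] is_rep_shape[OF u(2)] is_rep_shape[OF u(3)] is_rep_shape[OF u'(1)] is_rep_shape[OF u'(2)]
  obtain \<phi> where \<phi>: "rep_hom G P B \<phi>" "\<And>v. p v * \<phi> v = p' v" using projectiveD[OF proj(2) u(2,3,5,7,8) u'(4)] by metis
  obtain \<psi> where \<psi>: "rep_hom G B P \<psi>" "\<And>v. p' v * \<psi> v = p v" using projectiveD[OF proj(1) u'(2) u(3) u'(4,6,7) u(5)] by metis
  note d = hom_dims[OF u(4)] hom_dims[OF u(5)] hom_dims[OF u'(3)] hom_dims[OF u'(4)] hom_dims[OF \<phi>(1)] hom_dims[OF \<psi>(1)] carrier_matD[OF u(6)] carrier_matD[OF u'(5)]
  have a1: "rep_hom G K B (\<lambda>v. \<phi> v * k' v)" by (rule hom_comp[OF sh(4,5,2) u'(3) \<phi>(1)])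
  have z1: "p v * (\<phi> v * k' v) = 0\<^sub>m (rdim V v) (rdim K v)" for v
    using sses_pk[OF 2] \<phi>(2)[of v] by (simp add: mat_assoc[symmetric] d)
  note i1 = sses_factor[OF 1 sh(4) a1 z1]
  have a2: "rep_hom G A P (\<lambda>v. \<psi> v * k v)" by (rule hom_comp[OF sh(1,2,5) u(4) \<psi>(1)])
  have z2: "p' v * (\<psi> v * k v) = 0\<^sub>m (rdim V v) (rdim A v)" for v
    using sses_pk[OF 1] \<psi>(2)[of v] by (simp add: mat_assoc[symmetric] d)
  note q1 = sses_factor[OF 2 sh(1) a2 z2]
  have a3: "rep_hom G P P (\<lambda>v. 1\<^sub>m (rdim P v) - \<psi> v * \<phi> v)"
    by (intro hom_diff hom_id hom_comp[OF sh(5,2,5) \<phi>(1) \<psi>(1)] sh)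
  have z3: "p' v * (1\<^sub>m (rdim P v) - \<psi> v * \<phi> v) = 0\<^sub>m (rdim V v) (rdim P v)" for v
  proof -
    have "p' v * (\<psi> v * \<phi> v) = p' v" using \<phi>(2)[of v] \<psi>(2)[of v] by (simp add: mat_assoc[symmetric] d)
    then show ?thesis by (simp add: mat_ring0 d) (rule eq_matI, auto simp: d)
  qed
  note q2 = sses_factor[OF 2 sh(5) a3 z3]
  show ?thesis
  proof (rule that[OF i1(1) u'(3) q1(1) q2(1)])
    fix v
    have "r' v * (\<psi> v * k v) * (r v * (\<phi> v * k' v)) + r' v * (1\<^sub>m (rdim P v) - \<psi> v * \<phi> v) * k' v
       = r' v * (\<psi> v * (k v * (r v * (\<phi> v * k' v)))) + (r' v * k' v - r' v * (\<psi> v * (\<phi> v * k' v)))"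
      by (simp add: mat_ring d)
    also have "\<dots> = r' v * k' v" unfolding i1(2) by (rule eq_matI) (auto simp: d)
    finally show "r' v * (\<psi> v * k v) * (r v * (\<phi> v * k' v)) + r' v * (1\<^sub>m (rdim P v) - \<psi> v * \<phi> v) * k' v = 1\<^sub>m (rdim K v)"
      using u' by simp
  qed
qed

text \<open>Projective dimension at most \<open>n\<close>, in terms of syzygies.\<close>

primrec pdle :: "('a \<times> 'b list \<Rightarrow> complex) set \<Rightarrow> nat \<Rightarrow> ('a, 'b) rep \<Rightarrow> bool" where
  "pdle R 0 V = projective_rep G R V"
| "pdle R (Suc n) V = (\<exists>A B k p r s. projective_rep G R B \<and> sses R A B V k p r s \<and> pdle R n A)"

text \<open>\<open>\<epsilon>\<close> is bijective: the columns of \<open>s * \<epsilon> - 1\<close>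
  lie in its kernel, so the linear section \<open>s\<close> is a two-sided inverse and hence a
  homomorphism.\<close>

lemma surj_inj_projective:
  assumes "projective_rep G R X" "is_rep G R C" "rep_surj G X C \<epsilon>" "\<And>v. mat_kernel (\<epsilon> v) = {0\<^sub>v (rdim X v)}"
  shows "projective_rep G R C"
proof -
  have h: "rep_hom G X C \<epsilon>" using assms(3) unfolding rep_surj_def by blast
  obtain s where s: "\<And>v. s v \<in> carrier_mat (rdim X v) (rdim C v)" "\<And>v. \<epsilon> v * s v = 1\<^sub>m (rdim C v)"
    using rep_surj_right_inverse[OF assms(3)] by metis
  note sh = is_rep_shape[OF projective_is_rep[OF assms(1)]] is_rep_shape[OF assms(2)]
  note d = hom_dims[OF h] carrier_matD[OF s(1)]
  have sl: "s v * \<epsilon> v = 1\<^sub>m (rdim X v)" for v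
  proof (rule eq_matI)
    fix i j assume "i < dim_row (1\<^sub>m (rdim X v) :: complex mat)" "j < dim_col (1\<^sub>m (rdim X v) :: complex mat)"
    then have ij: "i < rdim X v" "j < rdim X v" by auto
    let ?D = "s v * \<epsilon> v - 1\<^sub>m (rdim X v)"
    have "\<epsilon> v * ?D = (\<epsilon> v * s v) * \<epsilon> v - \<epsilon> v" by (simp add: mat_ring d)
    also have "\<dots> = 0\<^sub>m (rdim C v) (rdim X v)" unfolding s(2) by (simp add: mat_ring0 d) (rule eq_matI, auto simp: d)
    finally have z: "\<epsilon> v * ?D = 0\<^sub>m (rdim C v) (rdim X v)" .
    have "\<epsilon> v *\<^sub>v col ?D j = col (\<epsilon> v * ?D) j" using ij by (intro col_mult2[symmetric]) (auto simp: d)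
    also have "\<dots> = 0\<^sub>v (rdim C v)" unfolding z using ij by simp
    finally have "col ?D j \<in> mat_kernel (\<epsilon> v)" by (intro mat_kernelI[OF hom_carrier[OF h]]) (auto simp: d intro!: carrier_vecI)
    then have "col ?D j $ i = 0" using assms(4) ij by auto
    then show "(s v * \<epsilon> v) $$ (i, j) = 1\<^sub>m (rdim X v) $$ (i, j)" using ij by (auto simp: d)
  qed (auto simp: d)
  show ?thesis
    by (rule projective_retract[OF assms(1,2) inverse_hom[OF sh h s(1) sl s(2)] h s(2)])
qed

text \<open>The induction walks down the resolution. \<open>C\<close> plays the role of the cokernel
  of the differential into degree \<open>j\<close>, with quotient map \<open>\<epsilon>\<close>, and
  \<open>m\<close> bounds the number of degrees left below \<open>j\<close>.\<close>

lemma resolution_pdle: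
  assumes X: "bounded_cplx G R X" "\<And>i. projective_rep G R (degree_rep X i)"
    and ex: "\<And>i v. i < 0 \<Longrightarrow> cycles X i v = boundaries X i v"
  shows "j \<le> 0 \<Longrightarrow> is_rep G R C \<Longrightarrow> rep_surj G (degree_rep X j) C \<epsilon> \<Longrightarrow> (\<And>v. mat_kernel (\<epsilon> v) = boundaries X j v) \<Longrightarrow>
     (\<And>i. i < j - int m \<Longrightarrow> rep_is_zero (degree_rep X i)) \<Longrightarrow> pdle R m C"
proof (induction m arbitrary: j C \<epsilon>)
  case 0
  have "dim_col (cdiff X (j - 1) v) = 0" "dim_row (cdiff X (j - 1) v) = cdim X j v" for v
  proof -
    have "rep_hom G (degree_rep X (j - 1)) (degree_rep X (j - 1 + 1)) (cdiff X (j - 1))" using X(1) unfolding bounded_cplx_def by blast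
    then show "dim_col (cdiff X (j - 1) v) = 0" "dim_row (cdiff X (j - 1) v) = cdim X j v"
      using "0.prems"(5)[of "j - 1"] by (auto simp: hom_dims rep_is_zero_def degree_rep_def)
  qed
  then have "boundaries X j v = {0\<^sub>v (cdim X j v)}" for v
    unfolding boundaries_def mat_image_def carrier_vec_def
    by (auto simp: image_iff intro!: exI[of _ "0\<^sub>v 0"] eq_vecI simp: scalar_prod_def)
  then have "mat_kernel (\<epsilon> v) = {0\<^sub>v (rdim (degree_rep X j) v)}" for v using 0 by (simp add: degree_rep_def)
  then show ?case using surj_inj_projective[OF X(2) 0(2,3)] by simp
next
  case (Suc m)
  note hX = X(1)[unfolded bounded_cplx_def]
  have Xr: "is_rep G R (degree_rep X i)" for i using hX by blast
  have h: "rep_hom G (degree_rep X j) C \<epsilon>" using Suc.prems(3) unfolding rep_surj_def by blast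
  obtain s where s: "\<And>v. s v \<in> carrier_mat (rdim (degree_rep X j) v) (rdim C v)" "\<And>v. \<epsilon> v * s v = 1\<^sub>m (rdim C v)"
    using rep_surj_right_inverse[OF Suc.prems(3)] by metis
  obtain A k r where A: "sses R A (degree_rep X j) C k \<epsilon> r s" using kernel_exists[OF Xr Suc.prems(2) h s] by metis
  have u: "is_rep G R A" "rep_hom G A (degree_rep X j) k" "\<And>v. r v \<in> carrier_mat (rdim A v) (rdim (degree_rep X j) v)"
    "\<And>v. r v * k v = 1\<^sub>m (rdim A v)" "\<And>v. k v * r v + s v * \<epsilon> v = 1\<^sub>m (rdim (degree_rep X j) v)" using A unfolding sses_def by auto
  have "rep_hom G (degree_rep X (j - 1)) (degree_rep X (j - 1 + 1)) (cdiff X (j - 1))" using hX by blast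
  then have f: "rep_hom G (degree_rep X (j - 1)) (degree_rep X j) (cdiff X (j - 1))" by simp
  note d = hom_dims[OF h] carrier_matD[OF s(1)] carrier_matD[OF u(3)] hom_dims[OF u(2)] hom_dims[OF f]
  have z: "\<epsilon> v * cdiff X (j - 1) v = 0\<^sub>m (rdim C v) (rdim (degree_rep X (j - 1)) v)" for v
  proof (rule mat_col_eqI)
    fix i assume i: "i < dim_col (0\<^sub>m (rdim C v) (rdim (degree_rep X (j - 1)) v) :: complex mat)"
    have "col (cdiff X (j - 1) v) i = cdiff X (j - 1) v *\<^sub>v unit_vec (rdim (degree_rep X (j - 1)) v) i"
      using i by (intro eq_vecI) (auto simp: d)
    then have "col (cdiff X (j - 1) v) i \<in> boundaries X j v" unfolding boundaries_def mat_image_def by (auto simp: d)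
    then have "\<epsilon> v *\<^sub>v col (cdiff X (j - 1) v) i = 0\<^sub>v (rdim C v)"
      using Suc.prems(4)[of v] mat_kernelD(2)[OF hom_carrier[OF h]] by blast
    moreover have "col (\<epsilon> v * cdiff X (j - 1) v) i = \<epsilon> v *\<^sub>v col (cdiff X (j - 1) v) i"
      using i by (intro col_mult2) (auto simp: d)
    ultimately show "col (\<epsilon> v * cdiff X (j - 1) v) i = col (0\<^sub>m (rdim C v) (rdim (degree_rep X (j - 1)) v)) i" using i by simp
  qed (auto simp: d)
  note f' = sses_factor[OF A is_rep_shape[OF Xr] f z]
  let ?f' = "\<lambda>v. r v * cdiff X (j - 1) v"
  \<comment> \<open>The differential, with its values taken in the kernel \<open>A\<close> of
    \<open>\<epsilon>\<close>, is the augmentation for the next step: the hypothesis on the kernel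
    of \<open>\<epsilon>\<close> makes it surjective, and exactness in degree \<open>j - 1\<close>
    identifies its own kernel.\<close>
  have surj: "rep_surj G (degree_rep X (j - 1)) A ?f'"
    unfolding rep_surj_def
  proof safe
    show "rep_hom G (degree_rep X (j - 1)) A ?f'" by (rule f')
  next
    fix v x assume "x \<in> mat_image (?f' v)"
    then show "x \<in> carrier_vec (rdim A v)" unfolding mat_image_def by (auto simp: d intro!: carrier_vecI)
  next
    fix v and y :: "complex vec" assume y: "y \<in> carrier_vec (rdim A v)"
    have "\<epsilon> v *\<^sub>v (k v *\<^sub>v y) = 0\<^sub>v (rdim C v)"
      using y sses_pk[OF A, of v] by (subst mat_mult_vec_assoc) (auto simp: d)
    then have "k v *\<^sub>v y \<in> boundaries X j v"
      using y unfolding Suc.prems(4)[symmetric] by (intro mat_kernelI[OF hom_carrier[OF h]]) (auto simp: d intro!: carrier_vecI)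
    then obtain x where x: "x \<in> carrier_vec (rdim (degree_rep X (j - 1)) v)" "k v *\<^sub>v y = cdiff X (j - 1) v *\<^sub>v x"
      unfolding boundaries_def mat_image_def by (auto simp: d)
    have "y = r v *\<^sub>v (k v *\<^sub>v y)" using y u(4) by (subst mat_mult_vec_assoc) (auto simp: d)
    also have "\<dots> = ?f' v *\<^sub>v x" unfolding x(2) using x(1) by (subst mat_mult_vec_assoc) (auto simp: d)
    finally show "y \<in> mat_image (?f' v)" using x(1) unfolding mat_image_def by (auto simp: d)
  qed
  have ker: "mat_kernel (?f' v) = boundaries X (j - 1) v" for v
  proof -
    have "mat_kernel (?f' v) = mat_kernel (cdiff X (j - 1) v)"
    proof safe
      fix x assume "x \<in> mat_kernel (?f' v)"
      then have x: "x \<in> carrier_vec (rdim (degree_rep X (j - 1)) v)" "?f' v *\<^sub>v x = 0\<^sub>v (rdim A v)" by (auto simp: mat_kernel_def d)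
      have "cdiff X (j - 1) v *\<^sub>v x = k v *\<^sub>v (?f' v *\<^sub>v x)"
        using x(1) f'(2)[of v] by (subst mat_mult_vec_assoc) (auto simp: d)
      also have "\<dots> = 0\<^sub>v (rdim (degree_rep X j) v)" unfolding x(2) by (simp add: mat_mult_zero_vec d)
      finally show "x \<in> mat_kernel (cdiff X (j - 1) v)" using x(1) by (auto simp: mat_kernel_def d)
    next
      fix x assume "x \<in> mat_kernel (cdiff X (j - 1) v)"
      then have x: "x \<in> carrier_vec (rdim (degree_rep X (j - 1)) v)" "cdiff X (j - 1) v *\<^sub>v x = 0\<^sub>v (rdim (degree_rep X j) v)" by (auto simp: mat_kernel_def d)
      have "?f' v *\<^sub>v x = r v *\<^sub>v (cdiff X (j - 1) v *\<^sub>v x)" using x(1) by (subst mat_mult_vec_assoc) (auto simp: d)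
      also have "\<dots> = 0\<^sub>v (rdim A v)" unfolding x(2) by (simp add: mat_mult_zero_vec d)
      finally show "x \<in> mat_kernel (?f' v)" using x(1) by (auto simp: mat_kernel_def d)
    qed
    also have "\<dots> = boundaries X (j - 1) v" using ex[of "j - 1" v] Suc.prems(1) unfolding cycles_def by simp
    finally show ?thesis .
  qed
  have "pdle R m A"
    by (rule Suc.IH[OF _ u(1) surj ker]) (use Suc.prems(1,5) in auto)
  then show ?case using A X(2) unfolding pdle.simps by blast
qed

lemma proj_dim_le_pdle:
  assumes "is_rep G R V" "proj_dim_le G R V n"
  shows "pdle R n V"
proof -
  obtain X \<epsilon> where X: "bounded_cplx G R X" "\<forall>i. projective_rep G R (degree_rep X i)"
     "\<forall>i. i < - int n \<or> 0 < i \<longrightarrow> rep_is_zero (degree_rep X i)"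
     "\<forall>i<0. \<forall>v. cycles X i v = boundaries X i v"
     "rep_surj G (degree_rep X 0) V \<epsilon>" "\<forall>v. mat_kernel (\<epsilon> v) = boundaries X 0 v"
    using assms(2) unfolding proj_dim_le_def by blast
  show ?thesis
    by (rule resolution_pdle[OF X(1), of 0 V \<epsilon> n]) (use X assms in auto)
qed

end

section \<open>The path algebra acting on representations\<close>

context bound_quiver begin

abbreviation "PA \<equiv> path_algebra Q"
definition "J = Idl\<^bsub>PA\<^esub> R"

lemma ideal_J: "ideal J PA" using admissible unfolding admissible_ideal_def J_def by blast

lemma ring_PA: "ring PA" using ideal_J by (rule ideal.axioms(2))

lemma R_carrier: "R \<subseteq> carrier PA" using relations unfolding quiver_relation_def by blast

lemma R_in_J: "\<rho> \<in> R \<Longrightarrow> \<rho> \<in> J"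
  unfolding J_def using ring.genideal_self[OF ring_PA R_carrier] by blast

lemma carrier_PA: "f \<in> carrier PA \<longleftrightarrow> finite {p. f p \<noteq> 0} \<and> {p. f p \<noteq> 0} \<subseteq> quiver_paths Q"
  unfolding path_algebra_def by simp

lemma mult_PA: "(f \<otimes>\<^bsub>PA\<^esub> g) (u, p) = (\<Sum>k\<le>length p. f (u, take k p) * g (awlast u (take k p), drop k p))"
  unfolding path_algebra_def by simp

lemma add_PA: "(f \<oplus>\<^bsub>PA\<^esub> g) = (\<lambda>p. f p + g p)" unfolding path_algebra_def by simp

lemma zero_PA: "\<zero>\<^bsub>PA\<^esub> = (\<lambda>_. 0)" unfolding path_algebra_def by simp

lemma supp_awalk: "f \<in> carrier PA \<Longrightarrow> f (u, p) \<noteq> 0 \<Longrightarrow> \<exists>w. awalk u p w"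
  unfolding carrier_PA quiver_paths_def by blast

lemma finite_supp: "f \<in> carrier PA \<Longrightarrow> finite {p. f (u, p) \<noteq> 0}"
proof -
  assume "f \<in> carrier PA"
  then have "finite (snd ` {p. f p \<noteq> 0})" unfolding carrier_PA by blast
  then show ?thesis by (rule rev_finite_subset) force
qed

lemma path_mat_append:
  assumes "hom_shape Q V" "awalk u p x" "awalk x q w"
  shows "path_mat Q V u (p @ q) = path_mat Q V x q * path_mat Q V u p"
  using assms(2)
proof (induction p arbitrary: u)
  case Nil
  then have "u = x" by (auto simp: awalk_def)
  then show ?case using path_mat_carrier[OF assms(1,3)] by (simp add: mat_ring0)
next
  case (Cons a p)
  then have a: "a \<in> arcs Q" "tail Q a = u" "awalk (head Q a) p x" by (auto simp: awalk_Cons_iff)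
  note c = path_mat_carrier[OF assms(1) a(3)] path_mat_carrier[OF assms(1,3)]
  show ?case using Cons.IH[OF a(3)] by (simp add: mat_assoc carrier_matD[OF c(1)] carrier_matD[OF c(2)] shape_dims[OF assms(1) a(1)])
qed

text \<open>The value \<open>0\<close> off the walks lets sums over walks range over an arbitrary finite support.\<close>

definition pent :: "('v, 'a) rep \<Rightarrow> 'v \<Rightarrow> 'a list \<Rightarrow> 'v \<Rightarrow> nat \<times> nat \<Rightarrow> complex" where
  "pent V u p w rc = (if awalk u p w then path_mat Q V u p $$ rc else 0)"

lemma relation_entry:
  assumes "finite S" "{p. f (u, p) \<noteq> 0} \<subseteq> S" "r < rdim V w" "c < rdim V u"
  shows "relation_mat Q V f u w $$ (r, c) = (\<Sum>p\<in>S. f (u, p) * pent V u p w (r, c))"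
proof -
  have "relation_mat Q V f u w $$ (r, c) = (\<Sum>p\<in>{p. f (u, p) \<noteq> 0 \<and> awalk u p w}. f (u, p) * path_mat Q V u p $$ (r, c))"
    using assms by (simp add: relation_mat_def)
  also have "\<dots> = (\<Sum>p\<in>S. f (u, p) * pent V u p w (r, c))"
    using assms by (intro sum.mono_neutral_cong_left) (auto simp: pent_def)
  finally show ?thesis .
qed

lemma relation_mat_dims[simp]: "dim_row (relation_mat Q V f u w) = rdim V w" "dim_col (relation_mat Q V f u w) = rdim V u"
  by (auto simp: relation_mat_def)

lemma pent_append:
  assumes V: "hom_shape Q V" and rc: "r < rdim V w" "c < rdim V u" and q: "\<exists>x. awalk u q x"
  shows "pent V u (q @ q') w (r, c) = (\<Sum>l<rdim V (awlast u q). pent V (awlast u q) q' w (r, l) * pent V u q (awlast u q) (l, c))"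
proof -
  let ?x = "awlast u q"
  have w1: "awalk u q ?x" using q by auto
  show ?thesis
  proof (cases "awalk ?x q' w")
    case True
    have "pent V u (q @ q') w (r, c) = (path_mat Q V ?x q' * path_mat Q V u q) $$ (r, c)"
      using w1 True by (simp add: pent_def path_mat_append[OF V w1 True])
    also have "\<dots> = (\<Sum>l<rdim V ?x. path_mat Q V ?x q' $$ (r, l) * path_mat Q V u q $$ (l, c))"
      using path_mat_carrier[OF V w1] path_mat_carrier[OF V True] rc by (subst mat_mult_index) auto
    finally show ?thesis using w1 True by (simp add: pent_def)
  qed (simp add: pent_def)
qed

text \<open>A product in the path algebra sums over all ways to cut a path in two, and
  \<open>path_mat\<close> is multiplicative on concatenation. Paths are read from left to right
  while matrices compose from right to left, so the matrix of \<open>g\<close> stands on the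
  left.\<close>

lemma relation_mult:
  assumes V: "hom_shape Q V" and fg: "f \<in> carrier PA" "g \<in> carrier PA" and rc: "r < rdim V w" "c < rdim V u"
  shows "relation_mat Q V (f \<otimes>\<^bsub>PA\<^esub> g) u w $$ (r, c) =
    (\<Sum>x\<in>verts Q. \<Sum>l<rdim V x. relation_mat Q V g x w $$ (r, l) * relation_mat Q V f u x $$ (l, c))"
proof -
  define P where "P = snd ` {p. f p \<noteq> 0} \<union> snd ` {p. g p \<noteq> 0}"
  have finP: "finite P" using fg unfolding P_def carrier_PA by simp
  have fP: "f (u, q) \<noteq> 0 \<Longrightarrow> q \<in> P" and gP: "g (u, q) \<noteq> 0 \<Longrightarrow> q \<in> P" for u q
    unfolding P_def by force+
  define S where "S = (\<lambda>(q, q'). q @ q') ` (P \<times> P)"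
  have finS: "finite S" unfolding S_def using finP by simp
  let ?t = "\<lambda>p k. f (u, take k p) * g (awlast u (take k p), drop k p) * pent V u p w (r, c)"
  have sub: "{p. (f \<otimes>\<^bsub>PA\<^esub> g) (u, p) \<noteq> 0} \<subseteq> S"
  proof safe
    fix p assume "(f \<otimes>\<^bsub>PA\<^esub> g) (u, p) \<noteq> 0"
    then obtain k where "f (u, take k p) \<noteq> 0" "g (awlast u (take k p), drop k p) \<noteq> 0"
      unfolding mult_PA by (metis (no_types, lifting) mult_eq_0_iff sum.neutral)
    then have "(take k p, drop k p) \<in> P \<times> P" using fP gP by blast
    then show "p \<in> S" unfolding S_def by (metis (mono_tags, lifting) append_take_drop_id case_prod_conv image_eqI)
  qed
  have "relation_mat Q V (f \<otimes>\<^bsub>PA\<^esub> g) u w $$ (r, c) = (\<Sum>p\<in>S. (\<Sum>k\<le>length p. ?t p k))"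
    by (simp add: relation_entry[OF finS sub rc] mult_PA sum_distrib_right)
  also have "\<dots> = (\<Sum>(p, k)\<in>Sigma S (\<lambda>p. {..length p}). ?t p k)"
    using finS by (subst sum.Sigma) auto
  also have "\<dots> = (\<Sum>(q, q')\<in>P \<times> P. f (u, q) * g (awlast u q, q') * pent V u (q @ q') w (r, c))"
  \<comment> \<open>A path with a cutting position is the same as a pair of paths. The index sets
    are only finite bounds for the supports, so the bijection is required off the zero
    terms.\<close>
  proof (rule sum.reindex_bij_witness_not_neutral[where S' = "{(p, k)\<in>Sigma S (\<lambda>p. {..length p}). ?t p k = 0}" and T' = "{(q, q')\<in>P \<times> P. f (u, q) * g (awlast u q, q') * pent V u (q @ q') w (r, c) = 0}"
        and i = "\<lambda>(q, q'). (q @ q', length q)" and j = "\<lambda>(p, k). (take k p, drop k p)"])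
    show "finite {(p, k) \<in> Sigma S (\<lambda>p. {..length p}). ?t p k = 0}"
      using finS by (intro finite_subset[OF _ finite_SigmaI[OF finS, of "\<lambda>p. {..length p}"]]) auto
    fix a assume a: "a \<in> Sigma S (\<lambda>p. {..length p}) - {(p, k) \<in> Sigma S (\<lambda>p. {..length p}). ?t p k = 0}"
    then obtain p k where pk: "a = (p, k)" "p \<in> S" "k \<le> length p" "?t p k \<noteq> 0" by auto
    then show "(case a of (p, k) \<Rightarrow> (take k p, drop k p)) \<in> P \<times> P - {(q, q')\<in>P \<times> P. f (u, q) * g (awlast u q, q') * pent V u (q @ q') w (r, c) = 0}" using fP gP by auto
    show "(case case a of (p, k) \<Rightarrow> (take k p, drop k p) of (q, q') \<Rightarrow> (q @ q', length q)) = a" using pk by auto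
  next
    fix a assume "a \<in> P \<times> P - {(q, q')\<in>P \<times> P. f (u, q) * g (awlast u q, q') * pent V u (q @ q') w (r, c) = 0}"
    then obtain q q' where a: "a = (q, q')" "q \<in> P" "q' \<in> P" "f (u, q) * g (awlast u q, q') * pent V u (q @ q') w (r, c) \<noteq> 0" by auto
    have "q @ q' \<in> S" using a unfolding S_def by force
    then show "(case a of (q, q') \<Rightarrow> (q @ q', length q)) \<in> Sigma S (\<lambda>p. {..length p}) - {(p, k) \<in> Sigma S (\<lambda>p. {..length p}). ?t p k = 0}"
      using a by auto
    show "(case case a of (q, q') \<Rightarrow> (q @ q', length q) of (p, k) \<Rightarrow> (take k p, drop k p)) = a" using a by auto
  next
    fix a assume "a \<in> Sigma S (\<lambda>p. {..length p})"
    then show "(case case a of (p, k) \<Rightarrow> (take k p, drop k p) of (q, q') \<Rightarrow> f (u, q) * g (awlast u q, q') * pent V u (q @ q') w (r, c)) = (case a of (p, k) \<Rightarrow> ?t p k)" by auto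
  next
    show "finite {(q, q')\<in>P \<times> P. f (u, q) * g (awlast u q, q') * pent V u (q @ q') w (r, c) = 0}"
      using finP by (intro finite_subset[OF _ finite_cartesian_product[OF finP finP]]) auto
  qed auto
  also have "\<dots> = (\<Sum>(q, q')\<in>P \<times> P. \<Sum>x\<in>verts Q. \<Sum>l<rdim V x. (g (x, q') * pent V x q' w (r, l)) * (f (u, q) * pent V u q x (l, c)))"
  proof (rule sum.cong[OF refl], safe)
    fix q q' assume "q \<in> P" "q' \<in> P"
    show "f (u, q) * g (awlast u q, q') * pent V u (q @ q') w (r, c) = (\<Sum>x\<in>verts Q. \<Sum>l<rdim V x. (g (x, q') * pent V x q' w (r, l)) * (f (u, q) * pent V u q x (l, c)))"
    \<comment> \<open>A path \<open>q\<close> in the support is a walk with a single end vertex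
      \<open>y\<close>, so only \<open>x = y\<close> contributes.\<close>
    proof (cases "f (u, q) = 0")
      case False
      then obtain y where y: "awalk u q y" using supp_awalk fg by blast
      then have yl: "awlast u q = y" by auto
      have z: "pent V u q x lc = 0" if "x \<noteq> y" for x lc
        using yl that by (auto simp: pent_def)
      have "(\<Sum>x\<in>verts Q. \<Sum>l<rdim V x. (g (x, q') * pent V x q' w (r, l)) * (f (u, q) * pent V u q x (l, c))) =
        (\<Sum>x\<in>{y}. \<Sum>l<rdim V x. (g (x, q') * pent V x q' w (r, l)) * (f (u, q) * pent V u q x (l, c)))"
        using y z by (intro sum.mono_neutral_right) auto
      also have "\<dots> = f (u, q) * g (awlast u q, q') * pent V u (q @ q') w (r, c)"
        using y by (subst pent_append[OF V rc]) (auto simp: yl sum_distrib_left algebra_simps)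
      finally show ?thesis by simp
    qed simp
  qed
  also have "\<dots> = (\<Sum>x\<in>verts Q. \<Sum>l<rdim V x. \<Sum>(q, q')\<in>P \<times> P. (g (x, q') * pent V x q' w (r, l)) * (f (u, q) * pent V u q x (l, c)))"
    unfolding split_def by (subst sum.swap, rule sum.cong[OF refl], subst sum.swap, rule refl)
  also have "\<dots> = (\<Sum>x\<in>verts Q. \<Sum>l<rdim V x. relation_mat Q V g x w $$ (r, l) * relation_mat Q V f u x $$ (l, c))"
  proof (intro sum.cong refl)
    fix x l assume "x \<in> verts Q" "l \<in> {..<rdim V x}"
    then have l: "l < rdim V x" by simp
    have e: "relation_mat Q V g x w $$ (r, l) = (\<Sum>q'\<in>P. g (x, q') * pent V x q' w (r, l))"
      using gP rc l by (intro relation_entry finP) auto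
    have e': "relation_mat Q V f u x $$ (l, c) = (\<Sum>q\<in>P. f (u, q) * pent V u q x (l, c))"
      using fP rc l by (intro relation_entry finP) auto
    have "relation_mat Q V g x w $$ (r, l) * relation_mat Q V f u x $$ (l, c) = relation_mat Q V f u x $$ (l, c) * relation_mat Q V g x w $$ (r, l)"
      by simp
    also have "\<dots> = (\<Sum>(q, q')\<in>P \<times> P. (f (u, q) * pent V u q x (l, c)) * (g (x, q') * pent V x q' w (r, l)))"
      unfolding e e' by (simp add: sum_product sum.cartesian_product)
    finally show "(\<Sum>(q, q')\<in>P \<times> P. (g (x, q') * pent V x q' w (r, l)) * (f (u, q) * pent V u q x (l, c))) = relation_mat Q V g x w $$ (r, l) * relation_mat Q V f u x $$ (l, c)"
      by (simp add: mult.commute)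
  qed
  finally show ?thesis .
qed

definition ann :: "('v, 'a) rep \<Rightarrow> ('v \<times> 'a list \<Rightarrow> complex) set" where
  "ann V = {f \<in> carrier PA. \<forall>u\<in>verts Q. \<forall>w\<in>verts Q. \<forall>r<rdim V w. \<forall>c<rdim V u. relation_mat Q V f u w $$ (r, c) = 0}"

text \<open>The relations in \<open>R\<close> kill a representation by definition, and
  \<open>J\<close> is the smallest ideal containing \<open>R\<close>. So for \<open>J_kills\<close>
  it suffices that the annihilator is an ideal, which follows from \<open>relation_mult\<close> and
  additivity.\<close>

lemma ann_ideal:
  assumes V: "hom_shape Q V"
  shows "ideal (ann V) PA"
proof (rule idealI[OF ring_PA])
  interpret P: ring PA by (rule ring_PA)
  have lin: "relation_mat Q V (\<lambda>p. f p + g p) u w $$ (r, c) = relation_mat Q V f u w $$ (r, c) + relation_mat Q V g u w $$ (r, c)"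
    if "f \<in> carrier PA" "g \<in> carrier PA" "r < rdim V w" "c < rdim V u" for f g u w r c
  proof -
    let ?S = "{p. f (u, p) \<noteq> 0} \<union> {p. g (u, p) \<noteq> 0}"
    have fin: "finite ?S" using finite_supp that by blast
    show ?thesis
      using that by (subst (1 2 3) relation_entry[OF fin]) (auto simp: sum.distrib algebra_simps)
  qed
  have z: "relation_mat Q V (\<lambda>_. 0) u w $$ (r, c) = 0" if "r < rdim V w" "c < rdim V u" for u w r c
    using that by (subst relation_entry[of "{}"]) auto
  show "subgroup (ann V) (add_monoid PA)"
  proof
    show "ann V \<subseteq> carrier (add_monoid PA)" unfolding ann_def by auto
    show "\<one>\<^bsub>add_monoid PA\<^esub> \<in> ann V" unfolding ann_def using P.zero_closed z by (simp add: zero_PA)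
    fix f g assume fg: "f \<in> ann V" "g \<in> ann V"
    then show "f \<otimes>\<^bsub>add_monoid PA\<^esub> g \<in> ann V"
      using P.a_closed[of f g] lin unfolding ann_def by (simp add: add_PA)
    have c: "\<ominus>\<^bsub>PA\<^esub> f \<in> carrier PA" "f \<in> carrier PA" using fg unfolding ann_def by auto
    have "(\<lambda>p. f p + (\<ominus>\<^bsub>PA\<^esub> f) p) = (\<lambda>_. 0)" using P.r_neg[OF c(2)] by (simp add: add_PA zero_PA)
    then have "relation_mat Q V f u w $$ (r, c) + relation_mat Q V (\<ominus>\<^bsub>PA\<^esub> f) u w $$ (r, c) = 0"
      if "r < rdim V w" "c < rdim V u" for u w r c using lin[OF c(2,1) that] z[OF that] by simp
    then show "inv\<^bsub>add_monoid PA\<^esub> f \<in> ann V"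
      unfolding a_inv_def[symmetric] using c fg unfolding ann_def by (simp add: eq_neg_iff_add_eq_0[symmetric])
  qed
  fix f g assume fg: "f \<in> ann V" "g \<in> carrier PA"
  then have f: "f \<in> carrier PA" unfolding ann_def by blast
  have fz: "relation_mat Q V f x y $$ (r, c) = 0" if "x \<in> verts Q" "y \<in> verts Q" "r < rdim V y" "c < rdim V x" for x y r c
    using fg that unfolding ann_def by blast
  show "g \<otimes>\<^bsub>PA\<^esub> f \<in> ann V" unfolding ann_def
    using P.m_closed[OF fg(2) f] fz by (auto simp: relation_mult[OF V fg(2) f] intro!: sum.neutral)
  show "f \<otimes>\<^bsub>PA\<^esub> g \<in> ann V" unfolding ann_def
    using P.m_closed[OF f fg(2)] fz by (auto simp: relation_mult[OF V f fg(2)] intro!: sum.neutral)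
qed

lemma J_kills:
  assumes "is_rep Q R V" "f \<in> J" "u \<in> verts Q" "w \<in> verts Q"
  shows "relation_mat Q V f u w = 0\<^sub>m (rdim V w) (rdim V u)"
proof -
  have "R \<subseteq> ann V" using assms(1) R_carrier unfolding ann_def is_rep_def by auto
  then have "J \<subseteq> ann V" unfolding J_def by (rule ring.genideal_minimal[OF ring_PA ann_ideal[OF is_rep_shape[OF assms(1)]]])
  then have f: "f \<in> ann V" using assms(2) by blast
  show ?thesis
  proof (rule eq_matI)
    fix r c assume "r < dim_row (0\<^sub>m (rdim V w) (rdim V u) :: complex mat)" "c < dim_col (0\<^sub>m (rdim V w) (rdim V u) :: complex mat)"
    then show "relation_mat Q V f u w $$ (r, c) = 0\<^sub>m (rdim V w) (rdim V u) $$ (r, c)" using f assms(3,4) unfolding ann_def by auto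
  qed auto
qed

subsection \<open>Linear combinations of parallel paths modulo the ideal\<close>

text \<open>\<open>el v c\<close> is the combination of paths starting at \<open>v\<close> with coefficients \<open>c\<close>, and \<open>Jc v w c\<close> says
  that it runs from \<open>v\<close> to \<open>w\<close> and vanishes modulo \<open>J\<close>.\<close>

definition el :: "'v \<Rightarrow> ('a list \<Rightarrow> complex) \<Rightarrow> 'v \<times> 'a list \<Rightarrow> complex" where
  "el v c = (\<lambda>(u, p). if u = v then c p else 0)"

definition Jc :: "'v \<Rightarrow> 'v \<Rightarrow> ('a list \<Rightarrow> complex) \<Rightarrow> bool" where
  "Jc v w c \<longleftrightarrow> finite {p. c p \<noteq> 0} \<and> (\<forall>p. c p \<noteq> 0 \<longrightarrow> awalk v p w) \<and> el v c \<in> J"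

lemma el_supp: "{x. el v c x \<noteq> 0} = Pair v ` {p. c p \<noteq> 0}" by (auto simp: el_def image_iff split: if_splits)

lemma el_carrier: "finite {p. c p \<noteq> 0} \<Longrightarrow> (\<And>p. c p \<noteq> 0 \<Longrightarrow> awalk v p w) \<Longrightarrow> el v c \<in> carrier PA"
  unfolding carrier_PA el_supp quiver_paths_def by auto

lemma J_add: "f \<in> J \<Longrightarrow> g \<in> J \<Longrightarrow> (\<lambda>p. f p + g p) \<in> J"
  using additive_subgroup.a_closed[OF ideal.axioms(1)[OF ideal_J]] by (simp add: add_PA)

lemma J_zero: "(\<lambda>_. 0) \<in> J"
  using additive_subgroup.zero_closed[OF ideal.axioms(1)[OF ideal_J]] by (simp add: zero_PA)

lemma J_left: "f \<in> carrier PA \<Longrightarrow> g \<in> J \<Longrightarrow> f \<otimes>\<^bsub>PA\<^esub> g \<in> J"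
  by (rule ideal.I_l_closed[OF ideal_J])

lemma J_right: "f \<in> J \<Longrightarrow> g \<in> carrier PA \<Longrightarrow> f \<otimes>\<^bsub>PA\<^esub> g \<in> J"
  by (rule ideal.I_r_closed[OF ideal_J])

text \<open>Only the cut at \<open>length b\<close> contributes. The product is written by its
  coefficients so that it is again of the form \<open>el v c\<close> to which \<open>Jc\<close>
  applies.\<close>

lemma el_left_mult:
  assumes "awalk v b u" "\<And>p. c p \<noteq> 0 \<Longrightarrow> awalk u p w"
  shows "el v (\<lambda>p. if p = b then t else 0) \<otimes>\<^bsub>PA\<^esub> el u c = el v (\<lambda>p. if take (length b) p = b then t * c (drop (length b) p) else 0)"
proof
  fix x show "(el v (\<lambda>p. if p = b then t else 0) \<otimes>\<^bsub>PA\<^esub> el u c) x = el v (\<lambda>p. if take (length b) p = b then t * c (drop (length b) p) else 0) x"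
  proof (cases x)
    case (Pair y p)
    have al: "awlast v b = u" using assms(1) by auto
    have "(el v (\<lambda>p. if p = b then t else 0) \<otimes>\<^bsub>PA\<^esub> el u c) (y, p) =
       (\<Sum>k\<le>length p. if k = length b then (if y = v \<and> take (length b) p = b then t * c (drop (length b) p) else 0) else 0)"
      unfolding mult_PA by (intro sum.cong refl) (auto simp: el_def al)
    also have "\<dots> = (if y = v \<and> take (length b) p = b then t * c (drop (length b) p) else 0)"
      by (auto simp: min_def split: if_splits)
    finally show ?thesis using Pair by (simp add: el_def)
  qed
qed

text \<open>Multiplication by a single arrow is enough on this side, since \<open>nf_append\<close>
  extends normal forms arrow by arrow.\<close>

lemma el_right_mult:
  assumes "a \<in> arcs Q" "tail Q a = w" "\<And>p. c p \<noteq> 0 \<Longrightarrow> awalk v p w"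
  shows "el v c \<otimes>\<^bsub>PA\<^esub> el w (\<lambda>p. if p = [a] then 1 else 0) = el v (\<lambda>p. if p \<noteq> [] \<and> last p = a then c (butlast p) else 0)"
proof
  fix x show "(el v c \<otimes>\<^bsub>PA\<^esub> el w (\<lambda>p. if p = [a] then 1 else 0)) x = el v (\<lambda>p. if p \<noteq> [] \<and> last p = a then c (butlast p) else 0) x"
  proof (cases x)
    case (Pair y p)
    have "(el v c \<otimes>\<^bsub>PA\<^esub> el w (\<lambda>p. if p = [a] then 1 else 0)) (y, p) =
       (\<Sum>k\<le>length p. if k = length p - 1 then (if y = v \<and> p \<noteq> [] \<and> last p = a then c (butlast p) else 0) else 0)"
      unfolding mult_PA
    proof (intro sum.cong refl)
      fix k assume k: "k \<in> {..length p}"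
      have dk: "drop k p = [a] \<longleftrightarrow> k = length p - 1 \<and> p \<noteq> [] \<and> last p = a"
      proof
        assume d: "drop k p = [a]"
        then have "length p - k = 1" by (metis length_drop length_Cons list.size(3) One_nat_def)
        moreover have "p = take k p @ [a]" using d by (metis append_take_drop_id)
        ultimately show "k = length p - 1 \<and> p \<noteq> [] \<and> last p = a" by (metis Nil_is_append_conv diff_diff_cancel k atMost_iff last_snoc not_Cons_self2)
      next
        assume "k = length p - 1 \<and> p \<noteq> [] \<and> last p = a"
        then show "drop k p = [a]" by (cases p rule: rev_cases) auto
      qed
      have bl: "take (length p - 1) p = butlast p" by (simp add: butlast_conv_take)
      show "el v c (y, take k p) * el w (\<lambda>p. if p = [a] then 1 else 0) (awlast y (take k p), drop k p) =
        (if k = length p - 1 then if y = v \<and> p \<noteq> [] \<and> last p = a then c (butlast p) else 0 else 0)"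
      proof (cases "k = length p - 1 \<and> p \<noteq> [] \<and> last p = a")
        case True
        then have "drop k p = [a]" "take k p = butlast p" using dk bl by auto
        then show ?thesis using True assms(3)[of "butlast p"] by (auto simp: el_def)
      next
        case False
        then show ?thesis using dk by (auto simp: el_def)
      qed
    qed
    also have "\<dots> = (if y = v \<and> p \<noteq> [] \<and> last p = a then c (butlast p) else 0)"
      by (auto)
    finally show ?thesis using Pair by (simp add: el_def)
  qed
qed

lemma Jc_supp: "Jc v w c \<Longrightarrow> finite {p. c p \<noteq> 0}" "Jc v w c \<Longrightarrow> c p \<noteq> 0 \<Longrightarrow> awalk v p w"
  unfolding Jc_def by auto

lemma Jc_add: "Jc v w c \<Longrightarrow> Jc v w c' \<Longrightarrow> Jc v w (\<lambda>p. c p + c' p)"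
  unfolding Jc_def
proof (elim conjE, intro conjI)
  assume *: "finite {p. c p \<noteq> 0}" "finite {p. c' p \<noteq> 0}" "el v c \<in> J" "el v c' \<in> J" "\<forall>p. c p \<noteq> 0 \<longrightarrow> awalk v p w" "\<forall>p. c' p \<noteq> 0 \<longrightarrow> awalk v p w"
  show "finite {p. c p + c' p \<noteq> 0}" by (rule finite_subset[OF _ finite_UnI[OF *(1,2)]]) auto
  have "el v (\<lambda>p. c p + c' p) = (\<lambda>p. el v c p + el v c' p)" by (auto simp: el_def)
  then show "el v (\<lambda>p. c p + c' p) \<in> J" using J_add *(3,4) by simp
  show "\<forall>p. c p + c' p \<noteq> 0 \<longrightarrow> awalk v p w" using * by (metis add.right_neutral)
qed

lemma Jc_zero: "Jc v w (\<lambda>_. 0)"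
proof -
  have "el v (\<lambda>_. 0) = (\<lambda>_. 0)" by (auto simp: el_def)
  then show ?thesis unfolding Jc_def using J_zero by simp
qed

lemma Jc_left:
  assumes "awalk v b u" "Jc u w c"
  shows "Jc v w (\<lambda>p. if take (length b) p = b then t * c (drop (length b) p) else 0)"
proof -
  have e: "el v (\<lambda>p. if p = b then t else 0) \<in> carrier PA" by (rule el_carrier[where w = u]) (use assms in \<open>auto split: if_splits\<close>)
  have "el v (\<lambda>p. if p = b then t else 0) \<otimes>\<^bsub>PA\<^esub> el u c \<in> J" using J_left[OF e] assms(2) unfolding Jc_def by blast
  moreover have "el v (\<lambda>p. if p = b then t else 0) \<otimes>\<^bsub>PA\<^esub> el u c = el v (\<lambda>p. if take (length b) p = b then t * c (drop (length b) p) else 0)"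
    by (rule el_left_mult[OF assms(1) Jc_supp(2)[OF assms(2)]])
  ultimately have 1: "el v (\<lambda>p. if take (length b) p = b then t * c (drop (length b) p) else 0) \<in> J" by simp
  have "{p. (if take (length b) p = b then t * c (drop (length b) p) else 0) \<noteq> 0} \<subseteq> (\<lambda>q. b @ q) ` {p. c p \<noteq> 0}"
  proof safe
    fix p assume *: "(if take (length b) p = b then t * c (drop (length b) p) else 0) \<noteq> 0"
    then have "p = b @ drop (length b) p" "c (drop (length b) p) \<noteq> 0" by (metis append_take_drop_id, metis mult_zero_right)
    then show "p \<in> (\<lambda>q. b @ q) ` {p. c p \<noteq> 0}" by blast
  qed
  note sub = this
  have w: "awalk v (b @ q) w" if "c q \<noteq> 0" for q
    using assms(1) Jc_supp(2)[OF assms(2) that] by (rule awalk_appendI)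
  show ?thesis unfolding Jc_def
  proof (intro conjI allI impI)
    show "finite {p. (if take (length b) p = b then t * c (drop (length b) p) else 0) \<noteq> 0}"
      by (rule finite_subset[OF sub finite_imageI[OF Jc_supp(1)[OF assms(2)]]])
    fix p assume "(if take (length b) p = b then t * c (drop (length b) p) else 0) \<noteq> 0"
    then have "p \<in> (\<lambda>q. b @ q) ` {p. c p \<noteq> 0}" by (intro subsetD[OF sub]) simp
    then obtain q where "p = b @ q" "c q \<noteq> 0" by (metis (mono_tags, lifting) image_iff mem_Collect_eq)
    then show "awalk v p w" using w by simp
  qed (rule 1)
qed

text \<open>Scaling is left multiplication by a multiple of the trivial path at \<open>v\<close>; if
  \<open>v\<close> is not a vertex, there are no walks and \<open>c\<close> vanishes.\<close>

lemma Jc_smult: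
  assumes "Jc v w c" shows "Jc v w (\<lambda>p. t * c p)"
proof (cases "v \<in> verts Q")
  case True
  then have "awalk v [] v" by (auto simp: awalk_def)
  from Jc_left[OF this assms, of t] show ?thesis by simp
next
  case False
  then have "c p = 0" for p using Jc_supp(2)[OF assms, of p] by (auto simp: awalk_def)
  then show ?thesis using Jc_zero by simp
qed

lemma Jc_right:
  assumes "a \<in> arcs Q" "tail Q a = w" "Jc v w c"
  shows "Jc v (head Q a) (\<lambda>p. if p \<noteq> [] \<and> last p = a then c (butlast p) else 0)"
proof -
  have e: "el w (\<lambda>p. if p = [a] then 1 else 0) \<in> carrier PA"
    by (rule el_carrier[where w = "head Q a"]) (use assms in \<open>auto split: if_splits simp: arc_implies_awalk awalk_Cons_iff awalk_Nil_iff\<close>)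
  have "el v c \<otimes>\<^bsub>PA\<^esub> el w (\<lambda>p. if p = [a] then 1 else 0) \<in> J" using J_right[OF _ e] assms(3) unfolding Jc_def by blast
  moreover have "el v c \<otimes>\<^bsub>PA\<^esub> el w (\<lambda>p. if p = [a] then 1 else 0) = el v (\<lambda>p. if p \<noteq> [] \<and> last p = a then c (butlast p) else 0)"
    by (rule el_right_mult[OF assms(1,2) Jc_supp(2)[OF assms(3)]])
  ultimately have 1: "el v (\<lambda>p. if p \<noteq> [] \<and> last p = a then c (butlast p) else 0) \<in> J" by simp
  have "{p. (if p \<noteq> [] \<and> last p = a then c (butlast p) else 0) \<noteq> 0} \<subseteq> (\<lambda>q. q @ [a]) ` {p. c p \<noteq> 0}"
  proof safe
    fix p assume *: "(if p \<noteq> [] \<and> last p = a then c (butlast p) else 0) \<noteq> 0"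
    then have "p = butlast p @ [a]" "c (butlast p) \<noteq> 0" by (metis append_butlast_last_id, metis)
    then show "p \<in> (\<lambda>q. q @ [a]) ` {p. c p \<noteq> 0}" by blast
  qed
  note sub = this
  have w: "awalk v (q @ [a]) (head Q a)" if "c q \<noteq> 0" for q
    using assms Jc_supp(2)[OF assms(3) that] by (auto intro!: awalk_appendI simp: awalk_Cons_iff awalk_Nil_iff simp del: awalk_append_iff)
  show ?thesis unfolding Jc_def
  proof (intro conjI allI impI)
    show "finite {p. (if p \<noteq> [] \<and> last p = a then c (butlast p) else 0) \<noteq> 0}"
      by (rule finite_subset[OF sub finite_imageI[OF Jc_supp(1)[OF assms(3)]]])
    fix p assume "(if p \<noteq> [] \<and> last p = a then c (butlast p) else 0) \<noteq> 0"
    then have "p \<in> (\<lambda>q. q @ [a]) ` {p. c p \<noteq> 0}" by (intro subsetD[OF sub]) simp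
    then obtain q where "p = q @ [a]" "c q \<noteq> 0" by (metis (mono_tags, lifting) image_iff mem_Collect_eq)
    then show "awalk v p (head Q a)" using w by simp
  qed (rule 1)
qed

text \<open>The upper bound on an admissible ideal, which lies in the square of the arrow ideal. It
  keeps trivial paths independent modulo \<open>J\<close>, so that they can serve as generators of
  projective modules.\<close>

lemma Jc_short: "Jc v w c \<Longrightarrow> length p < 2 \<Longrightarrow> c p = 0"
proof -
  assume *: "Jc v w c" "length p < 2"
  have "J \<subseteq> arrow_ideal_power Q 2" using admissible unfolding admissible_ideal_def J_def by blast
  then have "el v c (v, p) = 0" using * unfolding Jc_def arrow_ideal_power_def by fastforce
  then show "c p = 0" by (simp add: el_def)
qed

definition "nilp = (SOME m. 2 \<le> m \<and> arrow_ideal_power Q m \<subseteq> J)"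

lemma nilp: "2 \<le> nilp" "arrow_ideal_power Q nilp \<subseteq> J"
proof -
  have "\<exists>m. 2 \<le> m \<and> arrow_ideal_power Q m \<subseteq> J" using admissible unfolding admissible_ideal_def J_def by blast
  from someI_ex[OF this] show "2 \<le> nilp" "arrow_ideal_power Q nilp \<subseteq> J" unfolding nilp_def by auto
qed

text \<open>The lower bound on an admissible ideal, which contains all long paths. It makes the
  quotient finite-dimensional and lets long paths act as zero on every module.\<close>

lemma Jc_long: "awalk v p w \<Longrightarrow> nilp \<le> length p \<Longrightarrow> Jc v w (\<lambda>q. if q = p then 1 else 0)"
proof -
  assume *: "awalk v p w" "nilp \<le> length p"
  then have "el v (\<lambda>q. if q = p then 1 else 0) \<in> carrier PA" by (intro el_carrier[where w = w]) (auto split: if_splits)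
  then have "el v (\<lambda>q. if q = p then 1 else 0) \<in> arrow_ideal_power Q nilp"
    unfolding arrow_ideal_power_def using * by (auto simp: el_def split: if_splits)
  then show ?thesis unfolding Jc_def using nilp * by auto
qed

lemma Jc_kills:
  assumes "is_rep Q R V" "Jc v w c" "finite S" "{p. c p \<noteq> 0} \<subseteq> S" "\<And>p. p \<in> S \<Longrightarrow> awalk v p w" "r < rdim V w" "x < rdim V v"
  shows "(\<Sum>p\<in>S. c p * path_mat Q V v p $$ (r, x)) = 0"
proof (cases "v \<in> verts Q \<and> w \<in> verts Q")
  case True
  have "(\<Sum>p\<in>S. c p * path_mat Q V v p $$ (r, x)) = (\<Sum>p\<in>S. el v c (v, p) * pent V v p w (r, x))"
    using assms(5) by (intro sum.cong) (auto simp: el_def pent_def)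
  also have "\<dots> = relation_mat Q V (el v c) v w $$ (r, x)"
    using assms by (intro relation_entry[symmetric]) (auto simp: el_def)
  also have "\<dots> = 0" using J_kills[OF assms(1), of "el v c" v w] assms True unfolding Jc_def by auto
  finally show ?thesis .
next
  case False
  then have "c p = 0" for p using Jc_supp(2)[OF assms(2), of p] by (metis awalkE')
  then show ?thesis by simp
qed

lemma long_path_zero:
  assumes "is_rep Q R V" "awalk u p w" "nilp \<le> length p"
  shows "path_mat Q V u p = 0\<^sub>m (rdim V w) (rdim V u)"
proof (rule eq_matI)
  fix r c assume rc: "r < dim_row (0\<^sub>m (rdim V w) (rdim V u) :: complex mat)" "c < dim_col (0\<^sub>m (rdim V w) (rdim V u) :: complex mat)"
  have "(\<Sum>q\<in>{p}. (if q = p then 1 else 0) * path_mat Q V u q $$ (r, c)) = 0"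
    using assms rc by (intro Jc_kills[OF assms(1) Jc_long]) (auto split: if_splits)
  then show "path_mat Q V u p $$ (r, c) = 0\<^sub>m (rdim V w) (rdim V u) $$ (r, c)" using rc by simp
qed (use path_mat_carrier[OF is_rep_shape[OF assms(1)] assms(2)] in auto)

subsection \<open>A basis of paths and normal forms\<close>

text \<open>\<open>bas v w\<close> is a basis, consisting of paths, of the quotient by \<open>J\<close> of the span of the paths from
  \<open>v\<close> to \<open>w\<close>, and \<open>nf v w p\<close> are the coordinates of \<open>p\<close> in it.\<close>

definition indep :: "'v \<Rightarrow> 'v \<Rightarrow> 'a list set \<Rightarrow> bool" where
  "indep v w S \<longleftrightarrow> (\<forall>c. Jc v w c \<and> {p. c p \<noteq> 0} \<subseteq> S \<longrightarrow> (\<forall>p. c p = 0))"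

text \<open>The trivial path is prescribed as a basis element because it becomes the generator of
  \<open>Fr\<close>; by \<open>Jc_short\<close> this is compatible with independence.\<close>

definition basis_ok :: "'v \<Rightarrow> 'v \<Rightarrow> 'a list set \<Rightarrow> bool" where
  "basis_ok v w S \<longleftrightarrow> S \<subseteq> {p. awalk v p w \<and> length p < nilp} \<and> (v = w \<and> v \<in> verts Q \<longrightarrow> [] \<in> S) \<and> indep v w S"

lemma finite_short_walks: "finite {p. awalk v p w \<and> length p < n}"
  by (rule finite_subset[OF _ finite_lists_length_le[OF finite_arcs, of n]]) (auto simp: awalk_def)

lemma basis_ex: "\<exists>S. basis_ok v w S \<and> (\<forall>T. basis_ok v w T \<longrightarrow> card T \<le> card S)"
proof -
  let ?P = "{p. awalk v p w \<and> length p < nilp}"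
  let ?S0 = "if v = w \<and> v \<in> verts Q then {[]} else {}"
  have "basis_ok v w ?S0"
  proof -
    have "c p = 0" if "Jc v w c" "{p. c p \<noteq> 0} \<subseteq> ?S0" for c p
      using Jc_short[OF that(1), of p] that(2) by (cases "p = []") (auto split: if_splits)
    then have "indep v w ?S0" unfolding indep_def by blast
    then show ?thesis unfolding basis_ok_def using nilp(1) by (auto simp: awalk_def)
  qed
  moreover have "\<forall>T. basis_ok v w T \<longrightarrow> card T < Suc (card ?P)"
    using card_mono[OF finite_short_walks[of v w nilp]] unfolding basis_ok_def by (simp add: less_Suc_eq_le)
  ultimately show ?thesis using ex_has_greatest_nat[of "basis_ok v w" ?S0 card "Suc (card ?P)"] by metis
qed

definition "bas v w = (SOME S. basis_ok v w S \<and> (\<forall>T. basis_ok v w T \<longrightarrow> card T \<le> card S))"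

lemma bas: "basis_ok v w (bas v w)" "basis_ok v w T \<Longrightarrow> card T \<le> card (bas v w)"
  using someI_ex[OF basis_ex[of v w]] unfolding bas_def by auto

lemma bas_awalk: "b \<in> bas v w \<Longrightarrow> awalk v b w" using bas(1) unfolding basis_ok_def by blast
lemma bas_finite: "finite (bas v w)"
  using bas(1) finite_short_walks finite_subset unfolding basis_ok_def by metis
lemma bas_nil: "v \<in> verts Q \<Longrightarrow> [] \<in> bas v v" using bas(1) unfolding basis_ok_def by blast
lemma bas_indep: "Jc v w c \<Longrightarrow> {p. c p \<noteq> 0} \<subseteq> bas v w \<Longrightarrow> c p = 0" using bas(1) unfolding basis_ok_def indep_def by blast

text \<open>Long paths lie in \<open>J\<close>. Adding a short path \<open>p\<close> outside
  \<open>bas v w\<close> would contradict its maximal cardinality, so there is a dependence; the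
  coefficient at \<open>p\<close> is non-zero by independence of \<open>bas v w\<close>, and
  dividing by it expresses \<open>p\<close>.\<close>

lemma nf_ex:
  assumes "awalk v p w"
  shows "\<exists>c. {q. c q \<noteq> 0} \<subseteq> bas v w \<and> Jc v w (\<lambda>q. (if q = p then 1 else 0) - c q)"
proof -
  consider "p \<in> bas v w" | "nilp \<le> length p" | "p \<notin> bas v w" "length p < nilp" by linarith
  then show ?thesis
  proof cases
    case 1 then show ?thesis by (intro exI[of _ "\<lambda>q. if q = p then 1 else 0"]) (auto simp: Jc_zero split: if_splits)
  next
    case 2 then show ?thesis using Jc_long[OF assms] by (intro exI[of _ "\<lambda>q. 0"]) auto
  next
    case 3
    have "\<not> basis_ok v w (insert p (bas v w))" using bas(2)[of v w "insert p (bas v w)"] 3 bas_finite by fastforce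
    then have "\<not> indep v w (insert p (bas v w))" using bas(1)[of v w] 3 assms unfolding basis_ok_def by blast
    then obtain c q where c: "Jc v w c" "{q. c q \<noteq> 0} \<subseteq> insert p (bas v w)" "c q \<noteq> 0" unfolding indep_def by blast
    have cp: "c p \<noteq> 0" using bas_indep[OF c(1)] c(2,3) by blast
    have e: "(\<lambda>q. (if q = p then 1 else 0) - (if q = p then 0 else - (1 / c p) * c q)) = (\<lambda>q. (1 / c p) * c q)"
      using cp by auto
    show ?thesis
    proof (intro exI conjI)
      show "{q. (if q = p then 0 else - (1 / c p) * c q) \<noteq> 0} \<subseteq> bas v w" using c(2) by (auto split: if_splits)
      show "Jc v w (\<lambda>q. (if q = p then 1 else 0) - (if q = p then 0 else - (1 / c p) * c q))"
        unfolding e by (rule Jc_smult[OF c(1)])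
    qed
  qed
qed

definition "nf v w p = (SOME c. {q. c q \<noteq> 0} \<subseteq> bas v w \<and> Jc v w (\<lambda>q. (if q = p then 1 else 0) - c q))"

lemma nf:
  assumes "awalk v p w"
  shows "{q. nf v w p q \<noteq> 0} \<subseteq> bas v w" "Jc v w (\<lambda>q. (if q = p then 1 else 0) - nf v w p q)"
  using someI_ex[OF nf_ex[OF assms]] unfolding nf_def by auto

lemma nf_supp: "awalk v p w \<Longrightarrow> nf v w p q \<noteq> 0 \<Longrightarrow> q \<in> bas v w" using nf(1) by blast

lemma Jc_sum: "finite S \<Longrightarrow> (\<And>x. x \<in> S \<Longrightarrow> Jc v w (f x)) \<Longrightarrow> Jc v w (\<lambda>q. \<Sum>x\<in>S. f x q)"
  by (induction S rule: finite_induct) (auto simp: Jc_zero intro!: Jc_add)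

lemma sum_delta_sub:
  fixes g h :: "'x \<Rightarrow> complex"
  assumes "finite S" "p \<in> S"
  shows "(\<Sum>q\<in>S. ((if q = p then 1 else 0) - g q) * h q) = h p - (\<Sum>q\<in>S. g q * h q)"
proof -
  have "(\<Sum>q\<in>S. ((if q = p then 1 else 0) - g q) * h q) = (\<Sum>q\<in>S. (if q = p then h q else 0) - g q * h q)"
    by (intro sum.cong) (auto simp: algebra_simps)
  then show ?thesis using assms by (simp add: sum_subtractf)
qed

text \<open>Normal forms depend only on the class modulo \<open>J\<close>: the combination of the
  normal forms differs from \<open>c\<close> by an element of \<open>J\<close>, so it lies in
  \<open>J\<close> itself, and it is supported on an independent set.\<close>

lemma nf_lin:
  assumes "Jc v w c" "finite S" "{p. c p \<noteq> 0} \<subseteq> S" "\<And>p. p \<in> S \<Longrightarrow> awalk v p w"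
  shows "(\<Sum>p\<in>S. c p * nf v w p b) = 0"
proof -
  have 1: "Jc v w (\<lambda>q. \<Sum>p\<in>S. c p * ((if q = p then 1 else 0) - nf v w p q))"
    by (intro Jc_sum Jc_smult nf(2) assms)
  have cS: "c q = 0" if "q \<notin> S" for q using assms(3) that by blast
  have "(\<Sum>p\<in>S. c p * ((if q = p then 1 else 0) - nf v w p q)) = c q - (\<Sum>p\<in>S. c p * nf v w p q)" for q
  proof -
    have "(\<Sum>p\<in>S. c p * ((if q = p then 1 else 0) - nf v w p q)) = (\<Sum>p\<in>S. (if p = q then c q else 0) - c p * nf v w p q)"
      by (intro sum.cong) (auto simp: algebra_simps)
    then show ?thesis using assms(2) cS[of q] by (simp add: sum_subtractf)
  qed
  then have 2: "Jc v w (\<lambda>q. c q - (\<Sum>p\<in>S. c p * nf v w p q))" using 1 by simp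
  have "Jc v w (\<lambda>q. c q + (- 1) * (c q - (\<Sum>p\<in>S. c p * nf v w p q)))" by (intro Jc_add Jc_smult assms(1) 2)
  then have 3: "Jc v w (\<lambda>q. \<Sum>p\<in>S. c p * nf v w p q)" by simp
  have "{q. (\<Sum>p\<in>S. c p * nf v w p q) \<noteq> 0} \<subseteq> bas v w"
  proof safe
    fix q assume "(\<Sum>p\<in>S. c p * nf v w p q) \<noteq> 0"
    then obtain p where "p \<in> S" "nf v w p q \<noteq> 0" by (metis (no_types, lifting) mult_zero_right sum.neutral)
    then show "q \<in> bas v w" using nf_supp assms(4) by blast
  qed
  from bas_indep[OF 3 this] show ?thesis .
qed

lemma nf_basis:
  assumes "p \<in> bas v w" shows "nf v w p q = (if q = p then 1 else 0)"
proof -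
  note a = bas_awalk[OF assms]
  have "{q. (if q = p then 1 else 0) - nf v w p q \<noteq> 0} \<subseteq> bas v w"
    using nf_supp[OF a] assms by (auto split: if_splits)
  from bas_indep[OF nf(2)[OF a] this] show ?thesis by (metis eq_iff_diff_eq_0)
qed

text \<open>\<open>J\<close> is a right ideal, so the difference of \<open>p\<close> and its normal
  form stays in \<open>J\<close> after appending \<open>a\<close>; then \<open>nf_lin\<close>
  applies.\<close>

lemma nf_snoc:
  assumes "awalk v p w" "a \<in> arcs Q" "tail Q a = w"
  shows "nf v (head Q a) (p @ [a]) b = (\<Sum>q\<in>bas v w. nf v w p q * nf v (head Q a) (q @ [a]) b)"
proof -
  define c where "c = (\<lambda>q. (if q = p then 1 else 0) - nf v w p q)"
  define S where "S = insert p (bas v w)"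
  have finS: "finite S" unfolding S_def using bas_finite by simp
  have Sa: "awalk v q w" if "q \<in> S" for q using that assms(1) bas_awalk unfolding S_def by auto
  have ext: "awalk v (q @ [a]) (head Q a)" if "q \<in> S" for q
    using Sa[OF that] assms by (auto intro!: awalk_appendI simp: awalk_Cons_iff awalk_Nil_iff simp del: awalk_append_iff)
  have J1: "Jc v (head Q a) (\<lambda>p. if p \<noteq> [] \<and> last p = a then c (butlast p) else 0)"
    using nf(2)[OF assms(1)] assms(2,3) unfolding c_def by (intro Jc_right)
  have cS: "q \<in> S" if "c q \<noteq> 0" for q
    using that nf_supp[OF assms(1), of q] unfolding c_def S_def by (auto split: if_splits)
  have "(\<Sum>q\<in>(\<lambda>q. q @ [a]) ` S. (if q \<noteq> [] \<and> last q = a then c (butlast q) else 0) * nf v (head Q a) q b) = 0"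
  proof (rule nf_lin[OF J1])
    show "{p. (if p \<noteq> [] \<and> last p = a then c (butlast p) else 0) \<noteq> 0} \<subseteq> (\<lambda>q. q @ [a]) ` S"
    proof safe
      fix p assume *: "(if p \<noteq> [] \<and> last p = a then c (butlast p) else 0) \<noteq> 0"
      then have "p = butlast p @ [a]" "c (butlast p) \<noteq> 0" by (metis append_butlast_last_id, metis)
      then show "p \<in> (\<lambda>q. q @ [a]) ` S" using cS by blast
    qed
  qed (use finS ext in auto)
  then have "(\<Sum>q\<in>S. c q * nf v (head Q a) (q @ [a]) b) = 0"
    by (subst (asm) sum.reindex) (auto simp: inj_on_def)
  then have "nf v (head Q a) (p @ [a]) b = (\<Sum>q\<in>S. nf v w p q * nf v (head Q a) (q @ [a]) b)"
    unfolding c_def using sum_delta_sub[OF finS, of p "nf v w p" "\<lambda>q. nf v (head Q a) (q @ [a]) b"] by (simp add: S_def del: sum.insert sum.insert_if)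
  also have "\<dots> = (\<Sum>q\<in>bas v w. nf v w p q * nf v (head Q a) (q @ [a]) b)"
    unfolding S_def using nf_supp[OF assms(1)] bas_finite by (intro sum.mono_neutral_right) auto
  finally show ?thesis .
qed

lemma path_mat_nf:
  assumes "is_rep Q R V" "awalk v p w" "r < rdim V w" "x < rdim V v"
  shows "path_mat Q V v p $$ (r, x) = (\<Sum>b\<in>bas v w. nf v w p b * path_mat Q V v b $$ (r, x))"
proof -
  let ?c = "\<lambda>q. (if q = p then 1 else 0) - nf v w p q"
  let ?S = "insert p (bas v w)"
  have "(\<Sum>q\<in>?S. ?c q * path_mat Q V v q $$ (r, x)) = 0"
  proof (rule Jc_kills[OF assms(1) nf(2)[OF assms(2)] _ _ _ assms(3,4)])
    show "{q. ?c q \<noteq> 0} \<subseteq> ?S" using nf_supp[OF assms(2)] by (auto split: if_splits)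
  qed (use bas_finite bas_awalk assms in auto)
  then have "path_mat Q V v p $$ (r, x) = (\<Sum>q\<in>?S. nf v w p q * path_mat Q V v q $$ (r, x))"
    using sum_delta_sub[of ?S p "nf v w p" "\<lambda>q. path_mat Q V v q $$ (r, x)"] bas_finite by (simp del: sum.insert sum.insert_if)
  also have "\<dots> = (\<Sum>b\<in>bas v w. nf v w p b * path_mat Q V v b $$ (r, x))"
    using nf_supp[OF assms(2)] bas_finite by (intro sum.mono_neutral_right) auto
  finally show ?thesis .
qed

text \<open>\<open>J\<close> is a left ideal, so the relation prefixed by \<open>b\<close> stays in
  \<open>J\<close> and \<open>nf_lin\<close> applies. A relation consists of parallel paths; for end
  vertices other than its own the sum is empty.\<close>

lemma nf_relation:
  assumes "\<rho> \<in> R" "b \<in> bas v u"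
  shows "(\<Sum>p\<in>{p. \<rho> (u, p) \<noteq> 0 \<and> awalk u p w}. \<rho> (u, p) * nf v w (b @ p) b') = 0"
proof (cases "{p. \<rho> (u, p) \<noteq> 0 \<and> awalk u p w} = {}")
  case False
  have qr: "\<rho> \<in> carrier PA" "\<exists>u v. \<forall>w p. \<rho> (w, p) \<noteq> 0 \<longrightarrow> w = u \<and> awalk u p v"
    using relations[OF assms(1)] unfolding quiver_relation_def by auto
  from False obtain p0 where p0: "\<rho> (u, p0) \<noteq> 0" "awalk u p0 w" by blast
  obtain u' w' where uw: "\<And>x p. \<rho> (x, p) \<noteq> 0 \<Longrightarrow> x = u' \<and> awalk u' p w'" using qr(2) by blast
  have u': "u' = u" using uw[OF p0(1)] by simp
  have w': "w' = w" using uw[OF p0(1)] p0(2) u' by (metis awalkE')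
  define c where "c p = \<rho> (u, p)" for p
  have "\<rho> x = el u c x" for x using uw[of "fst x" "snd x"] u' unfolding c_def el_def by (cases x) auto
  then have "\<rho> = el u c" by blast
  then have Jc: "Jc u w c" unfolding Jc_def using R_in_J[OF assms(1)] finite_supp[OF qr(1), of u] uw[of u] u' w' by (auto simp: c_def)
  note J2 = Jc_left[OF bas_awalk[OF assms(2)] Jc, of 1]
  let ?S = "{p. c p \<noteq> 0}"
  have "(\<Sum>q\<in>(\<lambda>p. b @ p) ` ?S. (if take (length b) q = b then 1 * c (drop (length b) q) else 0) * nf v w q b') = 0"
  proof (rule nf_lin[OF J2])
    show "{p. (if take (length b) p = b then 1 * c (drop (length b) p) else 0) \<noteq> 0} \<subseteq> (@) b ` ?S"
    proof safe
      fix p assume *: "(if take (length b) p = b then 1 * c (drop (length b) p) else 0) \<noteq> 0"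
      then have "p = b @ drop (length b) p" "c (drop (length b) p) \<noteq> 0" by (metis append_take_drop_id, metis mult_zero_right)
      then show "p \<in> (@) b ` ?S" by blast
    qed
    show "finite ((@) b ` ?S)" using Jc_supp(1)[OF Jc] by simp
    fix p assume "p \<in> (@) b ` ?S"
    then show "awalk v p w" using Jc_supp(2)[OF Jc] bas_awalk[OF assms(2)] by (auto intro: awalk_appendI)
  qed
  then have "(\<Sum>p\<in>?S. c p * nf v w (b @ p) b') = 0" by (subst (asm) sum.reindex) (auto simp: inj_on_def)
  moreover have "{p. \<rho> (u, p) \<noteq> 0 \<and> awalk u p w} = ?S" using Jc_supp(2)[OF Jc] unfolding c_def by auto
  ultimately show ?thesis unfolding c_def by simp
next
  case True
  show ?thesis unfolding True by (rule sum.empty)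
qed

end

lemma mat_add_eq: "A + B = C \<Longrightarrow> dim_row A = dim_row B \<Longrightarrow> dim_col A = dim_col B \<Longrightarrow> A = C - (B :: complex mat)"
  by auto

lemma sum_nth_distinct: "distinct L \<Longrightarrow> (\<Sum>l<length L. F (L ! l)) = (\<Sum>x\<in>set L. F x)"
  by (rule sum.reindex_bij_betw) (rule bij_betw_nth, auto)

section \<open>The projective modules \<open>Fr d\<close>\<close>

context bound_quiver begin

text \<open>The module \<open>Fr d\<close> is the sum of \<open>d v\<close> copies of \<open>P\<^sub>v\<close>, with basis at \<open>w\<close> the triples \<open>(v, b, i)\<close>
  where \<open>b \<in> bas v w\<close> and \<open>i < d v\<close>.\<close>

definition trip :: "('v \<Rightarrow> nat) \<Rightarrow> 'v \<Rightarrow> ('v \<times> 'a list \<times> nat) set" where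
  "trip d w = {(v, b, i). v \<in> verts Q \<and> b \<in> bas v w \<and> i < d v}"

lemma trip_eq: "trip d w = (SIGMA v:verts Q. bas v w \<times> {..<d v})" unfolding trip_def by auto

lemma finite_trip: "finite (trip d w)" unfolding trip_eq using bas_finite by auto

definition "idx d w = (SOME xs. distinct xs \<and> set xs = trip d w)"

lemma idx: "distinct (idx d w)" "set (idx d w) = trip d w"
proof -
  have "\<exists>xs. distinct xs \<and> set xs = trip d w" using finite_distinct_list[OF finite_trip] by metis
  from someI_ex[OF this] show "distinct (idx d w)" "set (idx d w) = trip d w" unfolding idx_def by auto
qed

definition "fdim d w = length (idx d w)"

lemma fdim_sum: "fdim d w = (\<Sum>v\<in>verts Q. card (bas v w) * d v)"
proof -
  have "fdim d w = card (trip d w)" unfolding fdim_def using idx distinct_card by metis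
  also have "\<dots> = (\<Sum>v\<in>verts Q. card (bas v w) * d v)"
    unfolding trip_eq by (subst card_SigmaI) (auto simp: bas_finite card_cartesian_product)
  finally show ?thesis .
qed

lemma bas_outside: "w \<notin> verts Q \<Longrightarrow> bas v w = {}"
proof (rule ccontr)
  assume "w \<notin> verts Q" "bas v w \<noteq> {}"
  then obtain b where "awalk v b w" using bas_awalk by (metis ex_in_conv)
  then show False using \<open>w \<notin> verts Q\<close> by auto
qed

lemma fdim_outside: "w \<notin> verts Q \<Longrightarrow> fdim d w = 0"
  by (simp add: fdim_sum bas_outside)

lemma idx_nth: "c < fdim d w \<Longrightarrow> idx d w ! c \<in> trip d w"
  unfolding fdim_def using idx nth_mem by metis

lemma idx_nthE:
  assumes "c < fdim d w"
  obtains v b i where "idx d w ! c = (v, b, i)" "v \<in> verts Q" "b \<in> bas v w" "i < d v"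
  using idx_nth[OF assms] unfolding trip_def by auto

lemma idx_ex: "x \<in> trip d w \<Longrightarrow> \<exists>c<fdim d w. idx d w ! c = x"
  unfolding fdim_def using idx in_set_conv_nth by metis

lemma idx_inj: "c < fdim d w \<Longrightarrow> c' < fdim d w \<Longrightarrow> idx d w ! c = idx d w ! c' \<longleftrightarrow> c = c'"
  unfolding fdim_def using idx nth_eq_iff_index_eq by metis

lemma sum_idx: "(\<Sum>l<fdim d w. F (idx d w ! l)) = (\<Sum>x\<in>trip d w. F x)"
  unfolding fdim_def by (subst sum_nth_distinct) (auto simp: idx)

lemma sum_idx_delta:
  fixes F :: "'a list \<Rightarrow> complex"
  assumes "v \<in> verts Q" "i < d v"
  shows "(\<Sum>l<fdim d w. case idx d w ! l of (v', b, i') \<Rightarrow> if v = v' \<and> i = i' then F b else 0) = (\<Sum>b\<in>bas v w. F b)"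
proof -
  have "(\<Sum>l<fdim d w. case idx d w ! l of (v', b, i') \<Rightarrow> if v = v' \<and> i = i' then F b else 0) =
      (\<Sum>(v', b, i')\<in>trip d w. if v = v' \<and> i = i' then F b else 0)"
    by (rule sum_idx)
  also have "\<dots> = (\<Sum>(v', b, i')\<in>(\<lambda>b. (v, b, i)) ` bas v w. if v = v' \<and> i = i' then F b else 0)"
    using assms finite_trip by (intro sum.mono_neutral_right) (auto simp: trip_def)
  also have "\<dots> = (\<Sum>b\<in>bas v w. F b)" by (subst sum.reindex) (auto simp: inj_on_def)
  finally show ?thesis .
qed

text \<open>The action of the path \<open>q\<close> from \<open>u\<close> to \<open>w\<close>: the
  basis element \<open>(v, b, i)\<close> goes to the normal form of \<open>b @ q\<close> in the same
  copy \<open>(v, i)\<close>.\<close>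

definition fract :: "('v \<Rightarrow> nat) \<Rightarrow> 'v \<Rightarrow> 'a list \<Rightarrow> 'v \<Rightarrow> complex mat" where
  "fract d u q w = mat (fdim d w) (fdim d u) (\<lambda>(r, c). case idx d w ! r of (v', b', i') \<Rightarrow>
     case idx d u ! c of (v, b, i) \<Rightarrow> if v = v' \<and> i = i' then nf v w (b @ q) b' else 0)"

definition Fr :: "('v \<Rightarrow> nat) \<Rightarrow> ('v, 'a) rep" where
  "Fr d = \<lparr>rdim = fdim d, rmap = \<lambda>a. if a \<in> arcs Q then fract d (tail Q a) [a] (head Q a) else 0\<^sub>m 0 0\<rparr>"

lemma rdim_Fr[simp]: "rdim (Fr d) = fdim d" by (simp add: Fr_def)

lemma Fr_shape: "hom_shape Q (Fr d)"
  unfolding hom_shape_def by (auto simp: Fr_def fdim_outside fract_def)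

text \<open>Associativity of the multiplication modulo \<open>J\<close>, in coordinates; it makes
  \<open>fract\<close> multiplicative in the path.\<close>

lemma nf_append:
  assumes "awalk v p w" "awalk w q x"
  shows "nf v x (p @ q) b = (\<Sum>b'\<in>bas v w. nf v w p b' * nf v x (b' @ q) b)"
  using assms(2)
proof (induction q arbitrary: x b rule: rev_induct)
  case Nil
  then have x: "x = w" by (auto simp: awalk_def)
  have "(\<Sum>b'\<in>bas v w. nf v w p b' * nf v w b' b) = (\<Sum>b'\<in>bas v w. if b' = b then nf v w p b else 0)"
    by (intro sum.cong) (auto simp: nf_basis)
  also have "\<dots> = nf v w p b" using bas_finite nf_supp[OF assms(1), of b] by auto
  finally show ?case using x by simp
next
  case (snoc a q)
  let ?y = "awlast w q"
  have q: "awalk w q ?y" "a \<in> arcs Q" "tail Q a = ?y" "head Q a = x" using snoc.prems by (auto simp: awalk_Cons_iff awalk_Nil_iff)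
  have pq: "awalk v (p @ q) ?y" using assms(1) q(1) by (rule awalk_appendI)
  have bq: "awalk v (b' @ q) ?y" if "b' \<in> bas v w" for b' using bas_awalk[OF that] q(1) by (rule awalk_appendI)
  have "nf v x (p @ q @ [a]) b = (\<Sum>b''\<in>bas v ?y. nf v ?y (p @ q) b'' * nf v x (b'' @ [a]) b)"
    using nf_snoc[OF pq q(2,3)] q(4) by simp
  also have "\<dots> = (\<Sum>b''\<in>bas v ?y. \<Sum>b'\<in>bas v w. nf v w p b' * (nf v ?y (b' @ q) b'' * nf v x (b'' @ [a]) b))"
    unfolding snoc.IH[OF q(1)] sum_distrib_right by (simp add: mult.assoc)
  also have "\<dots> = (\<Sum>b'\<in>bas v w. nf v w p b' * (\<Sum>b''\<in>bas v ?y. nf v ?y (b' @ q) b'' * nf v x (b'' @ [a]) b))"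
    by (subst sum.swap) (simp add: sum_distrib_left)
  also have "\<dots> = (\<Sum>b'\<in>bas v w. nf v w p b' * nf v x (b' @ q @ [a]) b)"
  proof (intro sum.cong refl)
    fix b' assume "b' \<in> bas v w"
    from nf_snoc[OF bq[OF this] q(2,3), of b]
    show "nf v w p b' * (\<Sum>b''\<in>bas v ?y. nf v ?y (b' @ q) b'' * nf v x (b'' @ [a]) b) = nf v w p b' * nf v x (b' @ q @ [a]) b"
      using q(4) by simp
  qed
  finally show ?case by simp
qed

lemma fract_comp:
  assumes "awalk u p x" "awalk x q w"
  shows "fract d x q w * fract d u p x = fract d u (p @ q) w"
proof (rule eq_matI)
  fix r c assume "r < dim_row (fract d u (p @ q) w)" "c < dim_col (fract d u (p @ q) w)"
  then have rc: "r < fdim d w" "c < fdim d u" by (auto simp: fract_def)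
  obtain v' b' i' where r: "idx d w ! r = (v', b', i')" "v' \<in> verts Q" "b' \<in> bas v' w" "i' < d v'" using idx_nthE[OF rc(1)] by blast
  obtain v b i where c: "idx d u ! c = (v, b, i)" "v \<in> verts Q" "b \<in> bas v u" "i < d v" using idx_nthE[OF rc(2)] by blast
  have "(fract d x q w * fract d u p x) $$ (r, c) = (\<Sum>l<fdim d x. fract d x q w $$ (r, l) * fract d u p x $$ (l, c))"
    using rc by (subst mat_mult_index) (auto simp: fract_def)
  also have "\<dots> = (\<Sum>l<fdim d x. case idx d x ! l of (v'', b'', i'') \<Rightarrow> if v = v'' \<and> i = i'' then
      (if v = v' \<and> i = i' then nf v x (b @ p) b'' * nf v w (b'' @ q) b' else 0) else 0)"
    using rc by (intro sum.cong refl) (auto simp: fract_def r(1) c(1) split: prod.splits)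
  also have "\<dots> = (\<Sum>b''\<in>bas v x. if v = v' \<and> i = i' then nf v x (b @ p) b'' * nf v w (b'' @ q) b' else 0)"
    using c by (intro sum_idx_delta)
  also have "\<dots> = (if v = v' \<and> i = i' then nf v w (b @ p @ q) b' else 0)"
    using nf_append[OF awalk_appendI[OF bas_awalk[OF c(3)] assms(1)] assms(2), of b'] by (auto simp: append_assoc)
  also have "\<dots> = fract d u (p @ q) w $$ (r, c)" using rc r c by (simp add: fract_def)
  finally show "(fract d x q w * fract d u p x) $$ (r, c) = fract d u (p @ q) w $$ (r, c)" .
qed (auto simp: fract_def)

lemma path_mat_Fr:
  assumes "awalk u q w"
  shows "path_mat Q (Fr d) u q = fract d u q w"
  using assms
proof (induction q arbitrary: u)
  case Nil
  then have "w = u" by (auto simp: awalk_def)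
  moreover have "1\<^sub>m (fdim d u) = fract d u [] u"
  proof (rule eq_matI)
    fix r c assume "r < dim_row (fract d u [] u)" "c < dim_col (fract d u [] u)"
    then have rc: "r < fdim d u" "c < fdim d u" by (auto simp: fract_def)
    obtain v' b' i' where r: "idx d u ! r = (v', b', i')" "v' \<in> verts Q" "b' \<in> bas v' u" "i' < d v'" using idx_nthE[OF rc(1)] by blast
    obtain v b i where c: "idx d u ! c = (v, b, i)" "v \<in> verts Q" "b \<in> bas v u" "i < d v" using idx_nthE[OF rc(2)] by blast
    show "1\<^sub>m (fdim d u) $$ (r, c) = fract d u [] u $$ (r, c)"
      using rc idx_inj[OF rc] nf_basis[OF c(3), of b'] by (auto simp: fract_def r(1) c(1) split: if_splits)
  qed (auto simp: fract_def)
  ultimately show ?case by simp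
next
  case (Cons a q)
  then have a: "a \<in> arcs Q" "tail Q a = u" "awalk (head Q a) q w" by (auto simp: awalk_Cons_iff)
  have ua: "awalk u [a] (head Q a)" using a by (auto simp: awalk_Cons_iff awalk_Nil_iff)
  have "path_mat Q (Fr d) u (a # q) = fract d (head Q a) q w * fract d u [a] (head Q a)"
    using a Cons.IH[OF a(3)] by (simp add: Fr_def)
  then show ?case using fract_comp[OF ua a(3)] by simp
qed

lemma Fr_rep: "is_rep Q R (Fr d)"
  unfolding is_rep_iff
proof safe
  show "hom_shape Q (Fr d)" by (rule Fr_shape)
  fix \<rho> u w assume *: "\<rho> \<in> R" "u \<in> verts Q" "w \<in> verts Q"
  let ?S = "{p. \<rho> (u, p) \<noteq> 0 \<and> awalk u p w}"
  show "relation_mat Q (Fr d) \<rho> u w = 0\<^sub>m (rdim (Fr d) w) (rdim (Fr d) u)"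
  proof (rule eq_matI)
    fix r c assume "r < dim_row (0\<^sub>m (rdim (Fr d) w) (rdim (Fr d) u) :: complex mat)" "c < dim_col (0\<^sub>m (rdim (Fr d) w) (rdim (Fr d) u) :: complex mat)"
    then have rc: "r < fdim d w" "c < fdim d u" by auto
    obtain v' b' i' where r: "idx d w ! r = (v', b', i')" using idx_nthE[OF rc(1)] by blast
    obtain v b i where c: "idx d u ! c = (v, b, i)" "v \<in> verts Q" "b \<in> bas v u" "i < d v" using idx_nthE[OF rc(2)] by blast
    have "relation_mat Q (Fr d) \<rho> u w $$ (r, c) = (\<Sum>p\<in>?S. \<rho> (u, p) * path_mat Q (Fr d) u p $$ (r, c))"
      using rc by (simp add: relation_mat_def)
    also have "\<dots> = (\<Sum>p\<in>?S. if v = v' \<and> i = i' then \<rho> (u, p) * nf v w (b @ p) b' else 0)"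
      using rc by (intro sum.cong refl) (auto simp: path_mat_Fr fract_def r c(1))
    also have "\<dots> = 0" using nf_relation[OF *(1) c(3), of w b'] by (cases "v = v' \<and> i = i'") (auto intro!: sum.neutral)
    finally show "relation_mat Q (Fr d) \<rho> u w $$ (r, c) = 0\<^sub>m (rdim (Fr d) w) (rdim (Fr d) u) $$ (r, c)" using rc by simp
  qed auto
qed

text \<open>\<open>fs\<close> is the inclusion of the generators, \<open>ft\<close> the corresponding coordinate projection, and
  \<open>FH d M X\<close> the homomorphism \<open>Fr d \<rightarrow> M\<close> that sends the generators at \<open>v\<close> to the columns of \<open>X v\<close>.\<close>

definition fs :: "('v \<Rightarrow> nat) \<Rightarrow> 'v \<Rightarrow> complex mat" where
  "fs d w = mat (fdim d w) (d w) (\<lambda>(r, j). if idx d w ! r = (w, [], j) then 1 else 0)"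

definition ft :: "('v \<Rightarrow> nat) \<Rightarrow> 'v \<Rightarrow> complex mat" where
  "ft d w = mat (d w) (fdim d w) (\<lambda>(j, r). if idx d w ! r = (w, [], j) then 1 else 0)"

definition FH :: "('v \<Rightarrow> nat) \<Rightarrow> ('v, 'a) rep \<Rightarrow> ('v \<Rightarrow> complex mat) \<Rightarrow> 'v \<Rightarrow> complex mat" where
  "FH d M X w = mat (rdim M w) (fdim d w) (\<lambda>(r, c). case idx d w ! c of (v, b, i) \<Rightarrow> (path_mat Q M v b * X v) $$ (r, i))"

lemma fs_dims[simp]: "dim_row (fs d w) = fdim d w" "dim_col (fs d w) = d w" by (auto simp: fs_def)
lemma ft_dims[simp]: "dim_row (ft d w) = d w" "dim_col (ft d w) = fdim d w" by (auto simp: ft_def)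
lemma FH_dims[simp]: "dim_row (FH d M X w) = rdim M w" "dim_col (FH d M X w) = fdim d w" by (auto simp: FH_def)

lemma unit_col_mult:
  fixes A :: "complex mat"
  assumes "dim_col A = fdim d w" "c < fdim d w" "idx d w ! c = g j" "j < m" "r < dim_row A"
  shows "(A * mat (fdim d w) m (\<lambda>(r, j). if idx d w ! r = g j then 1 else 0)) $$ (r, j) = A $$ (r, c)"
proof -
  have "(A * mat (fdim d w) m (\<lambda>(r, j). if idx d w ! r = g j then 1 else 0)) $$ (r, j)
     = (\<Sum>l<fdim d w. A $$ (r, l) * mat (fdim d w) m (\<lambda>(r, j). if idx d w ! r = g j then 1 else 0) $$ (l, j))"
    using assms by (subst mat_mult_index) auto
  also have "\<dots> = (\<Sum>l<fdim d w. if l = c then A $$ (r, l) else 0)"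
    using assms idx_inj[OF _ assms(2)] by (intro sum.cong refl) auto
  finally have "(A * mat (fdim d w) m (\<lambda>(r, j). if idx d w ! r = g j then 1 else 0)) $$ (r, j)
     = (\<Sum>l<fdim d w. if l = c then A $$ (r, l) else 0)" .
  then show ?thesis using assms by simp
qed

lemma trip_nil: "w \<in> verts Q \<Longrightarrow> j < d w \<Longrightarrow> (w, [], j) \<in> trip d w"
  unfolding trip_def using bas_nil by auto

lemma ft_fs:
  assumes o: "w \<notin> verts Q \<Longrightarrow> d w = 0"
  shows "ft d w * fs d w = 1\<^sub>m (d w)"
proof (rule eq_matI)
  fix i j assume "i < dim_row (1\<^sub>m (d w) :: complex mat)" "j < dim_col (1\<^sub>m (d w) :: complex mat)"
  then have ij: "i < d w" "j < d w" "w \<in> verts Q" using o by (auto intro: ccontr)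
  obtain c where c: "c < fdim d w" "idx d w ! c = (w, [], j)" using idx_ex[OF trip_nil[where d = d, OF ij(3,2)]] by blast
  have "(ft d w * fs d w) $$ (i, j) = ft d w $$ (i, c)"
    unfolding fs_def using c ij by (intro unit_col_mult) auto
  also have "\<dots> = 1\<^sub>m (d w) $$ (i, j)" using c ij by (auto simp: ft_def)
  finally show "(ft d w * fs d w) $$ (i, j) = 1\<^sub>m (d w) $$ (i, j)" .
qed auto

lemma path_mat_Fr_fs:
  assumes "b \<in> bas v w"
  shows "path_mat Q (Fr d) v b * fs d v = mat (fdim d w) (d v) (\<lambda>(r, j). if idx d w ! r = (v, b, j) then 1 else 0)"
proof (rule eq_matI)
  note aw = bas_awalk[OF assms]
  have vv: "v \<in> verts Q" using aw by auto
  fix r j assume "r < dim_row (mat (fdim d w) (d v) (\<lambda>(r, j). if idx d w ! r = (v, b, j) then 1 else 0 :: complex))"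
    "j < dim_col (mat (fdim d w) (d v) (\<lambda>(r, j). if idx d w ! r = (v, b, j) then 1 else 0 :: complex))"
  then have rj: "r < fdim d w" "j < d v" by auto
  obtain c where c: "c < fdim d v" "idx d v ! c = (v, [], j)" using idx_ex[OF trip_nil[where d = d, OF vv rj(2)]] by blast
  have "(path_mat Q (Fr d) v b * fs d v) $$ (r, j) = fract d v b w $$ (r, c)"
    unfolding fs_def path_mat_Fr[OF aw] using c rj by (intro unit_col_mult) (auto simp: fract_def)
  also have "\<dots> = (if idx d w ! r = (v, b, j) then 1 else 0)"
    using c rj nf_basis[OF assms] by (auto simp: fract_def split: prod.splits)
  finally show "(path_mat Q (Fr d) v b * fs d v) $$ (r, j) = mat (fdim d w) (d v) (\<lambda>(r, j). if idx d w ! r = (v, b, j) then 1 else 0) $$ (r, j)"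
    using rj by simp
qed (use path_mat_carrier[OF Fr_shape bas_awalk[OF assms]] in auto)

text \<open>The basis element \<open>(v, b, i)\<close> arises from the generator
  \<open>(v, [], i)\<close> by the action of \<open>b\<close>, so its image under a homomorphism is
  \<open>b\<close> applied to the image of the generator.\<close>

lemma Fr_hom_entry:
  assumes "hom_shape Q M" "rep_hom Q (Fr d) M g" "r < rdim M w" "c < fdim d w" "idx d w ! c = (v, b, i)"
  shows "g w $$ (r, c) = (path_mat Q M v b * (g v * fs d v)) $$ (r, i)"
proof -
  have t: "b \<in> bas v w" "i < d v" "v \<in> verts Q" using idx_nth[OF assms(4)] assms(5) unfolding trip_def by auto
  note aw = bas_awalk[OF t(1)]
  note d = hom_dims[OF assms(2)] carrier_matD[OF path_mat_carrier[OF Fr_shape aw]] carrier_matD[OF path_mat_carrier[OF assms(1) aw]]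
  have "g w $$ (r, c) = (g w * (path_mat Q (Fr d) v b * fs d v)) $$ (r, i)"
    unfolding path_mat_Fr_fs[OF t(1)] by (rule unit_col_mult[symmetric]) (use assms t d in auto)
  also have "g w * (path_mat Q (Fr d) v b * fs d v) = (g w * path_mat Q (Fr d) v b) * fs d v"
    by (simp add: mat_assoc d)
  also have "\<dots> = path_mat Q M v b * (g v * fs d v)"
    unfolding path_mat_hom[OF Fr_shape assms(1,2) aw] by (simp add: mat_assoc d)
  finally show ?thesis .
qed

text \<open>This reduces identities between maps out of \<open>Fr d\<close> to the generators, where
  functoriality and naturality become identities of small matrices.\<close>

lemma Fr_hom_unique:
  assumes "hom_shape Q M" "rep_hom Q (Fr d) M g" "rep_hom Q (Fr d) M g'" "\<And>v. v \<in> verts Q \<Longrightarrow> g v * fs d v = g' v * fs d v"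
  shows "g w = g' w"
proof (rule eq_matI)
  fix r c assume "r < dim_row (g' w)" "c < dim_col (g' w)"
  then have rc: "r < rdim M w" "c < fdim d w" using hom_dims[OF assms(3)] by auto
  obtain v b i where c: "idx d w ! c = (v, b, i)" "v \<in> verts Q" using idx_nthE[OF rc(2)] by blast
  show "g w $$ (r, c) = g' w $$ (r, c)"
    using Fr_hom_entry[OF assms(1,2) rc c(1)] Fr_hom_entry[OF assms(1,3) rc c(1)] assms(4)[OF c(2)] by simp
qed (auto simp: hom_dims[OF assms(2)] hom_dims[OF assms(3)])

text \<open>For an arrow \<open>a\<close>, \<open>Fr d\<close> replaces \<open>b @ [a]\<close> by
  its normal form, while \<open>M\<close> applies the path itself. The two agree by
  \<open>path_mat_nf\<close>, that is, because \<open>J\<close> kills \<open>M\<close>.\<close>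

lemma FH_hom:
  assumes M: "is_rep Q R M" and X: "\<And>v. X v \<in> carrier_mat (rdim M v) (d v)"
  shows "rep_hom Q (Fr d) M (FH d M X)"
  unfolding rep_hom_def
proof safe
  fix a assume a: "a \<in> arcs Q"
  note sh = is_rep_shape[OF M]
  note dM = shape_dims[OF sh a] carrier_matD[OF X]
  show "FH d M X (head Q a) * rmap (Fr d) a = rmap M a * FH d M X (tail Q a)"
  proof (rule eq_matI)
    fix r c assume "r < dim_row (rmap M a * FH d M X (tail Q a))" "c < dim_col (rmap M a * FH d M X (tail Q a))"
    then have rc: "r < rdim M (head Q a)" "c < fdim d (tail Q a)" by (auto simp: dM)
    obtain v b i where c: "idx d (tail Q a) ! c = (v, b, i)" "v \<in> verts Q" "b \<in> bas v (tail Q a)" "i < d v" using idx_nthE[OF rc(2)] by blast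
    note aw = bas_awalk[OF c(3)]
    have aw1: "awalk (tail Q a) [a] (head Q a)" using a by (auto simp: awalk_Cons_iff awalk_Nil_iff)
    have aw2: "awalk v (b @ [a]) (head Q a)" by (rule awalk_appendI[OF aw aw1])
    note pd = carrier_matD[OF path_mat_carrier[OF sh aw]] carrier_matD[OF path_mat_carrier[OF sh aw2]]
    have "(FH d M X (head Q a) * rmap (Fr d) a) $$ (r, c) =
      (\<Sum>l<fdim d (head Q a). FH d M X (head Q a) $$ (r, l) * fract d (tail Q a) [a] (head Q a) $$ (l, c))"
      using rc a by (subst mat_mult_index) (auto simp: Fr_def fract_def)
    also have "\<dots> = (\<Sum>l<fdim d (head Q a). case idx d (head Q a) ! l of (v', b', i') \<Rightarrow> if v = v' \<and> i = i' then
       nf v (head Q a) (b @ [a]) b' * (path_mat Q M v b' * X v) $$ (r, i) else 0)"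
      using rc by (intro sum.cong refl) (auto simp: FH_def fract_def c(1) split: prod.splits)
    also have "\<dots> = (\<Sum>b'\<in>bas v (head Q a). nf v (head Q a) (b @ [a]) b' * (path_mat Q M v b' * X v) $$ (r, i))"
      using c by (intro sum_idx_delta)
    also have "\<dots> = (\<Sum>b'\<in>bas v (head Q a). \<Sum>l<rdim M v. nf v (head Q a) (b @ [a]) b' * path_mat Q M v b' $$ (r, l) * X v $$ (l, i))"
    proof (intro sum.cong refl)
      fix b' assume "b' \<in> bas v (head Q a)"
      note pb = carrier_matD[OF path_mat_carrier[OF sh bas_awalk[OF this]]]
      show "nf v (head Q a) (b @ [a]) b' * (path_mat Q M v b' * X v) $$ (r, i) = (\<Sum>l<rdim M v. nf v (head Q a) (b @ [a]) b' * path_mat Q M v b' $$ (r, l) * X v $$ (l, i))"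
        using rc c by (subst mat_mult_index) (auto simp: pb dM sum_distrib_left algebra_simps)
    qed
    also have "\<dots> = (\<Sum>l<rdim M v. path_mat Q M v (b @ [a]) $$ (r, l) * X v $$ (l, i))"
      using rc by (subst sum.swap) (auto simp: path_mat_nf[OF M aw2] sum_distrib_right intro!: sum.cong)
    also have "\<dots> = (path_mat Q M v (b @ [a]) * X v) $$ (r, i)"
      using rc c by (subst mat_mult_index) (auto simp: pd dM)
    also have "path_mat Q M v (b @ [a]) * X v = rmap M a * (path_mat Q M v b * X v)"
      by (simp add: path_mat_append[OF sh aw aw1] mat_ring pd dM a)
    also have "\<dots> $$ (r, i) = (\<Sum>l<rdim M (tail Q a). rmap M a $$ (r, l) * (path_mat Q M v b * X v) $$ (l, i))"
      using rc c by (subst mat_mult_index) (auto simp: pd dM)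
    also have "\<dots> = (rmap M a * FH d M X (tail Q a)) $$ (r, c)"
      using rc c by (subst mat_mult_index) (auto simp: FH_def dM intro!: sum.cong)
    finally show "(FH d M X (head Q a) * rmap (Fr d) a) $$ (r, c) = (rmap M a * FH d M X (tail Q a)) $$ (r, c)" .
  qed (auto simp: dM shape_dims[OF Fr_shape a])
qed (auto simp: FH_def)

lemma FH_fs:
  assumes M: "hom_shape Q M" and X: "\<And>v. X v \<in> carrier_mat (rdim M v) (d v)"
  shows "FH d M X w * fs d w = X w"
proof (rule eq_matI)
  fix r j assume "r < dim_row (X w)" "j < dim_col (X w)"
  then have rj: "r < rdim M w" "j < d w" using X[of w] by auto
  then have w: "w \<in> verts Q" using M unfolding hom_shape_def by (metis not_less_zero)
  obtain c where c: "c < fdim d w" "idx d w ! c = (w, [], j)" using idx_ex[OF trip_nil[where d = d, OF w rj(2)]] by blast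
  have "(FH d M X w * fs d w) $$ (r, j) = FH d M X w $$ (r, c)"
    unfolding fs_def using c rj by (intro unit_col_mult) auto
  also have "\<dots> = X w $$ (r, j)" using c rj X[of w] by (auto simp: FH_def mat_ring0)
  finally show "(FH d M X w * fs d w) $$ (r, j) = X w $$ (r, j)" .
qed (use X[of w] in auto)

text \<open>Choose linear preimages of the images of the generators and extend them by
  \<open>FH\<close>; the lift is correct because it is so on generators.\<close>

lemma Fr_projective: "projective_rep Q R (Fr d)"
proof (rule projectiveI[OF Fr_rep])
  fix V W f g s assume *: "is_rep Q R V" "is_rep Q R W" "rep_hom Q V W f" "\<And>v. s v \<in> carrier_mat (rdim V v) (rdim W v)"
       "\<And>v. f v * s v = 1\<^sub>m (rdim W v)" "rep_hom Q (Fr d) W g"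
  let ?X = "\<lambda>v. s v * (g v * fs d v)"
  note d = hom_dims[OF *(3)] hom_dims[OF *(6)] carrier_matD[OF *(4)]
  have X: "?X v \<in> carrier_mat (rdim V v) (d v)" for v by (auto simp: d)
  note h = FH_hom[OF *(1) X]
  have "f w * FH d V ?X w = g w" for w
  proof (rule Fr_hom_unique[OF is_rep_shape[OF *(2)] hom_comp[OF Fr_shape is_rep_shape[OF *(1)] is_rep_shape[OF *(2)] h *(3)] *(6)])
    fix v
    have "f v * FH d V ?X v * fs d v = f v * (FH d V ?X v * fs d v)" by (simp add: mat_assoc d)
    also have "\<dots> = (f v * s v) * (g v * fs d v)"
      unfolding FH_fs[OF is_rep_shape[OF *(1)] X] by (simp add: mat_assoc d)
    finally show "f v * FH d V ?X v * fs d v = g v * fs d v" by (simp add: *(5) mat_ring0 d)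
  qed
  then show "\<exists>h. rep_hom Q (Fr d) V h \<and> (\<forall>v. f v * h v = g v)" using h by blast
qed

subsection \<open>The syzygy functor\<close>

text \<open>\<open>Fr\<close> is left adjoint to forgetting the arrows. \<open>FrM\<close> is its
  action on families of linear maps, which need not commute with arrows, and \<open>ev\<close> is
  the counit of the adjunction.\<close>

definition FrM :: "('v \<Rightarrow> nat) \<Rightarrow> ('v \<Rightarrow> nat) \<Rightarrow> ('v \<Rightarrow> complex mat) \<Rightarrow> 'v \<Rightarrow> complex mat" where
  "FrM d d' f = FH d (Fr d') (\<lambda>v. fs d' v * f v)"

definition ev :: "('v, 'a) rep \<Rightarrow> 'v \<Rightarrow> complex mat" where
  "ev V = FH (rdim V) V (\<lambda>v. 1\<^sub>m (rdim V v))"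

lemma FrM_dims[simp]: "dim_row (FrM d d' f w) = fdim d' w" "dim_col (FrM d d' f w) = fdim d w" by (auto simp: FrM_def)
lemma ev_dims[simp]: "dim_row (ev V w) = rdim V w" "dim_col (ev V w) = fdim (rdim V) w" by (auto simp: ev_def)

lemma FrM_hom: "(\<And>v. f v \<in> carrier_mat (d' v) (d v)) \<Longrightarrow> rep_hom Q (Fr d) (Fr d') (FrM d d' f)"
  unfolding FrM_def by (rule FH_hom[OF Fr_rep]) (force intro!: carrier_matI)

lemma FrM_fs: "(\<And>v. f v \<in> carrier_mat (d' v) (d v)) \<Longrightarrow> FrM d d' f w * fs d w = fs d' w * f w"
  unfolding FrM_def by (rule FH_fs[OF Fr_shape]) (force intro!: carrier_matI)

lemma ev_hom: "is_rep Q R V \<Longrightarrow> rep_hom Q (Fr (rdim V)) V (ev V)"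
  unfolding ev_def by (rule FH_hom) auto

lemma ev_fs: "hom_shape Q V \<Longrightarrow> ev V w * fs (rdim V) w = 1\<^sub>m (rdim V w)"
  unfolding ev_def by (rule FH_fs) auto

lemma FrM_comp:
  assumes f: "\<And>v. f v \<in> carrier_mat (d' v) (d v)" and g: "\<And>v. g v \<in> carrier_mat (d'' v) (d' v)"
  shows "FrM d' d'' g w * FrM d d' f w = FrM d d'' (\<lambda>v. g v * f v) w"
proof (rule Fr_hom_unique[OF Fr_shape hom_comp[OF Fr_shape Fr_shape Fr_shape FrM_hom[OF f] FrM_hom[OF g]]])
  note dm = carrier_matD[OF f] carrier_matD[OF g]
  have gf: "g v * f v \<in> carrier_mat (d'' v) (d v)" for v by (auto simp: dm)
  show "rep_hom Q (Fr d) (Fr d'') (FrM d d'' (\<lambda>v. g v * f v))" by (rule FrM_hom[OF gf])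
  fix v
  have "FrM d' d'' g v * FrM d d' f v * fs d v = (FrM d' d'' g v * fs d' v) * f v"
    using FrM_fs[of f d' d v, OF f] by (simp add: mat_assoc dm)
  then show "FrM d' d'' g v * FrM d d' f v * fs d v = FrM d d'' (\<lambda>v. g v * f v) v * fs d v"
    unfolding FrM_fs[OF g] FrM_fs[OF gf] by (simp add: mat_assoc dm)
qed

lemma FrM_add:
  assumes f: "\<And>v. f v \<in> carrier_mat (d' v) (d v)" and g: "\<And>v. g v \<in> carrier_mat (d' v) (d v)"
  shows "FrM d d' (\<lambda>v. f v + g v) w = FrM d d' f w + FrM d d' g w"
proof (rule Fr_hom_unique[OF Fr_shape _ hom_add[OF Fr_shape Fr_shape FrM_hom[OF f] FrM_hom[OF g]]])
  note dm = carrier_matD[OF f] carrier_matD[OF g]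
  have gf: "f v + g v \<in> carrier_mat (d' v) (d v)" for v by (auto simp: dm intro!: carrier_matI)
  show "rep_hom Q (Fr d) (Fr d') (FrM d d' (\<lambda>v. f v + g v))" by (rule FrM_hom[OF gf])
  fix v
  show "FrM d d' (\<lambda>v. f v + g v) v * fs d v = (FrM d d' f v + FrM d d' g v) * fs d v"
    by (simp add: mat_ring0 FrM_fs[OF gf] FrM_fs[OF f] FrM_fs[OF g] dm)
qed

lemma FrM_one: "FrM d d (\<lambda>v. 1\<^sub>m (d v)) w = 1\<^sub>m (fdim d w)"
proof -
  have "FrM d d (\<lambda>v. 1\<^sub>m (d v)) w = (\<lambda>v. 1\<^sub>m (rdim (Fr d) v)) w"
    by (rule Fr_hom_unique[OF Fr_shape FrM_hom hom_id[OF Fr_shape]]) (auto simp: FrM_fs mat_ring0)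
  then show ?thesis by simp
qed

lemma FrM_zero: "FrM d d' (\<lambda>v. 0\<^sub>m (d' v) (d v)) w = 0\<^sub>m (fdim d' w) (fdim d w)"
proof -
  have "FrM d d' (\<lambda>v. 0\<^sub>m (d' v) (d v)) w = (\<lambda>v. 0\<^sub>m (rdim (Fr d') v) (rdim (Fr d) v)) w"
    by (rule Fr_hom_unique[OF Fr_shape FrM_hom hom_zero[OF Fr_shape Fr_shape]]) (auto simp: FrM_fs mat_ring0)
  then show ?thesis by simp
qed

lemma ev_natural:
  assumes "is_rep Q R V" "is_rep Q R W" "rep_hom Q V W f"
  shows "ev W w * FrM (rdim V) (rdim W) f w = f w * ev V w"
proof (rule Fr_hom_unique[OF is_rep_shape[OF assms(2)] hom_comp[OF Fr_shape Fr_shape is_rep_shape[OF assms(2)] FrM_hom ev_hom[OF assms(2)]]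
     hom_comp[OF Fr_shape is_rep_shape[OF assms(1)] is_rep_shape[OF assms(2)] ev_hom[OF assms(1)] assms(3)]])
  note d = hom_dims[OF assms(3)]
  show fc: "f v \<in> carrier_mat (rdim W v) (rdim V v)" for v by (rule hom_carrier[OF assms(3)])
  fix v
  have "ev W v * FrM (rdim V) (rdim W) f v * fs (rdim V) v = (ev W v * fs (rdim W) v) * f v"
    by (simp add: mat_assoc d FrM_fs[OF fc])
  also have "\<dots> = f v" unfolding ev_fs[OF is_rep_shape[OF assms(2)]] by (simp add: mat_ring0 d)
  also have "f v = f v * ev V v * fs (rdim V) v"
    by (simp add: mat_assoc d ev_fs[OF is_rep_shape[OF assms(1)]] mat_ring0)
  finally show "ev W v * FrM (rdim V) (rdim W) f v * fs (rdim V) v = f v * ev V v * fs (rdim V) v" .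
qed

text \<open>Since \<open>ev \<circ> fs = 1\<close>, the kernel of \<open>ev\<close> is the image of \<open>kk = (1 - fs \<circ> ev) \<circ> jj\<close>, where \<open>jj\<close>
  includes the non-generators; its left inverse \<open>rr\<close> does not depend on the module.\<close>

definition "kdim d w = fdim d w - d w"

definition "jr d w = (SOME jr. fst jr \<in> carrier_mat (fdim d w) (kdim d w) \<and> snd jr \<in> carrier_mat (kdim d w) (fdim d w) \<and>
   snd jr * fst jr = 1\<^sub>m (kdim d w) \<and> fst jr * snd jr + fs d w * ft d w = 1\<^sub>m (fdim d w))"

definition "jj d w = fst (jr d w)"
definition "rr d w = snd (jr d w)"

text \<open>Off the quiver \<open>fdim d\<close> is zero, so \<open>fs\<close> has a left inverse
  there only if \<open>d\<close> vanishes too. Under this condition \<open>split_dims\<close> shows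
  that the truncated subtraction in \<open>kdim\<close> is a true difference.\<close>

lemma jr_props:
  assumes "w \<notin> verts Q \<Longrightarrow> d w = 0"
  shows "jj d w \<in> carrier_mat (fdim d w) (kdim d w)" "rr d w \<in> carrier_mat (kdim d w) (fdim d w)"
   "rr d w * jj d w = 1\<^sub>m (kdim d w)" "jj d w * rr d w + fs d w * ft d w = 1\<^sub>m (fdim d w)" "fdim d w = kdim d w + d w"
proof -
  have c: "ft d w \<in> carrier_mat (d w) (fdim d w)" "fs d w \<in> carrier_mat (fdim d w) (d w)" by auto
  obtain n k r where *: "k () \<in> carrier_mat (fdim d w) (n ())" "r () \<in> carrier_mat (n ()) (fdim d w)"
    "r () * k () = 1\<^sub>m (n ())" "k () * r () + fs d w * ft d w = 1\<^sub>m (fdim d w)"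
    using complement_exists[of "\<lambda>_::unit. ft d w" "\<lambda>_. d w" "\<lambda>_. fdim d w" "\<lambda>_. fs d w"] c ft_fs[of w d] assms by metis
  have n: "fdim d w = n () + d w" by (rule split_dims[OF *(3) ft_fs[of w d] *(4,1,2)]) (use assms c in auto)
  then have nk: "n () = kdim d w" by (simp add: kdim_def)
  have "\<exists>jr. fst jr \<in> carrier_mat (fdim d w) (kdim d w) \<and> snd jr \<in> carrier_mat (kdim d w) (fdim d w) \<and>
   snd jr * fst jr = 1\<^sub>m (kdim d w) \<and> fst jr * snd jr + fs d w * ft d w = 1\<^sub>m (fdim d w)"
    using * unfolding nk by (intro exI[of _ "(k (), r ())"]) auto
  from someI_ex[OF this] show "jj d w \<in> carrier_mat (fdim d w) (kdim d w)" "rr d w \<in> carrier_mat (kdim d w) (fdim d w)"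
   "rr d w * jj d w = 1\<^sub>m (kdim d w)" "jj d w * rr d w + fs d w * ft d w = 1\<^sub>m (fdim d w)"
    unfolding jj_def rr_def jr_def by blast+
  show "fdim d w = kdim d w + d w" using n nk by simp
qed

definition kk :: "('v, 'a) rep \<Rightarrow> 'v \<Rightarrow> complex mat" where
  "kk V w = (1\<^sub>m (fdim (rdim V) w) - fs (rdim V) w * ev V w) * jj (rdim V) w"

definition KV :: "('v, 'a) rep \<Rightarrow> ('v, 'a) rep" where
  "KV V = ker_rep (Fr (rdim V)) (kdim (rdim V)) (kk V) (rr (rdim V))"

lemma rdim_KV[simp]: "rdim (KV V) = kdim (rdim V)" by (simp add: KV_def)

text \<open>\<open>rr\<close> is complementary to \<open>fs\<close> and kills it, so in
  \<open>rr * kk\<close> the correction by \<open>fs * ev\<close> drops out. Conversely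
  \<open>kk * rr\<close> is the product of \<open>1 - fs * ev\<close> and
  \<open>1 - fs * ft\<close>, which equals \<open>1 - fs * ev\<close> because
  \<open>ev * fs = 1\<close>.\<close>

lemma KV_sses:
  assumes V: "is_rep Q R V"
  shows "sses R (KV V) (Fr (rdim V)) V (kk V) (ev V) (rr (rdim V)) (fs (rdim V))"
proof -
  have o: "w \<notin> verts Q \<Longrightarrow> rdim V w = 0" for w using is_rep_shape[OF V] unfolding hom_shape_def by blast
  note j = jr_props[of _ "rdim V", OF o]
  note jd = carrier_matD[OF j(1)] carrier_matD[OF j(2)]
  have rs: "rr (rdim V) w * fs (rdim V) w = 0\<^sub>m (kdim (rdim V) w) (rdim V w)" for w
  proof (rule split_pk[of "ft (rdim V) w" "fs (rdim V) w" "rdim V w" "rr (rdim V) w" "jj (rdim V) w" "kdim (rdim V) w" "fdim (rdim V) w"])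
    show "ft (rdim V) w * fs (rdim V) w = 1\<^sub>m (rdim V w)" using ft_fs o by blast
    have "jj (rdim V) w * rr (rdim V) w + fs (rdim V) w * ft (rdim V) w = 1\<^sub>m (fdim (rdim V) w)" by (rule j)
    then show "fs (rdim V) w * ft (rdim V) w + jj (rdim V) w * rr (rdim V) w = 1\<^sub>m (fdim (rdim V) w)"
      by (subst comm_add_mat[of _ "fdim (rdim V) w" "fdim (rdim V) w"]) (auto simp: jd intro!: carrier_matI)
    show "rr (rdim V) w * jj (rdim V) w = 1\<^sub>m (kdim (rdim V) w)" by (rule j(3))
  qed (use j(1,2) in auto)
  note ef = ev_fs[OF is_rep_shape[OF V]]
  let ?s = "fs (rdim V)"
  have kc: "kk V w \<in> carrier_mat (fdim (rdim V) w) (kdim (rdim V) w)" for w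
    unfolding kk_def by (auto simp: jd intro!: carrier_matI)
  have rj: "rr (rdim V) w * jj (rdim V) w = 1\<^sub>m (kdim (rdim V) w)" for w by (rule j(3))
  have rk: "rr (rdim V) w * kk V w = 1\<^sub>m (kdim (rdim V) w)" for w
  proof -
    have "rr (rdim V) w * kk V w = rr (rdim V) w * jj (rdim V) w - (rr (rdim V) w * ?s w) * (ev V w * jj (rdim V) w)"
      unfolding kk_def by (simp add: mat_ring jd)
    also have "\<dots> = 1\<^sub>m (kdim (rdim V) w)" unfolding rs rj by (simp add: mat_ring0 jd)
    finally show ?thesis .
  qed
  have kr: "kk V w * rr (rdim V) w + ?s w * ev V w = 1\<^sub>m (fdim (rdim V) w)" for w
  proof -
    let ?e = "?s w * ev V w"
    have jre: "jj (rdim V) w * rr (rdim V) w = 1\<^sub>m (fdim (rdim V) w) - ?s w * ft (rdim V) w"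
      by (rule mat_add_eq[OF j(4)]) (auto simp: jd)
    have "kk V w * rr (rdim V) w = (1\<^sub>m (fdim (rdim V) w) - ?e) * (jj (rdim V) w * rr (rdim V) w)"
      unfolding kk_def by (subst mat_assoc) (auto simp: jd)
    also have "\<dots> = (1\<^sub>m (fdim (rdim V) w) - ?e) - (1\<^sub>m (fdim (rdim V) w) - ?e) * (?s w * ft (rdim V) w)"
      unfolding jre by (subst mat_diff_left) (auto simp: mat_ring0)
    also have "(1\<^sub>m (fdim (rdim V) w) - ?e) * (?s w * ft (rdim V) w) = ?s w * ft (rdim V) w - ?s w * ((ev V w * ?s w) * ft (rdim V) w)"
      by (simp add: mat_ring)
    also have "\<dots> = 0\<^sub>m (fdim (rdim V) w) (fdim (rdim V) w)" unfolding ef by (simp add: mat_ring0) (rule eq_matI, auto)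
    finally have "kk V w * rr (rdim V) w = 1\<^sub>m (fdim (rdim V) w) - ?e" by (simp add: mat_ring0)
    then show ?thesis by (simp, intro eq_matI) auto
  qed
  show ?thesis unfolding KV_def
  proof (rule ker_rep_sses[OF Fr_rep V ev_hom[OF V]])
    show "kk V v \<in> carrier_mat (rdim (Fr (rdim V)) v) (kdim (rdim V) v)" for v using kc by simp
    show "rr (rdim V) v \<in> carrier_mat (kdim (rdim V) v) (rdim (Fr (rdim V)) v)" for v using j(2) by simp
    show "kk V v * rr (rdim V) v + fs (rdim V) v * ev V v = 1\<^sub>m (rdim (Fr (rdim V)) v)" for v using kr by simp
  qed (auto simp: rk ef)
qed

lemma KV_rep: "is_rep Q R V \<Longrightarrow> is_rep Q R (KV V)" using ssesD(1)[OF KV_sses] .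

definition KM :: "('v, 'a) rep \<Rightarrow> ('v, 'a) rep \<Rightarrow> ('v \<Rightarrow> complex mat) \<Rightarrow> 'v \<Rightarrow> complex mat" where
  "KM V W f w = rr (rdim W) w * (FrM (rdim V) (rdim W) f w * kk V w)"

text \<open>By naturality of \<open>ev\<close>, the map \<open>FrM f\<close> sends the kernel of
  \<open>ev V\<close> into that of \<open>ev W\<close>; the retraction \<open>rr\<close> reads off
  its coordinates there.\<close>

lemma KM_props:
  assumes V: "is_rep Q R V" and W: "is_rep Q R W" and f: "rep_hom Q V W f"
  shows "rep_hom Q (KV V) (KV W) (KM V W f)" "kk W w * KM V W f w = FrM (rdim V) (rdim W) f w * kk V w"
proof -
  note s = KV_sses[OF V] and t = KV_sses[OF W]
  have c: "f v \<in> carrier_mat (rdim W v) (rdim V v)" for v by (rule hom_carrier[OF f])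
  note h = hom_comp[OF is_rep_shape[OF KV_rep[OF V]] Fr_shape Fr_shape ssesD(4)[OF s] FrM_hom[OF c]]
  have z: "ev W v * (FrM (rdim V) (rdim W) f v * kk V v) = 0\<^sub>m (rdim W v) (rdim (KV V) v)" for v
  proof -
    have "ev W v * (FrM (rdim V) (rdim W) f v * kk V v) = (ev W v * FrM (rdim V) (rdim W) f v) * kk V v"
      by (subst mat_assoc) (auto simp: hom_dims[OF ssesD(4)[OF s]])
    also have "\<dots> = f v * (ev V v * kk V v)" unfolding ev_natural[OF V W f] by (subst mat_assoc) (auto simp: hom_dims[OF ssesD(4)[OF s]] hom_dims[OF f])
    also have "\<dots> = 0\<^sub>m (rdim W v) (rdim (KV V) v)" unfolding sses_pk[OF s] by (simp add: mat_ring0 hom_dims[OF f])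
    finally show ?thesis .
  qed
  note fa = sses_factor[OF t is_rep_shape[OF KV_rep[OF V]] h z]
  show "rep_hom Q (KV V) (KV W) (KM V W f)" using fa(1) unfolding KM_def[abs_def] .
  show "kk W w * KM V W f w = FrM (rdim V) (rdim W) f w * kk V w" using fa(2)[of w] unfolding KM_def .
qed

lemma KM_unique:
  assumes V: "is_rep Q R V" and W: "is_rep Q R W" and "dim_row A = kdim (rdim W) w" "dim_row B = kdim (rdim W) w"
    and "kk W w * A = kk W w * B"
  shows "A = B"
proof -
  note t = KV_sses[OF W]
  show ?thesis
    by (rule mat_cancel_left[OF ssesD(8)[OF t] _ _ _ _ assms(5)])
      (use assms(3,4) hom_dims[OF ssesD(4)[OF t]] carrier_matD[OF ssesD(6)[OF t]] in auto)
qed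

lemma KM_comp:
  assumes V: "is_rep Q R V" and W: "is_rep Q R W" and Z: "is_rep Q R Z" and f: "rep_hom Q V W f" and g: "rep_hom Q W Z g"
  shows "KM W Z g w * KM V W f w = KM V Z (\<lambda>v. g v * f v) w"
proof -
  note gf = hom_comp[OF is_rep_shape[OF V] is_rep_shape[OF W] is_rep_shape[OF Z] f g]
  note p1 = KM_props[OF V W f] and p2 = KM_props[OF W Z g] and p3 = KM_props[OF V Z gf]
  note d = hom_dims[OF p1(1)] hom_dims[OF p2(1)] hom_dims[OF p3(1)] hom_dims[OF ssesD(4)[OF KV_sses[OF V]]] hom_dims[OF ssesD(4)[OF KV_sses[OF W]]] hom_dims[OF ssesD(4)[OF KV_sses[OF Z]]]
  show ?thesis
  proof (rule KM_unique[OF V Z])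
    have "kk Z w * (KM W Z g w * KM V W f w) = (kk Z w * KM W Z g w) * KM V W f w" by (simp add: mat_assoc d)
    also have "\<dots> = FrM (rdim W) (rdim Z) g w * (kk W w * KM V W f w)" unfolding p2(2) by (simp add: mat_assoc d)
    also have "\<dots> = (FrM (rdim W) (rdim Z) g w * FrM (rdim V) (rdim W) f w) * kk V w" unfolding p1(2) by (simp add: mat_assoc d)
    also have "\<dots> = kk Z w * KM V Z (\<lambda>v. g v * f v) w"
      unfolding p3(2) using FrM_comp[of f "rdim W" "rdim V" g "rdim Z" w] hom_carrier[OF f] hom_carrier[OF g] by simp
    finally show "kk Z w * (KM W Z g w * KM V W f w) = kk Z w * KM V Z (\<lambda>v. g v * f v) w" .
  qed (auto simp: d)
qed

lemma KM_add:
  assumes V: "is_rep Q R V" and W: "is_rep Q R W" and f: "rep_hom Q V W f" and g: "rep_hom Q V W g"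
  shows "KM V W (\<lambda>v. f v + g v) w = KM V W f w + KM V W g w"
proof -
  note gf = hom_add[OF is_rep_shape[OF V] is_rep_shape[OF W] f g]
  note p1 = KM_props[OF V W f] and p2 = KM_props[OF V W g] and p3 = KM_props[OF V W gf]
  note d = hom_dims[OF p1(1)] hom_dims[OF p2(1)] hom_dims[OF p3(1)] hom_dims[OF ssesD(4)[OF KV_sses[OF V]]] hom_dims[OF ssesD(4)[OF KV_sses[OF W]]]
  show ?thesis
  proof (rule KM_unique[OF V W])
    show "kk W w * KM V W (\<lambda>v. f v + g v) w = kk W w * (KM V W f w + KM V W g w)"
      using FrM_add[of f "rdim W" "rdim V" g w] hom_carrier[OF f] hom_carrier[OF g] by (simp add: p1(2) p2(2) p3(2) mat_ring0 d)
  qed (auto simp: d)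
qed

lemma KM_one:
  assumes V: "is_rep Q R V"
  shows "KM V V (\<lambda>v. 1\<^sub>m (rdim V v)) w = 1\<^sub>m (kdim (rdim V) w)"
proof -
  note p1 = KM_props[OF V V hom_id[OF is_rep_shape[OF V]]]
  note d = hom_dims[OF p1(1)] hom_dims[OF ssesD(4)[OF KV_sses[OF V]]]
  show ?thesis
    by (rule KM_unique[OF V V]) (auto simp: d p1(2) FrM_one mat_ring0)
qed

text \<open>A section \<open>\<sigma>\<close> of \<open>ev\<close> exists by projectivity; then
  \<open>1 - \<sigma> * ev\<close> retracts \<open>Fr\<close> onto the kernel, which is thus a
  summand of a projective module.\<close>

lemma KV_projective:
  assumes "projective_rep Q R P"
  shows "projective_rep Q R (KV P)"
proof -
  note P = projective_is_rep[OF assms]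
  note s = KV_sses[OF P]
  note sh = is_rep_shape[OF P]
  obtain \<sigma> where \<sigma>: "rep_hom Q P (Fr (rdim P)) \<sigma>" "\<And>v. ev P v * \<sigma> v = 1\<^sub>m (rdim P v)"
    using projectiveD[OF assms Fr_rep P ev_hom[OF P] _ ssesD(9)[OF s] hom_id[OF sh]] ssesD(7)[OF s] by metis
  note d = hom_dims[OF \<sigma>(1)]
  have h: "rep_hom Q (Fr (rdim P)) (Fr (rdim P)) (\<lambda>v. 1\<^sub>m (rdim (Fr (rdim P)) v) - \<sigma> v * ev P v)"
    by (intro hom_diff hom_id hom_comp[OF Fr_shape sh Fr_shape ev_hom[OF P] \<sigma>(1)] Fr_shape)
  have z: "ev P v * (1\<^sub>m (rdim (Fr (rdim P)) v) - \<sigma> v * ev P v) = 0\<^sub>m (rdim P v) (rdim (Fr (rdim P)) v)" for v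
  proof -
    have "ev P v * (\<sigma> v * ev P v) = ev P v" using \<sigma>(2)[of v] by (simp add: mat_assoc[symmetric] d mat_ring0)
    then show ?thesis by (simp add: mat_ring0 d) (rule eq_matI, auto)
  qed
  note q = sses_factor[OF s Fr_shape h z]
  have dk: "dim_row (kk P v) = fdim (rdim P) v" "dim_col (kk P v) = kdim (rdim P) v" for v using hom_dims[OF ssesD(4)[OF s], of v] by auto
  have dr: "dim_row (rr (rdim P) v) = kdim (rdim P) v" "dim_col (rr (rdim P) v) = fdim (rdim P) v" for v using carrier_matD[OF ssesD(6)[OF s], of v] by auto
  show ?thesis
  proof (rule projective_retract[OF Fr_projective KV_rep[OF P] ssesD(4)[OF s] q(1)])
    fix v
    have "rr (rdim P) v * (1\<^sub>m (rdim (Fr (rdim P)) v) - \<sigma> v * ev P v) * kk P v = rr (rdim P) v * kk P v - rr (rdim P) v * (\<sigma> v * (ev P v * kk P v))"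
      by (simp add: mat_ring d dk dr)
    also have "\<dots> = 1\<^sub>m (rdim (KV P) v)"
      unfolding sses_pk[OF s] ssesD(8)[OF s] by (simp add: mat_ring0 d dr)
    finally show "rr (rdim P) v * (1\<^sub>m (rdim (Fr (rdim P)) v) - \<sigma> v * ev P v) * kk P v = 1\<^sub>m (rdim (KV P) v)" .
  qed
qed

primrec Kn :: "nat \<Rightarrow> ('v, 'a) rep \<Rightarrow> ('v, 'a) rep" where
  "Kn 0 V = V" | "Kn (Suc n) V = Kn n (KV V)"

lemma Kn_rep: "is_rep Q R V \<Longrightarrow> is_rep Q R (Kn n V)"
  by (induction n arbitrary: V) (auto simp: KV_rep)

lemma Kn_projective: "projective_rep Q R P \<Longrightarrow> projective_rep Q R (Kn n P)"
  by (induction n arbitrary: P) (auto simp: KV_projective)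

text \<open>\<open>KM\<close> is additive and functorial, so the identity
  \<open>q1 * i1 + q2 * i2 = 1\<close> survives each syzygy. Writing summands in this way avoids
  comparing the syzygy of a direct sum with the sum of the syzygies.\<close>

lemma Kn_sum_retract:
  assumes "is_rep Q R A" "is_rep Q R P" "is_rep Q R W" "rep_hom Q W A i1" "rep_hom Q W P i2" "rep_hom Q A W q1" "rep_hom Q P W q2"
    "\<And>v. q1 v * i1 v + q2 v * i2 v = 1\<^sub>m (rdim W v)"
  shows "\<exists>i1 i2 q1 q2. rep_hom Q (Kn n W) (Kn n A) i1 \<and> rep_hom Q (Kn n W) (Kn n P) i2 \<and> rep_hom Q (Kn n A) (Kn n W) q1 \<and>
    rep_hom Q (Kn n P) (Kn n W) q2 \<and> (\<forall>v. q1 v * i1 v + q2 v * i2 v = 1\<^sub>m (rdim (Kn n W) v))"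
  using assms
proof (induction n arbitrary: A P W i1 i2 q1 q2)
  case 0 then show ?case by (auto intro!: exI)
next
  case (Suc n)
  note r = Suc.prems(1-3) and h = Suc.prems(4-7)
  note sh = is_rep_shape[OF r(1)] is_rep_shape[OF r(2)] is_rep_shape[OF r(3)]
  have "KM A W q1 v * KM W A i1 v + KM P W q2 v * KM W P i2 v = 1\<^sub>m (rdim (KV W) v)" for v
  proof -
    have e: "(\<lambda>v. q1 v * i1 v + q2 v * i2 v) = (\<lambda>v. 1\<^sub>m (rdim W v))" using Suc.prems(8) by auto
    have "KM A W q1 v * KM W A i1 v + KM P W q2 v * KM W P i2 v = KM W W (\<lambda>v. q1 v * i1 v) v + KM W W (\<lambda>v. q2 v * i2 v) v"
      by (simp add: KM_comp[OF r(3,1,3) h(1,3)] KM_comp[OF r(3,2,3) h(2,4)])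
    also have "\<dots> = KM W W (\<lambda>v. q1 v * i1 v + q2 v * i2 v) v"
      by (rule KM_add[symmetric, OF r(3,3) hom_comp[OF sh(3,1,3) h(1,3)] hom_comp[OF sh(3,2,3) h(2,4)]])
    also have "\<dots> = 1\<^sub>m (rdim (KV W) v)" unfolding e KM_one[OF r(3)] by simp
    finally show ?thesis .
  qed
  from Suc.IH[OF KV_rep[OF r(1)] KV_rep[OF r(2)] KV_rep[OF r(3)] KM_props(1)[OF r(3,1) h(1)] KM_props(1)[OF r(3,2) h(2)]
     KM_props(1)[OF r(1,3) h(3)] KM_props(1)[OF r(2,3) h(4)] this]
  show ?case by simp
qed

text \<open>By Schanuel's lemma \<open>KV V\<close> is a summand of \<open>A\<close> plus
  \<open>Fr (rdim V)\<close>, where \<open>A\<close> is the syzygy in the given resolution. Taking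
  \<open>n\<close> further syzygies preserves this and leaves two projective modules.\<close>

lemma pdle_Kn_projective:
  assumes "is_rep Q R V" "pdle R n V"
  shows "projective_rep Q R (Kn n V)"
  using assms
proof (induction n arbitrary: V)
  case (Suc n)
  then obtain A B k p r s where *: "projective_rep Q R B" "sses R A B V k p r s" "pdle R n A" by auto
  note A = ssesD(1)[OF *(2)] and K = KV_rep[OF Suc.prems(1)]
  obtain i1 i2 q1 q2 where h: "rep_hom Q (KV V) A i1" "rep_hom Q (KV V) (Fr (rdim V)) i2" "rep_hom Q A (KV V) q1" "rep_hom Q (Fr (rdim V)) (KV V) q2"
    "\<And>v. q1 v * i1 v + q2 v * i2 v = 1\<^sub>m (rdim (KV V) v)"
    using schanuel[OF *(2) KV_sses[OF Suc.prems(1)] *(1) Fr_projective] by metis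
  obtain i1 i2 q1 q2 where h: "rep_hom Q (Kn n (KV V)) (Kn n A) i1" "rep_hom Q (Kn n (KV V)) (Kn n (Fr (rdim V))) i2" "rep_hom Q (Kn n A) (Kn n (KV V)) q1"
    "rep_hom Q (Kn n (Fr (rdim V))) (Kn n (KV V)) q2" "\<And>v. q1 v * i1 v + q2 v * i2 v = 1\<^sub>m (rdim (Kn n (KV V)) v)"
    using Kn_sum_retract[OF A Fr_rep K h] by blast
  have "projective_rep Q R (Kn n (KV V))"
    by (rule projective_sum_retract[OF Suc.IH[OF A *(3)] Kn_projective[OF Fr_projective] Kn_rep[OF K] h])
  then show ?case by simp
qed simp

end

section \<open>Tops of modules and indecomposable projectives\<close>

context bound_quiver begin

text \<open>Pull \<open>\<xi>\<close> back along paths ending at \<open>w\<close>. Paths of length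
  \<open>nilp\<close> or more act as zero, so there is a longest path after which the functional is
  still non-zero; there it kills the images of all incoming arrows, that is, the radical.\<close>

lemma top_functional:
  assumes V: "is_rep Q R V" and w: "w \<in> verts Q" and \<xi>: "\<xi> \<in> carrier_mat 1 (rdim V w)" "\<xi> \<noteq> 0\<^sub>m 1 (rdim V w)"
  obtains u p where "awalk u p w" "\<xi> * path_mat Q V u p \<noteq> 0\<^sub>m 1 (rdim V u)"
    "\<And>a. a \<in> arcs Q \<Longrightarrow> head Q a = u \<Longrightarrow> \<xi> * path_mat Q V u p * rmap V a = 0\<^sub>m 1 (rdim V (tail Q a))"
proof -
  note sh = is_rep_shape[OF V]
  define ok where "ok x \<longleftrightarrow> awalk (fst x) (snd x) w \<and> \<xi> * path_mat Q V (fst x) (snd x) \<noteq> 0\<^sub>m 1 (rdim V (fst x))" for x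
  have "ok (w, [])" unfolding ok_def using w \<xi> by (auto simp: awalk_def mat_ring0)
  moreover have "\<forall>x. ok x \<longrightarrow> length (snd x) < nilp"
  proof (intro allI impI, rule ccontr)
    fix x assume *: "ok x" "\<not> length (snd x) < nilp"
    then have "path_mat Q V (fst x) (snd x) = 0\<^sub>m (rdim V w) (rdim V (fst x))"
      unfolding ok_def by (intro long_path_zero[OF V]) auto
    then show False using *(1) \<xi>(1) unfolding ok_def by (simp add: mat_ring0)
  qed
  ultimately obtain x where x: "ok x" "\<forall>y. ok y \<longrightarrow> length (snd y) \<le> length (snd x)"
    using ex_has_greatest_nat[of ok "(w, [])" "\<lambda>x. length (snd x)" nilp] by blast
  obtain u p where up: "x = (u, p)" by (cases x)
  have aw: "awalk u p w" "\<xi> * path_mat Q V u p \<noteq> 0\<^sub>m 1 (rdim V u)" using x(1) unfolding ok_def up by auto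
  show ?thesis
  proof (rule that[OF aw])
    fix a assume a: "a \<in> arcs Q" "head Q a = u"
    then have aa: "awalk (tail Q a) (a # p) w" using aw(1) by (auto simp: awalk_Cons_iff)
    have "\<not> ok (tail Q a, a # p)" using x(2) unfolding up by (metis length_Cons not_less_eq_eq order_refl snd_conv)
    then have "\<xi> * path_mat Q V (tail Q a) (a # p) = 0\<^sub>m 1 (rdim V (tail Q a))" unfolding ok_def using aa by simp
    then show "\<xi> * path_mat Q V u p * rmap V a = 0\<^sub>m 1 (rdim V (tail Q a))"
      using a \<xi>(1) carrier_matD[OF path_mat_carrier[OF sh aw(1)]] shape_dims[OF sh a(1)] by (simp add: mat_assoc)
  qed
qed

subsection \<open>Representations with zero maps\<close>

definition zrep :: "('v \<Rightarrow> nat) \<Rightarrow> ('v, 'a) rep" where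
  "zrep d = \<lparr>rdim = d, rmap = \<lambda>a. if a \<in> arcs Q then 0\<^sub>m (d (head Q a)) (d (tail Q a)) else 0\<^sub>m 0 0\<rparr>"

lemma rdim_zrep[simp]: "rdim (zrep d) = d" by (simp add: zrep_def)

lemma zrep_shape: "(\<And>v. v \<notin> verts Q \<Longrightarrow> d v = 0) \<Longrightarrow> hom_shape Q (zrep d)"
  unfolding hom_shape_def zrep_def by auto

text \<open>Every path in a relation has length at least two, as \<open>J\<close> lies in the square
  of the arrow ideal; so it contains an arrow and acts as zero.\<close>

lemma zrep_rep:
  assumes "\<And>v. v \<notin> verts Q \<Longrightarrow> d v = 0"
  shows "is_rep Q R (zrep d)"
  unfolding is_rep_iff
proof safe
  show sh: "hom_shape Q (zrep d)" using assms by (rule zrep_shape)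
  fix \<rho> u w assume *: "\<rho> \<in> R" "u \<in> verts Q" "w \<in> verts Q"
  have "J \<subseteq> arrow_ideal_power Q 2" using admissible unfolding admissible_ideal_def J_def by blast
  then have long: "\<rho> (u, p) \<noteq> 0 \<Longrightarrow> 2 \<le> length p" for p using R_in_J[OF *(1)] unfolding arrow_ideal_power_def by fastforce
  show "relation_mat Q (zrep d) \<rho> u w = 0\<^sub>m (rdim (zrep d) w) (rdim (zrep d) u)"
  proof (rule eq_matI)
    fix r c assume rc: "r < dim_row (0\<^sub>m (rdim (zrep d) w) (rdim (zrep d) u) :: complex mat)" "c < dim_col (0\<^sub>m (rdim (zrep d) w) (rdim (zrep d) u) :: complex mat)"
    have "\<rho> (u, p) * path_mat Q (zrep d) u p $$ (r, c) = 0" if p: "\<rho> (u, p) \<noteq> 0 \<and> awalk u p w" for p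
    proof -
      obtain a p' where ap: "p = a # p'" using long[of p] p by (cases p) auto
      then have a: "a \<in> arcs Q" "tail Q a = u" "awalk (head Q a) p' w" using p by (auto simp: awalk_Cons_iff)
      show ?thesis using rc a carrier_matD[OF path_mat_carrier[OF sh a(3)]] by (simp add: ap zrep_def mat_ring0)
    qed
    then show "relation_mat Q (zrep d) \<rho> u w $$ (r, c) = 0\<^sub>m (rdim (zrep d) w) (rdim (zrep d) u) $$ (r, c)"
      using rc by (simp add: relation_mat_def)
  qed auto
qed

lemma zrep_hom:
  assumes "hom_shape Q V" "\<And>v. f v \<in> carrier_mat (d v) (rdim V v)" "\<And>a. a \<in> arcs Q \<Longrightarrow> f (head Q a) * rmap V a = 0\<^sub>m (d (head Q a)) (rdim V (tail Q a))"
  shows "rep_hom Q V (zrep d) f"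
  unfolding rep_hom_def
proof safe
  fix a assume a: "a \<in> arcs Q"
  show "f (head Q a) * rmap V a = rmap (zrep d) a * f (tail Q a)"
    using a carrier_matD[OF assms(2)] unfolding assms(3)[OF a] by (simp add: zrep_def mat_ring0)
qed (use assms in auto)

definition "\<delta> v = (\<lambda>w. if w = v then 1 else 0 :: nat)"

lemma \<delta>_outside: "v \<in> verts Q \<Longrightarrow> w \<notin> verts Q \<Longrightarrow> \<delta> v w = 0" by (auto simp: \<delta>_def)

lemma zrep_\<delta>: "v \<in> verts Q \<Longrightarrow> is_rep Q R (zrep (\<delta> v))" by (rule zrep_rep) (rule \<delta>_outside)

text \<open>\<open>zrep (\<delta> u)\<close> is the simple module at \<open>u\<close>. A functional
  at \<open>u\<close> that vanishes on the images of the arrows is a homomorphism to it, extended by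
  matrices without rows at the other vertices.\<close>

definition fun_hom :: "'v \<Rightarrow> complex mat \<Rightarrow> ('v, 'a) rep \<Rightarrow> 'v \<Rightarrow> complex mat" where
  "fun_hom u \<eta> V w = (if w = u then \<eta> else 0\<^sub>m 0 (rdim V w))"

lemma fun_hom:
  assumes "hom_shape Q V" "\<eta> \<in> carrier_mat 1 (rdim V u)" "\<And>a. a \<in> arcs Q \<Longrightarrow> head Q a = u \<Longrightarrow> \<eta> * rmap V a = 0\<^sub>m 1 (rdim V (tail Q a))"
  shows "rep_hom Q V (zrep (\<delta> u)) (fun_hom u \<eta> V)"
proof (rule zrep_hom[OF assms(1)])
  show "fun_hom u \<eta> V v \<in> carrier_mat (\<delta> u v) (rdim V v)" for v using assms(2) by (auto simp: fun_hom_def \<delta>_def)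
  fix a assume a: "a \<in> arcs Q"
  show "fun_hom u \<eta> V (head Q a) * rmap V a = 0\<^sub>m (\<delta> u (head Q a)) (rdim V (tail Q a))"
    using assms(3)[OF a] shape_dims[OF assms(1) a] by (auto simp: fun_hom_def \<delta>_def mat_ring0)
qed

lemma mat_nonzero_entry:
  assumes "\<eta> \<in> carrier_mat n m" "\<eta> \<noteq> 0\<^sub>m n m"
  obtains i j where "i < n" "j < m" "\<eta> $$ (i, j) \<noteq> (0 :: complex)"
  using assms by (metis carrier_matD eq_matI index_zero_mat)

lemma functional_section:
  assumes "\<eta> \<in> carrier_mat 1 n" "\<eta> \<noteq> 0\<^sub>m 1 n"
  obtains x :: "complex mat" where "x \<in> carrier_mat n 1" "\<eta> * x = 1\<^sub>m 1"
proof -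
  obtain i j where ij: "i < 1" "j < n" "\<eta> $$ (i, j) \<noteq> 0" using mat_nonzero_entry[OF assms] .
  let ?x = "mat n 1 (\<lambda>(k, _). if k = j then 1 / \<eta> $$ (0, j) else 0)"
  have "(\<eta> * ?x) $$ (0, 0) = (\<Sum>l<n. \<eta> $$ (0, l) * ?x $$ (l, 0))" using assms by (subst mat_mult_index) auto
  also have "\<dots> = (\<Sum>l<n. if l = j then 1 else 0)" using ij by (intro sum.cong) auto
  finally have "\<eta> * ?x = 1\<^sub>m 1" using assms ij by (intro eq_matI) auto
  then show ?thesis using that[of ?x] by auto
qed

text \<open>An endomorphism of \<open>Fr (\<delta> v)\<close> over its simple top is invertible (Nakayama).\<close>

lemma top_endo_invertible:
  assumes v: "v \<in> verts Q" and h: "rep_hom Q (Fr (\<delta> v)) (Fr (\<delta> v)) h"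
    and ph: "\<And>w. ev (zrep (\<delta> v)) w * h w = ev (zrep (\<delta> v)) w"
  shows "\<exists>B\<in>carrier_mat (fdim (\<delta> v) w) (fdim (\<delta> v) w). h w * B = 1\<^sub>m (fdim (\<delta> v) w) \<and> B * h w = 1\<^sub>m (fdim (\<delta> v) w)"
proof (cases "w \<in> verts Q")
  case False
  then have "h w \<in> carrier_mat 0 0" using hom_carrier[OF h, of w] by (simp add: fdim_outside)
  then show ?thesis using False by (intro bexI[of _ "1\<^sub>m 0"]) (auto simp: fdim_outside intro!: eq_matI)
next
  case True
  let ?P = "Fr (\<delta> v)" and ?S = "zrep (\<delta> v)"
  note S = zrep_\<delta>[OF v]
  have eS: "rep_hom Q ?P ?S (ev ?S)" using ev_hom[OF S] by simp
  show ?thesis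
  proof (rule square_no_functional_invertible)
    show "h w \<in> carrier_mat (fdim (\<delta> v) w) (fdim (\<delta> v) w)" using hom_carrier[OF h, of w] by simp
    fix \<xi> :: "complex mat" assume \<xi>: "\<xi> \<in> carrier_mat 1 (fdim (\<delta> v) w)" "\<xi> * h w = 0\<^sub>m 1 (fdim (\<delta> v) w)"
    show "\<xi> = 0\<^sub>m 1 (fdim (\<delta> v) w)"
    proof (rule ccontr)
      assume nz: "\<xi> \<noteq> 0\<^sub>m 1 (fdim (\<delta> v) w)"
      \<comment> \<open>Pull \<open>\<xi>\<close> back to a functional \<open>\<eta>\<close> on the
        top of the module; since \<open>h\<close> commutes with paths, \<open>\<eta> * h\<close>
        vanishes as well.\<close>
      obtain u p where up: "awalk u p w" "\<xi> * path_mat Q ?P u p \<noteq> 0\<^sub>m 1 (rdim ?P u)"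
        "\<And>a. a \<in> arcs Q \<Longrightarrow> head Q a = u \<Longrightarrow> \<xi> * path_mat Q ?P u p * rmap ?P a = 0\<^sub>m 1 (rdim ?P (tail Q a))"
        using top_functional[OF Fr_rep True, of \<xi> "\<delta> v"] \<xi>(1) nz by auto
      define \<eta> where "\<eta> = \<xi> * path_mat Q ?P u p"
      note pc = path_mat_carrier[OF Fr_shape up(1), of "\<delta> v"]
      note dm = carrier_matD[OF pc] carrier_matD[OF \<xi>(1)] hom_dims[OF h]
      have \<eta>c: "\<eta> \<in> carrier_mat 1 (rdim ?P u)" unfolding \<eta>_def using \<xi>(1) pc by (intro carrier_matI) auto
      have uv: "u \<in> verts Q" using up(1) by auto
      have \<zeta>: "rep_hom Q ?P (zrep (\<delta> u)) (fun_hom u \<eta> ?P)"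
        by (rule fun_hom[OF Fr_shape \<eta>c]) (use up(3) in \<open>auto simp: \<eta>_def\<close>)
      have \<eta>h: "\<eta> * h u = 0\<^sub>m 1 (rdim ?P u)"
      proof -
        have "\<eta> * h u = \<xi> * (path_mat Q ?P u p * h u)" unfolding \<eta>_def by (simp add: mat_assoc dm)
        also have "\<dots> = (\<xi> * h w) * path_mat Q ?P u p"
          unfolding path_mat_hom[OF Fr_shape Fr_shape h up(1), symmetric] by (simp add: mat_assoc dm)
        finally show ?thesis unfolding \<xi>(2) by (simp add: mat_ring0 dm)
      qed
      \<comment> \<open>\<open>Fr (\<delta> v)\<close> is generated at \<open>v\<close>, so a map
        from it to the simple module at another vertex vanishes on the generators.\<close>
      have "u = v"
      proof (rule ccontr)
        assume ne: "u \<noteq> v"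
        have "fun_hom u \<eta> ?P u = 0\<^sub>m (rdim (zrep (\<delta> u)) u) (rdim ?P u)"
        proof (rule Fr_hom_unique[OF is_rep_shape[OF zrep_\<delta>[OF uv]] \<zeta> hom_zero[OF Fr_shape is_rep_shape[OF zrep_\<delta>[OF uv]]]])
          fix x
          show "fun_hom u \<eta> ?P x * fs (\<delta> v) x = 0\<^sub>m (rdim (zrep (\<delta> u)) x) (rdim ?P x) * fs (\<delta> v) x"
            using ne \<eta>c by (intro eq_matI) (auto simp: fun_hom_def \<delta>_def)
        qed
        then show False using up(2) by (simp add: fun_hom_def \<delta>_def \<eta>_def)
      qed
      note uvv = this
      define C where "C x = fun_hom u \<eta> ?P x * fs (\<delta> v) x" for x
      have Cc: "C x \<in> carrier_mat (\<delta> v x) (\<delta> v x)" for x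
        unfolding C_def uvv using hom_dims[OF \<zeta>, of x] by (intro carrier_matI) (auto simp: uvv)
      have CS: "rep_hom Q ?S ?S C"
        by (rule zrep_hom[OF is_rep_shape[OF S]]) (use Cc carrier_matD[OF Cc] in \<open>auto simp: zrep_def mat_ring0\<close>)
      \<comment> \<open>The map to the simple module factors over \<open>ev\<close>, and
        \<open>ev\<close> does not notice \<open>h\<close>; hence
        \<open>\<eta> = \<eta> * h = 0\<close>, against the choice of \<open>\<eta>\<close>.\<close>
      have Ce: "fun_hom u \<eta> ?P x = C x * ev ?S x" for x
      proof (rule Fr_hom_unique[OF is_rep_shape[OF S] _ hom_comp[OF Fr_shape is_rep_shape[OF S] is_rep_shape[OF S] eS CS]])
        show "rep_hom Q ?P ?S (fun_hom u \<eta> ?P)" using \<zeta> unfolding uvv .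
        fix x
        have "ev ?S x * fs (\<delta> v) x = 1\<^sub>m (\<delta> v x)" using ev_fs[OF is_rep_shape[OF S], of x] by simp
        then show "fun_hom u \<eta> ?P x * fs (\<delta> v) x = C x * ev ?S x * fs (\<delta> v) x"
          using carrier_matD[OF Cc] by (simp add: mat_assoc mat_ring0 C_def)
      qed
      have "\<eta> = fun_hom u \<eta> ?P u" by (simp add: fun_hom_def)
      also have "\<dots> = C u * (ev ?S u * h u)" unfolding ph by (rule Ce)
      also have "\<dots> = (C u * ev ?S u) * h u" using carrier_matD[OF Cc] by (simp add: mat_assoc dm)
      also have "\<dots> = \<eta> * h u" unfolding Ce[symmetric] by (simp add: fun_hom_def)
      finally show False using \<eta>h up(2) unfolding \<eta>_def by simp
    qed
  qed
qed

text \<open>A functional \<open>\<eta>\<close> on the top maps \<open>P\<close> onto a simple module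
  at some \<open>u\<close>. Lifting it over \<open>ev\<close> gives \<open>f\<close>; sending the
  generator of \<open>Fr (\<delta> u)\<close> to a vector \<open>x\<close> with
  \<open>\<eta> * x = 1\<close> gives \<open>g\<close>. Then \<open>f * g\<close> covers the
  identity of the top, so it is invertible, and \<open>r\<close> is \<open>f\<close> followed by its
  inverse.\<close>

lemma projective_retract_top:
  assumes P: "projective_rep Q R P" and nz: "\<not> rep_is_zero P"
  obtains v g r where "v \<in> verts Q" "rep_hom Q (Fr (\<delta> v)) P g" "rep_hom Q P (Fr (\<delta> v)) r" "\<And>w. r w * g w = 1\<^sub>m (fdim (\<delta> v) w)"
proof -
  note Pr = projective_is_rep[OF P]
  note sh = is_rep_shape[OF Pr]
  obtain w where w: "0 < rdim P w" using nz unfolding rep_is_zero_def by auto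
  then have wv: "w \<in> verts Q" using sh unfolding hom_shape_def by (metis not_less_zero)
  let ?\<xi> = "mat 1 (rdim P w) (\<lambda>_. 1 :: complex)"
  have "?\<xi> $$ (0, 0) = 1" using w by simp
  then have "?\<xi> \<noteq> 0\<^sub>m 1 (rdim P w)" using w by (metis index_zero_mat(1) less_numeral_extra(1) zero_neq_one)
  then obtain u p where up: "awalk u p w" "?\<xi> * path_mat Q P u p \<noteq> 0\<^sub>m 1 (rdim P u)"
     "\<And>a. a \<in> arcs Q \<Longrightarrow> head Q a = u \<Longrightarrow> ?\<xi> * path_mat Q P u p * rmap P a = 0\<^sub>m 1 (rdim P (tail Q a))"
    using top_functional[OF Pr wv, of ?\<xi>] by (metis mat_carrier)
  define \<eta> where "\<eta> = ?\<xi> * path_mat Q P u p"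
  have \<eta>c: "\<eta> \<in> carrier_mat 1 (rdim P u)" unfolding \<eta>_def using path_mat_carrier[OF sh up(1)] by (intro carrier_matI) auto
  have uv: "u \<in> verts Q" using up(1) by auto
  let ?F = "Fr (\<delta> u)" and ?S = "zrep (\<delta> u)"
  note S = zrep_\<delta>[OF uv]
  have eS: "rep_hom Q ?F ?S (ev ?S)" using ev_hom[OF S] by simp
  have es: "ev ?S w * fs (\<delta> u) w = 1\<^sub>m (\<delta> u w)" for w using ev_fs[OF is_rep_shape[OF S], of w] by simp
  have \<zeta>: "rep_hom Q P ?S (fun_hom u \<eta> P)"
    by (rule fun_hom[OF sh \<eta>c]) (use up(3) in \<open>auto simp: \<eta>_def\<close>)
  obtain x where x: "x \<in> carrier_mat (rdim P u) 1" "\<eta> * x = 1\<^sub>m 1" using functional_section[OF \<eta>c] up(2) unfolding \<eta>_def by blast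
  define X where "X w = (if w = u then x else 0\<^sub>m (rdim P w) 0)" for w
  have Xc: "X w \<in> carrier_mat (rdim P w) (\<delta> u w)" for w unfolding X_def \<delta>_def using x by auto
  obtain f where f: "rep_hom Q P ?F f" "\<And>w. ev ?S w * f w = fun_hom u \<eta> P w"
    by (rule projectiveD[OF P Fr_rep S eS _ _ \<zeta>, of "fs (\<delta> u)"]) (use es in auto)
  note g = FH_hom[OF Pr Xc] and gs = FH_fs[OF sh Xc]
  let ?g = "FH (\<delta> u) P X"
  note fg = hom_comp[OF Fr_shape sh Fr_shape g f(1)]
  note d = hom_dims[OF f(1)] hom_dims[OF \<zeta>]
  have eg: "fun_hom u \<eta> P w * ?g w = ev ?S w" for w
  proof (rule Fr_hom_unique[OF is_rep_shape[OF S] hom_comp[OF Fr_shape sh is_rep_shape[OF S] g \<zeta>] eS])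
    fix y
    have "fun_hom u \<eta> P y * ?g y * fs (\<delta> u) y = fun_hom u \<eta> P y * X y"
      using gs[of y] by (simp add: mat_assoc d)
    also have "\<dots> = 1\<^sub>m (\<delta> u y)" using x(2) by (auto simp: fun_hom_def X_def \<delta>_def intro!: eq_matI)
    finally show "fun_hom u \<eta> P y * ?g y * fs (\<delta> u) y = ev ?S y * fs (\<delta> u) y" using es by simp
  qed
  have "ev ?S w * (f w * ?g w) = ev ?S w" for w
    using f(2)[of w] eg[of w] by (simp add: mat_assoc[symmetric] d)
  then have "\<exists>B. B \<in> carrier_mat (fdim (\<delta> u) w) (fdim (\<delta> u) w) \<and> f w * ?g w * B = 1\<^sub>m (fdim (\<delta> u) w) \<and> B * (f w * ?g w) = 1\<^sub>m (fdim (\<delta> u) w)" for w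
    using top_endo_invertible[OF uv fg, of w] by blast
  then obtain B where B: "\<And>w. B w \<in> carrier_mat (fdim (\<delta> u) w) (fdim (\<delta> u) w)" "\<And>w. f w * ?g w * B w = 1\<^sub>m (fdim (\<delta> u) w)" "\<And>w. B w * (f w * ?g w) = 1\<^sub>m (fdim (\<delta> u) w)"
    by metis
  have Bh: "rep_hom Q ?F ?F B" by (rule inverse_hom[OF Fr_shape Fr_shape fg]) (use B in auto)
  show ?thesis
  proof (rule that[OF uv g hom_comp[OF sh Fr_shape Fr_shape f(1) Bh]])
    show "B w * f w * ?g w = 1\<^sub>m (fdim (\<delta> u) w)" for w
      using B(3)[of w] carrier_matD[OF B(1)] by (simp add: mat_assoc d)
  qed
qed

text \<open>The linear retraction satisfies \<open>r = r * (1 - s * p)\<close>, and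
  \<open>1 - s * p\<close> is a homomorphism into the kernel of \<open>p\<close>; so
  \<open>r\<close> is a homomorphism once \<open>s\<close> is.\<close>

lemma sses_split_iso:
  assumes "sses R A B C k p r s" "rep_hom Q C B s"
  shows "rep_iso Q (rep_dsum A C) B"
proof -
  note s = assms(1)
  note sh = is_rep_shape[OF ssesD(1)[OF s]] is_rep_shape[OF ssesD(2)[OF s]] is_rep_shape[OF ssesD(3)[OF s]]
  note d = hom_dims[OF ssesD(4)[OF s]] hom_dims[OF ssesD(5)[OF s]] carrier_matD[OF ssesD(6)[OF s]] carrier_matD[OF ssesD(7)[OF s]]
  have e: "1\<^sub>m (rdim B v) - s v * p v = k v * r v" for v
    using mat_add_eq[OF ssesD(10)[OF s, of v]] by (simp add: d)
  have h: "rep_hom Q B B (\<lambda>v. 1\<^sub>m (rdim B v) - s v * p v)"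
    by (intro hom_diff hom_id hom_comp[OF sh(2,3,2) ssesD(5)[OF s] assms(2)] sh)
  have z: "p v * (1\<^sub>m (rdim B v) - s v * p v) = 0\<^sub>m (rdim C v) (rdim B v)" for v
    unfolding e using sses_pk[OF s, of v] by (simp add: mat_assoc[symmetric] d mat_ring0)
  have "r v * (1\<^sub>m (rdim B v) - s v * p v) = r v" for v
    unfolding e using ssesD(8)[OF s, of v] by (simp add: mat_assoc[symmetric] d mat_ring0)
  then have "rep_hom Q B A r" using sses_factor(1)[OF s sh(2) h z] by simp
  then show ?thesis
    by (rule rep_iso_biproduct[OF sh(2,1,3) ssesD(4)[OF s] assms(2) _ ssesD(5)[OF s] ssesD(8,9,10)[OF s]])
qed

lemma zero_dims_zero_rep:
  assumes "is_rep Q R W" "rep_is_zero W" shows "W = zero_rep"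
proof -
  have "rmap W a = 0\<^sub>m 0 0" for a using assms unfolding is_rep_def rep_is_zero_def by (metis carrier_matD(1,2) eq_matI index_zero_mat(2,3) not_less_zero)
  then have "rmap W = (\<lambda>_. 0\<^sub>m 0 0)" "rdim W = (\<lambda>_. 0)" using assms(2) unfolding rep_is_zero_def by auto
  then show ?thesis unfolding zero_rep_def by (cases W) auto
qed

text \<open>The retract \<open>Fr (\<delta> v)\<close> of \<open>P\<close> is non-zero, as it
  contains its generator, so its complement in the indecomposable \<open>P\<close> vanishes.\<close>

lemma indecomposable_projective_iso:
  assumes P: "projective_rep Q R P" and I: "indecomposable_rep Q R P"
  obtains v where "v \<in> verts Q" "rep_iso Q (Fr (\<delta> v)) P"
proof -
  have nz: "\<not> rep_is_zero P" using I unfolding indecomposable_rep_def by blast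
  obtain v g r where *: "v \<in> verts Q" "rep_hom Q (Fr (\<delta> v)) P g" "rep_hom Q P (Fr (\<delta> v)) r" "\<And>w. r w * g w = 1\<^sub>m (fdim (\<delta> v) w)"
    using projective_retract_top[OF P nz] by metis
  note Pr = projective_is_rep[OF P]
  have rg: "r w * g w = 1\<^sub>m (rdim (Fr (\<delta> v)) w)" for w using *(4) by simp
  obtain W k q where s: "sses R W P (Fr (\<delta> v)) k r q g"
    using kernel_exists[OF Pr Fr_rep *(3) hom_carrier[OF *(2)] rg] by metis
  note iso = sses_split_iso[OF s *(2)]
  note W = ssesD(1)[OF s]
  have iso': "rep_iso Q P (rep_dsum W (Fr (\<delta> v)))"
    by (rule rep_iso_sym[OF iso dsum_shape[OF is_rep_shape[OF W] Fr_shape] is_rep_shape[OF Pr]])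
  have "1 \<le> fdim (\<delta> v) v"
    by (rule left_inverse_dims[of "ft (\<delta> v) v" "fs (\<delta> v) v"]) (use ft_fs[of v "\<delta> v"] *(1) in \<open>auto simp: \<delta>_def intro!: carrier_matI\<close>)
  then have "\<not> rep_is_zero (Fr (\<delta> v))" unfolding rep_is_zero_def by (auto intro!: exI[of _ v])
  then have "rep_is_zero W" using I iso' W Fr_rep unfolding indecomposable_rep_def by blast
  then have "W = zero_rep" using zero_dims_zero_rep W by blast
  then show ?thesis using that[OF *(1)] iso by (simp add: rep_dsum_zero)
qed

subsection \<open>Sums of lists of representations\<close>

definition "rsum xs = foldr rep_dsum xs zero_rep"

lemma rsum_simps[simp]: "rsum [] = zero_rep" "rsum (x # xs) = rep_dsum x (rsum xs)" by (auto simp: rsum_def)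

lemma rsum_append: "rsum (xs @ ys) = rep_dsum (rsum xs) (rsum ys)"
  by (induction xs) (auto simp: rep_dsum_zero rep_dsum_assoc)

lemma rsum_shape: "(\<And>x. x \<in> set xs \<Longrightarrow> hom_shape Q x) \<Longrightarrow> hom_shape Q (rsum xs)"
  by (induction xs) (auto simp: dsum_shape is_rep_shape[OF zero_rep_rep])

lemma dsum_iso_cong:
  assumes "rep_iso Q A A'" "rep_iso Q B B'" "hom_shape Q A" "hom_shape Q A'" "hom_shape Q B" "hom_shape Q B'"
  shows "rep_iso Q (rep_dsum A B) (rep_dsum A' B')"
proof -
  obtain f g where f: "rep_hom Q A A' f" "rep_hom Q A' A g" "\<And>v. g v * f v = 1\<^sub>m (rdim A v)" "\<And>v. f v * g v = 1\<^sub>m (rdim A' v)"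
    using rep_isoE[OF assms(1,3,4)] by metis
  obtain f' g' where f': "rep_hom Q B B' f'" "rep_hom Q B' B g'" "\<And>v. g' v * f' v = 1\<^sub>m (rdim B v)" "\<And>v. f' v * g' v = 1\<^sub>m (rdim B' v)"
    using rep_isoE[OF assms(2,5,6)] by metis
  note sh = dsum_shape[OF assms(4,6)]
  note D = dsum_homs[OF assms(4,6)]
  note d = hom_dims[OF f(1)] hom_dims[OF f(2)] hom_dims[OF f'(1)] hom_dims[OF f'(2)]
  show ?thesis
  proof (rule rep_iso_biproduct[OF sh assms(3,5) hom_comp[OF assms(3,4) sh f(1) D(1)] hom_comp[OF assms(5,6) sh f'(1) D(2)]
      hom_comp[OF sh assms(4,3) D(3) f(2)] hom_comp[OF sh assms(6,5) D(4) f'(2)]])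
    fix v
    let ?n = "rdim A' v" and ?m = "rdim B' v"
    show "g v * prj1 ?n ?m * (inc1 ?n ?m * f v) = 1\<^sub>m (rdim A v)"
      using f(3) by (simp add: mat_assoc d prj_inc_mult)
    show "g' v * prj2 ?n ?m * (inc2 ?n ?m * f' v) = 1\<^sub>m (rdim B v)"
      using f'(3) by (simp add: mat_assoc d prj_inc_mult2)
    have "inc1 ?n ?m * f v * (g v * prj1 ?n ?m) + inc2 ?n ?m * f' v * (g' v * prj2 ?n ?m) =
      inc1 ?n ?m * ((f v * g v) * prj1 ?n ?m) + inc2 ?n ?m * ((f' v * g' v) * prj2 ?n ?m)" by (simp add: mat_assoc d)
    also have "\<dots> = 1\<^sub>m (rdim (rep_dsum A' B') v)" unfolding f f' by (simp add: mat_ring0 prj_inc)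
    finally show "inc1 ?n ?m * f v * (g v * prj1 ?n ?m) + inc2 ?n ?m * f' v * (g' v * prj2 ?n ?m) = 1\<^sub>m (rdim (rep_dsum A' B') v)" .
  qed
qed

lemma dsum_iso_comm:
  assumes "hom_shape Q A" "hom_shape Q B"
  shows "rep_iso Q (rep_dsum A B) (rep_dsum B A)"
proof (rule rep_iso_biproduct[OF dsum_shape[OF assms(2,1)] assms dsum_homs(2,1)[OF assms(2,1)] dsum_homs(4,3)[OF assms(2,1)]])
  fix v
  have "inc2 (rdim B v) (rdim A v) * prj2 (rdim B v) (rdim A v) + inc1 (rdim B v) (rdim A v) * prj1 (rdim B v) (rdim A v)
     = inc1 (rdim B v) (rdim A v) * prj1 (rdim B v) (rdim A v) + inc2 (rdim B v) (rdim A v) * prj2 (rdim B v) (rdim A v)"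
    by (rule comm_add_mat[of _ "rdim B v + rdim A v" "rdim B v + rdim A v"]) (auto intro!: carrier_matI)
  then show "inc2 (rdim B v) (rdim A v) * prj2 (rdim B v) (rdim A v) + inc1 (rdim B v) (rdim A v) * prj1 (rdim B v) (rdim A v) = 1\<^sub>m (rdim (rep_dsum B A) v)"
    by (simp add: prj_inc)
qed (auto simp: prj_inc)

text \<open>Block sums are associative on the nose, so only moving one summand past the preceding
  ones needs an isomorphism.\<close>

lemma rsum_mset:
  assumes "mset xs = mset ys" "\<And>x. x \<in> set xs \<Longrightarrow> hom_shape Q x"
  shows "rep_iso Q (rsum xs) (rsum ys)"
  using assms
proof (induction xs arbitrary: ys)
  case Nil then show ?case by (simp add: rep_iso_refl[OF is_rep_shape[OF zero_rep_rep]])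
next
  case (Cons x xs)
  have "x \<in> set ys" using Cons.prems(1) by (metis list.set_intros(1) set_mset_mset)
  then obtain us vs where ys: "ys = us @ x # vs" by (metis split_list)
  then have m: "mset xs = mset (us @ vs)" using Cons.prems(1) by simp
  have sx: "hom_shape Q x" and sxs: "\<And>y. y \<in> set xs \<Longrightarrow> hom_shape Q y" using Cons.prems(2) by auto
  have st: "hom_shape Q y" if "y \<in> set (us @ vs)" for y using sxs that m by (metis set_mset_mset)
  note s = rsum_shape[OF sxs]
  have su: "hom_shape Q (rsum us)" "hom_shape Q (rsum vs)" "hom_shape Q (rsum (us @ vs))" by (rule rsum_shape, use st in auto)+
  have 1: "rep_iso Q (rep_dsum x (rsum xs)) (rep_dsum x (rsum (us @ vs)))"
    by (intro dsum_iso_cong rep_iso_refl Cons.IH m sx sxs s su)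
  have e1: "rep_dsum x (rsum (us @ vs)) = rep_dsum (rep_dsum x (rsum us)) (rsum vs)" by (simp add: rsum_append rep_dsum_assoc)
  have e2: "rsum ys = rep_dsum (rep_dsum (rsum us) x) (rsum vs)" by (simp add: ys rsum_append rep_dsum_assoc)
  have 2: "rep_iso Q (rep_dsum (rep_dsum x (rsum us)) (rsum vs)) (rep_dsum (rep_dsum (rsum us) x) (rsum vs))"
    by (intro dsum_iso_cong rep_iso_refl dsum_iso_comm dsum_shape sx su)
  show ?case
    using rep_iso_trans[OF 1[unfolded e1] 2] sx s su by (simp add: e2 dsum_shape)
qed

end

section \<open>Types of projective modules and the Cartan matrix\<close>

locale fgd_quiver = bound_quiver Q R for Q :: "('v, 'a) pre_digraph" and R +
  fixes Ps :: "('v, 'a) rep list"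
  assumes fgd: "finite_global_dimension Q R" and cip: "complete_indec_projectives Q R Ps"

context fgd_quiver begin

definition "plist n = concat (map (\<lambda>j. replicate (n j) (Ps ! j)) [0..<length Ps])"

lemma proj_sum_rsum: "proj_sum Ps n = rsum (plist n)" by (simp add: proj_sum_def rsum_def plist_def)

lemma Ps_props: "j < length Ps \<Longrightarrow> projective_rep Q R (Ps ! j)" "j < length Ps \<Longrightarrow> indecomposable_rep Q R (Ps ! j)"
  using cip unfolding complete_indec_projectives_def by auto

lemma plist_mset: "mset (plist n) = (\<Sum>j<length Ps. replicate_mset (n j) (Ps ! j))"
  unfolding plist_def mset_concat by (simp add: interv_sum_list_conv_sum_set_nat lessThan_atLeast0 comp_def)

lemma plist_set: "x \<in> set (plist n) \<Longrightarrow> \<exists>j<length Ps. x = Ps ! j"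
  unfolding plist_def by auto

lemma plist_shape: "x \<in> set (plist n) \<Longrightarrow> hom_shape Q x"
  using plist_set Ps_props(1) projective_is_rep is_rep_shape by metis

lemma proj_sum_add: "rep_iso Q (proj_sum Ps (\<lambda>j. n j + n' j)) (rep_dsum (proj_sum Ps n) (proj_sum Ps n'))"
proof -
  have repl: "replicate_mset (a + b) x = replicate_mset a x + replicate_mset b x" for a b :: nat and x :: "('v, 'a) rep"
    by (induction a) auto
  have "mset (plist (\<lambda>j. n j + n' j)) = mset (plist n @ plist n')"
    by (simp add: plist_mset repl sum.distrib)
  then show ?thesis unfolding proj_sum_rsum rsum_append[symmetric] by (rule rsum_mset) (rule plist_shape)
qed

lemma proj_sum_single: "j < length Ps \<Longrightarrow> proj_sum Ps (\<lambda>k. if k = j then 1 else 0) = Ps ! j"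
proof -
  assume j: "j < length Ps"
  have "mset (plist (\<lambda>k. if k = j then 1 else 0)) = (\<Sum>k<length Ps. if k = j then {#Ps ! j#} else {#})"
    unfolding plist_mset by (intro sum.cong) auto
  also have "\<dots> = {#Ps ! j#}" using j by simp
  finally have "plist (\<lambda>k. if k = j then 1 else 0) = [Ps ! j]" by simp
  then show ?thesis by (simp add: proj_sum_rsum rep_dsum_zero)
qed

lemma proj_sum_zero: "proj_sum Ps (\<lambda>_. 0) = zero_rep"
proof -
  have "mset (plist (\<lambda>_. 0)) = {#}" unfolding plist_mset by simp
  then show ?thesis by (simp add: proj_sum_rsum)
qed

lemma rsum_rdim: "rdim (rsum xs) w = (\<Sum>x\<in>#mset xs. rdim x w)"
  by (induction xs) (auto simp: zero_rep_def)

lemma proj_sum_rdim: "rdim (proj_sum Ps n) w = (\<Sum>j<length Ps. n j * rdim (Ps ! j) w)"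
proof -
  have "(\<Sum>x\<in>#(\<Sum>j\<in>S. replicate_mset (n j) (Ps ! j)). rdim x w) = (\<Sum>j\<in>S. n j * rdim (Ps ! j) w)" if "finite S" for S
    using that by (induction S rule: finite_induct) auto
  then show ?thesis by (simp add: proj_sum_rsum rsum_rdim plist_mset)
qed

lemma proj_sum_projective: "projective_rep Q R (proj_sum Ps n)"
proof -
  have "projective_rep Q R (rsum xs)" if "\<And>x. x \<in> set xs \<Longrightarrow> projective_rep Q R x" for xs
  proof -
    have "projective_rep Q R zero_rep" by (rule projective_zero[OF zero_rep_rep]) (simp add: zero_rep_def)
    then show ?thesis using that by (induction xs) (auto intro: projective_dsum)
  qed
  then show ?thesis unfolding proj_sum_rsum using plist_set Ps_props(1) by metis
qed

lemma proj_sum_rep: "is_rep Q R (proj_sum Ps n)" using projective_is_rep[OF proj_sum_projective] .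
lemmas proj_sum_shape = is_rep_shape[OF proj_sum_rep]

text \<open>By induction on the total dimension: a decomposable module splits into two smaller
  summands that are again projective. Uniqueness of the multiplicities comes later from dimension
  vectors, without the Krull-Schmidt theorem.\<close>

lemma projective_decomposition:
  assumes "projective_rep Q R P"
  shows "\<exists>n. (\<forall>j\<ge>length Ps. n j = 0) \<and> rep_iso Q P (proj_sum Ps n)"
  using assms
proof (induction "\<Sum>v\<in>verts Q. rdim P v" arbitrary: P rule: less_induct)
  case less
  note P = projective_is_rep[OF less.prems]
  note sh = is_rep_shape[OF P]
  consider "rep_is_zero P" | "indecomposable_rep Q R P" | "\<not> rep_is_zero P" "\<not> indecomposable_rep Q R P" by blast
  then show ?case
  proof cases
    case 1
    then have "P = zero_rep" using P zero_dims_zero_rep by blast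
    then show ?thesis using proj_sum_zero rep_iso_refl[OF sh] by (intro exI[of _ "\<lambda>_. 0"]) auto
  next
    case 2
    then obtain j where j: "j < length Ps" "rep_iso Q P (Ps ! j)" using cip less.prems unfolding complete_indec_projectives_def by blast
    then show ?thesis using proj_sum_single[OF j(1)] by (intro exI[of _ "\<lambda>k. if k = j then 1 else 0"]) auto
  next
    case 3
    then obtain U W where UW: "is_rep Q R U" "is_rep Q R W" "rep_iso Q P (rep_dsum U W)" "\<not> rep_is_zero U" "\<not> rep_is_zero W"
      using P unfolding indecomposable_rep_def by blast
    note shU = is_rep_shape[OF UW(1)] and shW = is_rep_shape[OF UW(2)]
    note pr = projective_dsumD[OF projective_iso[OF less.prems UW(3) dsum_rep[OF UW(1,2)]] UW(1,2)]
    have dims: "rdim P v = rdim U v + rdim W v" for v using rep_iso_dims[OF UW(3)] by simp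
    have pos: "0 < (\<Sum>v\<in>verts Q. rdim U v)" "0 < (\<Sum>v\<in>verts Q. rdim W v)"
    proof -
      have *: "0 < (\<Sum>v\<in>verts Q. rdim U v)" if h: "hom_shape Q U" "\<not> rep_is_zero U" for U :: "('v, 'a) rep"
      proof -
        obtain v where v: "rdim U v \<noteq> 0" using h(2) unfolding rep_is_zero_def by auto
        then have "v \<in> verts Q" using h(1) unfolding hom_shape_def by auto
        then show ?thesis using v by (intro sum_pos2[of _ v]) auto
      qed
      show "0 < (\<Sum>v\<in>verts Q. rdim U v)" "0 < (\<Sum>v\<in>verts Q. rdim W v)" using * shU shW UW by auto
    qed
    have sm: "(\<Sum>v\<in>verts Q. rdim U v) < (\<Sum>v\<in>verts Q. rdim P v)" "(\<Sum>v\<in>verts Q. rdim W v) < (\<Sum>v\<in>verts Q. rdim P v)"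
      using pos by (simp_all add: dims sum.distrib)
    obtain n where n: "\<forall>j\<ge>length Ps. n j = 0" "rep_iso Q U (proj_sum Ps n)" using less.hyps[OF sm(1) pr(1)] by blast
    obtain n' where n': "\<forall>j\<ge>length Ps. n' j = 0" "rep_iso Q W (proj_sum Ps n')" using less.hyps[OF sm(2) pr(2)] by blast
    note s = dsum_shape[OF shU shW] dsum_shape[OF proj_sum_shape proj_sum_shape]
    have "rep_iso Q (rep_dsum U W) (rep_dsum (proj_sum Ps n) (proj_sum Ps n'))"
      by (intro dsum_iso_cong n n' shU shW proj_sum_shape)
    then have "rep_iso Q P (rep_dsum (proj_sum Ps n) (proj_sum Ps n'))" by (rule rep_iso_trans[OF UW(3) _ sh s])
    then have "rep_iso Q P (proj_sum Ps (\<lambda>j. n j + n' j))"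
      by (rule rep_iso_trans[OF _ rep_iso_sym[OF proj_sum_add proj_sum_shape s(2)] sh s(2) proj_sum_shape])
    then show ?thesis using n n' by (intro exI[of _ "\<lambda>j. n j + n' j"]) auto
  qed
qed

text \<open>Each member of \<open>Ps\<close> is isomorphic to some \<open>Fr (\<delta> v)\<close>,
  and two with the same \<open>v\<close> would be isomorphic to each other, against the uniqueness
  of the index.\<close>

lemma card_Ps: "length Ps \<le> card (verts Q)"
proof -
  have "\<exists>v. v \<in> verts Q \<and> rep_iso Q (Fr (\<delta> v)) (Ps ! j)" if "j < length Ps" for j
    using indecomposable_projective_iso[OF Ps_props[OF that]] by metis
  then obtain V where V: "\<And>j. j < length Ps \<Longrightarrow> V j \<in> verts Q" "\<And>j. j < length Ps \<Longrightarrow> rep_iso Q (Fr (\<delta> (V j))) (Ps ! j)" by metis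
  have "inj_on V {..<length Ps}"
  proof (rule inj_onI)
    fix j k assume jk: "j \<in> {..<length Ps}" "k \<in> {..<length Ps}" "V j = V k"
    have sj: "hom_shape Q (Ps ! j)" "hom_shape Q (Ps ! k)" using jk Ps_props(1) projective_is_rep is_rep_shape by (metis lessThan_iff)+
    have "rep_iso Q (Ps ! j) (Ps ! k)"
      using rep_iso_trans[OF rep_iso_sym[OF V(2)[of j] Fr_shape sj(1)] V(2)[of k, folded jk(3)] sj(1) Fr_shape sj(2)] jk by simp
    moreover have "rep_iso Q (Ps ! j) (Ps ! j)" by (rule rep_iso_refl[OF sj(1)])
    moreover have "\<exists>!i. i < length Ps \<and> rep_iso Q (Ps ! j) (Ps ! i)"
      using cip jk Ps_props[of j] unfolding complete_indec_projectives_def by blast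
    ultimately show "j = k" using jk by blast
  qed
  then have "card (V ` {..<length Ps}) = length Ps" by (simp add: card_image)
  moreover have "card (V ` {..<length Ps}) \<le> card (verts Q)" using V(1) by (intro card_mono) auto
  ultimately show ?thesis by simp
qed

text \<open>Dimension vectors are additive on the sequence with terms \<open>A\<close>,
  \<open>B\<close>, \<open>V\<close>, so the coefficients of the syzygy \<open>A\<close> are
  subtracted; hence they are integers.\<close>

lemma pdle_span: "is_rep Q R V \<Longrightarrow> pdle R n V \<Longrightarrow> \<exists>c :: nat \<Rightarrow> int. \<forall>w. int (rdim V w) = (\<Sum>j<length Ps. c j * int (rdim (Ps ! j) w))"
proof (induction n arbitrary: V)
  case 0
  then obtain n where "rep_iso Q V (proj_sum Ps n)" using projective_decomposition by auto
  then have "rdim V = rdim (proj_sum Ps n)" by (rule rep_iso_dims)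
  then show ?case by (intro exI[of _ "\<lambda>j. int (n j)"]) (simp add: proj_sum_rdim)
next
  case (Suc n)
  then obtain A B k p r s where *: "projective_rep Q R B" "sses R A B V k p r s" "pdle R n A" by auto
  obtain c where c: "\<And>w. int (rdim A w) = (\<Sum>j<length Ps. c j * int (rdim (Ps ! j) w))" using Suc.IH[OF ssesD(1)[OF *(2)] *(3)] by blast
  obtain m where "rep_iso Q B (proj_sum Ps m)" using projective_decomposition[OF *(1)] by auto
  then have m: "rdim B = rdim (proj_sum Ps m)" by (rule rep_iso_dims)
  have "int (rdim V w) = (\<Sum>j<length Ps. (int (m j) - c j) * int (rdim (Ps ! j) w))" for w
  proof -
    have "int (rdim V w) = int (rdim B w) - int (rdim A w)" using sses_rdim[OF *(2), of w] by simp
    then show ?thesis by (simp add: m proj_sum_rdim c left_diff_distrib sum_subtractf)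
  qed
  then show ?case by (intro exI[of _ "\<lambda>j. int (m j) - c j"]) simp
qed

lemma dim_span:
  assumes "is_rep Q R V"
  shows "\<exists>c :: nat \<Rightarrow> int. \<forall>w. int (rdim V w) = (\<Sum>j<length Ps. c j * int (rdim (Ps ! j) w))"
  using fgd assms proj_dim_le_pdle pdle_span unfolding finite_global_dimension_def by blast

text \<open>The Cartan matrix is invertible: finite projective resolutions show that the dimension
  vectors of the \<open>Ps\<close> span the lattice, and there are at most as many of them as vertices.\<close>

lemma proj_sum_unique:
  assumes "rdim (proj_sum Ps n) = rdim (proj_sum Ps n')" "j < length Ps"
  shows "n j = n' j"
proof -
  obtain vs where vs: "distinct vs" "set vs = verts Q" using finite_distinct_list[OF finite_verts] by metis
  let ?l = "length Ps" and ?q = "length vs"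
  have lq: "?l \<le> ?q" using card_Ps vs distinct_card by metis
  have "\<exists>c :: nat \<Rightarrow> int. \<forall>w. int (\<delta> v w) = (\<Sum>j<?l. c j * int (rdim (Ps ! j) w))" if "v \<in> verts Q" for v
    using dim_span[OF zrep_\<delta>[OF that]] by simp
  then obtain c :: "'v \<Rightarrow> nat \<Rightarrow> int" where c: "\<And>v w. v \<in> verts Q \<Longrightarrow> int (\<delta> v w) = (\<Sum>j<?l. c v j * int (rdim (Ps ! j) w))" by metis
  \<comment> \<open>\<open>D\<close> holds the dimension vectors of \<open>Ps\<close>,
    \<open>C\<close> the coefficients that express the simple modules by them. Both are padded by
    zeros to square size, so that a one-sided inverse is two-sided.\<close>
  define D where "D = mat ?q ?q (\<lambda>(j, i). if j < ?l then of_nat (rdim (Ps ! j) (vs ! i)) else 0 :: complex)"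
  define C where "C = mat ?q ?q (\<lambda>(i, j). if j < ?l then of_int (c (vs ! i) j) else 0 :: complex)"
  define x where "x = mat 1 ?q (\<lambda>(_, j). if j < ?l then of_int (int (n j) - int (n' j)) else 0 :: complex)"
  have DC: "D \<in> carrier_mat ?q ?q" "C \<in> carrier_mat ?q ?q" "x \<in> carrier_mat 1 ?q" by (auto simp: D_def C_def x_def)
  have cut: "(\<Sum>j<?q. if j < ?l then f j else 0) = (\<Sum>j<?l. f j)" for f :: "nat \<Rightarrow> complex"
    using lq by (intro sum.mono_neutral_cong_right) auto
  have "C * D = 1\<^sub>m ?q"
  proof (rule eq_matI)
    fix i i' assume "i < dim_row (1\<^sub>m ?q :: complex mat)" "i' < dim_col (1\<^sub>m ?q :: complex mat)"
    then have ii: "i < ?q" "i' < ?q" by auto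
    have "(C * D) $$ (i, i') = (\<Sum>j<?q. if j < ?l then of_int (c (vs ! i) j * int (rdim (Ps ! j) (vs ! i'))) else 0)"
      using ii DC by (subst mat_mult_index) (auto simp: C_def D_def intro!: sum.cong)
    also have "\<dots> = of_int (int (\<delta> (vs ! i) (vs ! i')))"
      unfolding cut c[of "vs ! i", OF nth_mem[OF ii(1), unfolded vs(2)]] by simp
    also have "\<dots> = 1\<^sub>m ?q $$ (i, i')" using ii vs(1) by (auto simp: \<delta>_def nth_eq_iff_index_eq)
    finally show "(C * D) $$ (i, i') = 1\<^sub>m ?q $$ (i, i')" .
  qed (use DC in auto)
  then have D1: "D * C = 1\<^sub>m ?q" using mat_mult_left_right_inverse DC by blast
  \<comment> \<open>\<open>x\<close> is the difference of the multiplicities; equality of the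
    dimension vectors says that \<open>D\<close> kills it.\<close>
  have "x * D = 0\<^sub>m 1 ?q"
  proof (rule eq_matI)
    fix i i' assume "i < dim_row (0\<^sub>m 1 ?q :: complex mat)" "i' < dim_col (0\<^sub>m 1 ?q :: complex mat)"
    then have ii: "i = 0" "i' < ?q" by auto
    have "(x * D) $$ (i, i') = (\<Sum>j<?q. if j < ?l then of_int ((int (n j) - int (n' j)) * int (rdim (Ps ! j) (vs ! i'))) else 0)"
      using ii DC by (subst mat_mult_index) (auto simp: x_def D_def intro!: sum.cong)
    also have "\<dots> = of_int (\<Sum>j<?l. (int (n j) - int (n' j)) * int (rdim (Ps ! j) (vs ! i')))"
      unfolding cut by simp
    also have "(\<Sum>j<?l. (int (n j) - int (n' j)) * int (rdim (Ps ! j) (vs ! i'))) = int (rdim (proj_sum Ps n) (vs ! i')) - int (rdim (proj_sum Ps n') (vs ! i'))"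
      by (simp add: proj_sum_rdim left_diff_distrib sum_subtractf)
    also have "\<dots> = 0" using assms(1) by simp
    finally show "(x * D) $$ (i, i') = 0\<^sub>m 1 ?q $$ (i, i')" using ii by simp
  qed (use DC in auto)
  then have "x * (D * C) = 0\<^sub>m 1 ?q" using DC by (simp add: mat_assoc[symmetric] mat_ring0)
  then have "x = 0\<^sub>m 1 ?q" unfolding D1 using DC by (simp add: mat_ring0)
  then have "x $$ (0, j) = 0" using assms(2) lq by simp
  then have "(of_int (int (n j) - int (n' j)) :: complex) = 0" using assms(2) lq by (simp add: x_def)
  then have "int (n j) - int (n' j) = 0" by (simp only: of_int_eq_0_iff)
  then show ?thesis by simp
qed

text \<open>The type of a projective module as a function of its dimension vector alone, so that it
  is constant on a variety of complexes.\<close>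

definition "ptype d = (SOME n. (\<forall>j\<ge>length Ps. n j = 0) \<and> rdim (proj_sum Ps n) = d)"

lemma ptype:
  assumes "projective_rep Q R P"
  shows "rep_iso Q P (proj_sum Ps (ptype (rdim P)))" "\<And>j. length Ps \<le> j \<Longrightarrow> ptype (rdim P) j = 0"
    "rdim (proj_sum Ps (ptype (rdim P))) = rdim P"
proof -
  obtain n where n: "\<forall>j\<ge>length Ps. n j = 0" "rep_iso Q P (proj_sum Ps n)" using projective_decomposition[OF assms] by blast
  have rn: "rdim (proj_sum Ps n) = rdim P" using rep_iso_dims[OF n(2)] by simp
  have "\<exists>n. (\<forall>j\<ge>length Ps. n j = 0) \<and> rdim (proj_sum Ps n) = rdim P" using n rn by blast
  from someI_ex[OF this] have p: "\<forall>j\<ge>length Ps. ptype (rdim P) j = 0" "rdim (proj_sum Ps (ptype (rdim P))) = rdim P"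
    unfolding ptype_def by auto
  have "n j = ptype (rdim P) j" for j
  proof (cases "j < length Ps")
    case True show ?thesis by (rule proj_sum_unique[OF _ True]) (simp add: rn p(2))
  qed (use n p in auto)
  then have "n = ptype (rdim P)" by blast
  then show "rep_iso Q P (proj_sum Ps (ptype (rdim P)))" "\<And>j. length Ps \<le> j \<Longrightarrow> ptype (rdim P) j = 0"
    "rdim (proj_sum Ps (ptype (rdim P))) = rdim P" using n p by auto
qed

lemma ptype_unique:
  assumes "\<And>j. length Ps \<le> j \<Longrightarrow> n j = 0" "rdim (proj_sum Ps n) = d"
  shows "ptype d = n"
proof
  fix j
  have "\<exists>n. (\<forall>j\<ge>length Ps. n j = 0) \<and> rdim (proj_sum Ps n) = d" using assms by blast
  from someI_ex[OF this] have p: "\<forall>j\<ge>length Ps. ptype d j = 0" "rdim (proj_sum Ps (ptype d)) = d"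
    unfolding ptype_def by auto
  show "ptype d j = n j"
  proof (cases "j < length Ps")
    case True show ?thesis by (rule proj_sum_unique[OF _ True]) (simp add: assms p(2))
  qed (use assms p in auto)
qed

end

subsection \<open>Matrices acting on vectors\<close>

lemma mv_add: "dim_vec u = dim_vec w \<Longrightarrow> dim_col A = dim_vec u \<Longrightarrow> (A :: complex mat) *\<^sub>v (u + w) = A *\<^sub>v u + A *\<^sub>v w"
  by (rule mult_add_distrib_mat_vec[of _ "dim_row A" "dim_col A"]) (auto intro: carrier_vecI)

lemma mv_diff: "dim_vec u = dim_vec w \<Longrightarrow> dim_col A = dim_vec u \<Longrightarrow> (A :: complex mat) *\<^sub>v (u - w) = A *\<^sub>v u - A *\<^sub>v w"
  by (rule mult_minus_distrib_mat_vec[of _ "dim_row A" "dim_col A"]) (auto intro: carrier_vecI)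

lemma mv_neg: "dim_col A = dim_vec u \<Longrightarrow> (A :: complex mat) *\<^sub>v (- u) = - (A *\<^sub>v u)"
  by (rule eq_vecI) (auto simp: scalar_prod_def sum_negf)

lemma neg_mv: "dim_col A = dim_vec u \<Longrightarrow> (- A :: complex mat) *\<^sub>v u = - (A *\<^sub>v u)"
  by (rule eq_vecI) (auto simp: scalar_prod_def sum_negf)

lemma mv_assoc: "dim_col A = dim_row B \<Longrightarrow> dim_col B = dim_vec u \<Longrightarrow> (A * B) *\<^sub>v u = A *\<^sub>v (B *\<^sub>v (u :: complex vec))"
  by (simp add: mat_mult_vec_assoc)

lemma mv_one: "dim_vec u = n \<Longrightarrow> 1\<^sub>m n *\<^sub>v (u :: complex vec) = u"
  by (auto intro!: one_mult_mat_vec carrier_vecI)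

lemma mv_zero_mat: "dim_vec u = n \<Longrightarrow> 0\<^sub>m m n *\<^sub>v (u :: complex vec) = 0\<^sub>v m"
  by (rule eq_vecI) (auto simp: scalar_prod_def)

lemma vec_cancel_left:
  assumes "L * K = 1\<^sub>m n" "dim_col L = dim_row K" "dim_col K = n" "dim_vec u = n" "dim_vec w = n" "K *\<^sub>v u = K *\<^sub>v (w :: complex vec)"
  shows "u = w"
proof -
  have "u = (L * K) *\<^sub>v u" using assms by (simp add: mv_one)
  also have "\<dots> = L *\<^sub>v (K *\<^sub>v u)" using assms(2-5) by (intro mv_assoc) auto
  also have "\<dots> = (L * K) *\<^sub>v w" unfolding assms(6) using assms(2-5) by (intro mv_assoc[symmetric]) auto
  finally show ?thesis using assms by (simp add: mv_one)
qed

lemma prj_append: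
  assumes "dim_vec a = n" "dim_vec b = m"
  shows "prj1 n m *\<^sub>v (a @\<^sub>v b) = (a :: complex vec)" "prj2 n m *\<^sub>v (a @\<^sub>v b) = (b :: complex vec)"
proof -
  have s: "(\<Sum>l<m. if l = i then f l else 0) = f i" if "i < m" for f :: "nat \<Rightarrow> complex" and i m using that by simp
  show "prj1 n m *\<^sub>v (a @\<^sub>v b) = a"
  proof (rule eq_vecI)
    fix i assume "i < dim_vec a"
    then have i: "i < n" using assms by simp
    have "(prj1 n m *\<^sub>v (a @\<^sub>v b)) $ i = (\<Sum>l<n+m. if l = i then (a @\<^sub>v b) $ l else 0)"
      using i assms by (subst index_mult_mat_vec) (simp_all add: prj1_def scalar_prod_def lessThan_atLeast0 if_distribR if_distrib eq_commute[of i] cong: if_cong)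
    then show "(prj1 n m *\<^sub>v (a @\<^sub>v b)) $ i = a $ i" using s[of i "n + m"] i assms by simp
  qed (use assms in auto)
  show "prj2 n m *\<^sub>v (a @\<^sub>v b) = b"
  proof (rule eq_vecI)
    fix i assume "i < dim_vec b"
    then have i: "i < m" using assms by simp
    have "(prj2 n m *\<^sub>v (a @\<^sub>v b)) $ i = (\<Sum>l<n+m. if l = n + i then (a @\<^sub>v b) $ l else 0)"
      using i assms by (subst index_mult_mat_vec) (simp_all add: prj2_def scalar_prod_def lessThan_atLeast0 if_distribR if_distrib cong: if_cong)
    then show "(prj2 n m *\<^sub>v (a @\<^sub>v b)) $ i = b $ i" using s[of "n + i" "n + m"] i assms by simp
  qed (use assms in auto)
qed

lemma vec_split:
  fixes z :: "complex vec"
  assumes "z \<in> carrier_vec (n + m)"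
  obtains a b where "z = a @\<^sub>v b" "dim_vec a = n" "dim_vec b = m"
  using vec_first_last_append[OF assms] that[of "vec_first z n" "vec_last z m"] by auto

lemma four_block_append:
  assumes "A \<in> carrier_mat a b" "B \<in> carrier_mat a d" "C \<in> carrier_mat c b" "D \<in> carrier_mat c d" "dim_vec x = b" "dim_vec y = d"
  shows "four_block_mat A B C D *\<^sub>v (x @\<^sub>v y) = (A *\<^sub>v x + B *\<^sub>v y) @\<^sub>v (C *\<^sub>v x + D *\<^sub>v (y :: complex vec))"
  by (rule four_block_mat_mult_vec[OF assms(1-4)]) (use assms in \<open>auto intro: carrier_vecI\<close>)

lemma four_block_expand:
  assumes "A \<in> carrier_mat a b" "B \<in> carrier_mat a d" "C \<in> carrier_mat c b" "D \<in> carrier_mat c d"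
  shows "four_block_mat A B C D = (inc1 a c * A + inc2 a c * C) * prj1 b d + (inc1 a c * B + inc2 a c * (D :: complex mat)) * prj2 b d"
proof -
  let ?F = "four_block_mat A B C D"
  have d: "dim_row ?F = a + c" "dim_col ?F = b + d" using assms by auto
  have "?F = ?F * (inc1 b d * prj1 b d + inc2 b d * prj2 b d)" using d by (simp add: prj_inc mat_ring0)
  also have "\<dots> = (?F * inc1 b d) * prj1 b d + (?F * inc2 b d) * prj2 b d"
    using d by (subst mat_distrib_left) (simp_all add: mat_assoc)
  finally show ?thesis unfolding four_block_inc[OF assms] .
qed

lemma append_zero_vec: "0\<^sub>v n @\<^sub>v 0\<^sub>v m = (0\<^sub>v (n + m) :: complex vec)"
  by (rule eq_vecI) auto

lemma append_vec_zeroD: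
  assumes "a @\<^sub>v b = (0\<^sub>v (n + m) :: complex vec)" "dim_vec a = n" "dim_vec b = m"
  shows "a = 0\<^sub>v n" "b = 0\<^sub>v m"
proof -
  have e: "a @\<^sub>v b = 0\<^sub>v n @\<^sub>v 0\<^sub>v m" using assms(1) by (simp add: append_zero_vec)
  then have "a = 0\<^sub>v n \<and> b = 0\<^sub>v m" using append_vec_eq[of a n "0\<^sub>v n" b "0\<^sub>v m"] assms(2,3) by (auto intro: carrier_vecI)
  then show "a = 0\<^sub>v n" "b = 0\<^sub>v m" by auto
qed

subsection \<open>Complexes\<close>

lemma degree_rep_simps[simp]: "rdim (degree_rep X i) = cdim X i" "rmap (degree_rep X i) = cmap X i"
  by (auto simp: degree_rep_def)

lemma bcD:
  assumes "bounded_cplx Q R X"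
  shows "is_rep Q R (degree_rep X i)" "hom_shape Q (degree_rep X i)"
    "rep_hom Q (degree_rep X i) (degree_rep X (i + 1)) (cdiff X i)" "cdiff X i v \<in> carrier_mat (cdim X (i + 1) v) (cdim X i v)"
    "cdiff X (i + 1) v * cdiff X i v = 0\<^sub>m (cdim X (i + 2) v) (cdim X i v)" "finite {i. \<exists>v. cdim X i v \<noteq> 0}"
proof -
  show r: "is_rep Q R (degree_rep X i)" and h: "rep_hom Q (degree_rep X i) (degree_rep X (i + 1)) (cdiff X i)"
    and "cdiff X (i + 1) v * cdiff X i v = 0\<^sub>m (cdim X (i + 2) v) (cdim X i v)" "finite {i. \<exists>v. cdim X i v \<noteq> 0}"
    using assms unfolding bounded_cplx_def by auto
  show "hom_shape Q (degree_rep X i)" using r by (rule is_rep_shape)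
  show "cdiff X i v \<in> carrier_mat (cdim X (i + 1) v) (cdim X i v)" using hom_carrier[OF h, of v] by simp
qed

lemma bc_dims:
  assumes "bounded_cplx Q R X"
  shows "dim_row (cdiff X i v) = cdim X (i + 1) v" "dim_col (cdiff X i v) = cdim X i v"
  using bcD(4)[OF assms, of i v] by auto

lemma chain_mapD:
  assumes "chain_map Q X Y f"
  shows "rep_hom Q (degree_rep X i) (degree_rep Y i) (f i)" "f i v \<in> carrier_mat (cdim Y i v) (cdim X i v)"
    "f (i + 1) v * cdiff X i v = cdiff Y i v * f i v"
    "dim_row (f i v) = cdim Y i v" "dim_col (f i v) = cdim X i v"
proof -
  show h: "rep_hom Q (degree_rep X i) (degree_rep Y i) (f i)" and "f (i + 1) v * cdiff X i v = cdiff Y i v * f i v"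
    using assms unfolding chain_map_def by auto
  show "f i v \<in> carrier_mat (cdim Y i v) (cdim X i v)" using hom_carrier[OF h, of v] by simp
  then show "dim_row (f i v) = cdim Y i v" "dim_col (f i v) = cdim X i v" by auto
qed

lemma cyclesI: "dim_vec z = dim_col (cdiff X i v) \<Longrightarrow> cdiff X i v *\<^sub>v z = 0\<^sub>v (dim_row (cdiff X i v)) \<Longrightarrow> z \<in> cycles X i v"
  unfolding cycles_def mat_kernel_def by (auto intro: carrier_vecI)

lemma cyclesD: "z \<in> cycles X i v \<Longrightarrow> dim_vec z = dim_col (cdiff X i v) \<and> cdiff X i v *\<^sub>v z = 0\<^sub>v (dim_row (cdiff X i v))"
  unfolding cycles_def mat_kernel_def by auto

lemma boundariesI: "dim_vec z = dim_col (cdiff X (i - 1) v) \<Longrightarrow> cdiff X (i - 1) v *\<^sub>v z \<in> boundaries X i v"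
  unfolding boundaries_def mat_image_def by (auto intro!: imageI carrier_vecI)

lemma boundariesE:
  assumes "y \<in> boundaries X i v"
  obtains z where "dim_vec z = dim_col (cdiff X (i - 1) v)" "y = cdiff X (i - 1) v *\<^sub>v z"
proof -
  obtain x where "x \<in> carrier_vec (dim_col (cdiff X (i - 1) v))" "y = cdiff X (i - 1) v *\<^sub>v x"
    using assms unfolding boundaries_def mat_image_def by blast
  then show ?thesis using that[of x] by simp
qed

lemma bc_dd_vec:
  assumes X: "bounded_cplx Q R X" and "dim_vec z = cdim X i v"
  shows "cdiff X (i + 1) v *\<^sub>v (cdiff X i v *\<^sub>v z) = 0\<^sub>v (cdim X (i + 2) v)"
proof -
  have "cdiff X (i + 1) v *\<^sub>v (cdiff X i v *\<^sub>v z) = (cdiff X (i + 1) v * cdiff X i v) *\<^sub>v z"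
    using assms(2) by (intro mv_assoc[symmetric]) (auto simp: bc_dims[OF X])
  then show ?thesis unfolding bcD(5)[OF X] using assms(2) by (simp add: mv_zero_mat)
qed

lemma bc_dd_vec':
  assumes X: "bounded_cplx Q R X" and "dim_vec z = cdim X (i - 1) v"
  shows "cdiff X i v *\<^sub>v (cdiff X (i - 1) v *\<^sub>v z) = 0\<^sub>v (cdim X (i + 1) v)"
proof -
  have "i - 1 + 2 = i + 1" by simp
  then show ?thesis using bc_dd_vec[OF assms] by (simp add: add.commute)
qed

lemma chain_map_vec:
  assumes f: "chain_map Q X Y f" and X: "bounded_cplx Q R X" and Y: "bounded_cplx Q R Y" and "dim_vec z = cdim X i v"
  shows "f (i + 1) v *\<^sub>v (cdiff X i v *\<^sub>v z) = cdiff Y i v *\<^sub>v (f i v *\<^sub>v z)"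
proof -
  have "f (i + 1) v *\<^sub>v (cdiff X i v *\<^sub>v z) = (f (i + 1) v * cdiff X i v) *\<^sub>v z"
    using assms(4) by (intro mv_assoc[symmetric]) (auto simp: bc_dims[OF X] chain_mapD(4,5)[OF f])
  also have "\<dots> = cdiff Y i v *\<^sub>v (f i v *\<^sub>v z)"
    unfolding chain_mapD(3)[OF f] using assms(4) by (intro mv_assoc) (auto simp: bc_dims[OF Y] chain_mapD(4,5)[OF f])
  finally show ?thesis .
qed

lemma quasi_iso_refl: "bounded_cplx Q R X \<Longrightarrow> quasi_iso_map Q X X (\<lambda>i v. 1\<^sub>m (cdim X i v))"
proof -
  assume X: "bounded_cplx Q R X"
  have c: "chain_map Q X X (\<lambda>i v. 1\<^sub>m (cdim X i v))"
    unfolding chain_map_def using hom_id[OF bcD(2)[OF X]] by (auto simp: mat_ring0 bc_dims[OF X])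
  have z: "0\<^sub>v (cdim X i v) \<in> boundaries X i v" for i v
    using boundariesI[of "0\<^sub>v (cdim X (i - 1) v)" X i v] by (simp add: bc_dims[OF X] mat_mult_zero_vec)
  have 1: "1\<^sub>m (cdim X i v) *\<^sub>v z = z" if "z \<in> cycles X i v" for z i v
    using cyclesD[OF that] by (auto simp: mv_one bc_dims[OF X])
  show ?thesis unfolding quasi_iso_map_def
  proof (intro conjI allI ballI impI c)
    fix i v z assume "z \<in> cycles X i v" "1\<^sub>m (cdim X i v) *\<^sub>v z \<in> boundaries X i v"
    then show "z \<in> boundaries X i v" using 1 by simp
  next
    fix i v z assume zc: "z \<in> cycles X i v"
    then have "z - 1\<^sub>m (cdim X i v) *\<^sub>v z = 0\<^sub>v (cdim X i v)" using 1[OF zc] cyclesD[OF zc] by (auto simp: bc_dims[OF X])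
    then show "\<exists>z'\<in>cycles X i v. z - 1\<^sub>m (cdim X i v) *\<^sub>v z' \<in> boundaries X i v" using z zc by (metis bexI)
  qed
qed

lemma qisI: "bounded_cplx Q R X \<Longrightarrow> bounded_cplx Q R Y \<Longrightarrow> quasi_iso_map Q X Y f \<Longrightarrow> quasi_isomorphic Q R X Y"
  unfolding quasi_isomorphic_def by (rule r_into_equivclp) blast

lemma qis_refl: "quasi_isomorphic Q R X X" unfolding quasi_isomorphic_def by simp
lemma qis_sym: "quasi_isomorphic Q R X Y \<Longrightarrow> quasi_isomorphic Q R Y X"
  unfolding quasi_isomorphic_def by (rule equivclp_sym)
lemma qis_trans: "quasi_isomorphic Q R X Y \<Longrightarrow> quasi_isomorphic Q R Y Z \<Longrightarrow> quasi_isomorphic Q R X Z"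
  unfolding quasi_isomorphic_def by (rule equivclp_trans)

lemma zero_in_boundaries: "bounded_cplx Q R X \<Longrightarrow> 0\<^sub>v (cdim X i v) \<in> boundaries X i v"
  using boundariesI[of "0\<^sub>v (cdim X (i - 1) v)" X i v] by (simp add: bc_dims mat_mult_zero_vec)

lemma acyclic_qis:
  assumes f: "quasi_iso_map Q X Y f" and X: "bounded_cplx Q R X" and Y: "bounded_cplx Q R Y" and "acyclic_cplx Y"
  shows "acyclic_cplx X"
proof -
  have c: "chain_map Q X Y f" using f unfolding quasi_iso_map_def by blast
  show ?thesis unfolding acyclic_cplx_def
  proof (intro allI equalityI subsetI)
    fix i v z assume z: "z \<in> cycles X i v"
    note zz = cyclesD[OF z, unfolded bc_dims[OF X]]
    have "f i v *\<^sub>v z \<in> cycles Y i v"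
      using zz chain_map_vec[OF c X Y, of z i v] by (intro cyclesI) (auto simp: bc_dims[OF Y] chain_mapD(4,5)[OF c] mat_mult_zero_vec)
    then have "f i v *\<^sub>v z \<in> boundaries Y i v" using assms(4) unfolding acyclic_cplx_def by simp
    then show "z \<in> boundaries X i v" using f z unfolding quasi_iso_map_def by blast
  next
    fix i v z assume "z \<in> boundaries X i v"
    then obtain y where y: "dim_vec y = dim_col (cdiff X (i - 1) v)" "z = cdiff X (i - 1) v *\<^sub>v y" by (rule boundariesE)
    then show "z \<in> cycles X i v"
      using bc_dd_vec'[OF X, of y i v] by (intro cyclesI) (auto simp: bc_dims[OF X])
  qed
qed

lemma cplx_iso_quasi:
  assumes g: "cplx_iso_via Q g X Y" and X: "bounded_cplx Q R X" and Y: "bounded_cplx Q R Y"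
  shows "quasi_iso_map Q X Y g"
proof -
  have c: "chain_map Q X Y g" and inv: "\<And>i v. invertible_mat (g i v)" using g unfolding cplx_iso_via_def by auto
  have "\<exists>B\<in>carrier_mat (cdim X i v) (cdim Y i v). g i v * B = 1\<^sub>m (cdim Y i v) \<and> B * g i v = 1\<^sub>m (cdim X i v)" for i v
    using inv invertible_iff[OF chain_mapD(2)[OF c]] by blast
  then obtain B where B: "\<And>i v. B i v \<in> carrier_mat (cdim X i v) (cdim Y i v)" "\<And>i v. g i v * B i v = 1\<^sub>m (cdim Y i v)" "\<And>i v. B i v * g i v = 1\<^sub>m (cdim X i v)"
    by metis
  note d = bc_dims[OF X] bc_dims[OF Y] chain_mapD(4,5)[OF c] carrier_matD[OF B(1)]
  have gB: "g i v *\<^sub>v (B i v *\<^sub>v y) = y" if "dim_vec y = cdim Y i v" for i v y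
    using that by (simp add: mv_assoc[symmetric] d B(2) mv_one)
  show ?thesis unfolding quasi_iso_map_def
  proof (intro conjI allI ballI impI c)
    fix i v z assume z: "z \<in> cycles X i v" "g i v *\<^sub>v z \<in> boundaries Y i v"
    obtain y where y: "dim_vec y = cdim Y (i - 1) v" "g i v *\<^sub>v z = cdiff Y (i - 1) v *\<^sub>v y" using z(2) by (elim boundariesE) (auto simp: d)
    have "g i v *\<^sub>v z = g i v *\<^sub>v (cdiff X (i - 1) v *\<^sub>v (B (i - 1) v *\<^sub>v y))"
      using chain_map_vec[OF c X Y, of "B (i - 1) v *\<^sub>v y" "i - 1" v] gB[OF y(1)] y by (simp add: d)
    then have "z = cdiff X (i - 1) v *\<^sub>v (B (i - 1) v *\<^sub>v y)"
      by (rule vec_cancel_left[OF B(3), rotated 4]) (use cyclesD[OF z(1)] in \<open>auto simp: d\<close>)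
    then show "z \<in> boundaries X i v" using boundariesI[of "B (i - 1) v *\<^sub>v y" X i v] by (simp add: d)
  next
    fix i v y assume y: "y \<in> cycles Y i v"
    note yy = cyclesD[OF y, unfolded d]
    let ?z = "B i v *\<^sub>v y"
    have "g (i + 1) v *\<^sub>v (cdiff X i v *\<^sub>v ?z) = g (i + 1) v *\<^sub>v 0\<^sub>v (cdim X (i + 1) v)"
      using chain_map_vec[OF c X Y, of ?z i v] gB yy by (simp add: d mat_mult_zero_vec)
    then have "cdiff X i v *\<^sub>v ?z = 0\<^sub>v (cdim X (i + 1) v)"
      by (rule vec_cancel_left[OF B(3), rotated 4]) (auto simp: d)
    then have "?z \<in> cycles X i v" by (intro cyclesI) (auto simp: d)
    moreover have "y - g i v *\<^sub>v ?z = 0\<^sub>v (cdim Y i v)" using gB[of y i v] yy by (intro eq_vecI) auto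
    then have "y - g i v *\<^sub>v ?z \<in> boundaries Y i v" using zero_in_boundaries[OF Y, of i v] by simp
    ultimately show "\<exists>z\<in>cycles X i v. y - g i v *\<^sub>v z \<in> boundaries Y i v" by blast
  qed
qed

subsection \<open>Direct sums of complexes\<close>

lemma degree_dsum: "degree_rep (cplx_dsum X Y) i = rep_dsum (degree_rep X i) (degree_rep Y i)"
  by (simp add: degree_rep_def cplx_dsum_def rep_dsum_def)

lemma cdim_dsum[simp]: "cdim (cplx_dsum X Y) i v = cdim X i v + cdim Y i v"
  by (simp add: cplx_dsum_def)

lemma cplx_dsum_assoc: "cplx_dsum X (cplx_dsum Y Z) = cplx_dsum (cplx_dsum X Y) Z"
  by (simp add: cplx_dsum_def diag_assoc add.assoc)

lemma cplx_dsum_zero: "cplx_dsum zero_cplx X = X"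
  by (simp add: cplx_dsum_def zero_cplx_def diag_zero)

lemma finite_dims_add:
  "finite {i. \<exists>v. f i v \<noteq> (0::nat)} \<Longrightarrow> finite {i. \<exists>v. g i v \<noteq> 0} \<Longrightarrow> finite {i. \<exists>v. f i v + g i v \<noteq> 0}"
  by (rule finite_subset[of _ "{i. \<exists>v. f i v \<noteq> 0} \<union> {i. \<exists>v. g i v \<noteq> 0}"]) auto

context fin_digraph begin

lemma dsum_cdiff:
  assumes X: "bounded_cplx G R X" and Y: "bounded_cplx G R Y"
  shows "cdiff (cplx_dsum X Y) i v = four_block_mat (cdiff X i v) (0\<^sub>m (cdim X (i + 1) v) (cdim Y i v)) (0\<^sub>m (cdim Y (i + 1) v) (cdim X i v)) (cdiff Y i v)"
  by (simp add: cplx_dsum_def diag_block2 bc_dims[OF X] bc_dims[OF Y])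

lemma dsum_bounded:
  assumes X: "bounded_cplx G R X" and Y: "bounded_cplx G R Y"
  shows "bounded_cplx G R (cplx_dsum X Y)"
  unfolding bounded_cplx_def
proof (intro conjI allI)
  show "finite {i. \<exists>v. cdim (cplx_dsum X Y) i v \<noteq> 0}" unfolding cdim_dsum by (rule finite_dims_add[OF bcD(6)[OF X] bcD(6)[OF Y]])
  fix i
  show "is_rep G R (degree_rep (cplx_dsum X Y) i)" unfolding degree_dsum by (rule dsum_rep[OF bcD(1)[OF X] bcD(1)[OF Y]])
  note sX = bcD(2)[OF X] and sY = bcD(2)[OF Y]
  have e: "cdiff (cplx_dsum X Y) i = (\<lambda>v. inc1 (rdim (degree_rep X (i + 1)) v) (rdim (degree_rep Y (i + 1)) v) * (cdiff X i v * prj1 (rdim (degree_rep X i) v) (rdim (degree_rep Y i) v))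
      + inc2 (rdim (degree_rep X (i + 1)) v) (rdim (degree_rep Y (i + 1)) v) * (cdiff Y i v * prj2 (rdim (degree_rep X i) v) (rdim (degree_rep Y i) v)))"
  proof
    fix v
    show "cdiff (cplx_dsum X Y) i v = inc1 (rdim (degree_rep X (i + 1)) v) (rdim (degree_rep Y (i + 1)) v) * (cdiff X i v * prj1 (rdim (degree_rep X i) v) (rdim (degree_rep Y i) v))
      + inc2 (rdim (degree_rep X (i + 1)) v) (rdim (degree_rep Y (i + 1)) v) * (cdiff Y i v * prj2 (rdim (degree_rep X i) v) (rdim (degree_rep Y i) v))"
      using four_block_expand[OF bcD(4)[OF X] zero_carrier_mat zero_carrier_mat bcD(4)[OF Y], of i v i v]
      by (simp add: cplx_dsum_def diag_block2 bc_dims[OF X] bc_dims[OF Y] mat_ring)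
  qed
  show "rep_hom G (degree_rep (cplx_dsum X Y) i) (degree_rep (cplx_dsum X Y) (i + 1)) (cdiff (cplx_dsum X Y) i)"
    unfolding e degree_dsum
    by (intro hom_add dsum_shape sX sY
        hom_comp[OF dsum_shape[OF sX sY] sX dsum_shape[OF sX sY] _ dsum_homs(1)[OF sX sY]] hom_comp[OF dsum_shape[OF sX sY] sX sX dsum_homs(3)[OF sX sY] bcD(3)[OF X]]
        hom_comp[OF dsum_shape[OF sX sY] sY dsum_shape[OF sX sY] _ dsum_homs(2)[OF sX sY]] hom_comp[OF dsum_shape[OF sX sY] sY sY dsum_homs(4)[OF sX sY] bcD(3)[OF Y]])
  fix v
  have "cdiff (cplx_dsum X Y) (i + 1) v * cdiff (cplx_dsum X Y) i v = diag_block_mat [cdiff X (i + 1) v * cdiff X i v, cdiff Y (i + 1) v * cdiff Y i v]"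
    using bcD(4)[OF X, of "i + 1" v] bcD(4)[OF Y, of "i + 1" v]
    by (simp add: dsum_cdiff[OF X Y] diag_block2 bc_dims[OF X] bc_dims[OF Y]
        mult_four_block_mat[OF _ zero_carrier_mat zero_carrier_mat _ bcD(4)[OF X, of i v] zero_carrier_mat zero_carrier_mat bcD(4)[OF Y, of i v]])
      (simp add: mat_ring0 bc_dims[OF X] bc_dims[OF Y])
  also have "\<dots> = 0\<^sub>m (cdim (cplx_dsum X Y) (i + 2) v) (cdim (cplx_dsum X Y) i v)"
    unfolding bcD(5)[OF X] bcD(5)[OF Y] diag_block2 by (intro eq_matI) auto
  finally show "cdiff (cplx_dsum X Y) (i + 1) v * cdiff (cplx_dsum X Y) i v = 0\<^sub>m (cdim (cplx_dsum X Y) (i + 2) v) (cdim (cplx_dsum X Y) i v)" .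
qed

lemma dsum_diff_append:
  assumes X: "bounded_cplx G R X" and Y: "bounded_cplx G R Y" "dim_vec x = cdim X i v" "dim_vec y = cdim Y i v"
  shows "cdiff (cplx_dsum X Y) i v *\<^sub>v (x @\<^sub>v y) = (cdiff X i v *\<^sub>v x) @\<^sub>v (cdiff Y i v *\<^sub>v y)"
  unfolding cplx_dsum_def using four_block_append[OF bcD(4)[OF X] zero_carrier_mat zero_carrier_mat bcD(4)[OF Y(1)] assms(3,4)] assms(3,4)
  by (simp add: diag_block2 bc_dims[OF X] bc_dims[OF Y(1)] mv_zero_mat)
    (intro arg_cong2[where f = "(@\<^sub>v)"]; intro eq_vecI; auto simp: bc_dims[OF X] bc_dims[OF Y(1)])

lemma dsum_boundaries:
  assumes X: "bounded_cplx G R X" and Y: "bounded_cplx G R Y" "x \<in> boundaries X i v" "y \<in> boundaries Y i v"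
  shows "x @\<^sub>v y \<in> boundaries (cplx_dsum X Y) i v"
proof -
  obtain x' where x': "dim_vec x' = cdim X (i - 1) v" "x = cdiff X (i - 1) v *\<^sub>v x'" using assms(3) by (elim boundariesE) (auto simp: bc_dims[OF X])
  obtain y' where y': "dim_vec y' = cdim Y (i - 1) v" "y = cdiff Y (i - 1) v *\<^sub>v y'" using assms(4) by (elim boundariesE) (auto simp: bc_dims[OF Y(1)])
  have "x @\<^sub>v y = cdiff (cplx_dsum X Y) (i - 1) v *\<^sub>v (x' @\<^sub>v y')" using dsum_diff_append[OF X Y(1) x'(1) y'(1)] x' y' by simp
  then show ?thesis using boundariesI[of "x' @\<^sub>v y'" "cplx_dsum X Y" i v] x'(1) y'(1) by (simp add: bc_dims[OF dsum_bounded[OF X Y(1)]])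
qed

lemma dsum_cycleE:
  assumes X: "bounded_cplx G R X" and Y: "bounded_cplx G R Y" "z \<in> cycles (cplx_dsum X Y) i v"
  obtains x y where "z = x @\<^sub>v y" "x \<in> cycles X i v" "y \<in> cycles Y i v"
proof -
  note d = bc_dims[OF dsum_bounded[OF X Y(1)]] bc_dims[OF X] bc_dims[OF Y(1)]
  note z = cyclesD[OF Y(2), unfolded d]
  then have "z \<in> carrier_vec (cdim X i v + cdim Y i v)" by (auto intro: carrier_vecI)
  then obtain x y where xy: "z = x @\<^sub>v y" "dim_vec x = cdim X i v" "dim_vec y = cdim Y i v" by (rule vec_split)
  have "(cdiff X i v *\<^sub>v x) @\<^sub>v (cdiff Y i v *\<^sub>v y) = 0\<^sub>v (cdim X (i + 1) v + cdim Y (i + 1) v)"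
    using z dsum_diff_append[OF X Y(1) xy(2,3)] xy(1) by simp
  from append_vec_zeroD[OF this]
  have "x \<in> cycles X i v" "y \<in> cycles Y i v" using xy by (auto intro!: cyclesI simp: d)
  then show ?thesis using that xy(1) by blast
qed

lemma dsum_acyclic:
  assumes X: "bounded_cplx G R X" and Y: "bounded_cplx G R Y" "acyclic_cplx X" "acyclic_cplx Y"
  shows "acyclic_cplx (cplx_dsum X Y)"
  unfolding acyclic_cplx_def
proof (intro allI equalityI subsetI)
  fix i v z assume "z \<in> cycles (cplx_dsum X Y) i v"
  then obtain x y where "z = x @\<^sub>v y" "x \<in> cycles X i v" "y \<in> cycles Y i v" by (rule dsum_cycleE[OF X Y(1)])
  then show "z \<in> boundaries (cplx_dsum X Y) i v" using dsum_boundaries[OF X Y(1)] assms(3,4) unfolding acyclic_cplx_def by simp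
next
  note B = dsum_bounded[OF X Y(1)]
  fix i v z assume "z \<in> boundaries (cplx_dsum X Y) i v"
  then obtain y where y: "dim_vec y = dim_col (cdiff (cplx_dsum X Y) (i - 1) v)" "z = cdiff (cplx_dsum X Y) (i - 1) v *\<^sub>v y" by (rule boundariesE)
  then show "z \<in> cycles (cplx_dsum X Y) i v"
    using bc_dd_vec'[OF B, of y i v] by (intro cyclesI) (auto simp: bc_dims[OF B])
qed

text \<open>Cycles and boundaries of the sum are computed in the two summands, and \<open>M\<close>
  contributes no homology. Transition maps therefore do not leave the quasi-isomorphism
  class.\<close>

lemma dsum_acyclic_quasi:
  assumes X: "bounded_cplx G R X" and M: "bounded_cplx G R M" and ac: "acyclic_cplx M"
  shows "quasi_iso_map G (cplx_dsum X M) X (\<lambda>i v. prj1 (cdim X i v) (cdim M i v))"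
proof -
  note B = dsum_bounded[OF X M]
  have hm: "rep_hom G (degree_rep (cplx_dsum X M) i) (degree_rep X i) (\<lambda>v. prj1 (cdim X i v) (cdim M i v))" for i
    using dsum_homs(3)[OF bcD(2)[OF X] bcD(2)[OF M], of i i] unfolding degree_dsum by simp
  have c: "chain_map G (cplx_dsum X M) X (\<lambda>i v. prj1 (cdim X i v) (cdim M i v))"
    unfolding chain_map_def using hm diag_inc(3)[of "cdiff X i v" "cdiff M i v" for i v]
    by (simp add: cplx_dsum_def bc_dims[OF X] bc_dims[OF M])
  show ?thesis unfolding quasi_iso_map_def
  proof (intro conjI allI ballI impI c)
    fix i v z assume z: "z \<in> cycles (cplx_dsum X M) i v" "prj1 (cdim X i v) (cdim M i v) *\<^sub>v z \<in> boundaries X i v"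
    then obtain x y where xy: "z = x @\<^sub>v y" "x \<in> cycles X i v" "y \<in> cycles M i v" using dsum_cycleE[OF X M] by metis
    then have "x \<in> boundaries X i v" using z(2) cyclesD[OF xy(2)] cyclesD[OF xy(3)] by (simp add: prj_append bc_dims[OF X] bc_dims[OF M])
    then show "z \<in> boundaries (cplx_dsum X M) i v" unfolding xy(1) using dsum_boundaries[OF X M] ac xy(3) unfolding acyclic_cplx_def by simp
  next
    fix i v x assume x: "x \<in> cycles X i v"
    note xx = cyclesD[OF x, unfolded bc_dims[OF X]]
    let ?z = "x @\<^sub>v 0\<^sub>v (cdim M i v)"
    have "cdiff (cplx_dsum X M) i v *\<^sub>v ?z = 0\<^sub>v (cdim (cplx_dsum X M) (i + 1) v)"
      using xx by (subst dsum_diff_append[OF X M]) (auto simp: mat_mult_zero_vec bc_dims[OF M] append_zero_vec)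
    then have "?z \<in> cycles (cplx_dsum X M) i v" using xx by (intro cyclesI) (auto simp: bc_dims[OF B])
    moreover have "x - prj1 (cdim X i v) (cdim M i v) *\<^sub>v ?z = 0\<^sub>v (cdim X i v)" using xx by (auto simp: prj_append)
    ultimately show "\<exists>z\<in>cycles (cplx_dsum X M) i v. x - prj1 (cdim X i v) (cdim M i v) *\<^sub>v z \<in> boundaries X i v"
      using zero_in_boundaries[OF X] by metis
  qed
qed

subsection \<open>Mapping cones\<close>

lemma degree_cone: "degree_rep (mapping_cone X Y f) i = rep_dsum (degree_rep X (i + 1)) (degree_rep Y i)"
  by (simp add: degree_rep_def mapping_cone_def rep_dsum_def)

lemma cdim_cone[simp]: "cdim (mapping_cone X Y f) i v = cdim X (i + 1) v + cdim Y i v"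
  by (simp add: mapping_cone_def)

text \<open>The sign of the shifted differential makes the off-diagonal block of the squared
  differential the difference of the two sides of the chain map equation.\<close>

lemma cone_bounded:
  assumes X: "bounded_cplx G R X" and Y: "bounded_cplx G R Y" and f: "chain_map G X Y f"
  shows "bounded_cplx G R (mapping_cone X Y f)"
  unfolding bounded_cplx_def
proof (intro conjI allI)
  have "{i. \<exists>v. cdim X (i + 1) v \<noteq> 0} \<subseteq> (\<lambda>i. i - 1) ` {i. \<exists>v. cdim X i v \<noteq> 0}" by (auto intro!: image_eqI[of _ "\<lambda>i. i - 1" "i + 1" for i])
  then have "finite {i. \<exists>v. cdim X (i + 1) v \<noteq> 0}" by (rule finite_subset) (rule finite_imageI[OF bcD(6)[OF X]])
  from finite_dims_add[OF this bcD(6)[OF Y]] show "finite {i. \<exists>v. cdim (mapping_cone X Y f) i v \<noteq> 0}" unfolding cdim_cone .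
  fix i
  show "is_rep G R (degree_rep (mapping_cone X Y f) i)" unfolding degree_cone by (rule dsum_rep[OF bcD(1)[OF X] bcD(1)[OF Y]])
  note sX = bcD(2)[OF X] and sY = bcD(2)[OF Y]
  note d = bc_dims[OF X] bc_dims[OF Y] chain_mapD(4,5)[OF f]
  let ?A = "degree_rep X (i + 1)" and ?A' = "degree_rep X (i + 1 + 1)" and ?B = "degree_rep Y i" and ?B' = "degree_rep Y (i + 1)"
  have e: "cdiff (mapping_cone X Y f) i = (\<lambda>v. (inc1 (rdim ?A' v) (rdim ?B' v) * (- cdiff X (i + 1) v) + inc2 (rdim ?A' v) (rdim ?B' v) * f (i + 1) v) * prj1 (rdim ?A v) (rdim ?B v)
     + (inc2 (rdim ?A' v) (rdim ?B' v) * cdiff Y i v) * prj2 (rdim ?A v) (rdim ?B v))"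
  proof
    fix v
    have "- cdiff X (i + 1) v \<in> carrier_mat (cdim X (i + 2) v) (cdim X (i + 1) v)" using bcD(4)[OF X, of "i + 1" v] by (simp add: add.assoc)
    from four_block_expand[OF this zero_carrier_mat chain_mapD(2)[OF f, of "i + 1" v] bcD(4)[OF Y, of i v]]
    show "cdiff (mapping_cone X Y f) i v = (inc1 (rdim ?A' v) (rdim ?B' v) * (- cdiff X (i + 1) v) + inc2 (rdim ?A' v) (rdim ?B' v) * f (i + 1) v) * prj1 (rdim ?A v) (rdim ?B v)
     + (inc2 (rdim ?A' v) (rdim ?B' v) * cdiff Y i v) * prj2 (rdim ?A v) (rdim ?B v)"
      by (simp add: mapping_cone_def mat_ring0 d add.assoc)
  qed
  show "rep_hom G (degree_rep (mapping_cone X Y f) i) (degree_rep (mapping_cone X Y f) (i + 1)) (cdiff (mapping_cone X Y f) i)"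
    unfolding e degree_cone
    by (intro hom_add dsum_shape sX sY
        hom_comp[OF dsum_shape[OF sX sY] sX dsum_shape[OF sX sY] dsum_homs(3)[OF sX sY]] hom_comp[OF dsum_shape[OF sX sY] sY dsum_shape[OF sX sY] dsum_homs(4)[OF sX sY]]
        hom_comp[OF sX sX dsum_shape[OF sX sY] hom_uminus[OF sX sX bcD(3)[OF X]] dsum_homs(1)[OF sX sY]]
        hom_comp[OF sX sY dsum_shape[OF sX sY] chain_mapD(1)[OF f] dsum_homs(2)[OF sX sY]]
        hom_comp[OF sY sY dsum_shape[OF sX sY] bcD(3)[OF Y] dsum_homs(2)[OF sX sY]])
  fix v
  have c: "- cdiff X (i + 1 + 1) v \<in> carrier_mat (cdim X (i + 1 + 2) v) (cdim X (i + 2) v)" "- cdiff X (i + 1) v \<in> carrier_mat (cdim X (i + 2) v) (cdim X (i + 1) v)"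
    "f (i + 1 + 1) v \<in> carrier_mat (cdim Y (i + 2) v) (cdim X (i + 2) v)" "f (i + 1) v \<in> carrier_mat (cdim Y (i + 1) v) (cdim X (i + 1) v)"
    "cdiff Y (i + 1) v \<in> carrier_mat (cdim Y (i + 2) v) (cdim Y (i + 1) v)" "cdiff Y i v \<in> carrier_mat (cdim Y (i + 1) v) (cdim Y i v)"
    using bcD(4)[OF X, of "i + 1" v] bcD(4)[OF X, of "i + 2" v] chain_mapD(2)[OF f, of "i + 2" v] chain_mapD(2)[OF f, of "i + 1" v] bcD(4)[OF Y, of "i + 1" v] bcD(4)[OF Y, of i v]
    by (simp_all add: add.assoc)
  have "cdiff (mapping_cone X Y f) (i + 1) v * cdiff (mapping_cone X Y f) i v =
     four_block_mat (- cdiff X (i + 1 + 1) v * - cdiff X (i + 1) v + 0\<^sub>m (cdim X (i + 1 + 2) v) (cdim Y (i + 1) v) * f (i + 1) v)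
       (- cdiff X (i + 1 + 1) v * 0\<^sub>m (cdim X (i + 2) v) (cdim Y i v) + 0\<^sub>m (cdim X (i + 1 + 2) v) (cdim Y (i + 1) v) * cdiff Y i v)
       (f (i + 1 + 1) v * - cdiff X (i + 1) v + cdiff Y (i + 1) v * f (i + 1) v)
       (f (i + 1 + 1) v * 0\<^sub>m (cdim X (i + 2) v) (cdim Y i v) + cdiff Y (i + 1) v * cdiff Y i v)"
    unfolding mapping_cone_def using mult_four_block_mat[OF c(1) zero_carrier_mat c(3,5) c(2) zero_carrier_mat c(4,6)] by simp
  also have "- cdiff X (i + 1 + 1) v * - cdiff X (i + 1) v + 0\<^sub>m (cdim X (i + 1 + 2) v) (cdim Y (i + 1) v) * f (i + 1) v = 0\<^sub>m (cdim X (i + 1 + 2) v) (cdim X (i + 1) v)"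
    using c bcD(5)[OF X, of "i + 1" v] by (simp add: mat_ring0 d)
  also have "f (i + 1 + 1) v * - cdiff X (i + 1) v + cdiff Y (i + 1) v * f (i + 1) v = 0\<^sub>m (cdim Y (i + 2) v) (cdim X (i + 1) v)"
    using c chain_mapD(3)[OF f, of "i + 1" v] by (simp add: mat_ring0 d)
  also have "- cdiff X (i + 1 + 1) v * 0\<^sub>m (cdim X (i + 2) v) (cdim Y i v) + 0\<^sub>m (cdim X (i + 1 + 2) v) (cdim Y (i + 1) v) * cdiff Y i v = 0\<^sub>m (cdim X (i + 1 + 2) v) (cdim Y i v)"
    using c by (simp add: mat_ring0 d) (auto simp: add.assoc mat_ring0)
  also have "f (i + 1 + 1) v * 0\<^sub>m (cdim X (i + 2) v) (cdim Y i v) + cdiff Y (i + 1) v * cdiff Y i v = 0\<^sub>m (cdim Y (i + 2) v) (cdim Y i v)"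
    using c bcD(5)[OF Y, of i v] by (simp add: mat_ring0 d) (auto simp: add.assoc mat_ring0)
  finally show "cdiff (mapping_cone X Y f) (i + 1) v * cdiff (mapping_cone X Y f) i v = 0\<^sub>m (cdim (mapping_cone X Y f) (i + 2) v) (cdim (mapping_cone X Y f) i v)"
    by (simp add: add.assoc)
qed

lemma cone_diff_append:
  assumes X: "bounded_cplx G R X" and Y: "bounded_cplx G R Y" and f: "chain_map G X Y f" and "dim_vec x = cdim X (i + 1) v" "dim_vec y = cdim Y i v"
  shows "cdiff (mapping_cone X Y f) i v *\<^sub>v (x @\<^sub>v y) = (- (cdiff X (i + 1) v *\<^sub>v x)) @\<^sub>v (f (i + 1) v *\<^sub>v x + cdiff Y i v *\<^sub>v y)"
proof -
  have c: "- cdiff X (i + 1) v \<in> carrier_mat (cdim X (i + 2) v) (cdim X (i + 1) v)" using bcD(4)[OF X, of "i + 1" v] by (simp add: add.assoc)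
  have "- (cdiff X (i + 1) v *\<^sub>v x) + 0\<^sub>v (cdim X (i + 2) v) = - (cdiff X (i + 1) v *\<^sub>v x)"
    by (rule eq_vecI) (auto simp: bc_dims[OF X] add.assoc)
  then show ?thesis
    using four_block_append[OF c zero_carrier_mat chain_mapD(2)[OF f] bcD(4)[OF Y] assms(4,5)] assms(4,5)
    by (simp add: mapping_cone_def mv_zero_mat neg_mv bc_dims[OF X])
qed

end

section \<open>Short exact sequences of complexes and their cones\<close>

context fin_digraph begin

text \<open>In each degree \<open>r\<close> and \<open>s\<close> are linear splittings, which in
  general commute neither with arrows nor with differentials; they provide explicit lifts for the
  diagram chases.\<close>

definition cses :: "('a \<times> 'b list \<Rightarrow> complex) set \<Rightarrow> ('a, 'b) cplx \<Rightarrow> ('a, 'b) cplx \<Rightarrow> ('a, 'b) cplx \<Rightarrow>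
    (int \<Rightarrow> 'a \<Rightarrow> complex mat) \<Rightarrow> (int \<Rightarrow> 'a \<Rightarrow> complex mat) \<Rightarrow> (int \<Rightarrow> 'a \<Rightarrow> complex mat) \<Rightarrow> (int \<Rightarrow> 'a \<Rightarrow> complex mat) \<Rightarrow> bool" where
  "cses R A B C k p r s \<longleftrightarrow> bounded_cplx G R A \<and> bounded_cplx G R B \<and> bounded_cplx G R C \<and> chain_map G A B k \<and> chain_map G B C p \<and>
     (\<forall>i. sses R (degree_rep A i) (degree_rep B i) (degree_rep C i) (k i) (p i) (r i) (s i))"

lemma csesD:
  assumes "cses R A B C k p r s"
  shows "bounded_cplx G R A" "bounded_cplx G R B" "bounded_cplx G R C" "chain_map G A B k" "chain_map G B C p"
    "sses R (degree_rep A i) (degree_rep B i) (degree_rep C i) (k i) (p i) (r i) (s i)"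
  using assms unfolding cses_def by auto

definition ker_cplx :: "('a, 'b) cplx \<Rightarrow> (int \<Rightarrow> 'a \<Rightarrow> nat) \<Rightarrow> (int \<Rightarrow> 'a \<Rightarrow> complex mat) \<Rightarrow> (int \<Rightarrow> 'a \<Rightarrow> complex mat) \<Rightarrow> ('a, 'b) cplx" where
  "ker_cplx B n k r = \<lparr>cdim = n, cmap = \<lambda>i. rmap (ker_rep (degree_rep B i) (n i) (k i) (r i)),
     cdiff = \<lambda>i v. r (i + 1) v * (cdiff B i v * k i v)\<rparr>"

lemma degree_ker: "degree_rep (ker_cplx B n k r) i = ker_rep (degree_rep B i) (n i) (k i) (r i)"
  by (simp add: degree_rep_def ker_cplx_def ker_rep_def)

lemma ker_cses:
  assumes B: "bounded_cplx G R B" and C: "bounded_cplx G R C" and p: "chain_map G B C p"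
    and s: "\<And>i. sses R (ker_rep (degree_rep B i) (n i) (k i) (r i)) (degree_rep B i) (degree_rep C i) (k i) (p i) (r i) (s i)"
  shows "cses R (ker_cplx B n k r) B C k p r s"
proof -
  let ?A = "ker_cplx B n k r"
  let ?K = "\<lambda>i. ker_rep (degree_rep B i) (n i) (k i) (r i)"
  note kh = ssesD(4)[OF s]
  have kd: "dim_row (k i v) = cdim B i v" "dim_col (k i v) = n i v" for i v using hom_dims[OF kh, of i v] by auto
  have rd: "dim_row (r i v) = n i v" "dim_col (r i v) = cdim B i v" for i v using carrier_matD[OF ssesD(6)[OF s], of i v] by auto
  note pd = chain_mapD(4,5)[OF p]
  note d = kd rd pd bc_dims[OF B] bc_dims[OF C]
  have dk: "rep_hom G (?K i) (degree_rep B (i + 1)) (\<lambda>v. cdiff B i v * k i v)" for i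
    by (rule hom_comp[OF is_rep_shape[OF ssesD(1)[OF s]] bcD(2)[OF B] bcD(2)[OF B] kh bcD(3)[OF B]])
  have z: "p (i + 1) v * (cdiff B i v * k i v) = 0\<^sub>m (rdim (degree_rep C (i + 1)) v) (rdim (?K i) v)" for i v
  proof -
    have "p (i + 1) v * (cdiff B i v * k i v) = (p (i + 1) v * cdiff B i v) * k i v" by (simp add: mat_assoc d)
    also have "\<dots> = cdiff C i v * (p i v * k i v)" unfolding chain_mapD(3)[OF p] by (simp add: mat_assoc d)
    finally show ?thesis unfolding sses_pk[OF s] by (simp add: mat_ring0 d)
  qed
  note f = sses_factor[OF s is_rep_shape[OF ssesD(1)[OF s]] dk z]
  have kdk: "k (i + 1) v * cdiff ?A i v = cdiff B i v * k i v" for i v using f(2)[of i v] by (simp add: ker_cplx_def)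
  have dA: "dim_row (cdiff ?A i v) = n (i + 1) v" "dim_col (cdiff ?A i v) = n i v" for i v by (auto simp: ker_cplx_def d)
  have nB: "n i v \<le> cdim B i v" for i v using sses_rdim[OF s, of i v] by simp
  have A: "bounded_cplx G R ?A" unfolding bounded_cplx_def
  proof (intro conjI allI)
    show "finite {i. \<exists>v. cdim ?A i v \<noteq> 0}"
    proof (rule finite_subset[OF _ bcD(6)[OF B]], rule subsetI)
      fix i assume "i \<in> {i. \<exists>v. cdim ?A i v \<noteq> 0}"
      then obtain v where "n i v \<noteq> 0" by (auto simp: ker_cplx_def)
      then have "cdim B i v \<noteq> 0" using nB[of i v] by simp
      then show "i \<in> {i. \<exists>v. cdim B i v \<noteq> 0}" by blast
    qed
    fix i
    show "is_rep G R (degree_rep ?A i)" unfolding degree_ker by (rule ssesD(1)[OF s])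
    show "rep_hom G (degree_rep ?A i) (degree_rep ?A (i + 1)) (cdiff ?A i)"
      using f(1)[of i] unfolding degree_ker by (simp add: ker_cplx_def)
    fix v
    have "k (i + 1 + 1) v * (cdiff ?A (i + 1) v * cdiff ?A i v) = (k (i + 1 + 1) v * cdiff ?A (i + 1) v) * cdiff ?A i v"
      by (simp add: mat_assoc dA kd)
    also have "\<dots> = cdiff B (i + 1) v * (k (i + 1) v * cdiff ?A i v)" unfolding kdk[of "i + 1" v] by (simp add: mat_assoc dA d)
    also have "\<dots> = cdiff B (i + 1) v * (cdiff B i v * k i v)" by (rule arg_cong[OF kdk])
    also have "\<dots> = (cdiff B (i + 1) v * cdiff B i v) * k i v" by (simp add: mat_assoc d)
    also have "\<dots> = k (i + 1 + 1) v * 0\<^sub>m (n (i + 1 + 1) v) (n i v)" unfolding bcD(5)[OF B] by (simp add: mat_ring0 d add.assoc)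
    finally have e: "k (i + 1 + 1) v * (cdiff ?A (i + 1) v * cdiff ?A i v) = k (i + 1 + 1) v * 0\<^sub>m (n (i + 1 + 1) v) (n i v)" .
    have "cdiff ?A (i + 1) v * cdiff ?A i v = 0\<^sub>m (n (i + 1 + 1) v) (n i v)"
      by (rule mat_cancel_left[OF ssesD(8)[OF s] _ _ _ _ e]) (auto simp: dA d)
    then show "cdiff ?A (i + 1) v * cdiff ?A i v = 0\<^sub>m (cdim ?A (i + 2) v) (cdim ?A i v)" by (simp add: ker_cplx_def add.assoc)
  qed
  have "chain_map G ?A B k" unfolding chain_map_def degree_ker using kh kdk by blast
  then show ?thesis unfolding cses_def degree_ker using A B C p s by blast
qed

lemma chain_map_comp:
  assumes f: "chain_map G X Y f" and g: "chain_map G Y Z g" and X: "bounded_cplx G R X" and Y: "bounded_cplx G R Y" and Z: "bounded_cplx G R Z"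
  shows "chain_map G X Z (\<lambda>i v. g i v * f i v)"
  unfolding chain_map_def
proof (intro conjI allI)
  show "rep_hom G (degree_rep X i) (degree_rep Z i) (\<lambda>v. g i v * f i v)" for i
    by (rule hom_comp[OF bcD(2)[OF X] bcD(2)[OF Y] bcD(2)[OF Z] chain_mapD(1)[OF f] chain_mapD(1)[OF g]])
  fix i v
  note d = bc_dims[OF X] bc_dims[OF Y] bc_dims[OF Z] chain_mapD(4,5)[OF f] chain_mapD(4,5)[OF g]
  have "g (i + 1) v * f (i + 1) v * cdiff X i v = g (i + 1) v * (f (i + 1) v * cdiff X i v)" by (simp add: mat_assoc d)
  also have "\<dots> = (g (i + 1) v * cdiff Y i v) * f i v" unfolding chain_mapD(3)[OF f] by (simp add: mat_assoc d)
  also have "\<dots> = cdiff Z i v * (g i v * f i v)" unfolding chain_mapD(3)[OF g] by (simp add: mat_assoc d)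
  finally show "g (i + 1) v * f (i + 1) v * cdiff X i v = cdiff Z i v * (g i v * f i v)" .
qed

text \<open>With \<open>A' = A\<close> this compares the cone of an injection with its cokernel.
  Replacing \<open>A\<close> by a quasi-isomorphic \<open>A'\<close> is built into the same diagram
  chase, so that a resolution of the kernel can be spliced in without long exact sequences.\<close>

lemma cone_quasi_iso:
  assumes S: "cses R A B C k p r s" and A': "bounded_cplx G R A'" and \<rho>: "quasi_iso_map G A' A \<rho>"
  defines "f \<equiv> \<lambda>i v. k i v * \<rho> i v"
  shows "bounded_cplx G R (mapping_cone A' B f)"
    and "quasi_iso_map G (mapping_cone A' B f) C (\<lambda>i v. p i v * prj2 (cdim A' (i + 1) v) (cdim B i v))"
proof -
  note A = csesD(1)[OF S] and B = csesD(2)[OF S] and C = csesD(3)[OF S] and k = csesD(4)[OF S] and p = csesD(5)[OF S]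
  note ss = csesD(6)[OF S]
  have rc: "chain_map G A' A \<rho>" using \<rho> unfolding quasi_iso_map_def by blast
  have f: "chain_map G A' B f" unfolding f_def by (rule chain_map_comp[OF rc k A' A B])
  show cb: "bounded_cplx G R (mapping_cone A' B f)" by (rule cone_bounded[OF A' B f])
  have rd: "dim_row (r i v) = cdim A i v" "dim_col (r i v) = cdim B i v" for i v using carrier_matD[OF ssesD(6)[OF ss], of i v] by auto
  have sd: "dim_row (s i v) = cdim B i v" "dim_col (s i v) = cdim C i v" for i v using carrier_matD[OF ssesD(7)[OF ss], of i v] by auto
  note d = rd sd bc_dims[OF A'] bc_dims[OF A] bc_dims[OF B] bc_dims[OF C] chain_mapD(4,5)[OF k] chain_mapD(4,5)[OF p] chain_mapD(4,5)[OF rc] chain_mapD(4,5)[OF f] bc_dims[OF cb]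
  have krs: "k i v *\<^sub>v (r i v *\<^sub>v b) = b" if "dim_vec b = cdim B i v" "p i v *\<^sub>v b = 0\<^sub>v (cdim C i v)" for i v b
  proof -
    have "b = (k i v * r i v + s i v * p i v) *\<^sub>v b" using that ssesD(10)[OF ss, of i v] by (simp add: mv_one)
    also have "\<dots> = k i v *\<^sub>v (r i v *\<^sub>v b) + s i v *\<^sub>v (p i v *\<^sub>v b)"
      using that by (subst add_mult_distrib_mat_vec[of _ "cdim B i v" "cdim B i v"]) (auto simp: d mv_assoc intro!: carrier_matI carrier_vecI)
    also have "\<dots> = k i v *\<^sub>v (r i v *\<^sub>v b)" using that by (simp add: mat_mult_zero_vec d) (rule eq_vecI, auto simp: d)
    finally show ?thesis by simp
  qed
  have ps: "p i v *\<^sub>v (s i v *\<^sub>v c) = c" if "dim_vec c = cdim C i v" for i v c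
    using that ssesD(9)[OF ss, of i v] by (simp add: mv_assoc[symmetric] d mv_one)
  have kinj: "x = y" if "dim_vec x = cdim A i v" "dim_vec y = cdim A i v" "k i v *\<^sub>v x = k i v *\<^sub>v y" for i v x y
    by (rule vec_cancel_left[OF ssesD(8)[OF ss] _ _ _ _ that(3)]) (use that in \<open>auto simp: d\<close>)
  have pk: "p i v *\<^sub>v (k i v *\<^sub>v x) = 0\<^sub>v (cdim C i v)" if "dim_vec x = cdim A i v" for i v x
    using that sses_pk[OF ss, of i v] by (simp add: mv_assoc[symmetric] d mv_zero_mat)
  have fv: "f i v *\<^sub>v x = k i v *\<^sub>v (\<rho> i v *\<^sub>v x)" if "dim_vec x = cdim A' i v" for i v x
    using that unfolding f_def by (simp add: mv_assoc d)
  let ?q = "\<lambda>i v. p i v * prj2 (cdim A' (i + 1) v) (cdim B i v)"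
  have qv: "?q i v *\<^sub>v (x @\<^sub>v b) = p i v *\<^sub>v b" if "dim_vec x = cdim A' (i + 1) v" "dim_vec b = cdim B i v" for i v x b
    using that by (simp add: mv_assoc d prj_append)
  have "chain_map G (mapping_cone A' B f) C ?q" unfolding chain_map_def
  proof (intro conjI allI)
    fix i
    note h = dsum_homs(4)[OF bcD(2)[OF A', of "i + 1"] bcD(2)[OF B, of i]]
    show "rep_hom G (degree_rep (mapping_cone A' B f) i) (degree_rep C i) (?q i)"
      unfolding degree_cone
      using hom_comp[OF dsum_shape[OF bcD(2)[OF A', of "i + 1"] bcD(2)[OF B, of i]] bcD(2)[OF B] bcD(2)[OF C] h chain_mapD(1)[OF p]] by simp
    fix v
    have c: "- cdiff A' (i + 1) v \<in> carrier_mat (cdim A' (i + 2) v) (cdim A' (i + 1) v)" using bcD(4)[OF A', of "i + 1" v] by (simp add: add.assoc)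
    have "?q (i + 1) v * cdiff (mapping_cone A' B f) i v = p (i + 1) v * (prj2 (cdim A' (i + 2) v) (cdim B (i + 1) v) * cdiff (mapping_cone A' B f) i v)"
      by (subst mat_assoc) (auto simp: d add.assoc)
    also have "\<dots> = p (i + 1) v * (f (i + 1) v * prj1 (cdim A' (i + 1) v) (cdim B i v) + cdiff B i v * prj2 (cdim A' (i + 1) v) (cdim B i v))"
      using four_block_inc(4)[OF c zero_carrier_mat[of _ "cdim B i v"] chain_mapD(2)[OF f, of "i + 1" v] bcD(4)[OF B, of i v]] by (simp add: mapping_cone_def)
    also have "\<dots> = (p (i + 1) v * f (i + 1) v) * prj1 (cdim A' (i + 1) v) (cdim B i v) + (p (i + 1) v * cdiff B i v) * prj2 (cdim A' (i + 1) v) (cdim B i v)"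
      by (simp add: mat_ring d)
    also have "p (i + 1) v * f (i + 1) v = 0\<^sub>m (cdim C (i + 1) v) (cdim A' (i + 1) v)"
      unfolding f_def using sses_pk[OF ss, of "i + 1" v] by (simp add: mat_assoc[symmetric] d mat_ring0)
    also have "0\<^sub>m (cdim C (i + 1) v) (cdim A' (i + 1) v) * prj1 (cdim A' (i + 1) v) (cdim B i v) + (p (i + 1) v * cdiff B i v) * prj2 (cdim A' (i + 1) v) (cdim B i v)
       = cdiff C i v * ?q i v" unfolding chain_mapD(3)[OF p] by (simp add: mat_ring d)
    finally show "?q (i + 1) v * cdiff (mapping_cone A' B f) i v = cdiff C i v * ?q i v" .
  qed
  then show "quasi_iso_map G (mapping_cone A' B f) C ?q" unfolding quasi_iso_map_def
  proof (intro conjI allI ballI impI)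
    fix i v z assume z: "z \<in> cycles (mapping_cone A' B f) i v" "?q i v *\<^sub>v z \<in> boundaries C i v"
    note zz = cyclesD[OF z(1), unfolded d]
    have "z \<in> carrier_vec (cdim A' (i + 1) v + cdim B i v)" using zz by (auto intro!: carrier_vecI)
    then obtain x b where xb: "z = x @\<^sub>v b" "dim_vec x = cdim A' (i + 1) v" "dim_vec b = cdim B i v" by (rule vec_split)
    have "(- (cdiff A' (i + 1) v *\<^sub>v x)) @\<^sub>v (f (i + 1) v *\<^sub>v x + cdiff B i v *\<^sub>v b) = 0\<^sub>v (cdim A' (i + 2) v + cdim B (i + 1) v)"
      using zz xb cone_diff_append[OF A' B f xb(2,3)] by (simp add: add.assoc)
    from append_vec_zeroD[OF this] have "- (cdiff A' (i + 1) v *\<^sub>v x) = 0\<^sub>v (cdim A' (i + 2) v)" "f (i + 1) v *\<^sub>v x + cdiff B i v *\<^sub>v b = 0\<^sub>v (cdim B (i + 1) v)"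
      by (auto simp: d add.assoc)
    then have dx: "cdiff A' (i + 1) v *\<^sub>v x = 0\<^sub>v (cdim A' (i + 2) v)" and kb: "f (i + 1) v *\<^sub>v x + cdiff B i v *\<^sub>v b = 0\<^sub>v (cdim B (i + 1) v)"
      by (metis uminus_uminus_vec uminus_zero_vec, simp)
    have xcyc: "x \<in> cycles A' (i + 1) v" using dx xb by (intro cyclesI) (auto simp: d add.assoc)
    \<comment> \<open>To correct \<open>b\<close> by a boundary, lift the primitive \<open>c\<close>
      of its image to \<open>b0\<close>. The remainder \<open>y\<close> is then killed by
      \<open>p\<close> and comes from an element \<open>a\<close> of \<open>A\<close>.\<close>
    obtain c where c: "dim_vec c = cdim C (i - 1) v" "p i v *\<^sub>v b = cdiff C (i - 1) v *\<^sub>v c"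
      using z(2) unfolding xb(1) qv[OF xb(2,3)] by (elim boundariesE) (auto simp: d)
    define b0 where "b0 = s (i - 1) v *\<^sub>v c"
    have b0: "dim_vec b0 = cdim B (i - 1) v" by (simp add: b0_def d)
    have pb0: "p i v *\<^sub>v (cdiff B (i - 1) v *\<^sub>v b0) = p i v *\<^sub>v b"
      using chain_map_vec[OF p B C b0] ps[OF c(1)] c(2) by (simp add: b0_def)
    define y where "y = b - cdiff B (i - 1) v *\<^sub>v b0"
    have y: "dim_vec y = cdim B i v" by (simp add: y_def d)
    have "p i v *\<^sub>v y = 0\<^sub>v (cdim C i v)" unfolding y_def using xb(3) b0 pb0 by (subst mv_diff) (auto simp: d)
    then have ka: "k i v *\<^sub>v (r i v *\<^sub>v y) = y" by (rule krs[OF y])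
    define a where "a = r i v *\<^sub>v y"
    have a: "dim_vec a = cdim A i v" by (simp add: a_def d)
    have dBy: "cdiff B i v *\<^sub>v y = cdiff B i v *\<^sub>v b"
    proof -
      have "cdiff B i v *\<^sub>v y = cdiff B i v *\<^sub>v b - cdiff B i v *\<^sub>v (cdiff B (i - 1) v *\<^sub>v b0)"
        unfolding y_def using xb(3) b0 by (intro mv_diff) (auto simp: d)
      also have "\<dots> = cdiff B i v *\<^sub>v b" unfolding bc_dd_vec'[OF B b0] by (rule eq_vecI) (auto simp: d)
      finally show ?thesis .
    qed
    have "k (i + 1) v *\<^sub>v (cdiff A i v *\<^sub>v a) = cdiff B i v *\<^sub>v b"
      using chain_map_vec[OF k A B a] ka dBy by (simp add: a_def)
    also have "\<dots> = - (f (i + 1) v *\<^sub>v x)"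
    proof (rule eq_vecI)
      fix j assume "j < dim_vec (- (f (i + 1) v *\<^sub>v x))"
      then have j: "j < cdim B (i + 1) v" by (simp add: d)
      have "(f (i + 1) v *\<^sub>v x + cdiff B i v *\<^sub>v b) $ j = 0" using kb j by simp
      then show "(cdiff B i v *\<^sub>v b) $ j = (- (f (i + 1) v *\<^sub>v x)) $ j" using j by (simp add: d eq_neg_iff_add_eq_0 add.commute)
    qed (simp add: d)
    also have "\<dots> = k (i + 1) v *\<^sub>v (\<rho> (i + 1) v *\<^sub>v (- x))" using xb(2) by (simp add: fv mv_neg d)
    finally have e: "k (i + 1) v *\<^sub>v (cdiff A i v *\<^sub>v a) = k (i + 1) v *\<^sub>v (\<rho> (i + 1) v *\<^sub>v (- x))" .
    have "cdiff A i v *\<^sub>v a = \<rho> (i + 1) v *\<^sub>v (- x)" by (rule kinj[OF _ _ e]) (auto simp: d)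
    then have da: "cdiff A i v *\<^sub>v a = - (\<rho> (i + 1) v *\<^sub>v x)" using xb(2) by (simp add: mv_neg d)
    \<comment> \<open>So the image of \<open>x\<close> is a boundary in \<open>A\<close>;
      injectivity of \<open>\<rho>\<close> on homology makes \<open>x\<close> the boundary of some
      \<open>a1\<close> in \<open>A'\<close>.\<close>
    have "\<rho> (i + 1) v *\<^sub>v x = cdiff A i v *\<^sub>v (- a)" using a da by (simp add: mv_neg d)
    then have "\<rho> (i + 1) v *\<^sub>v x \<in> boundaries A (i + 1) v" using boundariesI[of "- a" A "i + 1" v] a by (simp add: d)
    then have "x \<in> boundaries A' (i + 1) v" using \<rho> xcyc unfolding quasi_iso_map_def by blast
    then obtain a1 where a1: "dim_vec a1 = cdim A' i v" "x = cdiff A' i v *\<^sub>v a1" by (elim boundariesE) (auto simp: d)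
    \<comment> \<open>The sum of \<open>a\<close> and the image of \<open>a1\<close> is a cycle,
      hence homologous to the image of a cycle \<open>z'\<close> by surjectivity of
      \<open>\<rho>\<close> on homology.\<close>
    have "cdiff A i v *\<^sub>v (a + \<rho> i v *\<^sub>v a1) = cdiff A i v *\<^sub>v a + cdiff A i v *\<^sub>v (\<rho> i v *\<^sub>v a1)"
      using a a1 by (intro mv_add) (auto simp: d)
    also have "cdiff A i v *\<^sub>v (\<rho> i v *\<^sub>v a1) = \<rho> (i + 1) v *\<^sub>v x" using chain_map_vec[OF rc A' A a1(1)] a1(2) by simp
    also have "cdiff A i v *\<^sub>v a + \<rho> (i + 1) v *\<^sub>v x = 0\<^sub>v (cdim A (i + 1) v)" unfolding da by (rule eq_vecI) (auto simp: d)
    finally have "a + \<rho> i v *\<^sub>v a1 \<in> cycles A i v" using a by (intro cyclesI) (auto simp: d)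
    then obtain z' where z': "z' \<in> cycles A' i v" "(a + \<rho> i v *\<^sub>v a1) - \<rho> i v *\<^sub>v z' \<in> boundaries A i v"
      using \<rho> unfolding quasi_iso_map_def by blast
    note zc = cyclesD[OF z'(1), unfolded d]
    obtain y' where y': "dim_vec y' = cdim A (i - 1) v" "(a + \<rho> i v *\<^sub>v a1) - \<rho> i v *\<^sub>v z' = cdiff A (i - 1) v *\<^sub>v y'"
      using z'(2) by (elim boundariesE) (auto simp: d)
    \<comment> \<open>The coordinates of a primitive of \<open>(x, b)\<close> in the cone:
      \<open>z'\<close> and \<open>y'\<close> account for the cycle just found, \<open>b0\<close>
      for the correction of \<open>b\<close>.\<close>
    let ?x = "z' - a1" and ?b = "b0 + k (i - 1) v *\<^sub>v y'"
    have 1: "- (cdiff A' i v *\<^sub>v ?x) = x"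
    proof -
      have "cdiff A' i v *\<^sub>v ?x = 0\<^sub>v (cdim A' (i + 1) v) - x" using zc a1 by (subst mv_diff) (auto simp: d)
      then show ?thesis using xb(2) by (auto intro!: eq_vecI)
    qed
    have 2: "f i v *\<^sub>v ?x + cdiff B (i - 1) v *\<^sub>v ?b = b"
    proof -
      have "f i v *\<^sub>v ?x = k i v *\<^sub>v (\<rho> i v *\<^sub>v z') - k i v *\<^sub>v (\<rho> i v *\<^sub>v a1)" using zc a1 by (simp add: fv mv_diff d)
      moreover have "cdiff B (i - 1) v *\<^sub>v ?b = cdiff B (i - 1) v *\<^sub>v b0 + k i v *\<^sub>v (cdiff A (i - 1) v *\<^sub>v y')"
        using chain_map_vec[OF k A B y'(1)] b0 y'(1) by (subst mv_add) (auto simp: d)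
      moreover have "k i v *\<^sub>v (cdiff A (i - 1) v *\<^sub>v y') = (k i v *\<^sub>v a + k i v *\<^sub>v (\<rho> i v *\<^sub>v a1)) - k i v *\<^sub>v (\<rho> i v *\<^sub>v z')"
        unfolding y'(2)[symmetric] using a by (simp add: mv_diff mv_add d)
      moreover have "k i v *\<^sub>v a = b - cdiff B (i - 1) v *\<^sub>v b0" using ka unfolding a_def y_def .
      ultimately show ?thesis using xb(3) by (intro eq_vecI) (auto simp: d)
    qed
    have "cdiff (mapping_cone A' B f) (i - 1) v *\<^sub>v (?x @\<^sub>v ?b) = x @\<^sub>v b"
      using cone_diff_append[OF A' B f, of ?x "i - 1" v ?b] 1 2 zc a1 b0 by (simp add: d)
    then show "z \<in> boundaries (mapping_cone A' B f) i v"
      unfolding xb(1) using boundariesI[of "?x @\<^sub>v ?b" "mapping_cone A' B f" i v] a1 by (simp add: d)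
  next
    fix i v c assume c: "c \<in> cycles C i v"
    note cc = cyclesD[OF c, unfolded d]
    \<comment> \<open>Lift \<open>c\<close> to \<open>b\<close>. Its differential comes from a cycle
      \<open>a\<close> of \<open>A\<close>, which is homologous to the image of a cycle
      \<open>x\<close> of \<open>A'\<close>; with \<open>y\<close> witnessing this,
      \<open>- x\<close> and \<open>b - k y\<close> form a cycle of the cone over
      \<open>c\<close>.\<close>
    define b where "b = s i v *\<^sub>v c"
    have b: "dim_vec b = cdim B i v" by (simp add: b_def d)
    have pb: "p i v *\<^sub>v b = c" using ps cc unfolding b_def by blast
    have "p (i + 1) v *\<^sub>v (cdiff B i v *\<^sub>v b) = 0\<^sub>v (cdim C (i + 1) v)" using chain_map_vec[OF p B C b] pb cc by simp
    then have ka: "k (i + 1) v *\<^sub>v (r (i + 1) v *\<^sub>v (cdiff B i v *\<^sub>v b)) = cdiff B i v *\<^sub>v b" by (intro krs) (auto simp: d)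
    define a where "a = r (i + 1) v *\<^sub>v (cdiff B i v *\<^sub>v b)"
    have a: "dim_vec a = cdim A (i + 1) v" by (simp add: a_def d)
    have "k (i + 1 + 1) v *\<^sub>v (cdiff A (i + 1) v *\<^sub>v a) = 0\<^sub>v (cdim B (i + 2) v)"
      using chain_map_vec[OF k A B a] ka bc_dd_vec[OF B b] by (simp add: a_def)
    also have "\<dots> = k (i + 1 + 1) v *\<^sub>v 0\<^sub>v (cdim A (i + 1 + 1) v)" by (simp add: mat_mult_zero_vec d add.assoc)
    finally have e: "k (i + 1 + 1) v *\<^sub>v (cdiff A (i + 1) v *\<^sub>v a) = k (i + 1 + 1) v *\<^sub>v 0\<^sub>v (cdim A (i + 1 + 1) v)" .
    have "cdiff A (i + 1) v *\<^sub>v a = 0\<^sub>v (cdim A (i + 1 + 1) v)" by (rule kinj[OF _ _ e]) (auto simp: d)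
    then have "a \<in> cycles A (i + 1) v" using a by (intro cyclesI) (auto simp: d)
    then obtain x where x: "x \<in> cycles A' (i + 1) v" "a - \<rho> (i + 1) v *\<^sub>v x \<in> boundaries A (i + 1) v" using \<rho> unfolding quasi_iso_map_def by blast
    note xx = cyclesD[OF x(1), unfolded d]
    obtain y where y: "dim_vec y = cdim A i v" "a - \<rho> (i + 1) v *\<^sub>v x = cdiff A i v *\<^sub>v y" using x(2) by (elim boundariesE) (auto simp: d)
    let ?z = "(- x) @\<^sub>v (b - k i v *\<^sub>v y)"
    have 1: "- (cdiff A' (i + 1) v *\<^sub>v (- x)) = 0\<^sub>v (cdim A' (i + 2) v)" using xx by (simp add: mv_neg d add.assoc)
    have 2: "f (i + 1) v *\<^sub>v (- x) + cdiff B i v *\<^sub>v (b - k i v *\<^sub>v y) = 0\<^sub>v (cdim B (i + 1) v)"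
    proof -
      have "f (i + 1) v *\<^sub>v (- x) = - (k (i + 1) v *\<^sub>v (\<rho> (i + 1) v *\<^sub>v x))" using xx by (simp add: fv mv_neg d)
      moreover have "cdiff B i v *\<^sub>v (b - k i v *\<^sub>v y) = k (i + 1) v *\<^sub>v a - k (i + 1) v *\<^sub>v (cdiff A i v *\<^sub>v y)"
        using chain_map_vec[OF k A B y(1)] ka b y(1) by (subst mv_diff) (auto simp: d a_def)
      moreover have "k (i + 1) v *\<^sub>v (cdiff A i v *\<^sub>v y) = k (i + 1) v *\<^sub>v a - k (i + 1) v *\<^sub>v (\<rho> (i + 1) v *\<^sub>v x)"
        unfolding y(2)[symmetric] using a by (simp add: mv_diff d)
      ultimately show ?thesis by (intro eq_vecI) (auto simp: d)
    qed
    have "cdiff (mapping_cone A' B f) i v *\<^sub>v ?z = 0\<^sub>v (cdim A' (i + 2) v + cdim B (i + 1) v)"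
      using cone_diff_append[OF A' B f, of "- x" i v "b - k i v *\<^sub>v y"] 1 2 xx b y by (simp add: d append_zero_vec)
    then have zc: "?z \<in> cycles (mapping_cone A' B f) i v" using xx b y by (intro cyclesI) (auto simp: d add.assoc)
    have "?q i v *\<^sub>v ?z = c - p i v *\<^sub>v (k i v *\<^sub>v y)"
      using xx b y by (subst qv) (auto simp: d mv_diff pb)
    also have "\<dots> = c" unfolding pk[OF y(1)] using cc by (auto intro!: eq_vecI)
    finally have "c - ?q i v *\<^sub>v ?z = 0\<^sub>v (cdim C i v)" using cc by auto
    then have "c - ?q i v *\<^sub>v ?z \<in> boundaries C i v" using zero_in_boundaries[OF C] by simp
    then show "\<exists>z\<in>cycles (mapping_cone A' B f) i v. c - ?q i v *\<^sub>v z \<in> boundaries C i v" using zc by blast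
  qed
qed

end

subsection \<open>A functorial resolution\<close>

context bound_quiver begin

definition cFr :: "('v, 'a) cplx \<Rightarrow> ('v, 'a) cplx" where
  "cFr X = \<lparr>cdim = \<lambda>i. fdim (cdim X i), cmap = \<lambda>i. rmap (Fr (cdim X i)), cdiff = \<lambda>i. FrM (cdim X i) (cdim X (i + 1)) (cdiff X i)\<rparr>"

definition cK :: "('v, 'a) cplx \<Rightarrow> ('v, 'a) cplx" where
  "cK X = ker_cplx (cFr X) (\<lambda>i. kdim (cdim X i)) (\<lambda>i. kk (degree_rep X i)) (\<lambda>i. rr (cdim X i))"

lemma degree_cFr: "degree_rep (cFr X) i = Fr (cdim X i)"
  by (simp add: degree_rep_def cFr_def Fr_def)

lemma degree_cK: "degree_rep (cK X) i = KV (degree_rep X i)"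
  by (simp add: cK_def degree_ker degree_cFr KV_def)

lemma cdim_cFr[simp]: "cdim (cFr X) i = fdim (cdim X i)" by (simp add: cFr_def)
lemma cdim_cK[simp]: "cdim (cK X) i = kdim (cdim X i)" by (simp add: cK_def ker_cplx_def)

lemma fdim_zero: "(\<And>v. d v = 0) \<Longrightarrow> fdim d w = 0" by (simp add: fdim_sum)

lemma cFr_bounded:
  assumes X: "bounded_cplx Q R X"
  shows "bounded_cplx Q R (cFr X)"
  unfolding bounded_cplx_def
proof (intro conjI allI)
  show "finite {i. \<exists>v. cdim (cFr X) i v \<noteq> 0}"
    by (rule finite_subset[OF _ bcD(6)[OF X]]) (auto dest: fdim_zero[rotated] intro: ccontr simp: fdim_zero)
  fix i
  show "is_rep Q R (degree_rep (cFr X) i)" unfolding degree_cFr by (rule Fr_rep)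
  show "rep_hom Q (degree_rep (cFr X) i) (degree_rep (cFr X) (i + 1)) (cdiff (cFr X) i)"
    unfolding degree_cFr using FrM_hom[OF bcD(4)[OF X]] by (simp add: cFr_def)
  fix v
  have "cdiff (cFr X) (i + 1) v * cdiff (cFr X) i v = FrM (cdim X i) (cdim X (i + 1 + 1)) (\<lambda>v. cdiff X (i + 1) v * cdiff X i v) v"
    unfolding cFr_def using FrM_comp[OF bcD(4)[OF X, of i] bcD(4)[OF X, of "i + 1"]] by simp
  also have "(\<lambda>v. cdiff X (i + 1) v * cdiff X i v) = (\<lambda>v. 0\<^sub>m (cdim X (i + 1 + 1) v) (cdim X i v))"
    using bcD(5)[OF X, of i] by (auto simp: add.assoc)
  finally show "cdiff (cFr X) (i + 1) v * cdiff (cFr X) i v = 0\<^sub>m (cdim (cFr X) (i + 2) v) (cdim (cFr X) i v)"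
    unfolding FrM_zero by (simp add: add.assoc)
qed

lemma cev_chain:
  assumes X: "bounded_cplx Q R X"
  shows "chain_map Q (cFr X) X (\<lambda>i. ev (degree_rep X i))"
  unfolding chain_map_def
proof (intro conjI allI)
  fix i v
  show "rep_hom Q (degree_rep (cFr X) i) (degree_rep X i) (ev (degree_rep X i))"
    unfolding degree_cFr using ev_hom[OF bcD(1)[OF X, of i]] by simp
  show "ev (degree_rep X (i + 1)) v * cdiff (cFr X) i v = cdiff X i v * ev (degree_rep X i) v"
    using ev_natural[OF bcD(1)[OF X] bcD(1)[OF X] bcD(3)[OF X], of i v] by (simp add: cFr_def)
qed

lemma cK_cses:
  assumes X: "bounded_cplx Q R X"
  shows "cses R (cK X) (cFr X) X (\<lambda>i. kk (degree_rep X i)) (\<lambda>i. ev (degree_rep X i)) (\<lambda>i. rr (cdim X i)) (\<lambda>i. fs (cdim X i))"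
  unfolding cK_def
proof (rule ker_cses[OF cFr_bounded[OF X] X cev_chain[OF X]])
  fix i
  show "sses R (ker_rep (degree_rep (cFr X) i) (kdim (cdim X i)) (kk (degree_rep X i)) (rr (cdim X i))) (degree_rep (cFr X) i) (degree_rep X i)
    (kk (degree_rep X i)) (ev (degree_rep X i)) (rr (cdim X i)) (fs (cdim X i))"
    using KV_sses[OF bcD(1)[OF X, of i]] unfolding degree_cFr by (simp add: KV_def)
qed

text \<open>The second component is the quasi-isomorphism from the resolution to \<open>X\<close>.\<close>

primrec RR :: "nat \<Rightarrow> ('v, 'a) cplx \<Rightarrow> ('v, 'a) cplx \<times> (int \<Rightarrow> 'v \<Rightarrow> complex mat)" where
  "RR 0 X = (X, \<lambda>i v. 1\<^sub>m (cdim X i v))"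
| "RR (Suc n) X = (mapping_cone (fst (RR n (cK X))) (cFr X) (\<lambda>i v. kk (degree_rep X i) v * snd (RR n (cK X)) i v),
     \<lambda>i v. ev (degree_rep X i) v * prj2 (cdim (fst (RR n (cK X))) (i + 1) v) (fdim (cdim X i) v))"

lemma RR_quasi_iso:
  assumes "bounded_cplx Q R X"
  shows "bounded_cplx Q R (fst (RR n X)) \<and> quasi_iso_map Q (fst (RR n X)) X (snd (RR n X))"
  using assms
proof (induction n arbitrary: X)
  case 0 then show ?case using quasi_iso_refl[OF 0] by simp
next
  case (Suc n)
  note S = cK_cses[OF Suc.prems]
  from Suc.IH[OF csesD(1)[OF S]] have IH: "bounded_cplx Q R (fst (RR n (cK X)))" "quasi_iso_map Q (fst (RR n (cK X))) (cK X) (snd (RR n (cK X)))" by auto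
  from cone_quasi_iso[OF S IH] show ?case by simp
qed

text \<open>Unfolding the cones, the term in degree \<open>i\<close> is the \<open>n\<close>-th
  syzygy of the term of \<open>X\<close> in degree \<open>i + n\<close> plus modules of the form
  \<open>Fr\<close>.\<close>

lemma RR_projective:
  assumes "\<And>i. projective_rep Q R (Kn n (degree_rep X i))"
  shows "projective_rep Q R (degree_rep (fst (RR n X)) i)"
  using assms
proof (induction n arbitrary: X i)
  case (Suc n)
  have "projective_rep Q R (degree_rep (fst (RR n (cK X))) (i + 1))"
    by (rule Suc.IH) (use Suc.prems in \<open>simp add: degree_cK\<close>)
  then show ?case using projective_dsum[OF _ Fr_projective] by (simp add: degree_cone degree_cFr)
qed simp

primrec rdims :: "nat \<Rightarrow> (int \<Rightarrow> 'v \<Rightarrow> nat) \<Rightarrow> int \<Rightarrow> 'v \<Rightarrow> nat" where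
  "rdims 0 dd = dd"
| "rdims (Suc n) dd = (\<lambda>i v. rdims n (\<lambda>i. kdim (dd i)) (i + 1) v + fdim (dd i) v)"

lemma RR_cdim: "cdim (fst (RR n X)) = rdims n (cdim X)"
proof (induction n arbitrary: X)
  case (Suc n)
  have "cdim (cK X) = (\<lambda>i. kdim (cdim X i))" by auto
  then show ?case using Suc.IH[of "cK X"] by (auto simp: mapping_cone_def)
qed simp

text \<open>\<open>kdim\<close> is a truncated difference; it is additive because \<open>d\<close>
  is at most \<open>fdim d\<close> when \<open>d\<close> vanishes off the quiver.\<close>

lemma kdim_add:
  assumes "\<And>w. w \<notin> verts Q \<Longrightarrow> d w = 0" "\<And>w. w \<notin> verts Q \<Longrightarrow> d' w = 0"
  shows "kdim (\<lambda>v. d v + d' v) w = kdim d w + kdim d' w"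
proof -
  have f: "fdim (\<lambda>v. d v + d' v) w = fdim d w + fdim d' w" by (simp add: fdim_sum distrib_left sum.distrib)
  have "fdim d w = kdim d w + d w" "fdim d' w = kdim d' w + d' w" using jr_props(5) assms by blast+
  then show ?thesis using f by (simp add: kdim_def)
qed

lemma kdim_outside: "w \<notin> verts Q \<Longrightarrow> kdim d w = 0" by (simp add: kdim_def fdim_outside)

text \<open>The source of the additivity of types: each stage of the resolution is additive in the
  dimensions.\<close>

lemma rdims_add:
  assumes "\<And>i w. w \<notin> verts Q \<Longrightarrow> dd i w = 0" "\<And>i w. w \<notin> verts Q \<Longrightarrow> dd' i w = 0"
  shows "rdims n (\<lambda>i v. dd i v + dd' i v) i w = rdims n dd i w + rdims n dd' i w"
  using assms
proof (induction n arbitrary: dd dd' i w)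
  case (Suc n)
  have e: "(\<lambda>i. kdim (\<lambda>v. dd i v + dd' i v)) = (\<lambda>i v. kdim (dd i) v + kdim (dd' i) v)"
    using kdim_add Suc.prems by blast
  have "rdims n (\<lambda>i v. kdim (dd i) v + kdim (dd' i) v) (i + 1) w = rdims n (\<lambda>i. kdim (dd i)) (i + 1) w + rdims n (\<lambda>i. kdim (dd' i)) (i + 1) w"
    by (rule Suc.IH) (auto simp: kdim_outside)
  then show ?case by (simp add: e fdim_sum distrib_left sum.distrib)
qed simp

end

section \<open>The relations of the Grothendieck group\<close>

context bound_quiver begin

abbreviation "FG \<equiv> free_Abelian_group (Collect (bounded_cplx Q R))"
abbreviation "rel \<equiv> K0_relations Q R"

lemma rel_subgroup: "subgroup rel FG"
proof -
  have "group FG" by (rule group_free_Abelian_group)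
  moreover have "{frag_of Y - frag_of X - frag_of Z | X Y Z. bounded_cplx Q R X \<and> bounded_cplx Q R Y \<and> bounded_cplx Q R Z \<and> triangle_vertices Q R X Y Z} \<subseteq> carrier FG"
  proof safe
    fix X Y Z assume *: "bounded_cplx Q R X" "bounded_cplx Q R Y" "bounded_cplx Q R Z"
    have "Poly_Mapping.keys (frag_of Y - frag_of X - frag_of Z) \<subseteq> {X, Y, Z}"
      using keys_diff[of "frag_of Y - frag_of X" "frag_of Z"] keys_diff[of "frag_of Y" "frag_of X"] by auto
    then show "frag_of Y - frag_of X - frag_of Z \<in> carrier FG" using * by (auto simp: free_Abelian_group_def)
  qed
  ultimately show ?thesis unfolding K0_relations_def by (intro group.generate_is_subgroup)
qed

lemma rel_add: "a \<in> rel \<Longrightarrow> b \<in> rel \<Longrightarrow> a + b \<in> rel"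
  using subgroup.m_closed[OF rel_subgroup, of a b] by simp

lemma rel_neg: "a \<in> rel \<Longrightarrow> - a \<in> rel"
  using subgroup.m_inv_closed[OF rel_subgroup, of a] subgroup.mem_carrier[OF rel_subgroup, of a] by simp

lemma rel_zero: "0 \<in> rel"
  using subgroup.one_closed[OF rel_subgroup] by simp

lemma rel_diff: "a \<in> rel \<Longrightarrow> b \<in> rel \<Longrightarrow> a - b \<in> rel"
  using rel_add[OF _ rel_neg, of a b] by simp

lemma triangle_rel:
  assumes "bounded_cplx Q R X" "bounded_cplx Q R Y" "bounded_cplx Q R Z" "triangle_vertices Q R X Y Z"
  shows "frag_of Y - frag_of X - frag_of Z \<in> rel"
  unfolding K0_relations_def using assms by (intro generate.incl) blast

text \<open>The cone \<open>Z\<close> of the identity of \<open>X\<close> completes a triangle from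
  \<open>X\<close> to \<open>X\<close> and, through the quasi-isomorphism, one from \<open>Y\<close>
  to \<open>X\<close>. Subtracting the two relations leaves \<open>X - Y\<close>.\<close>

lemma qis_rel:
  assumes X: "bounded_cplx Q R X" and Y: "bounded_cplx Q R Y" and q: "quasi_isomorphic Q R X Y"
  shows "frag_of X - frag_of Y \<in> rel"
proof -
  let ?f = "\<lambda>i v. 1\<^sub>m (cdim X i v)"
  let ?Z = "mapping_cone X X ?f"
  have f: "chain_map Q X X ?f" using quasi_iso_refl[OF X] unfolding quasi_iso_map_def by blast
  have Z: "bounded_cplx Q R ?Z" by (rule cone_bounded[OF X X f])
  have t: "triangle_vertices Q R X' X ?Z" if "quasi_isomorphic Q R X' X" for X'
    unfolding triangle_vertices_def using X f that qis_refl by blast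
  have "frag_of X - frag_of Y - frag_of ?Z \<in> rel" by (rule triangle_rel[OF Y X Z t[OF qis_sym[OF q]]])
  moreover have "frag_of X - frag_of X - frag_of ?Z \<in> rel" by (rule triangle_rel[OF X X Z t[OF qis_refl]])
  ultimately show ?thesis using rel_diff by fastforce
qed

text \<open>The cokernel \<open>C\<close> is quasi-isomorphic to the cone of \<open>k\<close>: this
  is \<open>cone_quasi_iso\<close> with the identity of \<open>A\<close> in place of a
  resolution.\<close>

lemma cses_rel:
  assumes S: "cses R A B C k p r s"
  shows "frag_of B - frag_of A - frag_of C \<in> rel"
proof -
  note A = csesD(1)[OF S] and B = csesD(2)[OF S] and C = csesD(3)[OF S]
  note q = quasi_iso_refl[OF A]
  have f: "chain_map Q A B (\<lambda>i v. k i v * 1\<^sub>m (cdim A i v))"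
    by (rule chain_map_comp[OF _ csesD(4)[OF S] A A B]) (use q in \<open>simp add: quasi_iso_map_def\<close>)
  note c = cone_quasi_iso[OF S A q]
  have "quasi_isomorphic Q R C (mapping_cone A B (\<lambda>i v. k i v * 1\<^sub>m (cdim A i v)))"
    by (rule qis_sym[OF qisI[OF c(1) C c(2)]])
  then have "triangle_vertices Q R A B C" unfolding triangle_vertices_def using A B f qis_refl by blast
  then show ?thesis by (rule triangle_rel[OF A B C])
qed

lemma K0_class_eqI:
  assumes "bounded_cplx Q R X" "bounded_cplx Q R Y" "frag_of X - frag_of Y \<in> rel"
  shows "K0_class Q R X = K0_class Q R Y"
proof -
  have c: "frag_of Y \<in> carrier FG" using assms(2) by (simp add: free_Abelian_group_def)
  have "frag_of X \<in> rel #>\<^bsub>FG\<^esub> frag_of Y" unfolding r_coset_def using assms(3) by (auto intro!: bexI[of _ "frag_of X - frag_of Y"])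
  from group.repr_independence[OF group_free_Abelian_group this c rel_subgroup]
  show ?thesis unfolding K0_class_def by simp
qed

subsection \<open>The class of a complex is determined by its dimensions\<close>

text \<open>A reference point of each variety of complexes: it shows that the variety is non-empty,
  and comparison with it makes the class depend on the dimensions alone.\<close>

definition zc :: "(int \<Rightarrow> 'v \<Rightarrow> nat) \<Rightarrow> ('v, 'a) cplx" where
  "zc dd = \<lparr>cdim = dd, cmap = \<lambda>i. rmap (zrep (dd i)), cdiff = \<lambda>i v. 0\<^sub>m (dd (i + 1) v) (dd i v)\<rparr>"

lemma degree_zc: "degree_rep (zc dd) i = zrep (dd i)"
  by (simp add: degree_rep_def zc_def zrep_def)

lemma cdim_zc[simp]: "cdim (zc dd) = dd" by (simp add: zc_def)

lemma zc_bounded: "dim_seq Q dd \<Longrightarrow> bounded_cplx Q R (zc dd)"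
  unfolding bounded_cplx_def degree_zc
proof (intro conjI allI)
  assume d: "dim_seq Q dd"
  then have o: "v \<notin> verts Q \<Longrightarrow> dd i v = 0" for i v unfolding dim_seq_def by blast
  show "finite {i. \<exists>v. cdim (zc dd) i v \<noteq> 0}" using d unfolding dim_seq_def by simp
  fix i
  show "is_rep Q R (zrep (dd i))" by (rule zrep_rep[OF o])
  show "rep_hom Q (zrep (dd i)) (zrep (dd (i + 1))) (cdiff (zc dd) i)"
    using hom_zero[OF zrep_shape[of "dd i"] zrep_shape[of "dd (i + 1)"]] o by (simp add: zc_def)
  fix v show "cdiff (zc dd) (i + 1) v * cdiff (zc dd) i v = 0\<^sub>m (cdim (zc dd) (i + 2) v) (cdim (zc dd) i v)"
    by (simp add: zc_def add.assoc)
qed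

lemma Cb_dim_seq: "X \<in> Cb Q R dd \<Longrightarrow> dim_seq Q dd"
  unfolding Cb_def bounded_cplx_def is_rep_def dim_seq_def by auto

definition "single i0 u = (\<lambda>i. if i = i0 then \<delta> u else (\<lambda>_. 0))"

text \<open>The conditions on \<open>\<eta>\<close> make it a chain map from \<open>X\<close> onto
  the simple module at \<open>u\<close> placed in degree \<open>i0\<close>; \<open>A\<close> is its
  kernel, and \<open>cses_rel\<close> gives the relation.\<close>

lemma peel:
  assumes X: "bounded_cplx Q R X" and u: "u \<in> verts Q" and \<eta>: "\<eta> \<in> carrier_mat 1 (cdim X i0 u)" "\<eta> \<noteq> 0\<^sub>m 1 (cdim X i0 u)"
    and arr: "\<And>a. a \<in> arcs Q \<Longrightarrow> head Q a = u \<Longrightarrow> \<eta> * cmap X i0 a = 0\<^sub>m 1 (cdim X i0 (tail Q a))"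
    and bd: "\<eta> * cdiff X (i0 - 1) u = 0\<^sub>m 1 (cdim X (i0 - 1) u)"
  shows "\<exists>A. bounded_cplx Q R A \<and> (\<forall>i v. cdim X i v = cdim A i v + single i0 u i v) \<and> frag_of X - frag_of A - frag_of (zc (single i0 u)) \<in> rel"
proof -
  let ?C = "zc (single i0 u)"
  have so: "v \<notin> verts Q \<Longrightarrow> single i0 u i v = 0" for i v using u by (auto simp: single_def \<delta>_def)
  have "{i. \<exists>v. single i0 u i v \<noteq> 0} \<subseteq> {i0}" by (auto simp: single_def)
  then have "dim_seq Q (single i0 u)" unfolding dim_seq_def using so finite_subset by blast
  then have C: "bounded_cplx Q R ?C" by (rule zc_bounded)
  define p where "p i = (if i = i0 then fun_hom u \<eta> (degree_rep X i0) else (\<lambda>v. 0\<^sub>m 0 (cdim X i v)))" for i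
  have ph: "rep_hom Q (degree_rep X i) (degree_rep ?C i) (p i)" for i
  proof (cases "i = i0")
    case True
    have "rep_hom Q (degree_rep X i0) (zrep (\<delta> u)) (fun_hom u \<eta> (degree_rep X i0))"
      by (rule fun_hom[OF bcD(2)[OF X]]) (use \<eta> arr in auto)
    then show ?thesis using True by (simp add: degree_zc p_def single_def)
  next
    case False
    have "rep_hom Q (degree_rep X i) (zrep (\<lambda>_. 0)) (\<lambda>v. 0\<^sub>m (rdim (zrep (\<lambda>_. 0)) v) (rdim (degree_rep X i) v))"
      by (rule hom_zero[OF bcD(2)[OF X] zrep_shape]) simp
    then show ?thesis using False by (simp add: degree_zc p_def single_def)
  qed
  have pd: "dim_row (p i v) = single i0 u i v" "dim_col (p i v) = cdim X i v" for i v
    using hom_dims[OF ph, of i v] by (auto simp: degree_zc)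
  have pc: "chain_map Q X ?C p" unfolding chain_map_def
  proof (intro conjI allI ph)
    fix i v
    have "p (i + 1) v * cdiff X i v = 0\<^sub>m (single i0 u (i + 1) v) (cdim X i v)"
    proof (cases "i + 1 = i0 \<and> v = u")
      case True
      then have e: "p (i + 1) v = \<eta>" "i0 - 1 = i" by (auto simp: p_def fun_hom_def)
      show ?thesis using bd True unfolding e by (simp add: single_def \<delta>_def)
    next
      case False
      then have "single i0 u (i + 1) v = 0" by (auto simp: single_def \<delta>_def)
      then show ?thesis using pd[of "i + 1" v] by (intro eq_matI) (auto simp: bc_dims[OF X])
    qed
    then show "p (i + 1) v * cdiff X i v = cdiff ?C i v * p i v" using pd[of i v] by (simp add: zc_def mat_ring0)
  qed
  obtain x where x: "x \<in> carrier_mat (cdim X i0 u) 1" "\<eta> * x = 1\<^sub>m 1" using functional_section[OF \<eta>] .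
  define s where "s i v = (if i = i0 \<and> v = u then x else 0\<^sub>m (cdim X i v) 0)" for i v
  have sc: "s i v \<in> carrier_mat (cdim X i v) (single i0 u i v)" for i v using x unfolding s_def single_def \<delta>_def by auto
  have ps: "p i v * s i v = 1\<^sub>m (single i0 u i v)" for i v
  proof (cases "i = i0 \<and> v = u")
    case True then show ?thesis using x by (simp add: p_def s_def fun_hom_def single_def \<delta>_def)
  next
    case False
    then have "single i0 u i v = 0" by (auto simp: single_def \<delta>_def)
    then show ?thesis using pd[of i v] sc[of i v] by (intro eq_matI) auto
  qed
  have pcm: "p i v \<in> carrier_mat (single i0 u i v) (cdim X i v)" for i v using pd by (intro carrier_matI) auto
  \<comment> \<open>The kernel is chosen simultaneously for all pairs of a degree and a
    vertex.\<close>
  obtain n k r where kr: "\<And>x. k x \<in> carrier_mat (cdim X (fst x) (snd x)) (n x)" "\<And>x. r x \<in> carrier_mat (n x) (cdim X (fst x) (snd x))"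
    "\<And>x. r x * k x = 1\<^sub>m (n x)" "\<And>x. k x * r x + s (fst x) (snd x) * p (fst x) (snd x) = 1\<^sub>m (cdim X (fst x) (snd x))"
    by (rule complement_exists[of "\<lambda>x. p (fst x) (snd x)" "\<lambda>x. single i0 u (fst x) (snd x)" "\<lambda>x. cdim X (fst x) (snd x)" "\<lambda>x. s (fst x) (snd x)"])
      (use pcm sc ps in auto)
  let ?n = "\<lambda>i v. n (i, v)" and ?k = "\<lambda>i v. k (i, v)" and ?r = "\<lambda>i v. r (i, v)"
  have ss: "sses R (ker_rep (degree_rep X i) (?n i) (?k i) (?r i)) (degree_rep X i) (degree_rep ?C i) (?k i) (p i) (?r i) (s i)" for i
    by (rule ker_rep_sses[OF bcD(1)[OF X] bcD(1)[OF C] ph])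
      (use kr(1)[of "(i, _)"] kr(2)[of "(i, _)"] kr(3)[of "(i, _)"] kr(4)[of "(i, _)"] sc ps in \<open>simp_all add: degree_zc\<close>)
  note S = ker_cses[OF X C pc ss]
  let ?A = "ker_cplx X ?n ?k ?r"
  have "cdim X i v = cdim ?A i v + single i0 u i v" for i v
    using sses_rdim[OF csesD(6)[OF S], of i v] by (simp add: degree_zc)
  then show ?thesis using csesD(1)[OF S] cses_rel[OF S] by blast
qed

definition "tdim dd = (\<Sum>i\<in>{i. \<exists>v. dd i v \<noteq> 0}. \<Sum>v\<in>verts Q. dd i v :: nat)"

lemma tdim_single:
  assumes fin: "finite {i. \<exists>v. dd i v \<noteq> 0}" and u: "u \<in> verts Q" and e: "\<And>i v. dd i v = dd' i v + single i0 u i v"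
  shows "tdim dd' < tdim dd"
proof -
  let ?I = "{i. \<exists>v. dd i v \<noteq> 0}"
  have sub: "{i. \<exists>v. dd' i v \<noteq> 0} \<subseteq> ?I" using e by auto
  have i0: "i0 \<in> ?I" using e[of i0 u] by (auto simp: single_def \<delta>_def intro!: exI[of _ u])
  have "tdim dd' = (\<Sum>i\<in>?I. \<Sum>v\<in>verts Q. dd' i v)"
    unfolding tdim_def using fin sub by (intro sum.mono_neutral_left) auto
  also have "\<dots> < (\<Sum>i\<in>?I. \<Sum>v\<in>verts Q. dd i v)"
  proof (rule sum_strict_mono_ex1[OF fin])
    show "\<forall>i\<in>?I. (\<Sum>v\<in>verts Q. dd' i v) \<le> (\<Sum>v\<in>verts Q. dd i v)" by (auto intro!: sum_mono simp: e)
    have "(\<Sum>v\<in>verts Q. dd' i0 v) < (\<Sum>v\<in>verts Q. dd i0 v)"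
      using u by (intro sum_strict_mono_ex1) (auto simp: e single_def \<delta>_def)
    then show "\<exists>a\<in>?I. (\<Sum>v\<in>verts Q. dd' a v) < (\<Sum>v\<in>verts Q. dd a v)" using i0 by blast
  qed
  finally show ?thesis unfolding tdim_def .
qed

lemma zero_cplx_unique:
  assumes X: "bounded_cplx Q R X" and z: "\<And>i v. cdim X i v = 0"
  shows "X = zc (cdim X)"
proof -
  have z': "cdim X = (\<lambda>_ _. 0)" using z by auto
  have "degree_rep X i = zero_rep" for i
    using zero_dims_zero_rep[OF bcD(1)[OF X]] z by (simp add: rep_is_zero_def)
  then have "cmap X = (\<lambda>i. rmap (zrep (cdim X i)))"
    by (auto simp: zrep_def z' zero_rep_def degree_rep_def fun_eq_iff)
  moreover have "cdiff X = (\<lambda>i v. 0\<^sub>m (cdim X (i + 1) v) (cdim X i v))"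
    by (intro ext eq_matI) (auto simp: bc_dims[OF X] z)
  ultimately show ?thesis unfolding zc_def by (cases X) auto
qed

text \<open>No differential arrives in the lowest non-zero degree, so a functional on the top splits
  off a simple module there. The same functional works for \<open>zc (cdim X)\<close>, where all
  maps are zero; both kernels have equal dimensions and smaller total dimension, so induction
  compares them.\<close>

lemma frag_zc: "bounded_cplx Q R X \<Longrightarrow> frag_of X - frag_of (zc (cdim X)) \<in> rel"
proof (induction "tdim (cdim X)" arbitrary: X rule: less_induct)
  case less
  note X = less.prems
  have ds: "dim_seq Q (cdim X)" using Cb_dim_seq[of X "cdim X"] X unfolding Cb_def by simp
  have Z: "bounded_cplx Q R (zc (cdim X))" by (rule zc_bounded[OF ds])
  let ?I = "{i. \<exists>v. cdim X i v \<noteq> 0}"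
  show ?case
  proof (cases "?I = {}")
    case True
    then have "X = zc (cdim X)" using zero_cplx_unique[OF X] by blast
    then have "frag_of X - frag_of (zc (cdim X)) = 0" by simp
    then show ?thesis using rel_zero by simp
  next
    case False
    define i0 where "i0 = Min ?I"
    have i0: "i0 \<in> ?I" "\<And>i. i \<in> ?I \<Longrightarrow> i0 \<le> i" using Min_in[OF bcD(6)[OF X] False] Min_le[OF bcD(6)[OF X]] unfolding i0_def by auto
    have low: "cdim X (i0 - 1) v = 0" for v using i0(2)[of "i0 - 1"] by fastforce
    obtain w where w: "cdim X i0 w \<noteq> 0" using i0(1) by blast
    have wv: "w \<in> verts Q" by (rule ccontr) (use w ds in \<open>auto simp: dim_seq_def\<close>)
    let ?\<xi> = "mat 1 (cdim X i0 w) (\<lambda>_. 1 :: complex)"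
    have "?\<xi> $$ (0, 0) = 1" using w by simp
    then have nz: "?\<xi> \<noteq> 0\<^sub>m 1 (rdim (degree_rep X i0) w)" using w by (metis degree_rep_simps(1) index_zero_mat(1) less_numeral_extra(1) neq0_conv zero_neq_one)
    obtain u q where up: "awalk u q w" "?\<xi> * path_mat Q (degree_rep X i0) u q \<noteq> 0\<^sub>m 1 (rdim (degree_rep X i0) u)"
      "\<And>a. a \<in> arcs Q \<Longrightarrow> head Q a = u \<Longrightarrow> ?\<xi> * path_mat Q (degree_rep X i0) u q * rmap (degree_rep X i0) a = 0\<^sub>m 1 (rdim (degree_rep X i0) (tail Q a))"
      by (rule top_functional[OF bcD(1)[OF X] wv _ nz]) auto
    define \<eta> where "\<eta> = ?\<xi> * path_mat Q (degree_rep X i0) u q"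
    have \<eta>: "\<eta> \<in> carrier_mat 1 (cdim X i0 u)" unfolding \<eta>_def using path_mat_carrier[OF bcD(2)[OF X] up(1)] by (intro carrier_matI) auto
    have \<eta>nz: "\<eta> \<noteq> 0\<^sub>m 1 (cdim X i0 u)" using up(2) unfolding \<eta>_def by simp
    have uv: "u \<in> verts Q" using up(1) by auto
    have "\<eta> * cdiff X (i0 - 1) u = 0\<^sub>m 1 (cdim X (i0 - 1) u)" using \<eta> by (intro eq_matI) (auto simp: low bc_dims[OF X])
    then obtain A where A: "bounded_cplx Q R A" "\<And>i v. cdim X i v = cdim A i v + single i0 u i v" "frag_of X - frag_of A - frag_of (zc (single i0 u)) \<in> rel"
      using peel[OF X uv \<eta> \<eta>nz] up(3) unfolding \<eta>_def by auto
    have "\<eta> * cdiff (zc (cdim X)) (i0 - 1) u = 0\<^sub>m 1 (cdim X (i0 - 1) u)" "\<And>a. a \<in> arcs Q \<Longrightarrow> head Q a = u \<Longrightarrow> \<eta> * cmap (zc (cdim X)) i0 a = 0\<^sub>m 1 (cdim X i0 (tail Q a))"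
      using \<eta> by (auto simp: zc_def zrep_def mat_ring0)
    then obtain A' where A': "bounded_cplx Q R A'" "\<And>i v. cdim X i v = cdim A' i v + single i0 u i v" "frag_of (zc (cdim X)) - frag_of A' - frag_of (zc (single i0 u)) \<in> rel"
      using peel[OF Z uv, of \<eta> i0] \<eta> \<eta>nz by auto
    have AA: "cdim A = cdim A'"
    proof (intro ext)
      fix i v show "cdim A i v = cdim A' i v" using A(2)[of i v] A'(2)[of i v] by simp
    qed
    have lt: "tdim (cdim A) < tdim (cdim X)" "tdim (cdim A') < tdim (cdim X)"
      using tdim_single[OF bcD(6)[OF X] uv A(2)] tdim_single[OF bcD(6)[OF X] uv A'(2)] by auto
    have 1: "frag_of A - frag_of (zc (cdim A)) \<in> rel" by (rule less.hyps[OF lt(1) A(1)])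
    have 2: "frag_of A' - frag_of (zc (cdim A)) \<in> rel" using less.hyps[OF lt(2) A'(1)] unfolding AA .
    have "(frag_of X - frag_of A - frag_of (zc (single i0 u))) - (frag_of (zc (cdim X)) - frag_of A' - frag_of (zc (single i0 u)))
       + (frag_of A - frag_of (zc (cdim A))) - (frag_of A' - frag_of (zc (cdim A))) \<in> rel"
      by (intro rel_add rel_diff A(3) A'(3) 1 2)
    then show ?thesis by (simp add: algebra_simps)
  qed
qed

lemma dim_class_eq:
  assumes "X \<in> Cb Q R dd"
  shows "dim_class Q R dd = K0_class Q R X"
  unfolding dim_class_def
proof (rule the_equality)
  show "\<exists>Y\<in>Cb Q R dd. K0_class Q R X = K0_class Q R Y" using assms by blast
  fix c assume "\<exists>Y\<in>Cb Q R dd. c = K0_class Q R Y"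
  then obtain Y where Y: "Y \<in> Cb Q R dd" "c = K0_class Q R Y" by blast
  have b: "bounded_cplx Q R X" "cdim X = dd" "bounded_cplx Q R Y" "cdim Y = dd" using assms Y unfolding Cb_def by auto
  have "(frag_of Y - frag_of (zc dd)) - (frag_of X - frag_of (zc dd)) \<in> rel"
    using rel_diff[OF frag_zc[OF b(3)] frag_zc[OF b(1)]] unfolding b by simp
  then show "c = K0_class Q R X" unfolding Y(2) by (intro K0_class_eqI b) simp
qed

text \<open>So passing to a resolution, or adding an acyclic complex, stays in the same fibre of
  \<open>dim_class\<close>.\<close>

lemma qis_dim_class:
  assumes "X \<in> Cb Q R dd" "Y \<in> Cb Q R dd'" "quasi_isomorphic Q R X Y"
  shows "dim_class Q R dd = dim_class Q R dd'"
  unfolding dim_class_eq[OF assms(1)] dim_class_eq[OF assms(2)]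
  using assms by (intro K0_class_eqI qis_rel) (auto simp: Cb_def)

end

subsection \<open>Polynomial families\<close>

text \<open>Agreement with a polynomial is asked on \<open>S\<close> only, because sizes and entries
  of the matrices are under control only for complexes of the given dimensions.\<close>

definition pfun :: "('x \<Rightarrow> complex) set \<Rightarrow> 'x set \<Rightarrow> ('x \<Rightarrow> complex) \<Rightarrow> bool" where
  "pfun K S f \<longleftrightarrow> (\<exists>p. polynomial_in K p \<and> (\<forall>x\<in>S. f x = p x))"

lemma pfun_const: "pfun K S (\<lambda>_. c)" unfolding pfun_def using polynomial_in.intros(2) by blast
lemma pfun_coord: "k \<in> K \<Longrightarrow> pfun K S k" unfolding pfun_def using polynomial_in.intros(1) by blast
lemma pfun_add: "pfun K S f \<Longrightarrow> pfun K S g \<Longrightarrow> pfun K S (\<lambda>x. f x + g x)"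
  unfolding pfun_def by (elim exE conjE, rule_tac x = "\<lambda>x. p x + pa x" in exI) (auto intro: polynomial_in.intros(3))
lemma pfun_mult: "pfun K S f \<Longrightarrow> pfun K S g \<Longrightarrow> pfun K S (\<lambda>x. f x * g x)"
  unfolding pfun_def by (elim exE conjE, rule_tac x = "\<lambda>x. p x * pa x" in exI) (auto intro: polynomial_in.intros(4))
lemma pfun_neg: "pfun K S f \<Longrightarrow> pfun K S (\<lambda>x. - f x)"
  using pfun_mult[OF pfun_const[of K S "-1"]] by fastforce
lemma pfun_sum: "finite I \<Longrightarrow> (\<And>i. i \<in> I \<Longrightarrow> pfun K S (f i)) \<Longrightarrow> pfun K S (\<lambda>x. \<Sum>i\<in>I. f i x)"
  by (induction I rule: finite_induct) (auto intro: pfun_const pfun_add)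
lemma pfun_cong: "(\<And>x. x \<in> S \<Longrightarrow> f x = g x) \<Longrightarrow> pfun K S f \<Longrightarrow> pfun K S g"
  unfolding pfun_def by (metis (full_types))
lemma pfun_subset: "pfun K S f \<Longrightarrow> S' \<subseteq> S \<Longrightarrow> pfun K S' f" unfolding pfun_def by blast

definition pmat :: "('x \<Rightarrow> complex) set \<Rightarrow> 'x set \<Rightarrow> nat \<Rightarrow> nat \<Rightarrow> ('x \<Rightarrow> complex mat) \<Rightarrow> bool" where
  "pmat K S n m F \<longleftrightarrow> (\<forall>x\<in>S. F x \<in> carrier_mat n m) \<and> (\<forall>i<n. \<forall>j<m. pfun K S (\<lambda>x. F x $$ (i, j)))"

lemma pmatI: "(\<And>x. x \<in> S \<Longrightarrow> F x \<in> carrier_mat n m) \<Longrightarrow> (\<And>i j. i < n \<Longrightarrow> j < m \<Longrightarrow> pfun K S (\<lambda>x. F x $$ (i, j))) \<Longrightarrow> pmat K S n m F"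
  unfolding pmat_def by blast
lemma pmatD: "pmat K S n m F \<Longrightarrow> x \<in> S \<Longrightarrow> F x \<in> carrier_mat n m" "pmat K S n m F \<Longrightarrow> i < n \<Longrightarrow> j < m \<Longrightarrow> pfun K S (\<lambda>x. F x $$ (i, j))"
  unfolding pmat_def by auto
lemma pmat_const: "A \<in> carrier_mat n m \<Longrightarrow> pmat K S n m (\<lambda>_. A)"
  by (rule pmatI) (auto intro: pfun_const)
lemma pmat_cong: "(\<And>x. x \<in> S \<Longrightarrow> F x = G x) \<Longrightarrow> pmat K S n m F \<Longrightarrow> pmat K S n m G"
proof -
  assume e: "\<And>x. x \<in> S \<Longrightarrow> F x = G x" and F: "pmat K S n m F"
  show "pmat K S n m G"
  proof (rule pmatI)
    show "x \<in> S \<Longrightarrow> G x \<in> carrier_mat n m" for x using e[of x] pmatD(1)[OF F, of x] by simp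
    fix i j assume ij: "i < n" "j < m"
    show "pfun K S (\<lambda>x. G x $$ (i, j))" by (rule pfun_cong[OF _ pmatD(2)[OF F ij]]) (simp add: e)
  qed
qed
lemma pmat_subset: "pmat K S n m F \<Longrightarrow> S' \<subseteq> S \<Longrightarrow> pmat K S' n m F" unfolding pmat_def using pfun_subset by blast

lemma pmat_mult:
  assumes F: "pmat K S n m F" and G: "pmat K S m l G"
  shows "pmat K S n l (\<lambda>x. F x * G x)"
proof (rule pmatI)
  show "x \<in> S \<Longrightarrow> F x * G x \<in> carrier_mat n l" for x using pmatD(1)[OF F, of x] pmatD(1)[OF G, of x] by (rule mult_carrier_mat)
  fix i j assume ij: "i < n" "j < l"
  have "pfun K S (\<lambda>x. \<Sum>t<m. F x $$ (i, t) * G x $$ (t, j))"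
    using ij by (intro pfun_sum pfun_mult pmatD(2)[OF F] pmatD(2)[OF G]) auto
  then show "pfun K S (\<lambda>x. (F x * G x) $$ (i, j))"
  proof (rule pfun_cong[rotated])
    fix x assume x: "x \<in> S"
    show "(\<Sum>t<m. F x $$ (i, t) * G x $$ (t, j)) = (F x * G x) $$ (i, j)"
      using pmatD(1)[OF F x] pmatD(1)[OF G x] ij by (subst mat_mult_index) auto
  qed
qed

lemma pmat_diff:
  assumes F: "pmat K S n m F" and G: "pmat K S n m G"
  shows "pmat K S n m (\<lambda>x. F x - G x)"
proof (rule pmatI)
  show "x \<in> S \<Longrightarrow> F x - G x \<in> carrier_mat n m" for x using pmatD(1)[OF G, of x] by (rule minus_carrier_mat)
  fix i j assume ij: "i < n" "j < m"
  have "pfun K S (\<lambda>x. F x $$ (i, j) + - G x $$ (i, j))"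
    using ij by (intro pfun_add pfun_neg pmatD(2)[OF F] pmatD(2)[OF G]) auto
  then show "pfun K S (\<lambda>x. (F x - G x) $$ (i, j))"
  proof (rule pfun_cong[rotated])
    fix x assume "x \<in> S"
    from carrier_matD[OF pmatD(1)[OF F this]] carrier_matD[OF pmatD(1)[OF G this]] ij
    show "F x $$ (i, j) + - G x $$ (i, j) = (F x - G x) $$ (i, j)" by simp
  qed
qed

lemma pmat_neg:
  assumes F: "pmat K S n m F"
  shows "pmat K S n m (\<lambda>x. - F x)"
proof (rule pmatI)
  show "x \<in> S \<Longrightarrow> - F x \<in> carrier_mat n m" for x using pmatD(1)[OF F] by auto
  fix i j assume ij: "i < n" "j < m"
  show "pfun K S (\<lambda>x. (- F x) $$ (i, j))"
  proof (rule pfun_cong[OF _ pfun_neg[OF pmatD(2)[OF F ij]]])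
    fix x assume "x \<in> S"
    from carrier_matD[OF pmatD(1)[OF F this]] ij show "- F x $$ (i, j) = (- F x) $$ (i, j)" by simp
  qed
qed

lemma pmat_four_block:
  assumes "pmat K S a b A" "pmat K S a d B" "pmat K S c b C" "pmat K S c d D"
  shows "pmat K S (a + c) (b + d) (\<lambda>x. four_block_mat (A x) (B x) (C x) (D x))"
proof (rule pmatI)
  have cc: "A x \<in> carrier_mat a b" "B x \<in> carrier_mat a d" "C x \<in> carrier_mat c b" "D x \<in> carrier_mat c d" if "x \<in> S" for x
    using that pmatD(1) assms by metis+
  show "x \<in> S \<Longrightarrow> four_block_mat (A x) (B x) (C x) (D x) \<in> carrier_mat (a + c) (b + d)" for x using cc by (auto intro: four_block_carrier_mat)
  fix i j assume ij: "i < a + c" "j < b + d"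
  have "pfun K S (\<lambda>x. if i < a then if j < b then A x $$ (i, j) else B x $$ (i, j - b) else if j < b then C x $$ (i - a, j) else D x $$ (i - a, j - b))"
    using ij pmatD(2)[OF assms(1), of i j] pmatD(2)[OF assms(2), of i "j - b"] pmatD(2)[OF assms(3), of "i - a" j] pmatD(2)[OF assms(4), of "i - a" "j - b"]
    by (cases "i < a"; cases "j < b") simp_all
  then show "pfun K S (\<lambda>x. four_block_mat (A x) (B x) (C x) (D x) $$ (i, j))"
  proof (rule pfun_cong[rotated])
    fix x assume "x \<in> S"
    from cc[OF this] show "(if i < a then if j < b then A x $$ (i, j) else B x $$ (i, j - b) else if j < b then C x $$ (i - a, j) else D x $$ (i - a, j - b)) =
      four_block_mat (A x) (B x) (C x) (D x) $$ (i, j)" using ij by auto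
  qed
qed

lemma pmat_diag:
  assumes A: "pmat K S a b A" and B: "pmat K S c d B"
  shows "pmat K S (a + c) (b + d) (\<lambda>x. diag_block_mat [A x, B x])"
proof (rule pmat_cong[OF _ pmat_four_block[OF A pmat_const[OF zero_carrier_mat] pmat_const[OF zero_carrier_mat] B]])
  fix x assume "x \<in> S"
  from pmatD(1)[OF A this] pmatD(1)[OF B this]
  show "four_block_mat (A x) (0\<^sub>m a d) (0\<^sub>m c b) (B x) = diag_block_mat [A x, B x]" by (auto simp: diag_block2)
qed

lemma closed_zero:
  assumes "pfun K S f"
  shows "zariski_closed_in K S {x \<in> S. f x = 0}"
proof -
  obtain p where "polynomial_in K p" "\<forall>x\<in>S. f x = p x" using assms unfolding pfun_def by blast
  then show ?thesis unfolding zariski_closed_in_def by (intro exI[of _ "{p}"]) auto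
qed

text \<open>Closed sets are given by arbitrary families of equations, so intersections over any type
  are allowed, in particular over all integers as degrees.\<close>

lemma closed_all:
  assumes "\<And>t. zariski_closed_in K S {x \<in> S. C t x}"
  shows "zariski_closed_in K S {x \<in> S. \<forall>t. C t x}"
proof -
  have "\<forall>t. \<exists>F. (\<forall>p\<in>F. polynomial_in K p) \<and> {x \<in> S. C t x} = {x \<in> S. \<forall>p\<in>F. p x = 0}"
    using assms unfolding zariski_closed_in_def by simp
  from choice[OF this] obtain F where F: "\<And>t. (\<forall>p\<in>F t. polynomial_in K p) \<and> {x \<in> S. C t x} = {x \<in> S. \<forall>p\<in>F t. p x = 0}" by auto
  have c: "C t x \<longleftrightarrow> (\<forall>p\<in>F t. p x = 0)" if "x \<in> S" for t x
  proof -
    have "x \<in> {x \<in> S. C t x} \<longleftrightarrow> x \<in> {x \<in> S. \<forall>p\<in>F t. p x = 0}" using F[of t] by simp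
    then show ?thesis using that by simp
  qed
  have "{x \<in> S. \<forall>t. C t x} = {x \<in> S. \<forall>p\<in>(\<Union>t. F t). p x = 0}" using c by auto
  moreover have "\<forall>p\<in>(\<Union>t. F t). polynomial_in K p" using F by auto
  ultimately show ?thesis unfolding zariski_closed_in_def by (intro exI[of _ "\<Union>t. F t"]) simp
qed

lemma closed_true: "zariski_closed_in K S {x \<in> S. True}"
  unfolding zariski_closed_in_def by (intro exI[of _ "{}"]) auto

lemma closed_false: "zariski_closed_in K S {}"
  unfolding zariski_closed_in_def by (intro exI[of _ "{\<lambda>_. 1}"]) (auto intro: polynomial_in.intros(2))

lemma closed_imp: "(P \<Longrightarrow> zariski_closed_in K S {x \<in> S. C x}) \<Longrightarrow> zariski_closed_in K S {x \<in> S. P \<longrightarrow> C x}"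
  using closed_true by (cases P) auto

lemma closed_conj:
  assumes "zariski_closed_in K S {x \<in> S. C x}" "zariski_closed_in K S {x \<in> S. D x}"
  shows "zariski_closed_in K S {x \<in> S. C x \<and> D x}"
proof -
  have "zariski_closed_in K S {x \<in> S. if b then C x else D x}" for b using assms by (cases b) simp_all
  then have "zariski_closed_in K S {x \<in> S. \<forall>b. (if b then C x else D x)}" by (rule closed_all)
  moreover have "(\<forall>b. if b then C x else D x) \<longleftrightarrow> C x \<and> D x" for x by (metis (full_types))
  ultimately show ?thesis by simp
qed

lemma closed_mat_eq:
  assumes F: "pmat K S n m F" and G: "pmat K S n m G"
  shows "zariski_closed_in K S {x \<in> S. F x = G x}"
proof -
  have "zariski_closed_in K S {x \<in> S. \<forall>i j. i < n \<and> j < m \<longrightarrow> (F x - G x) $$ (i, j) = 0}"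
    by (intro closed_all closed_imp closed_zero pmatD(2)[OF pmat_diff[OF F G]]) auto
  moreover have "{x \<in> S. F x = G x} = {x \<in> S. \<forall>i j. i < n \<and> j < m \<longrightarrow> (F x - G x) $$ (i, j) = 0}"
  proof (intro Collect_cong conj_cong refl)
    fix x assume x: "x \<in> S"
    note c = pmatD(1)[OF F x] pmatD(1)[OF G x]
    show "(F x = G x) \<longleftrightarrow> (\<forall>i j. i < n \<and> j < m \<longrightarrow> (F x - G x) $$ (i, j) = 0)"
    proof
      assume "\<forall>i j. i < n \<and> j < m \<longrightarrow> (F x - G x) $$ (i, j) = 0"
      then show "F x = G x" using c by (intro eq_matI) auto
    qed (use c in auto)
  qed
  ultimately show ?thesis by simp
qed

section \<open>The resolution as a polynomial map\<close>

context bound_quiver begin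

definition pcplx :: "('x \<Rightarrow> complex) set \<Rightarrow> 'x set \<Rightarrow> (int \<Rightarrow> 'v \<Rightarrow> nat) \<Rightarrow> ('x \<Rightarrow> ('v, 'a) cplx) \<Rightarrow> bool" where
  "pcplx K S dd F \<longleftrightarrow> (\<forall>x\<in>S. F x \<in> Cb Q R dd) \<and>
     (\<forall>i. \<forall>a\<in>arcs Q. pmat K S (dd i (head Q a)) (dd i (tail Q a)) (\<lambda>x. cmap (F x) i a)) \<and>
     (\<forall>i v. pmat K S (dd (i + 1) v) (dd i v) (\<lambda>x. cdiff (F x) i v))"

lemma pcplxD:
  assumes "pcplx K S dd F"
  shows "x \<in> S \<Longrightarrow> F x \<in> Cb Q R dd" "x \<in> S \<Longrightarrow> bounded_cplx Q R (F x)" "x \<in> S \<Longrightarrow> cdim (F x) = dd"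
    "a \<in> arcs Q \<Longrightarrow> pmat K S (dd i (head Q a)) (dd i (tail Q a)) (\<lambda>x. cmap (F x) i a)"
    "pmat K S (dd (i + 1) v) (dd i v) (\<lambda>x. cdiff (F x) i v)"
  using assms unfolding pcplx_def Cb_def by auto

lemma CbD: "X \<in> Cb Q R dd \<Longrightarrow> bounded_cplx Q R X" "X \<in> Cb Q R dd \<Longrightarrow> cdim X = dd"
  unfolding Cb_def by auto

lemma cmap_carrier:
  assumes "bounded_cplx Q R X" "a \<in> arcs Q"
  shows "cmap X i a \<in> carrier_mat (cdim X i (head Q a)) (cdim X i (tail Q a))"
  using bcD(2)[OF assms(1), of i] assms(2) unfolding hom_shape_def by simp

lemma pcplx_id: "pcplx (cplx_coords Q dd) (Cb Q R dd) dd (\<lambda>X. X)"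
  unfolding pcplx_def
proof (intro conjI allI ballI)
  fix i a assume a: "a \<in> arcs Q"
  show "pmat (cplx_coords Q dd) (Cb Q R dd) (dd i (head Q a)) (dd i (tail Q a)) (\<lambda>x. cmap x i a)"
  proof (rule pmatI)
    show "X \<in> Cb Q R dd \<Longrightarrow> cmap X i a \<in> carrier_mat (dd i (head Q a)) (dd i (tail Q a))" for X
      using cmap_carrier[OF _ a, of X i] CbD[of X dd] by simp
    fix r c assume "r < dd i (head Q a)" "c < dd i (tail Q a)"
    then show "pfun (cplx_coords Q dd) (Cb Q R dd) (\<lambda>x. cmap x i a $$ (r, c))"
      by (intro pfun_coord) (use a in \<open>auto simp: cplx_coords_def\<close>)
  qed
next
  fix i v
  show "pmat (cplx_coords Q dd) (Cb Q R dd) (dd (i + 1) v) (dd i v) (\<lambda>x. cdiff x i v)"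
  proof (rule pmatI)
    show "X \<in> Cb Q R dd \<Longrightarrow> cdiff X i v \<in> carrier_mat (dd (i + 1) v) (dd i v)" for X
      using bcD(4)[of Q R X i v] CbD[of X dd] by simp
    fix r c assume rc: "r < dd (i + 1) v" "c < dd i v"
    show "pfun (cplx_coords Q dd) (Cb Q R dd) (\<lambda>x. cdiff x i v $$ (r, c))"
    proof (cases "v \<in> verts Q")
      case True
      then show ?thesis by (intro pfun_coord) (use rc in \<open>auto simp: cplx_coords_def\<close>)
    next
      \<comment> \<open>A non-zero dimension outside the quiver leaves no complexes, and on the
        empty set every function is polynomial.\<close>
      case False
      then have "Cb Q R dd = {}" using Cb_dim_seq[of _ dd] rc unfolding dim_seq_def by fastforce
      then show ?thesis using pfun_const[of "cplx_coords Q dd" "{}" 0] by (simp add: pfun_def)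
    qed
  qed
qed simp

lemma pmat_path:
  assumes F: "pcplx K S dd F" and p: "awalk u p w"
  shows "pmat K S (dd i w) (dd i u) (\<lambda>x. path_mat Q (degree_rep (F x) i) u p)"
  using p
proof (induction p arbitrary: u)
  case Nil
  then have "w = u" by (auto simp: awalk_def)
  show ?case unfolding \<open>w = u\<close>
    by (intro pmat_cong[OF _ pmat_const[OF one_carrier_mat]]) (auto simp: pcplxD(3)[OF F])
next
  case (Cons a p)
  then have a: "a \<in> arcs Q" "tail Q a = u" "awalk (head Q a) p w" by (auto simp: awalk_Cons_iff)
  show ?case using pmat_mult[OF Cons.IH[OF a(3)] pcplxD(4)[OF F a(1), of i]] a(2) by simp
qed

lemma pmat_FH:
  assumes M: "\<And>v b w. b \<in> bas v w \<Longrightarrow> pmat K S (d' w) (d' v) (\<lambda>x. path_mat Q (M x) v b)" and dM: "\<And>x. x \<in> S \<Longrightarrow> rdim (M x) = d'"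
    and X: "\<And>v. pmat K S (d' v) (d v) (\<lambda>x. X x v)"
  shows "pmat K S (d' w) (fdim d w) (\<lambda>x. FH d (M x) (X x) w)"
proof (rule pmatI)
  show "x \<in> S \<Longrightarrow> FH d (M x) (X x) w \<in> carrier_mat (d' w) (fdim d w)" for x using dM by (intro carrier_matI) auto
  fix r c assume rc: "r < d' w" "c < fdim d w"
  obtain v b i where c: "idx d w ! c = (v, b, i)" "v \<in> verts Q" "b \<in> bas v w" "i < d v" using idx_nthE[OF rc(2)] by blast
  have "pfun K S (\<lambda>x. (path_mat Q (M x) v b * X x v) $$ (r, i))"
    by (rule pmatD(2)[OF pmat_mult[OF M[OF c(3)] X] rc(1) c(4)])
  then show "pfun K S (\<lambda>x. FH d (M x) (X x) w $$ (r, c))"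
    by (rule pfun_cong[rotated]) (use rc dM c(1) in \<open>auto simp: FH_def\<close>)
qed

lemma pmat_FrM:
  assumes f: "\<And>v. pmat K S (d' v) (d v) (\<lambda>x. f x v)"
  shows "pmat K S (fdim d' w) (fdim d w) (\<lambda>x. FrM d d' (f x) w)"
  unfolding FrM_def
proof (rule pmat_FH)
  show "b \<in> bas v w \<Longrightarrow> pmat K S (fdim d' w) (fdim d' v) (\<lambda>x. path_mat Q (Fr d') v b)" for v b w
    using path_mat_carrier[OF Fr_shape bas_awalk, of b v w d'] by (intro pmat_const) simp
  show "pmat K S (fdim d' v) (d v) (\<lambda>x. fs d' v * f x v)" for v
    by (rule pmat_mult[OF pmat_const f]) (auto intro!: carrier_matI)
qed simp

lemma pmat_ev:
  assumes F: "pcplx K S dd F"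
  shows "pmat K S (dd i w) (fdim (dd i) w) (\<lambda>x. ev (degree_rep (F x) i) w)"
proof -
  have "pmat K S (dd i w) (fdim (dd i) w) (\<lambda>x. FH (dd i) (degree_rep (F x) i) (\<lambda>v. 1\<^sub>m (dd i v)) w)"
    by (rule pmat_FH[OF pmat_path[OF F bas_awalk]]) (auto simp: pcplxD(3)[OF F] intro: pmat_const)
  then show ?thesis by (rule pmat_cong[rotated]) (simp add: ev_def pcplxD(3)[OF F])
qed

lemma pcplx_outside: "pcplx K S dd F \<Longrightarrow> x \<in> S \<Longrightarrow> w \<notin> verts Q \<Longrightarrow> dd i w = 0"
proof -
  assume F: "pcplx K S dd F" and x: "x \<in> S" and w: "w \<notin> verts Q"
  from Cb_dim_seq[OF pcplxD(1)[OF F x]] show "dd i w = 0" unfolding dim_seq_def using w by simp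
qed

lemma pmat_empty: "S = {} \<Longrightarrow> pmat K S n m F"
  unfolding pmat_def pfun_def by (auto intro: polynomial_in.intros(2))

text \<open>For fixed dimensions \<open>fs\<close> and \<open>jj\<close> are constant matrices and
  only \<open>ev\<close> varies, so this basis of the kernel is polynomial on the whole variety. On
  an empty \<open>S\<close> the dimensions might violate the hypothesis of \<open>jr_props\<close>,
  hence the case distinction.\<close>

lemma pmat_kk:
  assumes F: "pcplx K S dd F"
  shows "pmat K S (fdim (dd i) w) (kdim (dd i) w) (\<lambda>x. kk (degree_rep (F x) i) w)"
proof (cases "S = {}")
  case False
  then have o: "w \<notin> verts Q \<Longrightarrow> dd i w = 0" using pcplx_outside[OF F] by blast
  have "pmat K S (fdim (dd i) w) (kdim (dd i) w) (\<lambda>x. (1\<^sub>m (fdim (dd i) w) - fs (dd i) w * ev (degree_rep (F x) i) w) * jj (dd i) w)"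
    by (intro pmat_mult[OF pmat_diff[OF pmat_const pmat_mult[OF pmat_const pmat_ev[OF F]]] pmat_const] jr_props(1)[of w "dd i", OF o]) (auto intro!: carrier_matI)
  then show ?thesis by (rule pmat_cong[rotated]) (simp add: kk_def pcplxD(3)[OF F])
qed (rule pmat_empty)

lemma pmat_rr:
  assumes F: "pcplx K S dd F"
  shows "pmat K S (kdim (dd i) w) (fdim (dd i) w) (\<lambda>x. rr (cdim (F x) i) w)"
proof (cases "S = {}")
  case False
  then have o: "w \<notin> verts Q \<Longrightarrow> dd i w = 0" using pcplx_outside[OF F] by blast
  show ?thesis by (rule pmat_cong[OF _ pmat_const[OF jr_props(2)[of w "dd i", OF o]]]) (simp_all add: pcplxD(3)[OF F])
qed (rule pmat_empty)

lemma pcplx_cFr: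
  assumes F: "pcplx K S dd F"
  shows "pcplx K S (\<lambda>i. fdim (dd i)) (\<lambda>x. cFr (F x))"
  unfolding pcplx_def
proof (intro conjI allI ballI)
  show "x \<in> S \<Longrightarrow> cFr (F x) \<in> Cb Q R (\<lambda>i. fdim (dd i))" for x
    using cFr_bounded[OF pcplxD(2)[OF F, of x]] pcplxD(3)[OF F, of x] unfolding Cb_def by (auto intro!: ext)
  fix i a assume a: "a \<in> arcs Q"
  have "rmap (Fr (dd i)) a \<in> carrier_mat (fdim (dd i) (head Q a)) (fdim (dd i) (tail Q a))"
    using Fr_shape[of "dd i"] a unfolding hom_shape_def by simp
  then show "pmat K S (fdim (dd i) (head Q a)) (fdim (dd i) (tail Q a)) (\<lambda>x. cmap (cFr (F x)) i a)"
    by (intro pmat_cong[OF _ pmat_const]) (auto simp: cFr_def pcplxD(3)[OF F])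
next
  fix i v
  show "pmat K S (fdim (dd (i + 1)) v) (fdim (dd i) v) (\<lambda>x. cdiff (cFr (F x)) i v)"
    by (rule pmat_cong[OF _ pmat_FrM[OF pcplxD(5)[OF F]]]) (simp add: cFr_def pcplxD(3)[OF F])
qed

lemma pcplx_cK:
  assumes F: "pcplx K S dd F"
  shows "pcplx K S (\<lambda>i. kdim (dd i)) (\<lambda>x. cK (F x))"
  unfolding pcplx_def
proof (intro conjI allI ballI)
  show "x \<in> S \<Longrightarrow> cK (F x) \<in> Cb Q R (\<lambda>i. kdim (dd i))" for x
    using csesD(1)[OF cK_cses[OF pcplxD(2)[OF F, of x]]] pcplxD(3)[OF F, of x] unfolding Cb_def by (auto intro!: ext)
  fix i a assume a: "a \<in> arcs Q"
  have "pmat K S (kdim (dd i) (head Q a)) (kdim (dd i) (tail Q a))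
     (\<lambda>x. rr (cdim (F x) i) (head Q a) * cmap (cFr (F x)) i a * kk (degree_rep (F x) i) (tail Q a))"
    by (rule pmat_mult[OF pmat_mult[OF pmat_rr[OF F] pcplxD(4)[OF pcplx_cFr[OF F] a]] pmat_kk[OF F]])
  then show "pmat K S (kdim (dd i) (head Q a)) (kdim (dd i) (tail Q a)) (\<lambda>x. cmap (cK (F x)) i a)"
    using a by (simp add: cK_def ker_cplx_def)
next
  fix i v
  have "pmat K S (kdim (dd (i + 1)) v) (kdim (dd i) v) (\<lambda>x. rr (cdim (F x) (i + 1)) v * (cdiff (cFr (F x)) i v * kk (degree_rep (F x) i) v))"
    by (rule pmat_mult[OF pmat_rr[OF F] pmat_mult[OF pcplxD(5)[OF pcplx_cFr[OF F]] pmat_kk[OF F]]])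
  then show "pmat K S (kdim (dd (i + 1)) v) (kdim (dd i) v) (\<lambda>x. cdiff (cK (F x)) i v)"
    by (simp add: cK_def ker_cplx_def)
qed

lemma pcplx_cone:
  assumes F: "pcplx K S dd F" and G: "pcplx K S ee G" and f: "\<And>i v. pmat K S (ee i v) (dd i v) (\<lambda>x. f x i v)"
    and b: "\<And>x. x \<in> S \<Longrightarrow> bounded_cplx Q R (mapping_cone (F x) (G x) (f x))"
  shows "pcplx K S (\<lambda>i v. dd (i + 1) v + ee i v) (\<lambda>x. mapping_cone (F x) (G x) (f x))"
  unfolding pcplx_def
proof (intro conjI allI ballI)
  show "x \<in> S \<Longrightarrow> mapping_cone (F x) (G x) (f x) \<in> Cb Q R (\<lambda>i v. dd (i + 1) v + ee i v)" for x
    using b pcplxD(3)[OF F] pcplxD(3)[OF G] unfolding Cb_def by (auto simp: fun_eq_iff)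
  fix i a assume a: "a \<in> arcs Q"
  show "pmat K S (dd (i + 1) (head Q a) + ee i (head Q a)) (dd (i + 1) (tail Q a) + ee i (tail Q a)) (\<lambda>x. cmap (mapping_cone (F x) (G x) (f x)) i a)"
    using pmat_diag[OF pcplxD(4)[OF F a] pcplxD(4)[OF G a]] by (simp add: mapping_cone_def)
next
  fix i v
  have "pmat K S (dd (i + 1 + 1) v + ee (i + 1) v) (dd (i + 1) v + ee i v)
     (\<lambda>x. four_block_mat (- cdiff (F x) (i + 1) v) (0\<^sub>m (dd (i + 1 + 1) v) (ee i v)) (f x (i + 1) v) (cdiff (G x) i v))"
    by (rule pmat_four_block[OF pmat_neg[OF pcplxD(5)[OF F]] pmat_const[OF zero_carrier_mat] f pcplxD(5)[OF G]])
  then show "pmat K S (dd (i + 1 + 1) v + ee (i + 1) v) (dd (i + 1) v + ee i v) (\<lambda>x. cdiff (mapping_cone (F x) (G x) (f x)) i v)"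
    by (rule pmat_cong[rotated]) (simp add: mapping_cone_def pcplxD(3)[OF F] pcplxD(3)[OF G] add.assoc)
qed

text \<open>The quasi-isomorphism has to be carried along in the induction, since it enters the
  differential of the next cone.\<close>

lemma pcplx_RR:
  assumes "pcplx K S dd F"
  shows "pcplx K S (rdims n dd) (\<lambda>x. fst (RR n (F x))) \<and> (\<forall>i v. pmat K S (dd i v) (rdims n dd i v) (\<lambda>x. snd (RR n (F x)) i v))"
  using assms
proof (induction n arbitrary: dd F)
  case 0
  have "pmat K S (dd i v) (dd i v) (\<lambda>x. 1\<^sub>m (cdim (F x) i v))" for i v
    by (rule pmat_cong[OF _ pmat_const[OF one_carrier_mat]]) (simp add: pcplxD(3)[OF 0])
  then show ?case using 0 by simp
next
  case (Suc n)
  note F = Suc.prems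
  from Suc.IH[OF pcplx_cK[OF F]] have IH: "pcplx K S (rdims n (\<lambda>i. kdim (dd i))) (\<lambda>x. fst (RR n (cK (F x))))"
    "\<And>i v. pmat K S (kdim (dd i) v) (rdims n (\<lambda>i. kdim (dd i)) i v) (\<lambda>x. snd (RR n (cK (F x))) i v)" by auto
  have b: "bounded_cplx Q R (mapping_cone (fst (RR n (cK (F x)))) (cFr (F x)) (\<lambda>i v. kk (degree_rep (F x) i) v * snd (RR n (cK (F x))) i v))" if "x \<in> S" for x
    using RR_quasi_iso[OF pcplxD(2)[OF F that], of "Suc n"] by simp
  have 1: "pcplx K S (rdims (Suc n) dd) (\<lambda>x. fst (RR (Suc n) (F x)))"
    using pcplx_cone[OF IH(1) pcplx_cFr[OF F] pmat_mult[OF pmat_kk[OF F] IH(2)] b] by simp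
  have "pmat K S (dd i v) (rdims (Suc n) dd i v) (\<lambda>x. snd (RR (Suc n) (F x)) i v)" for i v
  proof -
    have "pmat K S (dd i v) (rdims (Suc n) dd i v) (\<lambda>x. ev (degree_rep (F x) i) v * prj2 (rdims n (\<lambda>i. kdim (dd i)) (i + 1) v) (fdim (dd i) v))"
      by (simp, rule pmat_mult[OF pmat_ev[OF F] pmat_const]) (auto intro: carrier_matI)
    then show ?thesis by (rule pmat_cong[rotated]) (simp add: pcplxD(3)[OF IH(1)] pcplxD(3)[OF F])
  qed
  then show ?case using 1 by blast
qed

subsection \<open>Transition maps\<close>

lemma cplx_eqI:
  assumes X: "bounded_cplx Q R X" and Y: "bounded_cplx Q R Y" "cdim X = cdim Y" "\<And>i a. a \<in> arcs Q \<Longrightarrow> cmap X i a = cmap Y i a" "\<And>i v. cdiff X i v = cdiff Y i v"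
  shows "X = Y"
proof -
  have "cmap X i a = cmap Y i a" for i a
    using assms(4) bcD(2)[OF X, of i] bcD(2)[OF Y(1), of i] unfolding hom_shape_def by (cases "a \<in> arcs Q") auto
  then have "cmap X = cmap Y" "cdiff X = cdiff Y" using assms(5) by blast+
  then show ?thesis using assms(3) by (cases X, cases Y) auto
qed

lemma iso_inverse:
  assumes "cplx_iso_via Q g X Y"
  obtains g' where "\<And>i v. g i v \<in> carrier_mat (cdim Y i v) (cdim X i v)" "\<And>i v. g' i v \<in> carrier_mat (cdim X i v) (cdim Y i v)"
    "\<And>i v. g i v * g' i v = 1\<^sub>m (cdim Y i v)" "\<And>i v. g' i v * g i v = 1\<^sub>m (cdim X i v)"
proof -
  have c: "chain_map Q X Y g" and inv: "\<And>i v. invertible_mat (g i v)" using assms unfolding cplx_iso_via_def by auto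
  have "\<exists>B\<in>carrier_mat (cdim X i v) (cdim Y i v). g i v * B = 1\<^sub>m (cdim Y i v) \<and> B * g i v = 1\<^sub>m (cdim X i v)" for i v
    using inv invertible_iff[OF chain_mapD(2)[OF c]] by blast
  then show ?thesis using that chain_mapD(2)[OF c] by metis
qed

lemma iso_maps:
  assumes "cplx_iso_via Q g X Y"
  shows "a \<in> arcs Q \<Longrightarrow> g i (head Q a) * cmap X i a = cmap Y i a * g i (tail Q a)"
    "g (i + 1) v * cdiff X i v = cdiff Y i v * g i v"
proof -
  have c: "chain_map Q X Y g" using assms unfolding cplx_iso_via_def by auto
  show "a \<in> arcs Q \<Longrightarrow> g i (head Q a) * cmap X i a = cmap Y i a * g i (tail Q a)" using hom_comm[OF chain_mapD(1)[OF c, of i]] by simp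
  show "g (i + 1) v * cdiff X i v = cdiff Y i v * g i v" by (rule chain_mapD(3)[OF c])
qed

lemma iso_target_formula:
  assumes g: "\<And>i v. g i v \<in> carrier_mat (cdim Y i v) (cdim X i v)" "\<And>i v. g' i v \<in> carrier_mat (cdim X i v) (cdim Y i v)"
    "\<And>i v. g i v * g' i v = 1\<^sub>m (cdim Y i v)" "cplx_iso_via Q g X Y" and X: "bounded_cplx Q R X" and Y: "bounded_cplx Q R Y"
  shows "a \<in> arcs Q \<Longrightarrow> cmap Y i a = g i (head Q a) * cmap X i a * g' i (tail Q a)"
    "cdiff Y i v = g (i + 1) v * cdiff X i v * g' i v"
proof -
  note d = carrier_matD[OF g(1)] carrier_matD[OF g(2)]
  show "cmap Y i a = g i (head Q a) * cmap X i a * g' i (tail Q a)" if a: "a \<in> arcs Q"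
    unfolding iso_maps(1)[OF g(4) a] using carrier_matD[OF cmap_carrier[OF Y a]] by (simp add: mat_assoc d g(3) mat_ring0)
  show "cdiff Y i v = g (i + 1) v * cdiff X i v * g' i v"
    unfolding iso_maps(2)[OF g(4)] by (simp add: mat_assoc d g(3) mat_ring0 bc_dims[OF Y])
qed

lemma iso_source_formula:
  assumes g: "\<And>i v. g i v \<in> carrier_mat (cdim Y i v) (cdim X i v)" "\<And>i v. g' i v \<in> carrier_mat (cdim X i v) (cdim Y i v)"
    "\<And>i v. g' i v * g i v = 1\<^sub>m (cdim X i v)" "cplx_iso_via Q g X Y" and X: "bounded_cplx Q R X" and Y: "bounded_cplx Q R Y"
  shows "a \<in> arcs Q \<Longrightarrow> cmap X i a = g' i (head Q a) * cmap Y i a * g i (tail Q a)"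
    "cdiff X i v = g' (i + 1) v * cdiff Y i v * g i v"
proof -
  note d = carrier_matD[OF g(1)] carrier_matD[OF g(2)]
  show "cmap X i a = g' i (head Q a) * cmap Y i a * g i (tail Q a)" if a: "a \<in> arcs Q"
  proof -
    note c = carrier_matD[OF cmap_carrier[OF Y a]] carrier_matD[OF cmap_carrier[OF X a]]
    have "g' i (head Q a) * cmap Y i a * g i (tail Q a) = g' i (head Q a) * (g i (head Q a) * cmap X i a)"
      unfolding iso_maps(1)[OF g(4) a] by (simp add: mat_assoc d c)
    also have "\<dots> = cmap X i a" using g(3) by (simp add: mat_assoc[symmetric] d c mat_ring0)
    finally show ?thesis by simp
  qed
  have "g' (i + 1) v * cdiff Y i v * g i v = g' (i + 1) v * (g (i + 1) v * cdiff X i v)"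
    unfolding iso_maps(2)[OF g(4)] by (simp add: mat_assoc d bc_dims[OF Y])
  also have "\<dots> = cdiff X i v" using g(3) by (simp add: mat_assoc[symmetric] d bc_dims[OF X] mat_ring0)
  finally show "cdiff X i v = g' (i + 1) v * cdiff Y i v * g i v" by simp
qed

lemma iso_target_unique:
  assumes "cplx_iso_via Q g X Y" "cplx_iso_via Q g X Y'" and X: "bounded_cplx Q R X" and Y: "bounded_cplx Q R Y" and Y': "bounded_cplx Q R Y'" "cdim Y = cdim Y'"
  shows "Y = Y'"
proof -
  obtain g' where g: "\<And>i v. g i v \<in> carrier_mat (cdim Y i v) (cdim X i v)" "\<And>i v. g' i v \<in> carrier_mat (cdim X i v) (cdim Y i v)"
    "\<And>i v. g i v * g' i v = 1\<^sub>m (cdim Y i v)" using iso_inverse[OF assms(1)] by metis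
  note f = iso_target_formula[OF g assms(1) X Y]
  note f' = iso_target_formula[OF g[unfolded Y'(2)] assms(2) X Y'(1)]
  show ?thesis by (rule cplx_eqI[OF Y Y']) (simp add: f(1) f'(1), metis f(2) f'(2))
qed

lemma diag_inj:
  assumes "diag_block_mat [A, C] = diag_block_mat [B, C]" "dim_row A = dim_row B" "dim_col A = dim_col (B :: complex mat)"
  shows "A = B"
proof (rule eq_matI)
  fix i j assume ij: "i < dim_row B" "j < dim_col B"
  have "diag_block_mat [A, C] $$ (i, j) = diag_block_mat [B, C] $$ (i, j)" using assms(1) by simp
  then show "A $$ (i, j) = B $$ (i, j)" using ij assms(2,3) by (simp add: diag_block2)
qed (use assms in auto)

lemma dsum_inj:
  assumes X: "bounded_cplx Q R X" and X': "bounded_cplx Q R X'" and "cdim X = cdim X'" "cplx_dsum X M = cplx_dsum X' M"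
  shows "X = X'"
proof (rule cplx_eqI[OF X X' assms(3)])
  fix i a assume a: "a \<in> arcs Q"
  have "cmap (cplx_dsum X M) i a = cmap (cplx_dsum X' M) i a" using assms(4) by simp
  then show "cmap X i a = cmap X' i a"
    using carrier_matD[OF cmap_carrier[OF X a]] carrier_matD[OF cmap_carrier[OF X' a]] assms(3) by (auto simp: cplx_dsum_def intro: diag_inj)
next
  fix i v
  have "cdiff (cplx_dsum X M) i v = cdiff (cplx_dsum X' M) i v" using assms(4) by simp
  then show "cdiff X i v = cdiff X' i v" using bc_dims[OF X] bc_dims[OF X'] assms(3) by (auto simp: cplx_dsum_def intro: diag_inj)
qed

lemma transition_inj:
  assumes "cplx_iso_via Q g (cplx_dsum X M) Y" "cplx_iso_via Q g (cplx_dsum X' M) Y"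
    and X: "bounded_cplx Q R X" and X': "bounded_cplx Q R X'" and Y: "bounded_cplx Q R Y" and M: "bounded_cplx Q R M" and e: "cdim X = cdim X'"
  shows "X = X'"
proof -
  note D = dsum_bounded[OF X M] and D' = dsum_bounded[OF X' M]
  have cd: "cdim (cplx_dsum X M) = cdim (cplx_dsum X' M)" using e by (auto simp: fun_eq_iff)
  obtain g' where g: "\<And>i v. g i v \<in> carrier_mat (cdim Y i v) (cdim (cplx_dsum X M) i v)" "\<And>i v. g' i v \<in> carrier_mat (cdim (cplx_dsum X M) i v) (cdim Y i v)"
    "\<And>i v. g' i v * g i v = 1\<^sub>m (cdim (cplx_dsum X M) i v)" using iso_inverse[OF assms(1)] by metis
  note f = iso_source_formula[OF g assms(1) D Y]
  note f' = iso_source_formula[OF g[unfolded cd] assms(2) D' Y]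
  have "cplx_dsum X M = cplx_dsum X' M" by (rule cplx_eqI[OF D D' cd]) (simp add: f(1) f'(1), metis f(2) f'(2))
  then show ?thesis using dsum_inj[OF X X' e] by simp
qed

text \<open>The identification \<open>g\<close> does not depend on the point, so \<open>T x\<close>
  is the sum of \<open>F x\<close> and \<open>M\<close>, conjugated by constant matrices. Their
  inverses are taken from some point of \<open>S\<close>, which is why the empty set is
  separate.\<close>

lemma pcplx_transition:
  assumes F: "pcplx K S dd F" and M: "M \<in> Cb Q R mm" and T: "\<And>x. x \<in> S \<Longrightarrow> T x \<in> Cb Q R ee \<and> cplx_iso_via Q g (cplx_dsum (F x) M) (T x)"
  shows "pcplx K S ee T"
proof (cases "S = {}")
  case True then show ?thesis unfolding pcplx_def using pmat_empty by blast
next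
  case False
  then obtain x0 where x0: "x0 \<in> S" by blast
  note Mb = CbD[OF M]
  have Tb: "bounded_cplx Q R (T x)" "cdim (T x) = ee" if "x \<in> S" for x using T[OF that] CbD by blast+
  have cd: "cdim (cplx_dsum (F x) M) i v = dd i v + mm i v" if "x \<in> S" for x i v using pcplxD(3)[OF F that] Mb(2) by simp
  obtain g' where "\<And>i v. g i v \<in> carrier_mat (cdim (T x0) i v) (cdim (cplx_dsum (F x0) M) i v)" "\<And>i v. g' i v \<in> carrier_mat (cdim (cplx_dsum (F x0) M) i v) (cdim (T x0) i v)"
    "\<And>i v. g i v * g' i v = 1\<^sub>m (cdim (T x0) i v)" using iso_inverse T[OF x0] by metis
  then have g: "g i v \<in> carrier_mat (ee i v) (dd i v + mm i v)" "g' i v \<in> carrier_mat (dd i v + mm i v) (ee i v)" "g i v * g' i v = 1\<^sub>m (ee i v)" for i v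
    unfolding cd[OF x0] Tb(2)[OF x0] by auto
  have f: "a \<in> arcs Q \<Longrightarrow> cmap (T x) i a = g i (head Q a) * diag_block_mat [cmap (F x) i a, cmap M i a] * g' i (tail Q a)"
      "cdiff (T x) i v = g (i + 1) v * diag_block_mat [cdiff (F x) i v, cdiff M i v] * g' i v" if x: "x \<in> S" for x i a v
  proof -
    have iso: "cplx_iso_via Q g (cplx_dsum (F x) M) (T x)" using T[OF x] by simp
    have g2: "g i v \<in> carrier_mat (cdim (T x) i v) (cdim (cplx_dsum (F x) M) i v)" "g' i v \<in> carrier_mat (cdim (cplx_dsum (F x) M) i v) (cdim (T x) i v)"
      "g i v * g' i v = 1\<^sub>m (cdim (T x) i v)" for i v unfolding cd[OF x] Tb(2)[OF x] by (rule g)+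
    note f = iso_target_formula[OF g2 iso dsum_bounded[OF pcplxD(2)[OF F x] Mb(1)] Tb(1)[OF x]]
    show "a \<in> arcs Q \<Longrightarrow> cmap (T x) i a = g i (head Q a) * diag_block_mat [cmap (F x) i a, cmap M i a] * g' i (tail Q a)"
      using f(1)[of a i] by (simp add: cplx_dsum_def)
    show "cdiff (T x) i v = g (i + 1) v * diag_block_mat [cdiff (F x) i v, cdiff M i v] * g' i v"
      using f(2)[of i v] by (simp add: cplx_dsum_def)
  qed
  show ?thesis unfolding pcplx_def
  proof (intro conjI allI ballI)
    show "x \<in> S \<Longrightarrow> T x \<in> Cb Q R ee" for x using T by blast
    fix i a assume a: "a \<in> arcs Q"
    have Mc: "cmap M i a \<in> carrier_mat (mm i (head Q a)) (mm i (tail Q a))" using cmap_carrier[OF Mb(1) a, of i] Mb(2) by simp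
    have "pmat K S (ee i (head Q a)) (ee i (tail Q a)) (\<lambda>x. g i (head Q a) * diag_block_mat [cmap (F x) i a, cmap M i a] * g' i (tail Q a))"
      by (rule pmat_mult[OF pmat_mult[OF pmat_const[OF g(1)] pmat_diag[OF pcplxD(4)[OF F a] pmat_const[OF Mc]]] pmat_const[OF g(2)]])
    then show "pmat K S (ee i (head Q a)) (ee i (tail Q a)) (\<lambda>x. cmap (T x) i a)" by (rule pmat_cong[rotated]) (simp add: f(1) a)
  next
    fix i v
    have Mc: "cdiff M i v \<in> carrier_mat (mm (i + 1) v) (mm i v)" using bcD(4)[OF Mb(1), of i v] Mb(2) by simp
    have "pmat K S (ee (i + 1) v) (ee i v) (\<lambda>x. g (i + 1) v * diag_block_mat [cdiff (F x) i v, cdiff M i v] * g' i v)"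
      by (rule pmat_mult[OF pmat_mult[OF pmat_const[OF g(1)] pmat_diag[OF pcplxD(5)[OF F] pmat_const[OF Mc]]] pmat_const[OF g(2)]])
    then show "pmat K S (ee (i + 1) v) (ee i v) (\<lambda>x. cdiff (T x) i v)" by (rule pmat_cong[rotated]) (simp add: f(2))
  qed
qed

text \<open>\<open>Y\<close> embeds into a complex, compatibly with arrows and differentials, so the
  relations and the vanishing of composites are inherited by cancelling \<open>k\<close>.\<close>

lemma sub_cplx:
  assumes W: "bounded_cplx Q R W" and k: "\<And>i v. k i v \<in> carrier_mat (cdim W i v) (cdim Y i v)" "\<And>i v. r i v \<in> carrier_mat (cdim Y i v) (cdim W i v)"
    "\<And>i v. r i v * k i v = 1\<^sub>m (cdim Y i v)"
    and sh: "\<And>i. hom_shape Q (degree_rep Y i)" and dY: "\<And>i v. cdiff Y i v \<in> carrier_mat (cdim Y (i + 1) v) (cdim Y i v)"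
    and c: "\<And>i a. a \<in> arcs Q \<Longrightarrow> k i (head Q a) * cmap Y i a = cmap W i a * k i (tail Q a)" "\<And>i v. k (i + 1) v * cdiff Y i v = cdiff W i v * k i v"
    and fin: "finite {i. \<exists>v. cdim Y i v \<noteq> 0}"
  shows "bounded_cplx Q R Y"
proof -
  have h: "rep_hom Q (degree_rep Y i) (degree_rep W i) (k i)" for i unfolding rep_hom_def using k(1) c(1) by simp
  note d = carrier_matD[OF k(1)] carrier_matD[OF k(2)] carrier_matD[OF dY] bc_dims[OF W]
  show ?thesis unfolding bounded_cplx_def
  proof (intro conjI allI fin)
    fix i
    show "is_rep Q R (degree_rep Y i)" by (rule sub_rep[OF sh bcD(1)[OF W] h, of "r i"]) (use k in auto)
    show "rep_hom Q (degree_rep Y i) (degree_rep Y (i + 1)) (cdiff Y i)" unfolding rep_hom_def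
    proof (intro conjI allI ballI)
      fix a assume a: "a \<in> arcs Q"
      note da = shape_dims[OF sh a] carrier_matD[OF cmap_carrier[OF W a]]
      have "k (i + 1) (head Q a) * (cdiff Y i (head Q a) * cmap Y i a) = (k (i + 1) (head Q a) * cdiff Y i (head Q a)) * cmap Y i a"
        using da[of i] by (simp add: mat_assoc d)
      also have "\<dots> = cdiff W i (head Q a) * (k i (head Q a) * cmap Y i a)" unfolding c(2) using da[of i] by (simp add: mat_assoc d)
      also have "\<dots> = (cdiff W i (head Q a) * cmap W i a) * k i (tail Q a)" unfolding c(1)[OF a] using da by (simp add: mat_assoc d)
      also have "cdiff W i (head Q a) * cmap W i a = cmap W (i + 1) a * cdiff W i (tail Q a)" using hom_comm[OF bcD(3)[OF W, of i] a] by simp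
      also have "cmap W (i + 1) a * cdiff W i (tail Q a) * k i (tail Q a) = cmap W (i + 1) a * (k (i + 1) (tail Q a) * cdiff Y i (tail Q a))"
        unfolding c(2) using da by (simp add: mat_assoc d)
      also have "\<dots> = (cmap W (i + 1) a * k (i + 1) (tail Q a)) * cdiff Y i (tail Q a)" using da by (simp add: mat_assoc d)
      also have "\<dots> = k (i + 1) (head Q a) * (cmap Y (i + 1) a * cdiff Y i (tail Q a))"
        unfolding c(1)[OF a, symmetric] using da[of "i + 1"] by (simp add: mat_assoc d)
      finally have e: "k (i + 1) (head Q a) * (cdiff Y i (head Q a) * cmap Y i a) = k (i + 1) (head Q a) * (cmap Y (i + 1) a * cdiff Y i (tail Q a))" .
      have "cdiff Y i (head Q a) * cmap Y i a = cmap Y (i + 1) a * cdiff Y i (tail Q a)"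
        by (rule mat_cancel_left[OF k(3) _ _ _ _ e]) (use da[of "i + 1"] in \<open>auto simp: d\<close>)
      then show "cdiff Y i (head Q a) * rmap (degree_rep Y i) a = rmap (degree_rep Y (i + 1)) a * cdiff Y i (tail Q a)" by simp
    qed (use dY in auto)
    fix v
    have "k (i + 1 + 1) v * (cdiff Y (i + 1) v * cdiff Y i v) = (k (i + 1 + 1) v * cdiff Y (i + 1) v) * cdiff Y i v" by (simp add: mat_assoc d)
    also have "\<dots> = cdiff W (i + 1) v * (k (i + 1) v * cdiff Y i v)" unfolding c(2)[of "i + 1"] by (simp add: mat_assoc d)
    also have "\<dots> = (cdiff W (i + 1) v * cdiff W i v) * k i v" unfolding c(2)[of i] by (simp add: mat_assoc d)
    also have "\<dots> = k (i + 1 + 1) v * 0\<^sub>m (cdim Y (i + 1 + 1) v) (cdim Y i v)" unfolding bcD(5)[OF W] by (simp add: mat_ring0 d add.assoc)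
    finally have e: "k (i + 1 + 1) v * (cdiff Y (i + 1) v * cdiff Y i v) = k (i + 1 + 1) v * 0\<^sub>m (cdim Y (i + 1 + 1) v) (cdim Y i v)" .
    have "cdiff Y (i + 1) v * cdiff Y i v = 0\<^sub>m (cdim Y (i + 1 + 1) v) (cdim Y i v)"
      by (rule mat_cancel_left[OF k(3) _ _ _ _ e]) (auto simp: d)
    then show "cdiff Y (i + 1) v * cdiff Y i v = 0\<^sub>m (cdim Y (i + 2) v) (cdim Y i v)" by (simp add: add.assoc)
  qed
qed

text \<open>Undo the constant conjugation by \<open>g\<close>. A point lies in the image iff the
  result is block diagonal with second block \<open>M\<close>, a system of polynomial equations; the
  first block is then the preimage.\<close>

lemma transition_image:
  assumes W: "pcplx K S ee W" and M: "M \<in> Cb Q R mm" and ne: "Cb Q R nn \<noteq> {}"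
    and T: "\<And>Y. Y \<in> Cb Q R nn \<Longrightarrow> T Y \<in> Cb Q R ee \<and> cplx_iso_via Q g (cplx_dsum Y M) (T Y)"
  defines "Z \<equiv> {x \<in> S. \<exists>Y\<in>Cb Q R nn. T Y = W x}"
  shows "zariski_closed_in K S Z"
    and "\<exists>Yf. (\<forall>x\<in>Z. Yf x \<in> Cb Q R nn \<and> T (Yf x) = W x) \<and> pcplx K Z nn Yf"
proof -
  obtain Y0 where Y0: "Y0 \<in> Cb Q R nn" using ne by blast
  note Mb = CbD[OF M]
  have nn: "dim_seq Q nn" by (rule Cb_dim_seq[OF Y0])
  have cd: "cdim (cplx_dsum Y M) i v = nn i v + mm i v" if "Y \<in> Cb Q R nn" for Y i v using CbD[OF that] Mb(2) by simp
  have Tb: "bounded_cplx Q R (T Y)" "cdim (T Y) = ee" if "Y \<in> Cb Q R nn" for Y using T[OF that] CbD by blast+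
  obtain g' where "\<And>i v. g i v \<in> carrier_mat (cdim (T Y0) i v) (cdim (cplx_dsum Y0 M) i v)" "\<And>i v. g' i v \<in> carrier_mat (cdim (cplx_dsum Y0 M) i v) (cdim (T Y0) i v)"
    "\<And>i v. g i v * g' i v = 1\<^sub>m (cdim (T Y0) i v)" "\<And>i v. g' i v * g i v = 1\<^sub>m (cdim (cplx_dsum Y0 M) i v)" using iso_inverse T[OF Y0] by metis
  then have g: "g i v \<in> carrier_mat (ee i v) (nn i v + mm i v)" "g' i v \<in> carrier_mat (nn i v + mm i v) (ee i v)" "g i v * g' i v = 1\<^sub>m (ee i v)" "g' i v * g i v = 1\<^sub>m (nn i v + mm i v)" for i v
    unfolding cd[OF Y0] Tb(2)[OF Y0] by auto
  note gd = carrier_matD[OF g(1)] carrier_matD[OF g(2)]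
  have inv: "invertible_mat (g i v)" for i v using invertible_iff[OF g(1)] g by blast
  \<comment> \<open>The arrows and differentials of \<open>W x\<close> in the coordinates of the sum
    of \<open>Y\<close> and \<open>M\<close>.\<close>
  define V where "V x i a = g' i (head Q a) * cmap (W x) i a * g i (tail Q a)" for x i a
  define D where "D x i v = g' (i + 1) v * cdiff (W x) i v * g i v" for x i v
  have pV: "pmat K S (nn i (head Q a) + mm i (head Q a)) (nn i (tail Q a) + mm i (tail Q a)) (\<lambda>x. V x i a)" if a: "a \<in> arcs Q" for i a
    unfolding V_def by (intro pmat_mult[OF pmat_mult[OF pmat_const pcplxD(4)[OF W a]] pmat_const] g)
  have pD: "pmat K S (nn (i + 1) v + mm (i + 1) v) (nn i v + mm i v) (\<lambda>x. D x i v)" for i v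
    unfolding D_def by (intro pmat_mult[OF pmat_mult[OF pmat_const pcplxD(5)[OF W]] pmat_const] g)
  \<comment> \<open>The upper left blocks, which are the only candidates for the matrices of a
    preimage.\<close>
  define Ya where "Ya x i a = prj1 (nn i (head Q a)) (mm i (head Q a)) * V x i a * inc1 (nn i (tail Q a)) (mm i (tail Q a))" for x i a
  define Yd where "Yd x i v = prj1 (nn (i + 1) v) (mm (i + 1) v) * D x i v * inc1 (nn i v) (mm i v)" for x i v
  have pYa: "pmat K S (nn i (head Q a)) (nn i (tail Q a)) (\<lambda>x. Ya x i a)" if a: "a \<in> arcs Q" for i a
    unfolding Ya_def by (intro pmat_mult[OF pmat_mult[OF pmat_const pV[OF a]] pmat_const]) (auto intro: carrier_matI)
  have pYd: "pmat K S (nn (i + 1) v) (nn i v) (\<lambda>x. Yd x i v)" for i v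
    unfolding Yd_def by (intro pmat_mult[OF pmat_mult[OF pmat_const pD] pmat_const]) (auto intro: carrier_matI)
  have Ma: "cmap M i a \<in> carrier_mat (mm i (head Q a)) (mm i (tail Q a))" if "a \<in> arcs Q" for i a using cmap_carrier[OF Mb(1) that, of i] Mb(2) by simp
  have Md: "cdiff M i v \<in> carrier_mat (mm (i + 1) v) (mm i v)" for i v using bcD(4)[OF Mb(1), of i v] Mb(2) by simp
  define cond where "cond x \<longleftrightarrow> (\<forall>i a. a \<in> arcs Q \<longrightarrow> V x i a = diag_block_mat [Ya x i a, cmap M i a]) \<and> (\<forall>i v. D x i v = diag_block_mat [Yd x i v, cdiff M i v])" for x
  define Yf where "Yf x = \<lparr>cdim = nn, cmap = \<lambda>i a. if a \<in> arcs Q then Ya x i a else 0\<^sub>m 0 0, cdiff = Yd x\<rparr>" for x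
  have closed: "zariski_closed_in K S {x \<in> S. cond x}"
    unfolding cond_def by (intro closed_conj closed_all closed_imp closed_mat_eq[OF pV pmat_diag[OF pYa pmat_const[OF Ma]]] closed_mat_eq[OF pD pmat_diag[OF pYd pmat_const[OF Md]]])
  have fwd: "Yf x \<in> Cb Q R nn \<and> T (Yf x) = W x" if x: "x \<in> S" and c: "cond x" for x
  proof -
    note Wb = pcplxD(2,3)[OF W x]
    have Wa: "cmap (W x) i a \<in> carrier_mat (ee i (head Q a)) (ee i (tail Q a))" if "a \<in> arcs Q" for i a using cmap_carrier[OF Wb(1) that, of i] Wb(2) by simp
    note Wd = bc_dims[OF Wb(1), unfolded Wb(2)]
    have ca: "a \<in> arcs Q \<Longrightarrow> V x i a = diag_block_mat [Ya x i a, cmap M i a]" and cdd: "D x i v = diag_block_mat [Yd x i v, cdiff M i v]" for i a v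
      using c unfolding cond_def by auto
    have Yac: "Ya x i a \<in> carrier_mat (nn i (head Q a)) (nn i (tail Q a))" if "a \<in> arcs Q" for i a using pmatD(1)[OF pYa[OF that] x] .
    have Ydc: "Yd x i v \<in> carrier_mat (nn (i + 1) v) (nn i v)" for i v using pmatD(1)[OF pYd x] .
    have gV: "g i (head Q a) * V x i a = cmap (W x) i a * g i (tail Q a)" if a: "a \<in> arcs Q" for i a
      unfolding V_def using g(3) carrier_matD[OF Wa[OF a]] by (simp add: mat_assoc[symmetric] gd mat_ring0)
    have gD: "g (i + 1) v * D x i v = cdiff (W x) i v * g i v" for i v
      unfolding D_def using g(3) by (simp add: mat_assoc[symmetric] gd mat_ring0 Wd)
    \<comment> \<open>The equations make the first summand stable under arrows and differentials, so
      \<open>g\<close> restricted to it embeds the candidate into \<open>W x\<close>.\<close>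
    have b: "bounded_cplx Q R (Yf x)"
    proof (rule sub_cplx[OF Wb(1), where k = "\<lambda>i v. g i v * inc1 (nn i v) (mm i v)" and r = "\<lambda>i v. prj1 (nn i v) (mm i v) * g' i v"])
      fix i v
      show "g i v * inc1 (nn i v) (mm i v) \<in> carrier_mat (cdim (W x) i v) (cdim (Yf x) i v)" by (intro carrier_matI) (auto simp: gd Wb(2) Yf_def)
      show "prj1 (nn i v) (mm i v) * g' i v \<in> carrier_mat (cdim (Yf x) i v) (cdim (W x) i v)" by (intro carrier_matI) (auto simp: gd Wb(2) Yf_def)
      have "prj1 (nn i v) (mm i v) * g' i v * (g i v * inc1 (nn i v) (mm i v)) = prj1 (nn i v) (mm i v) * ((g' i v * g i v) * inc1 (nn i v) (mm i v))" by (simp add: mat_assoc gd)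
      then show "prj1 (nn i v) (mm i v) * g' i v * (g i v * inc1 (nn i v) (mm i v)) = 1\<^sub>m (cdim (Yf x) i v)" by (simp add: g(4) mat_ring0 prj_inc Yf_def)
      show "cdiff (Yf x) i v \<in> carrier_mat (cdim (Yf x) (i + 1) v) (cdim (Yf x) i v)" using Ydc by (simp add: Yf_def)
      have "g (i + 1) v * inc1 (nn (i + 1) v) (mm (i + 1) v) * Yd x i v = g (i + 1) v * (D x i v * inc1 (nn i v) (mm i v))"
        using diag_inc(1)[of "Yd x i v" "cdiff M i v"] carrier_matD[OF Ydc] carrier_matD[OF Md] unfolding cdd by (simp add: mat_assoc gd)
      also have "\<dots> = (g (i + 1) v * D x i v) * inc1 (nn i v) (mm i v)" using carrier_matD[OF pmatD(1)[OF pD x]] by (simp add: mat_assoc gd)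
      also have "\<dots> = cdiff (W x) i v * (g i v * inc1 (nn i v) (mm i v))" unfolding gD by (simp add: mat_assoc gd Wd)
      finally show "g (i + 1) v * inc1 (nn (i + 1) v) (mm (i + 1) v) * cdiff (Yf x) i v = cdiff (W x) i v * (g i v * inc1 (nn i v) (mm i v))" by (simp add: Yf_def)
    next
      fix i
      show "hom_shape Q (degree_rep (Yf x) i)" unfolding hom_shape_def using Yac nn by (auto simp: Yf_def dim_seq_def)
    next
      fix i a assume a: "a \<in> arcs Q"
      have "g i (head Q a) * inc1 (nn i (head Q a)) (mm i (head Q a)) * Ya x i a = g i (head Q a) * (V x i a * inc1 (nn i (tail Q a)) (mm i (tail Q a)))"
        using diag_inc(1)[of "Ya x i a" "cmap M i a"] carrier_matD[OF Yac[OF a]] carrier_matD[OF Ma[OF a]] unfolding ca[OF a] by (simp add: mat_assoc gd)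
      also have "\<dots> = (g i (head Q a) * V x i a) * inc1 (nn i (tail Q a)) (mm i (tail Q a))" using carrier_matD[OF pmatD(1)[OF pV[OF a] x]] by (simp add: mat_assoc gd)
      also have "\<dots> = cmap (W x) i a * (g i (tail Q a) * inc1 (nn i (tail Q a)) (mm i (tail Q a)))" unfolding gV[OF a] using carrier_matD[OF Wa[OF a]] by (simp add: mat_assoc gd)
      finally show "g i (head Q a) * inc1 (nn i (head Q a)) (mm i (head Q a)) * cmap (Yf x) i a = cmap (W x) i a * (g i (tail Q a) * inc1 (nn i (tail Q a)) (mm i (tail Q a)))"
        using a by (simp add: Yf_def)
    next
      show "finite {i. \<exists>v. cdim (Yf x) i v \<noteq> 0}" using nn unfolding dim_seq_def by (simp add: Yf_def)
    qed
    have Cb: "Yf x \<in> Cb Q R nn" unfolding Cb_def using b by (simp add: Yf_def)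
    have iso: "cplx_iso_via Q g (cplx_dsum (Yf x) M) (W x)"
      unfolding cplx_iso_via_def chain_map_def rep_hom_def
    proof (intro conjI allI ballI inv)
      fix i v show "g i v \<in> carrier_mat (rdim (degree_rep (W x) i) v) (rdim (degree_rep (cplx_dsum (Yf x) M) i) v)"
        using g(1)[of i v] Wb(2) Mb(2) by (simp add: Yf_def)
    next
      fix i a assume a: "a \<in> arcs Q"
      show "g i (head Q a) * rmap (degree_rep (cplx_dsum (Yf x) M) i) a = rmap (degree_rep (W x) i) a * g i (tail Q a)"
        using gV[OF a, of i] ca[OF a, of i] a by (simp add: cplx_dsum_def Yf_def)
    next
      fix i v show "g (i + 1) v * cdiff (cplx_dsum (Yf x) M) i v = cdiff (W x) i v * g i v"
        using gD[of i v] cdd[of i v] by (simp add: cplx_dsum_def Yf_def)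
    qed
    \<comment> \<open>Both sides arise from the same block sum by conjugation with the same
      \<open>g\<close>.\<close>
    have "T (Yf x) = W x"
      using iso_target_unique[OF _ iso dsum_bounded[OF b Mb(1)] Tb(1)[OF Cb] Wb(1)] T[OF Cb] Tb(2)[OF Cb] Wb(2) by simp
    then show ?thesis using Cb by simp
  qed
  have bwd: "cond x" if x: "x \<in> S" and Y: "Y \<in> Cb Q R nn" "T Y = W x" for x Y
  proof -
    note Yb = CbD[OF Y(1)]
    have iso: "cplx_iso_via Q g (cplx_dsum Y M) (W x)" using T[OF Y(1)] Y(2) by simp
    note Wb = pcplxD(2,3)[OF W x]
    have g2: "g i v \<in> carrier_mat (cdim (W x) i v) (cdim (cplx_dsum Y M) i v)" "g' i v \<in> carrier_mat (cdim (cplx_dsum Y M) i v) (cdim (W x) i v)"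
      "g' i v * g i v = 1\<^sub>m (cdim (cplx_dsum Y M) i v)" for i v unfolding cd[OF Y(1)] Wb(2) by (rule g)+
    note f = iso_source_formula[OF g2 iso dsum_bounded[OF Yb(1) Mb(1)] Wb(1)]
    have V1: "V x i a = diag_block_mat [cmap Y i a, cmap M i a]" if "a \<in> arcs Q" for i a using f(1)[OF that, of i] by (simp add: V_def cplx_dsum_def)
    have D1: "D x i v = diag_block_mat [cdiff Y i v, cdiff M i v]" for i v using f(2)[of i v] by (simp add: D_def cplx_dsum_def)
    have "Ya x i a = cmap Y i a" if a: "a \<in> arcs Q" for i a
    proof -
      note c = carrier_matD[OF cmap_carrier[OF Yb(1) a, of i], unfolded Yb(2)] carrier_matD[OF Ma[OF a]]
      show ?thesis unfolding Ya_def V1[OF a] using diag_inc(1)[of "cmap Y i a" "cmap M i a"] c by (simp add: mat_assoc prj_inc_mult)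
    qed
    moreover have "Yd x i v = cdiff Y i v" for i v
    proof -
      note c = bc_dims[OF Yb(1), unfolded Yb(2)] carrier_matD[OF Md]
      show ?thesis unfolding Yd_def D1 using diag_inc(1)[of "cdiff Y i v" "cdiff M i v"] c by (simp add: mat_assoc prj_inc_mult)
    qed
    ultimately show ?thesis unfolding cond_def using V1 D1 by simp
  qed
  have Zc: "Z = {x \<in> S. cond x}" unfolding Z_def using fwd bwd by blast
  show "zariski_closed_in K S Z" unfolding Zc by (rule closed)
  have "pcplx K Z nn Yf" unfolding pcplx_def
  proof (intro conjI allI ballI)
    show "x \<in> Z \<Longrightarrow> Yf x \<in> Cb Q R nn" for x using fwd unfolding Zc by blast
    have ZS: "Z \<subseteq> S" unfolding Zc by blast
    show "a \<in> arcs Q \<Longrightarrow> pmat K Z (nn i (head Q a)) (nn i (tail Q a)) (\<lambda>x. cmap (Yf x) i a)" for i a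
      using pmat_subset[OF pYa ZS] by (simp add: Yf_def)
    show "pmat K Z (nn (i + 1) v) (nn i v) (\<lambda>x. cdiff (Yf x) i v)" for i v
      using pmat_subset[OF pYd ZS] by (simp add: Yf_def)
  qed
  then show "\<exists>Yf. (\<forall>x\<in>Z. Yf x \<in> Cb Q R nn \<and> T (Yf x) = W x) \<and> pcplx K Z nn Yf" using fwd Zc by blast
qed

end

subsection \<open>Direct limits of varieties of complexes\<close>

text \<open>Both direct systems at once: \<open>'c\<close> is the type of vertices for complexes of
  modules, and the type of indices into \<open>Ps\<close> for complexes of projectives.
  \<open>I_shift\<close> stands in for directedness of the index set.\<close>

locale limit_system = bound_quiver Q R for Q :: "('v, 'a) pre_digraph" and R +
  fixes I :: "(int \<Rightarrow> 'c \<Rightarrow> nat) set" and F :: "(int \<Rightarrow> 'c \<Rightarrow> nat) \<Rightarrow> ('v, 'a) cplx set" and ok :: "('v, 'a) cplx \<Rightarrow> bool"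
    and M :: "(int \<Rightarrow> 'c \<Rightarrow> nat) \<Rightarrow> (int \<Rightarrow> 'c \<Rightarrow> nat) \<Rightarrow> ('v, 'a) cplx" and T :: "(int \<Rightarrow> 'c \<Rightarrow> nat) \<Rightarrow> (int \<Rightarrow> 'c \<Rightarrow> nat) \<Rightarrow> ('v, 'a) cplx \<Rightarrow> ('v, 'a) cplx"
  assumes ts: "transition_system Q I F ok M T"
    and F_bounded: "X \<in> F i \<Longrightarrow> bounded_cplx Q R X"
    and F_cdim: "X \<in> F i \<Longrightarrow> Y \<in> F i \<Longrightarrow> cdim X = cdim Y"
    and ok_acyclic: "X \<in> F i \<Longrightarrow> ok X \<Longrightarrow> acyclic_cplx X"
    and F_zero: "zero_cplx \<in> F (\<lambda>_ _. 0)" "ok zero_cplx"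
    and F_add: "X \<in> F i \<Longrightarrow> Y \<in> F j \<Longrightarrow> ok X \<Longrightarrow> ok Y \<Longrightarrow> cplx_dsum X Y \<in> F (\<lambda>n c. i n c + j n c) \<and> ok (cplx_dsum X Y)"
    and I_shift: "k \<in> I \<Longrightarrow> i \<in> I \<Longrightarrow> j \<in> I \<Longrightarrow> seq_le F ok i j \<Longrightarrow> (\<lambda>n c. k n c + seq_diff j i n c) \<in> I"
begin

abbreviation le where "le \<equiv> seq_le F ok"
abbreviation L where "L \<equiv> direct_limit_rel I le F T"

lemma le_refl: "le i i"
  unfolding seq_le_def seq_diff_def using F_zero by auto

lemma le_trans:
  assumes "le i j" "le j k"
  shows "le i k"
proof -
  obtain X Y where X: "X \<in> F (seq_diff j i)" "ok X" and Y: "Y \<in> F (seq_diff k j)" "ok Y" using assms unfolding seq_le_def by blast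
  have ij: "\<And>n c. i n c \<le> j n c" "\<And>n c. j n c \<le> k n c" using assms unfolding seq_le_def by auto
  have "(\<lambda>n c. seq_diff j i n c + seq_diff k j n c) = seq_diff k i"
    using ij by (intro ext) (simp add: seq_diff_def)
  then have "\<exists>Z\<in>F (seq_diff k i). ok Z" using F_add[OF X(1) Y(1) X(2) Y(2)] by auto
  moreover have "i n c \<le> k n c" for n c using ij order_trans by blast
  ultimately show ?thesis unfolding seq_le_def by blast
qed

text \<open>The index set need not be directed, but two upper bounds \<open>k\<close> and \<open>k'\<close> of \<open>i\<close> have the common
  upper bound \<open>k + (k' - i)\<close>.\<close>

lemma le_directed:
  assumes "i \<in> I" "k \<in> I" "k' \<in> I" "le i k" "le i k'"
  obtains k'' where "k'' \<in> I" "le k k''" "le k' k''"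
proof -
  define k'' where "k'' n c = k n c + seq_diff k' i n c" for n c
  have ik: "\<And>n c. i n c \<le> k n c" "\<And>n c. i n c \<le> k' n c" using assms unfolding seq_le_def by auto
  have d: "seq_diff k'' k = seq_diff k' i" "seq_diff k'' k' = seq_diff k i"
    using ik by (auto simp: k''_def seq_diff_def fun_eq_iff add.commute)
  have "k n c \<le> k'' n c" "k' n c \<le> k'' n c" for n c using ik(1)[of n c] ik(2)[of n c] unfolding k''_def seq_diff_def by linarith+
  then have "le k k''" "le k' k''" using assms(4,5) unfolding seq_le_def d by auto
  moreover have "k'' \<in> I" using I_shift[OF assms(2,1,3,5)] by (simp add: k''_def[abs_def])
  ultimately show ?thesis using that by blast
qed

lemma le_finite_bound:
  assumes "finite A" "A \<subseteq> I" "m \<in> I" "\<And>k. k \<in> A \<Longrightarrow> le m k"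
  shows "\<exists>K\<in>I. le m K \<and> (\<forall>k\<in>A. le k K)"
  using assms
proof (induction A rule: finite_induct)
  case empty then show ?case using le_refl by blast
next
  case (insert k A)
  then obtain K where K: "K \<in> I" "le m K" "\<forall>k\<in>A. le k K" by auto
  obtain K' where "K' \<in> I" "le K K'" "le k K'" using le_directed[of m K k] insert.prems K by auto
  then show ?case using K le_trans by blast
qed

lemma trans_props:
  assumes "i \<in> I" "j \<in> I" "le i j"
  shows "M i j \<in> F (seq_diff j i)" "acyclic_cplx (M i j)" "\<exists>g. \<forall>X\<in>F i. T i j X \<in> F j \<and> cplx_iso_via Q g (cplx_dsum X (M i j)) (T i j X)"
proof -
  have "M i j \<in> F (seq_diff j i) \<and> ok (M i j) \<and> (\<exists>g. \<forall>X\<in>F i. T i j X \<in> F j \<and> cplx_iso_via Q g (cplx_dsum X (M i j)) (T i j X))"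
    using ts assms unfolding transition_system_def by blast
  then show "M i j \<in> F (seq_diff j i)" "acyclic_cplx (M i j)" "\<exists>g. \<forall>X\<in>F i. T i j X \<in> F j \<and> cplx_iso_via Q g (cplx_dsum X (M i j)) (T i j X)"
    using ok_acyclic by auto
qed

lemma trans_in:
  assumes "i \<in> I" "j \<in> I" "le i j" "X \<in> F i"
  shows "T i j X \<in> F j"
  using trans_props(3)[OF assms(1-3)] assms(4) by blast

lemma trans_qis:
  assumes "i \<in> I" "j \<in> I" "le i j" "X \<in> F i"
  shows "quasi_isomorphic Q R X (T i j X)"
proof -
  note p = trans_props[OF assms(1-3)]
  note Mb = F_bounded[OF p(1)] and Xb = F_bounded[OF assms(4)]
  obtain g where g: "T i j X \<in> F j" "cplx_iso_via Q g (cplx_dsum X (M i j)) (T i j X)" using p(3) assms(4) by blast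
  note D = dsum_bounded[OF Xb Mb]
  have "quasi_isomorphic Q R (cplx_dsum X (M i j)) X" using qisI[OF D Xb dsum_acyclic_quasi[OF Xb Mb p(2)]] .
  moreover have "quasi_isomorphic Q R (cplx_dsum X (M i j)) (T i j X)" using qisI[OF D F_bounded[OF g(1)] cplx_iso_quasi[OF g(2) D F_bounded[OF g(1)]]] .
  ultimately show ?thesis using qis_trans[OF qis_sym] by blast
qed

lemma trans_inj:
  assumes "i \<in> I" "j \<in> I" "le i j" "X \<in> F i" "Y \<in> F i" "T i j X = T i j Y"
  shows "X = Y"
proof -
  note p = trans_props[OF assms(1-3)]
  obtain g where g: "\<And>X. X \<in> F i \<Longrightarrow> cplx_iso_via Q g (cplx_dsum X (M i j)) (T i j X)" using p(3) by blast
  show ?thesis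
    by (rule transition_inj[OF g[OF assms(4)] g[OF assms(5), folded assms(6)] F_bounded[OF assms(4)] F_bounded[OF assms(5)] F_bounded[OF trans_in[OF assms(1-4)]] F_bounded[OF p(1)]
        F_cdim[OF assms(4,5)]])
qed

lemma trans_comp:
  assumes "i \<in> I" "j \<in> I" "k \<in> I" "le i j" "le j k" "X \<in> F i"
  shows "T j k (T i j X) = T i k X"
proof -
  have "\<forall>i\<in>I. \<forall>j\<in>I. \<forall>k\<in>I. le i j \<and> le j k \<longrightarrow> cplx_iso Q (cplx_dsum (M i j) (M j k)) (M i k) \<and> (\<forall>X\<in>F i. T j k (T i j X) = T i k X)"
    using ts unfolding transition_system_def by (rule conjunct2)
  then show ?thesis using assms by simp
qed

text \<open>\<open>T i i\<close> is idempotent by composition and injective by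
  \<open>trans_inj\<close>, hence the identity.\<close>

lemma trans_id: "i \<in> I \<Longrightarrow> X \<in> F i \<Longrightarrow> T i i X = X"
  by (rule trans_inj[OF _ _ le_refl trans_in[OF _ _ le_refl]]) (auto intro: trans_comp le_refl)

lemma L_iff: "((i, X), (j, Y)) \<in> L \<longleftrightarrow> i \<in> I \<and> X \<in> F i \<and> j \<in> I \<and> Y \<in> F j \<and> (\<exists>k\<in>I. le i k \<and> le j k \<and> T i k X = T j k Y)"
  unfolding direct_limit_rel_def by auto

text \<open>Transition maps are injective, so an equality over one upper bound can be transported to
  any other through a common larger one.\<close>

lemma L_at:
  assumes I: "i \<in> I" "j \<in> I" "k \<in> I" "le i k" "le j k" and X: "X \<in> F i" "Y \<in> F j"
  shows "((i, X), (j, Y)) \<in> L \<longleftrightarrow> T i k X = T j k Y"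
proof
  assume "((i, X), (j, Y)) \<in> L"
  then obtain k' where k': "k' \<in> I" "le i k'" "le j k'" "T i k' X = T j k' Y" unfolding L_iff by blast
  obtain l where l: "l \<in> I" "le k l" "le k' l" using le_directed[OF I(1,3) k'(1) I(4) k'(2)] .
  have "T k l (T i k X) = T k' l (T i k' X)" using trans_comp[OF I(1,3) l(1) I(4) l(2) X(1)] trans_comp[OF I(1) k'(1) l(1) k'(2) l(3) X(1)] by simp
  also have "\<dots> = T k l (T j k Y)" unfolding k'(4) using trans_comp[OF I(2,3) l(1) I(5) l(2) X(2)] trans_comp[OF I(2) k'(1) l(1) k'(3) l(3) X(2)] by simp
  finally show "T i k X = T j k Y" using trans_inj[OF I(3) l(1,2) trans_in[OF I(1,3,4) X(1)] trans_in[OF I(2,3,5) X(2)]] by blast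
qed (use assms in \<open>auto simp: L_iff\<close>)

lemma L_equiv: "equiv (Sigma I F) L"
proof (rule equivI)
  show "L \<subseteq> Sigma I F \<times> Sigma I F" unfolding direct_limit_rel_def by blast
  show "refl_on (Sigma I F) L" unfolding refl_on_def using L_iff le_refl by fastforce
  show "sym L" unfolding sym_def direct_limit_rel_def by (auto intro: sym)
  show "trans L"
  proof (rule transI, clarify)
    fix i X j Y l Z assume a: "((i, X), (j, Y)) \<in> L" and b: "((j, Y), (l, Z)) \<in> L"
    then obtain k k' where k: "i \<in> I" "X \<in> F i" "j \<in> I" "Y \<in> F j" "k \<in> I" "le i k" "le j k" and k': "l \<in> I" "Z \<in> F l" "k' \<in> I" "le j k'" "le l k'"
      unfolding L_iff by blast
    \<comment> \<open>Both \<open>k\<close> and \<open>k'\<close> lie above \<open>j\<close>, so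
      \<open>le_directed\<close> provides a common upper bound.\<close>
    obtain m where m: "m \<in> I" "le k m" "le k' m" using le_directed[OF k(3,5) k'(3) k(7) k'(4)] .
    have le: "le i m" "le j m" "le l m" using le_trans k k' m by blast+
    show "((i, X), (l, Z)) \<in> L"
      using a b L_at[OF k(1,3) m(1) le(1,2) k(2,4)] L_at[OF k(3) k'(1) m(1) le(2,3) k(4) k'(2)] L_at[OF k(1) k'(1) m(1) le(1,3) k(2) k'(2)] by simp
  qed
qed

lemma L_qis:
  assumes "((i, X), (j, Y)) \<in> L"
  shows "quasi_isomorphic Q R X Y"
proof -
  obtain k where k: "i \<in> I" "X \<in> F i" "j \<in> I" "Y \<in> F j" "k \<in> I" "le i k" "le j k" "T i k X = T j k Y" using assms unfolding L_iff by blast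
  show ?thesis using qis_trans[OF trans_qis[OF k(1,5,6,2)] qis_sym[OF trans_qis[OF k(3,5,7,4)], folded k(8)]] .
qed

abbreviation lim where "lim \<equiv> direct_limit I le F T"
abbreviation to where "to \<equiv> to_limit I le F T"

lemma to_in: "i \<in> I \<Longrightarrow> X \<in> F i \<Longrightarrow> to i X \<in> lim"
  unfolding to_limit_def direct_limit_def by (rule quotientI) simp

lemma mem_to: "i \<in> I \<Longrightarrow> X \<in> F i \<Longrightarrow> (i, X) \<in> to i X"
  unfolding to_limit_def using equiv_class_self[OF L_equiv, of "(i, X)"] by simp

lemma to_eq:
  assumes "i \<in> I" "X \<in> F i" "j \<in> I" "Y \<in> F j"
  shows "to i X = to j Y \<longleftrightarrow> ((i, X), (j, Y)) \<in> L"
  unfolding to_limit_def using eq_equiv_class_iff[OF L_equiv, of "(i, X)" "(j, Y)"] assms by simp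

lemma to_trans:
  assumes "i \<in> I" "j \<in> I" "le i j" "X \<in> F i"
  shows "to j (T i j X) = to i X"
  using to_eq[OF assms(2) trans_in[OF assms] assms(1,4)] L_at[OF assms(2,1,2) le_refl assms(3) trans_in[OF assms] assms(4)] trans_id[OF assms(2) trans_in[OF assms]] by simp

lemma to_inj: "i \<in> I \<Longrightarrow> X \<in> F i \<Longrightarrow> Y \<in> F i \<Longrightarrow> to i X = to i Y \<Longrightarrow> X = Y"
  using to_eq[of i X i Y] L_at[of i i i X Y] trans_id le_refl by simp

lemma limD:
  assumes "p \<in> lim" "(i, X) \<in> p"
  shows "i \<in> I" "X \<in> F i" "p = to i X"
proof -
  have "(i, X) \<in> Sigma I F" using assms in_quotient_imp_subset[OF L_equiv] unfolding direct_limit_def by blast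
  then show "i \<in> I" "X \<in> F i" by auto
  then show "p = to i X" using assms quotient_eqI[OF L_equiv, of p "to i X" "(i, X)" "(i, X)"] to_in mem_to L_iff le_refl unfolding direct_limit_def by fastforce
qed

lemma lim_rep:
  assumes "p \<in> lim"
  obtains i X where "i \<in> I" "X \<in> F i" "p = to i X"
proof -
  obtain i X where "(i, X) \<in> p" using in_quotient_imp_non_empty[OF L_equiv, of p] assms unfolding direct_limit_def by fastforce
  then show ?thesis using that limD[OF assms] by blast
qed

lemma limit_qis_to:
  assumes "i \<in> I" "X \<in> F i" "j \<in> I" "Y \<in> F j"
  shows "(to i X, to j Y) \<in> limit_qis Q R lim \<longleftrightarrow> quasi_isomorphic Q R X Y"
proof
  assume "(to i X, to j Y) \<in> limit_qis Q R lim"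
  then obtain i' X' j' Y' where *: "(i', X') \<in> to i X" "(j', Y') \<in> to j Y" "quasi_isomorphic Q R X' Y'" unfolding limit_qis_def by blast
  then have "quasi_isomorphic Q R X X'" "quasi_isomorphic Q R Y Y'" unfolding to_limit_def by (auto intro: L_qis)
  then show "quasi_isomorphic Q R X Y" using *(3) qis_trans qis_sym by blast
qed (use assms in \<open>auto simp: limit_qis_def intro: to_in mem_to\<close>)

lemma limit_qis_equiv: "equiv lim (limit_qis Q R lim)"
proof (rule equivI)
  show "limit_qis Q R lim \<subseteq> lim \<times> lim" unfolding limit_qis_def by blast
  show "refl_on lim (limit_qis Q R lim)" unfolding refl_on_def
  proof
    fix p assume "p \<in> lim"
    then show "(p, p) \<in> limit_qis Q R lim" by (rule lim_rep) (simp add: limit_qis_to qis_refl)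
  qed
  show "sym (limit_qis Q R lim)" unfolding sym_def limit_qis_def by (blast intro: qis_sym)
  show "trans (limit_qis Q R lim)"
  proof (rule transI)
    fix p q r assume a: "(p, q) \<in> limit_qis Q R lim" "(q, r) \<in> limit_qis Q R lim"
    then have "p \<in> lim" "q \<in> lim" "r \<in> lim" unfolding limit_qis_def by auto
    then obtain i X j Y k Z where "i \<in> I" "X \<in> F i" "p = to i X" "j \<in> I" "Y \<in> F j" "q = to j Y" "k \<in> I" "Z \<in> F k" "r = to k Z" by (metis lim_rep)
    then show "(p, r) \<in> limit_qis Q R lim" using a by (auto simp: limit_qis_to intro: qis_trans)
  qed
qed

end

section \<open>Maps induced on quotients\<close>

lemma induced_map_class:
  assumes A: "equiv A r" and B: "equiv B s" and f: "\<forall>(x, x')\<in>r. (f x, f x') \<in> s" and x: "x \<in> A"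
  shows "induced_map s f (r `` {x}) = s `` {f x}"
proof -
  have "s `` {f x'} = s `` {f x}" if "x' \<in> r `` {x}" for x'
    using equiv_class_eq[OF B, of "f x" "f x'"] f that by auto
  moreover have "x \<in> r `` {x}" using equiv_class_self[OF A x] .
  ultimately show ?thesis unfolding induced_map_def by blast
qed

lemma inverse_on_quotientsI:
  assumes A: "equiv A r" and B: "equiv B s" and f: "f \<in> A \<rightarrow> B" "\<forall>(x, x')\<in>r. (f x, f x') \<in> s" and g: "g \<in> B \<rightarrow> A" "\<forall>(y, y')\<in>s. (g y, g y') \<in> r"
    and gf: "\<And>x. x \<in> A \<Longrightarrow> (g (f x), x) \<in> r" and fg: "\<And>y. y \<in> B \<Longrightarrow> (f (g y), y) \<in> s"
  shows "inverse_on_quotients A r B s f g"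
proof -
  have "induced_map r g (induced_map s f c) = c" if c: "c \<in> A // r" for c
  proof -
    obtain x where x: "x \<in> A" "c = r `` {x}" using c by (rule quotientE)
    then have "f x \<in> B" using f(1) by auto
    then have "induced_map r g (induced_map s f c) = r `` {g (f x)}" using induced_map_class[OF A B f(2) x(1)] induced_map_class[OF B A g(2)] x(2) by simp
    then show ?thesis using equiv_class_eq[OF A gf[OF x(1)]] x(2) by simp
  qed
  moreover have "induced_map s f (induced_map r g c) = c" if c: "c \<in> B // s" for c
  proof -
    obtain x where x: "x \<in> B" "c = s `` {x}" using c by (rule quotientE)
    then have "g x \<in> A" using g(1) by auto
    then have "induced_map s f (induced_map r g c) = s `` {f (g x)}" using induced_map_class[OF B A g(2) x(1)] induced_map_class[OF A B f(2)] x(2) by simp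
    then show ?thesis using equiv_class_eq[OF B fg[OF x(1)]] x(2) by simp
  qed
  ultimately show ?thesis unfolding inverse_on_quotients_def using A B f g by blast
qed

section \<open>Kernels and images of zero and identity matrices\<close>

lemma carrier_vec_0: "carrier_vec 0 = {0\<^sub>v 0 :: complex vec}"
proof -
  have "v = 0\<^sub>v 0" if "v \<in> carrier_vec 0" for v :: "complex vec"
    by (rule eq_vecI) (use carrier_vecD[OF that] in simp_all)
  then show ?thesis using zero_carrier_vec[of 0] by blast
qed

lemma kernel_zero: "mat_kernel (0\<^sub>m n 0) = {0\<^sub>v 0 :: complex vec}" "mat_kernel (0\<^sub>m 0 n) = (carrier_vec n :: complex vec set)"
  unfolding mat_kernel_def by (auto simp: carrier_vec_0 intro!: eq_vecI)

lemma kernel_one: "mat_kernel (1\<^sub>m n) = {0\<^sub>v n :: complex vec}"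
  unfolding mat_kernel_def by auto

lemma image_zero: "mat_image (0\<^sub>m n 0) = {0\<^sub>v n}" "mat_image (0\<^sub>m 0 n) = {0\<^sub>v 0}"
proof -
  have *: "mat_image (0\<^sub>m m l) = {0\<^sub>v m}" for m l
  proof -
    have "mat_image (0\<^sub>m m l) = (\<lambda>z. 0\<^sub>v m) ` (carrier_vec l :: complex vec set)" unfolding mat_image_def index_zero_mat(3)
      by (rule image_cong[OF refl]) (rule mv_zero_mat, rule carrier_vecD)
    also have "\<dots> = {0\<^sub>v m}" by (rule image_constant[OF zero_carrier_vec])
    finally show ?thesis .
  qed
  show "mat_image (0\<^sub>m n 0) = {0\<^sub>v n}" "mat_image (0\<^sub>m 0 n) = {0\<^sub>v 0}" by (rule *)+
qed

lemma image_one: "mat_image (1\<^sub>m n) = carrier_vec n"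
proof -
  have "(\<lambda>z. 1\<^sub>m n *\<^sub>v z) ` carrier_vec n = (\<lambda>z. z) ` (carrier_vec n :: complex vec set)" by (intro image_cong) auto
  then show ?thesis unfolding mat_image_def by simp
qed

section \<open>Closed and constructible subsets\<close>

lemma closed_union:
  assumes "zariski_closed_in K S A" "zariski_closed_in K S B"
  shows "zariski_closed_in K S (A \<union> B)"
proof -
  obtain F where F: "\<And>p. p \<in> F \<Longrightarrow> polynomial_in K p" "A = {x \<in> S. \<forall>p\<in>F. p x = 0}" using assms(1) unfolding zariski_closed_in_def by auto
  obtain G where G: "\<And>p. p \<in> G \<Longrightarrow> polynomial_in K p" "B = {x \<in> S. \<forall>p\<in>G. p x = 0}" using assms(2) unfolding zariski_closed_in_def by auto
  define H where "H = (\<lambda>(p, q) x. p x * q x) ` (F \<times> G)"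
  have "\<forall>p\<in>H. polynomial_in K p" unfolding H_def using F(1) G(1) by (auto intro: polynomial_in.intros(4))
  moreover have "A \<union> B = {x \<in> S. \<forall>p\<in>H. p x = 0}" unfolding F(2) G(2) H_def by auto
  ultimately show ?thesis unfolding zariski_closed_in_def by (intro exI[of _ H]) simp
qed

lemma closed_UN: "finite A \<Longrightarrow> (\<And>a. a \<in> A \<Longrightarrow> zariski_closed_in K S (Z a)) \<Longrightarrow> zariski_closed_in K S (\<Union>a\<in>A. Z a)"
  by (induction A rule: finite_induct) (auto intro: closed_false closed_union)

lemma closed_diff_constructible: "zariski_closed_in K S Z \<Longrightarrow> zariski_closed_in K S W \<Longrightarrow> constructible_in K S (Z - W)"
  unfolding constructible_in_def by (intro exI[of _ "{(Z, W)}"]) auto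

lemma pfun_regular: "pfun K S f \<Longrightarrow> regular_on K S f"
  unfolding pfun_def regular_on_def
proof (elim exE conjE, intro ballI)
  fix p x assume "polynomial_in K p" "\<forall>x\<in>S. f x = p x"
  then show "\<exists>p q. polynomial_in K p \<and> polynomial_in K q \<and> q x \<noteq> 0 \<and> (\<forall>y\<in>S. q y \<noteq> 0 \<longrightarrow> f y = p y / q y)"
    by (intro exI[of _ p] exI[of _ "\<lambda>_. 1"]) (auto intro: polynomial_in.intros(2))
qed

lemma (in bound_quiver) pcplx_subset: "pcplx K S dd F \<Longrightarrow> S' \<subseteq> S \<Longrightarrow> pcplx K S' dd F"
  unfolding pcplx_def by (auto intro: pmat_subset[of K S])

lemma (in bound_quiver) pcplx_coords:
  assumes F: "pcplx K S dd F" and k: "k \<in> cplx_coords Q dd"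
  shows "pfun K S (\<lambda>x. k (F x))"
proof -
  consider i a r c where "k = (\<lambda>X. cmap X i a $$ (r, c))" "a \<in> arcs Q" "r < dd i (head Q a)" "c < dd i (tail Q a)"
    | i v r c where "k = (\<lambda>X. cdiff X i v $$ (r, c))" "r < dd (i + 1) v" "c < dd i v"
    using k unfolding cplx_coords_def by blast
  then show ?thesis
  proof cases
    case 1 show ?thesis unfolding 1(1) by (rule pmatD(2)[OF pcplxD(4)[OF F 1(2)] 1(3,4)])
  next
    case 2 show ?thesis unfolding 2(1) by (rule pmatD(2)[OF pcplxD(5)[OF F] 2(2,3)])
  qed
qed

section \<open>The direct system of complexes of modules\<close>

context bound_quiver begin

lemma degree_zero: "degree_rep zero_cplx i = zero_rep" by (simp add: degree_rep_def zero_cplx_def zero_rep_def)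

lemma zero_cplx_bounded: "bounded_cplx Q R zero_cplx"
proof -
  have r: "is_rep Q R (degree_rep zero_cplx i)" for i using zero_rep_rep[of Q R] unfolding degree_zero .
  show ?thesis unfolding bounded_cplx_def rep_hom_def using r by (simp add: zero_cplx_def)
qed

lemma zero_cplx_acyclic: "acyclic_cplx zero_cplx"
  unfolding acyclic_cplx_def cycles_def boundaries_def by (simp add: zero_cplx_def kernel_zero image_zero)

lemma disk_bounded:
  assumes S: "is_rep Q R S"
  shows "bounded_cplx Q R (disk_cplx k S)"
proof -
  have d: "degree_rep (disk_cplx k S) i = (if i = k \<or> i = k + 1 then S else zero_rep)" for i
    by (cases S) (simp add: degree_rep_def disk_cplx_def zero_rep_def)
  note sh = is_rep_shape[OF S]
  show ?thesis unfolding bounded_cplx_def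
  proof (intro conjI allI)
    have "{i. \<exists>v. cdim (disk_cplx k S) i v \<noteq> 0} \<subseteq> {k, k + 1}" by (auto simp: disk_cplx_def split: if_splits)
    then show "finite {i. \<exists>v. cdim (disk_cplx k S) i v \<noteq> 0}" by (rule finite_subset) simp
    show "is_rep Q R (degree_rep (disk_cplx k S) i)" for i unfolding d using S zero_rep_rep[of Q R] by simp
    show "rep_hom Q (degree_rep (disk_cplx k S) i) (degree_rep (disk_cplx k S) (i + 1)) (cdiff (disk_cplx k S) i)" for i
      unfolding d rep_hom_def using shape_dims[OF sh] by (auto simp: disk_cplx_def zero_rep_def mat_ring0 intro!: eq_matI carrier_matI)
    show "cdiff (disk_cplx k S) (i + 1) v * cdiff (disk_cplx k S) i v = 0\<^sub>m (cdim (disk_cplx k S) (i + 2) v) (cdim (disk_cplx k S) i v)" for i v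
      by (auto simp: disk_cplx_def mat_ring0 intro!: eq_matI)
  qed
qed

lemma disk_acyclic: "acyclic_cplx (disk_cplx k S)"
  unfolding acyclic_cplx_def cycles_def boundaries_def
  by (simp add: disk_cplx_def kernel_zero image_zero kernel_one image_one)

abbreviation "dsums ds \<equiv> foldr cplx_dsum (map (\<lambda>(k, S). disk_cplx k S) ds) zero_cplx"

lemma dsums_acyclic: "(\<forall>(k, S)\<in>set ds. simple_rep Q R S) \<Longrightarrow> bounded_cplx Q R (dsums ds) \<and> acyclic_cplx (dsums ds)"
proof (induction ds)
  case Nil then show ?case using zero_cplx_bounded zero_cplx_acyclic by simp
next
  case (Cons d ds)
  obtain k S where d: "d = (k, S)" by (cases d)
  then have S: "is_rep Q R S" using Cons.prems unfolding simple_rep_def by auto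
  have "bounded_cplx Q R (dsums ds)" "acyclic_cplx (dsums ds)" using Cons by auto
  then show ?case using dsum_bounded[OF disk_bounded[OF S]] dsum_acyclic[OF disk_bounded[OF S] _ disk_acyclic] by (simp add: d)
qed

lemma dsums_append: "dsums (ds @ es) = cplx_dsum (dsums ds) (dsums es)"
  by (induction ds) (auto simp: cplx_dsum_zero cplx_dsum_assoc)

lemma cplx_iso_acyclic:
  assumes "cplx_iso Q X Y" "bounded_cplx Q R X" "bounded_cplx Q R Y" "acyclic_cplx Y"
  shows "acyclic_cplx X"
  using assms acyclic_qis cplx_iso_quasi unfolding cplx_iso_def by blast

lemma simple_disk_sum_acyclic:
  assumes "bounded_cplx Q R X" "simple_disk_sum Q R X"
  shows "acyclic_cplx X"
proof -
  obtain ds where "\<forall>(k, S)\<in>set ds. simple_rep Q R S" "cplx_iso Q X (dsums ds)" using assms(2) unfolding simple_disk_sum_def by blast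
  then show ?thesis using cplx_iso_acyclic[OF _ assms(1)] dsums_acyclic by blast
qed

lemma cplx_iso_refl:
  assumes "bounded_cplx Q R X"
  shows "cplx_iso Q X X"
proof -
  have "invertible_mat (1\<^sub>m n :: complex mat)" for n by (rule invertible_iff[THEN iffD2, of _ n]) auto
  then show ?thesis using quasi_iso_refl[OF assms] unfolding cplx_iso_def cplx_iso_via_def quasi_iso_map_def by blast
qed

lemma dsum_iso:
  assumes X: "bounded_cplx Q R X" "bounded_cplx Q R X'" and Y: "bounded_cplx Q R Y" "bounded_cplx Q R Y'" and iso: "cplx_iso Q X X'" "cplx_iso Q Y Y'"
  shows "cplx_iso Q (cplx_dsum X Y) (cplx_dsum X' Y')"
proof -
  obtain f g where f: "cplx_iso_via Q f X X'" and g: "cplx_iso_via Q g Y Y'" using iso unfolding cplx_iso_def by blast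
  obtain f' where f': "\<And>i v. f i v \<in> carrier_mat (cdim X' i v) (cdim X i v)" "\<And>i v. f' i v \<in> carrier_mat (cdim X i v) (cdim X' i v)"
    "\<And>i v. f i v * f' i v = 1\<^sub>m (cdim X' i v)" "\<And>i v. f' i v * f i v = 1\<^sub>m (cdim X i v)" using iso_inverse[OF f] by metis
  obtain g' where g': "\<And>i v. g i v \<in> carrier_mat (cdim Y' i v) (cdim Y i v)" "\<And>i v. g' i v \<in> carrier_mat (cdim Y i v) (cdim Y' i v)"
    "\<And>i v. g i v * g' i v = 1\<^sub>m (cdim Y' i v)" "\<And>i v. g' i v * g i v = 1\<^sub>m (cdim Y i v)" using iso_inverse[OF g] by metis
  have mult: "diag_block_mat [A, B] * diag_block_mat [C, D] = diag_block_mat [A * C, B * (D :: complex mat)]"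
    if "A \<in> carrier_mat a b" "C \<in> carrier_mat b c" "B \<in> carrier_mat a' b'" "D \<in> carrier_mat b' c'" for A B C D a b c a' b' c'
    using that by (subst (1 2 3) diag_block2) (simp add: mult_four_block_mat[of A a b _ b' _ a' _ C c _ c'] mat_ring0)
  show ?thesis unfolding cplx_iso_def cplx_iso_via_def chain_map_def rep_hom_def
  proof (intro exI[of _ "\<lambda>i v. diag_block_mat [f i v, g i v]"] conjI allI ballI)
    fix i v
    show "diag_block_mat [f i v, g i v] \<in> carrier_mat (rdim (degree_rep (cplx_dsum X' Y') i) v) (rdim (degree_rep (cplx_dsum X Y) i) v)"
      using f'(1)[of i v] g'(1)[of i v] by (auto simp: diag_block2 intro!: carrier_matI)
    have o: "diag_block_mat [1\<^sub>m n, 1\<^sub>m m] = (1\<^sub>m (n + m) :: complex mat)" for n m by (auto simp: diag_block2 intro!: eq_matI)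
    show "invertible_mat (diag_block_mat [f i v, g i v])"
    proof (rule invertible_iff[THEN iffD2, of _ "cdim X' i v + cdim Y' i v" "cdim X i v + cdim Y i v"])
      show "diag_block_mat [f i v, g i v] \<in> carrier_mat (cdim X' i v + cdim Y' i v) (cdim X i v + cdim Y i v)"
        using f'(1)[of i v] g'(1)[of i v] by (auto intro!: carrier_matI)
      show "\<exists>B\<in>carrier_mat (cdim X i v + cdim Y i v) (cdim X' i v + cdim Y' i v). diag_block_mat [f i v, g i v] * B = 1\<^sub>m (cdim X' i v + cdim Y' i v) \<and> B * diag_block_mat [f i v, g i v] = 1\<^sub>m (cdim X i v + cdim Y i v)"
      proof (intro bexI[of _ "diag_block_mat [f' i v, g' i v]"] conjI)
        show "diag_block_mat [f i v, g i v] * diag_block_mat [f' i v, g' i v] = 1\<^sub>m (cdim X' i v + cdim Y' i v)"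
          using mult[OF f'(1,2)[of i v] g'(1,2)[of i v]] f'(3)[of i v] g'(3)[of i v] o by simp
        show "diag_block_mat [f' i v, g' i v] * diag_block_mat [f i v, g i v] = 1\<^sub>m (cdim X i v + cdim Y i v)"
          using mult[OF f'(2,1)[of i v] g'(2,1)[of i v]] f'(4)[of i v] g'(4)[of i v] o by simp
        show "diag_block_mat [f' i v, g' i v] \<in> carrier_mat (cdim X i v + cdim Y i v) (cdim X' i v + cdim Y' i v)"
          using f'(2)[of i v] g'(2)[of i v] by (auto intro!: carrier_matI)
      qed
    qed
  next
    fix i v
    show "diag_block_mat [f (i + 1) v, g (i + 1) v] * cdiff (cplx_dsum X Y) i v = cdiff (cplx_dsum X' Y') i v * diag_block_mat [f i v, g i v]"
      using iso_maps(2)[OF f, of i v] iso_maps(2)[OF g, of i v]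
        mult[OF f'(1)[of "i + 1" v] bcD(4)[OF X(1), of i v] g'(1)[of "i + 1" v] bcD(4)[OF Y(1), of i v]]
        mult[OF bcD(4)[OF X(2), of i v] f'(1)[of i v] bcD(4)[OF Y(2), of i v] g'(1)[of i v]] by (simp add: cplx_dsum_def)
  next
    fix i a assume a: "a \<in> arcs Q"
    show "diag_block_mat [f i (head Q a), g i (head Q a)] * rmap (degree_rep (cplx_dsum X Y) i) a = rmap (degree_rep (cplx_dsum X' Y') i) a * diag_block_mat [f i (tail Q a), g i (tail Q a)]"
      using iso_maps(1)[OF f a, of i] iso_maps(1)[OF g a, of i]
        mult[OF f'(1)[of i "head Q a"] cmap_carrier[OF X(1) a, of i] g'(1)[of i "head Q a"] cmap_carrier[OF Y(1) a, of i]]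
        mult[OF cmap_carrier[OF X(2) a, of i] f'(1)[of i "tail Q a"] cmap_carrier[OF Y(2) a, of i] g'(1)[of i "tail Q a"]] by (simp add: cplx_dsum_def)
  qed
qed

lemma simple_disk_sum_add:
  assumes X: "bounded_cplx Q R X" and Y: "bounded_cplx Q R Y" "simple_disk_sum Q R X" "simple_disk_sum Q R Y"
  shows "simple_disk_sum Q R (cplx_dsum X Y)"
proof -
  obtain ds where ds: "\<forall>(k, S)\<in>set ds. simple_rep Q R S" "cplx_iso Q X (dsums ds)" using assms(3) unfolding simple_disk_sum_def by blast
  obtain es where es: "\<forall>(k, S)\<in>set es. simple_rep Q R S" "cplx_iso Q Y (dsums es)" using assms(4) unfolding simple_disk_sum_def by blast
  have "cplx_iso Q (cplx_dsum X Y) (dsums (ds @ es))"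
    unfolding dsums_append using dsum_iso[OF X _ Y(1) _ ds(2) es(2)] dsums_acyclic ds(1) es(1) by blast
  moreover have "\<forall>(k, S)\<in>set (ds @ es). simple_rep Q R S" using ds es by auto
  ultimately show ?thesis unfolding simple_disk_sum_def by blast
qed

lemma simple_disk_sum_zero: "simple_disk_sum Q R zero_cplx"
  unfolding simple_disk_sum_def using cplx_iso_refl[OF zero_cplx_bounded] by (intro exI[of _ "[]"]) simp

lemma zc_Cb: "dim_seq Q dd \<Longrightarrow> zc dd \<in> Cb Q R dd"
  unfolding Cb_def using zc_bounded by simp

lemma dim_seq_add: "dim_seq Q dd \<Longrightarrow> dim_seq Q mm \<Longrightarrow> dim_seq Q (\<lambda>i v. dd i v + mm i v)"
  unfolding dim_seq_def using finite_dims_add by auto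

text \<open>Adding an acyclic complex to a reference complex gives a quasi-isomorphic one, so the
  class is unchanged. This yields \<open>I_shift\<close> for both direct systems.\<close>

lemma dim_fibre_add:
  assumes dd: "dd \<in> dim_fibre Q R d" and M: "M \<in> Cb Q R mm" "acyclic_cplx M"
  shows "(\<lambda>i v. dd i v + mm i v) \<in> dim_fibre Q R d"
proof -
  have s: "dim_seq Q dd" "dim_class Q R dd = d" using dd unfolding dim_fibre_def by auto
  note X = zc_Cb[OF s(1)]
  note D = dsum_bounded[OF CbD(1)[OF X] CbD(1)[OF M(1)]]
  have "quasi_isomorphic Q R (cplx_dsum (zc dd) M) (zc dd)"
    by (rule qisI[OF D CbD(1)[OF X] dsum_acyclic_quasi[OF CbD(1)[OF X] CbD(1)[OF M(1)] M(2)]])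
  moreover have "cplx_dsum (zc dd) M \<in> Cb Q R (\<lambda>i v. dd i v + mm i v)" using D CbD(2)[OF M(1)] unfolding Cb_def by (auto intro!: ext)
  ultimately have "dim_class Q R (\<lambda>i v. dd i v + mm i v) = d" using qis_dim_class[OF _ X] s(2) by simp
  then show ?thesis unfolding dim_fibre_def using dim_seq_add[OF s(1) Cb_dim_seq[OF M(1)]] by simp
qed

lemma limit_system_Cb:
  assumes "transition_system Q (dim_fibre Q R d) (Cb Q R) (simple_disk_sum Q R) M T"
  shows "limit_system Q R (dim_fibre Q R d) (Cb Q R) (simple_disk_sum Q R) M T"
proof (unfold_locales)
  show "transition_system Q (dim_fibre Q R d) (Cb Q R) (simple_disk_sum Q R) M T" by (rule assms)
  show "X \<in> Cb Q R i \<Longrightarrow> bounded_cplx Q R X" for X i by (rule CbD(1))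
  show "X \<in> Cb Q R i \<Longrightarrow> Y \<in> Cb Q R i \<Longrightarrow> cdim X = cdim Y" for X Y i unfolding Cb_def by simp
  show "X \<in> Cb Q R i \<Longrightarrow> simple_disk_sum Q R X \<Longrightarrow> acyclic_cplx X" for X i using simple_disk_sum_acyclic CbD(1) by blast
  show "zero_cplx \<in> Cb Q R (\<lambda>_ _. 0)" unfolding Cb_def using zero_cplx_bounded by (simp add: zero_cplx_def)
  show "simple_disk_sum Q R zero_cplx" by (rule simple_disk_sum_zero)
  show "X \<in> Cb Q R i \<Longrightarrow> Y \<in> Cb Q R j \<Longrightarrow> simple_disk_sum Q R X \<Longrightarrow> simple_disk_sum Q R Y \<Longrightarrow>
    cplx_dsum X Y \<in> Cb Q R (\<lambda>n c. i n c + j n c) \<and> simple_disk_sum Q R (cplx_dsum X Y)" for X Y i j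
    using simple_disk_sum_add[of X Y] dsum_bounded unfolding Cb_def by (auto intro!: ext)
  fix k i j assume "k \<in> dim_fibre Q R d" "seq_le (Cb Q R) (simple_disk_sum Q R) i j"
  then show "(\<lambda>n c. k n c + seq_diff j i n c) \<in> dim_fibre Q R d"
    unfolding seq_le_def using dim_fibre_add simple_disk_sum_acyclic CbD(1) by blast
qed

lemma Pb_D:
  assumes "X \<in> Pb Q R Ps e"
  shows "X \<in> Cb Q R (dims_of Ps e)" "bounded_cplx Q R X" "cdim X = dims_of Ps e" "rep_iso Q (degree_rep X i) (proj_sum Ps (e i))"
  using assms unfolding Pb_def Cb_def by auto

end

section \<open>Resolutions of complexes of fixed dimensions\<close>

context fgd_quiver begin

definition gld :: nat where "gld = (SOME n. \<forall>V. is_rep Q R V \<longrightarrow> proj_dim_le Q R V n)"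

lemma gld: "is_rep Q R V \<Longrightarrow> proj_dim_le Q R V gld"
  using someI_ex[of "\<lambda>n. \<forall>V. is_rep Q R V \<longrightarrow> proj_dim_le Q R V n"] fgd unfolding finite_global_dimension_def gld_def by blast

definition Res :: "('v, 'a) cplx \<Rightarrow> ('v, 'a) cplx" where "Res X = fst (RR gld X)"
definition etype :: "(int \<Rightarrow> 'v \<Rightarrow> nat) \<Rightarrow> int \<Rightarrow> nat \<Rightarrow> nat" where "etype dd i = ptype (rdims gld dd i)"

lemma Res_bounded: "bounded_cplx Q R X \<Longrightarrow> bounded_cplx Q R (Res X)"
  and Res_quasi: "bounded_cplx Q R X \<Longrightarrow> quasi_iso_map Q (Res X) X (snd (RR gld X))"
  using RR_quasi_iso unfolding Res_def by blast+

lemma Res_qis: "bounded_cplx Q R X \<Longrightarrow> quasi_isomorphic Q R (Res X) X"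
  using qisI[OF Res_bounded _ Res_quasi] by blast

lemma Res_acyclic: "bounded_cplx Q R X \<Longrightarrow> acyclic_cplx X \<Longrightarrow> acyclic_cplx (Res X)"
  using acyclic_qis[OF Res_quasi Res_bounded] by blast

lemma Res_projective:
  assumes "bounded_cplx Q R X"
  shows "projective_rep Q R (degree_rep (Res X) i)"
  unfolding Res_def
proof (rule RR_projective)
  fix i show "projective_rep Q R (Kn gld (degree_rep X i))"
    using pdle_Kn_projective[OF bcD(1)[OF assms] proj_dim_le_pdle[OF bcD(1)[OF assms] gld[OF bcD(1)[OF assms]]]] .
qed

lemma Res_cdim: "X \<in> Cb Q R dd \<Longrightarrow> cdim (Res X) = rdims gld dd"
  unfolding Res_def RR_cdim Cb_def by simp

text \<open>The dimensions of the resolution depend on \<open>dd\<close> only, and projective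
  modules are determined by their dimension vectors; so all of \<open>Cb Q R dd\<close> is resolved
  inside a single \<open>Pb\<close>.\<close>

lemma etype_props:
  assumes X: "X \<in> Cb Q R dd"
  shows "dims_of Ps (etype dd) = rdims gld dd" "length Ps \<le> j \<Longrightarrow> etype dd i j = 0" "Res X \<in> Pb Q R Ps (etype dd)" "proj_dim_seq Ps (etype dd)"
proof -
  note b = CbD(1)[OF X]
  note p = ptype[OF Res_projective[OF b]]
  have r: "rdim (degree_rep (Res X) i) = rdims gld dd i" for i using Res_cdim[OF X] by simp
  note p = p[unfolded r]
  show d: "dims_of Ps (etype dd) = rdims gld dd" unfolding dims_of_def etype_def using rep_iso_dims[OF p(1)] r by auto
  have z: "length Ps \<le> j \<Longrightarrow> etype dd i j = 0" for i j using p(2) unfolding etype_def by simp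
  then show "length Ps \<le> j \<Longrightarrow> etype dd i j = 0" .
  show P: "Res X \<in> Pb Q R Ps (etype dd)" unfolding Pb_def Cb_def using Res_bounded[OF b] Res_cdim[OF X] d p(1) by (simp add: etype_def)
  have "{i. \<exists>j. etype dd i j \<noteq> 0} \<subseteq> {i. \<exists>v. cdim (Res X) i v \<noteq> 0}"
  proof
    fix i assume "i \<in> {i. \<exists>j. etype dd i j \<noteq> 0}"
    then obtain j where j: "etype dd i j \<noteq> 0" by blast
    show "i \<in> {i. \<exists>v. cdim (Res X) i v \<noteq> 0}"
    proof (rule ccontr)
      assume "i \<notin> {i. \<exists>v. cdim (Res X) i v \<noteq> 0}"
      then have "rdims gld dd i = (\<lambda>_. 0)" unfolding Res_cdim[OF X] by auto
      \<comment> \<open>By uniqueness of types the zero module has type zero, so the type lives only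
        in degrees where the resolution is non-zero.\<close>
      moreover have "ptype (\<lambda>_. 0) = (\<lambda>_. 0)" by (rule ptype_unique) (simp_all add: proj_sum_zero zero_rep_def)
      ultimately show False using j unfolding etype_def by simp
    qed
  qed
  moreover have "finite {i. \<exists>v. cdim (Res X) i v \<noteq> 0}" using Res_bounded[OF b] unfolding bounded_cplx_def by blast
  ultimately show "proj_dim_seq Ps (etype dd)" unfolding proj_dim_seq_def using z finite_subset by blast
qed

lemma dims_of_add: "dims_of Ps (\<lambda>i j. e i j + e' i j) = (\<lambda>i v. dims_of Ps e i v + dims_of Ps e' i v)"
  unfolding dims_of_def by (simp add: proj_sum_rdim sum.distrib add_mult_distrib fun_eq_iff)

text \<open>The sum of the two types has the right dimensions by \<open>rdims_add\<close>, and types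
  are unique.\<close>

lemma etype_add:
  assumes X: "X \<in> Cb Q R dd" and Y: "Y \<in> Cb Q R mm"
  shows "etype (\<lambda>i v. dd i v + mm i v) = (\<lambda>i j. etype dd i j + etype mm i j)"
proof (intro ext)
  fix i j
  have "ptype (rdims gld (\<lambda>i v. dd i v + mm i v) i) = (\<lambda>j. etype dd i j + etype mm i j)"
  proof (rule ptype_unique)
    show "length Ps \<le> j \<Longrightarrow> etype dd i j + etype mm i j = 0" for j using etype_props(2)[OF X] etype_props(2)[OF Y] by simp
    have "rdim (proj_sum Ps (\<lambda>j. etype dd i j + etype mm i j)) = dims_of Ps (\<lambda>i j. etype dd i j + etype mm i j) i" by (simp add: dims_of_def)
    also have "\<dots> = (\<lambda>v. rdims gld dd i v + rdims gld mm i v)" unfolding dims_of_add etype_props(1)[OF X] etype_props(1)[OF Y] ..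
    also have "\<dots> = rdims gld (\<lambda>i v. dd i v + mm i v) i"
      using rdims_add[of dd mm] Cb_dim_seq[OF X] Cb_dim_seq[OF Y] unfolding dim_seq_def by (intro ext) simp
    finally show "rdim (proj_sum Ps (\<lambda>j. etype dd i j + etype mm i j)) = rdims gld (\<lambda>i v. dd i v + mm i v) i" .
  qed
  then show "etype (\<lambda>i v. dd i v + mm i v) i j = etype dd i j + etype mm i j" by (simp add: etype_def)
qed

lemma etype_fibre:
  assumes "dd \<in> dim_fibre Q R d"
  shows "etype dd \<in> proj_fibre Q R Ps d"
proof -
  have s: "dim_seq Q dd" "dim_class Q R dd = d" using assms unfolding dim_fibre_def by auto
  note X = zc_Cb[OF s(1)]
  note P = Pb_D(1)[OF etype_props(3)[OF X]]
  have "dim_class Q R (dims_of Ps (etype dd)) = d" using qis_dim_class[OF P X Res_qis[OF CbD(1)[OF X]]] s(2) by simp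
  then show ?thesis unfolding proj_fibre_def dim_fibre_def using etype_props(4)[OF X] Cb_dim_seq[OF P] by simp
qed

text \<open>The order on dimension sequences is witnessed by an acyclic complex of dimensions
  \<open>seq_diff j i\<close>. Its resolution is acyclic too, and by additivity its type is the
  difference of the two types.\<close>

lemma etype_le:
  assumes "dim_seq Q i" and le: "seq_le (Cb Q R) (simple_disk_sum Q R) i j"
  shows "seq_le (Pb Q R Ps) acyclic_cplx (etype i) (etype j)"
proof -
  obtain X where X: "X \<in> Cb Q R (seq_diff j i)" "simple_disk_sum Q R X" and ij: "\<And>n c. i n c \<le> j n c" using le unfolding seq_le_def by blast
  have j: "j = (\<lambda>n c. i n c + seq_diff j i n c)" using ij by (simp add: seq_diff_def fun_eq_iff)
  have e: "etype j = (\<lambda>n c. etype i n c + etype (seq_diff j i) n c)" by (subst j) (rule etype_add[OF zc_Cb[OF assms(1)] X(1)])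
  have d: "seq_diff (etype j) (etype i) = etype (seq_diff j i)" unfolding e by (simp add: seq_diff_def[of "\<lambda>n c. etype i n c + etype (seq_diff j i) n c"])
  have "Res X \<in> Pb Q R Ps (etype (seq_diff j i))" by (rule etype_props(3)[OF X(1)])
  moreover have "acyclic_cplx (Res X)" using Res_acyclic[OF CbD(1)[OF X(1)] simple_disk_sum_acyclic[OF CbD(1)[OF X(1)] X(2)]] .
  ultimately show ?thesis unfolding seq_le_def d by (auto simp: e)
qed

text \<open>Multiplicities beyond \<open>length Ps\<close> do not enter \<open>proj_sum\<close>, so
  agreement with \<open>ptype\<close> below that bound is enough.\<close>

lemma projective_iso_proj_sum:
  assumes P: "projective_rep Q R P" and d: "rdim (proj_sum Ps n) = rdim P"
  shows "rep_iso Q P (proj_sum Ps n)"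
proof -
  have "n j = ptype (rdim P) j" if "j < length Ps" for j
    by (rule proj_sum_unique[OF _ that]) (simp add: d ptype(3)[OF P])
  then have "map (\<lambda>j. replicate (n j) (Ps ! j)) [0..<length Ps] = map (\<lambda>j. replicate (ptype (rdim P) j) (Ps ! j)) [0..<length Ps]" by (intro map_cong) auto
  then have "proj_sum Ps n = proj_sum Ps (ptype (rdim P))" unfolding proj_sum_def by (rule arg_cong[where f = "\<lambda>l. foldr rep_dsum (concat l) zero_rep"])
  then show ?thesis using ptype(1)[OF P] by simp
qed

lemma Pb_add:
  assumes X: "X \<in> Pb Q R Ps e" and Y: "Y \<in> Pb Q R Ps e'"
  shows "cplx_dsum X Y \<in> Pb Q R Ps (\<lambda>n c. e n c + e' n c)"
proof -
  note D = dsum_bounded[OF Pb_D(2)[OF X] Pb_D(2)[OF Y]]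
  have "rep_iso Q (degree_rep (cplx_dsum X Y) i) (proj_sum Ps (\<lambda>c. e i c + e' i c))" for i
  proof -
    note PX = projective_iso[OF proj_sum_projective rep_iso_sym[OF Pb_D(4)[OF X, of i] bcD(2)[OF Pb_D(2)[OF X]] proj_sum_shape] bcD(1)[OF Pb_D(2)[OF X]]]
    note PY = projective_iso[OF proj_sum_projective rep_iso_sym[OF Pb_D(4)[OF Y, of i] bcD(2)[OF Pb_D(2)[OF Y]] proj_sum_shape] bcD(1)[OF Pb_D(2)[OF Y]]]
    have P: "projective_rep Q R (degree_rep (cplx_dsum X Y) i)" unfolding degree_dsum by (rule projective_dsum[OF PX PY])
    have "rdim (proj_sum Ps (\<lambda>c. e i c + e' i c)) = rdim (degree_rep (cplx_dsum X Y) i)"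
      using dims_of_add[of e e'] Pb_D(3)[OF X] Pb_D(3)[OF Y] by (simp add: dims_of_def fun_eq_iff)
    then show ?thesis by (rule projective_iso_proj_sum[OF P])
  qed
  moreover have "cdim (cplx_dsum X Y) = dims_of Ps (\<lambda>n c. e n c + e' n c)" unfolding dims_of_add using Pb_D(3)[OF X] Pb_D(3)[OF Y] by (auto intro!: ext)
  ultimately show ?thesis unfolding Pb_def Cb_def using D by simp
qed

lemma Pb_zero: "zero_cplx \<in> Pb Q R Ps (\<lambda>_ _. 0)"
proof -
  have i: "rep_iso Q (degree_rep zero_cplx i) (zero_rep :: ('v, 'a) rep)" for i unfolding degree_zero
    by (rule rep_iso_refl[OF is_rep_shape[OF zero_rep_rep[of Q R]]])
  have "cdim zero_cplx = (\<lambda>i. rdim (zero_rep :: ('v, 'a) rep))" by (simp add: zero_cplx_def zero_rep_def)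
  then show ?thesis unfolding Pb_def Cb_def dims_of_def proj_sum_zero using zero_cplx_bounded i by simp
qed

lemma limit_system_Pb:
  assumes "transition_system Q (proj_fibre Q R Ps d) (Pb Q R Ps) acyclic_cplx N U"
  shows "limit_system Q R (proj_fibre Q R Ps d) (Pb Q R Ps) acyclic_cplx N U"
proof (unfold_locales)
  show "transition_system Q (proj_fibre Q R Ps d) (Pb Q R Ps) acyclic_cplx N U" by (rule assms)
  show "X \<in> Pb Q R Ps i \<Longrightarrow> bounded_cplx Q R X" for X i by (rule Pb_D(2))
  show "X \<in> Pb Q R Ps i \<Longrightarrow> Y \<in> Pb Q R Ps i \<Longrightarrow> cdim X = cdim Y" for X Y i using Pb_D(3) by metis
  show "acyclic_cplx X \<Longrightarrow> acyclic_cplx X" for X :: "('v, 'a) cplx" .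
  show "zero_cplx \<in> Pb Q R Ps (\<lambda>_ _. 0)" by (rule Pb_zero)
  show "acyclic_cplx (zero_cplx :: ('v, 'a) cplx)" by (rule zero_cplx_acyclic)
  show "X \<in> Pb Q R Ps i \<Longrightarrow> Y \<in> Pb Q R Ps j \<Longrightarrow> acyclic_cplx X \<Longrightarrow> acyclic_cplx Y \<Longrightarrow>
    cplx_dsum X Y \<in> Pb Q R Ps (\<lambda>n c. i n c + j n c) \<and> acyclic_cplx (cplx_dsum X Y)" for X Y i j
    using Pb_add dsum_acyclic Pb_D(2) by blast
  fix k i j assume k: "k \<in> proj_fibre Q R Ps d" and ij: "i \<in> proj_fibre Q R Ps d" "j \<in> proj_fibre Q R Ps d" and le: "seq_le (Pb Q R Ps) acyclic_cplx i j"
  obtain X where X: "X \<in> Pb Q R Ps (seq_diff j i)" "acyclic_cplx X" using le unfolding seq_le_def by blast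
  have "dims_of Ps (\<lambda>n c. k n c + seq_diff j i n c) \<in> dim_fibre Q R d"
    unfolding dims_of_add by (rule dim_fibre_add[OF _ Pb_D(1)[OF X(1)] X(2)]) (use k in \<open>simp add: proj_fibre_def\<close>)
  moreover have "proj_dim_seq Ps (\<lambda>n c. k n c + seq_diff j i n c)"
  proof -
    have p: "proj_dim_seq Ps k" "proj_dim_seq Ps j" using k ij unfolding proj_fibre_def by auto
    have "{n. \<exists>c. k n c + seq_diff j i n c \<noteq> 0} \<subseteq> {n. \<exists>c. k n c \<noteq> 0} \<union> {n. \<exists>c. j n c \<noteq> 0}" unfolding seq_diff_def by auto
    then show ?thesis using p finite_subset unfolding proj_dim_seq_def seq_diff_def by fastforce
  qed
  ultimately show "(\<lambda>n c. k n c + seq_diff j i n c) \<in> proj_fibre Q R Ps d" unfolding proj_fibre_def by simp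
qed

end

section \<open>The map between the direct limits\<close>

locale limit_pair = fgd_quiver Q R Ps
  + C: limit_system Q R "dim_fibre Q R d" "Cb Q R" "simple_disk_sum Q R" M T
  + P: limit_system Q R "proj_fibre Q R Ps d" "Pb Q R Ps" acyclic_cplx N U
  for Q :: "('v, 'a) pre_digraph" and R Ps d M T N U
begin

abbreviation "I \<equiv> dim_fibre Q R d"

text \<open>A dimension sequence is encoded by the finite set of its non-zero entries. Countability
  comes from the finite set of vertices, as their type is arbitrary.\<close>

lemma countable_fibre: "countable I"
proof -
  let ?s = "\<lambda>dd :: int \<Rightarrow> 'v \<Rightarrow> nat. {(i, v, k). k = dd i v \<and> k \<noteq> 0}"
  have "inj ?s"
  proof (rule injI, intro ext)
    fix dd dd' i v assume "?s dd = ?s dd'"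
    then have "(i, v, k) \<in> ?s dd \<longleftrightarrow> (i, v, k) \<in> ?s dd'" for k by simp
    from this[of "dd i v"] this[of "dd' i v"] show "dd i v = dd' i v" by auto
  qed
  moreover have "?s ` I \<subseteq> {A. finite A \<and> A \<subseteq> UNIV \<times> verts Q \<times> UNIV}"
  proof (rule image_subsetI)
    fix dd assume "dd \<in> I"
    then have s: "finite {i. \<exists>v. dd i v \<noteq> 0}" "\<And>i v. v \<notin> verts Q \<Longrightarrow> dd i v = 0" unfolding dim_fibre_def dim_seq_def by auto
    have v: "v \<in> verts Q" if "dd i v \<noteq> 0" for i v using s(2)[of v i] that by blast
    have "?s dd \<subseteq> (\<lambda>(i, v). (i, v, dd i v)) ` ({i. \<exists>v. dd i v \<noteq> 0} \<times> verts Q)" using v by (auto simp: image_iff)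
    then have "finite (?s dd)" using s(1) finite_subset by (metis (no_types, lifting) finite_SigmaI finite_imageI finite_verts)
    moreover have "?s dd \<subseteq> UNIV \<times> verts Q \<times> UNIV" using v by auto
    ultimately show "?s dd \<in> {A. finite A \<and> A \<subseteq> UNIV \<times> verts Q \<times> UNIV}" by simp
  qed
  moreover have "countable {A. finite A \<and> A \<subseteq> (UNIV :: int set) \<times> verts Q \<times> (UNIV :: nat set)}"
    by (rule countable_Collect_finite_subset) (simp add: countable_finite)
  ultimately show ?thesis by (meson countable_image_inj_on countable_subset inj_on_subset subset_UNIV)
qed

definition num :: "(int \<Rightarrow> 'v \<Rightarrow> nat) \<Rightarrow> nat" where "num = (SOME f. inj_on f I)"

lemma num_inj: "inj_on num I"
  unfolding num_def using countable_fibre unfolding countable_def by (rule someI_ex)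

text \<open>A point of the limit is represented in the first dimension sequence, in a fixed enumeration,
  in which it has a representative.\<close>

definition occurs where "occurs p n \<longleftrightarrow> n \<in> I \<and> (\<exists>X\<in>Cb Q R n. p = C.to n X)"
definition src where "src p = (SOME n. occurs p n \<and> (\<forall>m. occurs p m \<longrightarrow> num n \<le> num m))"
definition rp where "rp p = (SOME X. X \<in> Cb Q R (src p) \<and> p = C.to (src p) X)"
definition psi where "psi p = P.to (etype (src p)) (Res (rp p))"

lemma src:
  assumes "p \<in> C.lim"
  shows "occurs p (src p)" "occurs p m \<Longrightarrow> num (src p) \<le> num m"
proof -
  obtain i X where "i \<in> I" "X \<in> Cb Q R i" "p = C.to i X" using C.lim_rep[OF assms] .
  then have "occurs p i" unfolding occurs_def by blast
  from someI_ex[OF ex_has_least_nat[of "occurs p", OF this, of num], folded src_def]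
  show "occurs p (src p)" "occurs p m \<Longrightarrow> num (src p) \<le> num m" by auto
qed

lemma rp:
  assumes "p \<in> C.lim"
  shows "src p \<in> I" "rp p \<in> Cb Q R (src p)" "C.to (src p) (rp p) = p"
proof -
  have "\<exists>X. X \<in> Cb Q R (src p) \<and> p = C.to (src p) X" "src p \<in> I" using src(1)[OF assms] unfolding occurs_def by auto
  then show "src p \<in> I" "rp p \<in> Cb Q R (src p)" "C.to (src p) (rp p) = p" using someI_ex[of "\<lambda>X. X \<in> Cb Q R (src p) \<and> p = C.to (src p) X"] unfolding rp_def by auto
qed

lemma rp_eq:
  assumes "n \<in> I" "X \<in> Cb Q R n" "src (C.to n X) = n"
  shows "rp (C.to n X) = X"
  using rp[OF C.to_in[OF assms(1,2)]] C.to_inj[OF assms(1) _ assms(2)] assms(3) by simp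

lemma psi_in: "p \<in> C.lim \<Longrightarrow> psi p \<in> P.lim"
  unfolding psi_def using P.to_in[OF etype_fibre etype_props(3)] rp by blast

text \<open>The sequence \<open>m\<close> itself represents every point coming from
  \<open>Cb Q R m\<close>, so the chosen sequences are not later than \<open>m\<close> and only
  finitely many occur. A common upper bound \<open>K\<close> allows comparing all of them, and by
  \<open>etype_le\<close> every stratum can be moved into the variety of type
  \<open>etype K\<close>.\<close>

lemma constructible:
  assumes m: "m \<in> I"
  shows "constructible_into_Pb_limit Q R Ps d U m (\<lambda>X. psi (C.to m X))"
proof -
  let ?K = "cplx_coords Q m" and ?S = "Cb Q R m"
  define A where "A = {n \<in> I. num n \<le> num m \<and> (\<exists>k\<in>I. C.le n k \<and> C.le m k)}"
  have AI: "A \<subseteq> I" and mA: "m \<in> A" unfolding A_def using m C.le_refl by auto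
  have "finite (num ` A)" by (rule finite_subset[of _ "{..num m}"]) (auto simp: A_def)
  then have finA: "finite A" using finite_imageD inj_on_subset[OF num_inj AI] by blast
  obtain k where k: "\<And>n. n \<in> A \<Longrightarrow> k n \<in> I \<and> C.le n (k n) \<and> C.le m (k n)" unfolding A_def by (atomize_elim, intro choice) auto
  obtain K where K: "K \<in> I" "C.le m K" "\<And>n. n \<in> A \<Longrightarrow> C.le (k n) K"
    using C.le_finite_bound[of "k ` A" m] k finA m by auto
  have le: "C.le n K" if "n \<in> A" for n using C.le_trans k[OF that] K(3)[OF that] by blast
  \<comment> \<open>By \<open>L_at\<close>, a point of \<open>Cb Q R m\<close> occurs at the index
    \<open>n\<close> iff its image at \<open>K\<close> lies in the image of \<open>T n K\<close>,
    which is a closed condition by \<open>transition_image\<close>.\<close>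
  define Z where "Z n = {X \<in> ?S. \<exists>Y\<in>Cb Q R n. T n K Y = T m K X}" for n
  have Z_iff: "X \<in> Z n \<longleftrightarrow> occurs (C.to m X) n" if n: "n \<in> A" and X: "X \<in> ?S" for X n
  proof -
    have "C.to m X = C.to n Y \<longleftrightarrow> T n K Y = T m K X" if Y: "Y \<in> Cb Q R n" for Y
      using C.to_eq[OF m X _ Y] C.L_at[OF m _ K(1,2) le[OF n] X Y] AI n by auto
    then show ?thesis unfolding Z_def occurs_def using n AI X by auto
  qed
  have srcA: "src (C.to m X) \<in> A" if X: "X \<in> ?S" for X
  proof -
    note p = C.to_in[OF m X]
    have "occurs (C.to m X) m" unfolding occurs_def using m X by blast
    then have "num (src (C.to m X)) \<le> num m" by (rule src(2)[OF p])
    moreover have "((src (C.to m X), rp (C.to m X)), (m, X)) \<in> C.L" using C.to_eq[OF rp(1,2)[OF p] m X] rp(3)[OF p] by simp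
    ultimately show ?thesis unfolding A_def using rp(1)[OF p] unfolding C.L_iff by blast
  qed
  define W where "W n = {X \<in> ?S. src (C.to m X) = n}" for n
  \<comment> \<open>The chosen index is \<open>n\<close> iff the point occurs there and at no
    earlier index. It suffices to exclude earlier members of \<open>A\<close>, as \<open>src\<close>
    always lies in \<open>A\<close>.\<close>
  have W_eq: "W n = Z n - (\<Union>n'\<in>{n' \<in> A. num n' < num n}. Z n')" if n: "n \<in> A" for n
  proof (rule Set.set_eqI)
    fix X
    show "X \<in> W n \<longleftrightarrow> X \<in> Z n - (\<Union>n'\<in>{n' \<in> A. num n' < num n}. Z n')"
    proof (cases "X \<in> ?S")
      case X: True
      note s = src[OF C.to_in[OF m X]]
      show ?thesis
      proof
        assume "X \<in> W n"
        then have "src (C.to m X) = n" by (simp add: W_def)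
        then show "X \<in> Z n - (\<Union>n'\<in>{n' \<in> A. num n' < num n}. Z n')" using s Z_iff[OF _ X] n by fastforce
      next
        assume a: "X \<in> Z n - (\<Union>n'\<in>{n' \<in> A. num n' < num n}. Z n')"
        then have "num (src (C.to m X)) \<le> num n" using s(2) Z_iff[OF n X] by simp
        moreover have "\<not> num (src (C.to m X)) < num n" using a srcA[OF X] Z_iff[OF srcA[OF X] X] s(1) by blast
        ultimately have "src (C.to m X) = n" using inj_onD[OF num_inj, of "src (C.to m X)" n] srcA[OF X] n AI by auto
        then show "X \<in> W n" using X by (simp add: W_def)
      qed
    qed (simp add: W_def Z_def)
  qed
  let ?e = "etype K"
  have eI: "?e \<in> proj_fibre Q R Ps d" by (rule etype_fibre[OF K(1)])
  have en: "etype n \<in> proj_fibre Q R Ps d" "P.le (etype n) ?e" if n: "n \<in> A" for n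
    using etype_fibre etype_le[OF _ le[OF n]] n AI unfolding dim_fibre_def by auto
  \<comment> \<open>On the stratum of \<open>n\<close> the resolution has type
    \<open>etype n\<close>; moving it on to type \<open>etype K\<close> gives all strata the same
    target without changing the point of the limit.\<close>
  define h where "h X = U (etype (src (C.to m X))) ?e (Res (rp (C.to m X)))" for X
  have h: "h X \<in> Pb Q R Ps ?e" "psi (C.to m X) = P.to ?e (h X)" if X: "X \<in> ?S" for X
  proof -
    note p = C.to_in[OF m X]
    note R = etype_props(3)[OF rp(2)[OF p]]
    show "h X \<in> Pb Q R Ps ?e" unfolding h_def by (rule P.trans_in[OF en(1)[OF srcA[OF X]] eI en(2)[OF srcA[OF X]] R])
    show "psi (C.to m X) = P.to ?e (h X)" unfolding h_def psi_def by (rule P.to_trans[OF en(1)[OF srcA[OF X]] eI en(2)[OF srcA[OF X]] R, symmetric])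
  qed
  obtain gm where gm: "\<And>X. X \<in> ?S \<Longrightarrow> T m K X \<in> Cb Q R K \<and> cplx_iso_via Q gm (cplx_dsum X (M m K)) (T m K X)"
    using C.trans_props(3)[OF m K(1,2)] by blast
  have pT: "pcplx ?K ?S K (T m K)" by (rule pcplx_transition[OF pcplx_id C.trans_props(1)[OF m K(1,2)] gm])
  have strat: "zariski_closed_in ?K ?S (Z n) \<and> pcplx ?K (W n) (dims_of Ps ?e) h" if n: "n \<in> A" for n
  proof
    have nI: "n \<in> I" using n AI by blast
    then have ne: "Cb Q R n \<noteq> {}" using zc_Cb[of n] unfolding dim_fibre_def by blast
    obtain gn where gn: "\<And>X. X \<in> Cb Q R n \<Longrightarrow> T n K X \<in> Cb Q R K \<and> cplx_iso_via Q gn (cplx_dsum X (M n K)) (T n K X)"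
      using C.trans_props(3)[OF nI K(1) le[OF n]] by blast
    note ti = transition_image[OF pT C.trans_props(1)[OF nI K(1) le[OF n]] ne, of "T n K", OF gn, folded Z_def]
    show "zariski_closed_in ?K ?S (Z n)" by (rule ti(1))
    obtain Y where Y: "\<And>X. X \<in> Z n \<Longrightarrow> Y X \<in> Cb Q R n \<and> T n K (Y X) = T m K X" and pY: "pcplx ?K (Z n) n Y" using ti(2) by blast
    have WZ: "W n \<subseteq> Z n" using W_eq[OF n] by blast
    \<comment> \<open>The preimage that varies polynomially is the chosen representative, since a
      point of the limit has at most one representative at each index.\<close>
    have rpY: "rp (C.to m X) = Y X" if X: "X \<in> W n" for X
    proof -
      have X': "X \<in> ?S" "src (C.to m X) = n" using X unfolding W_def by auto
      have y: "Y X \<in> Cb Q R n" "T n K (Y X) = T m K X" using Y WZ X by auto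
      have "C.to n (Y X) = C.to m X" using C.to_eq[OF nI y(1) m X'(1)] C.L_at[OF nI m K(1) le[OF n] K(2) y(1) X'(1)] y(2) by simp
      then show ?thesis using rp_eq[OF nI y(1)] X'(2) by simp
    qed
    have "pcplx ?K (W n) (rdims gld n) (\<lambda>X. fst (RR gld (Y X)))" using pcplx_RR[OF pcplx_subset[OF pY WZ]] by blast
    then have pR: "pcplx ?K (W n) (rdims gld n) (\<lambda>X. Res (Y X))" by (simp add: Res_def)
    obtain g where g: "\<And>X. X \<in> Pb Q R Ps (etype n) \<Longrightarrow> U (etype n) ?e X \<in> Pb Q R Ps ?e \<and> cplx_iso_via Q g (cplx_dsum X (N (etype n) ?e)) (U (etype n) ?e X)"
      using P.trans_props(3)[OF en(1)[OF n] eI en(2)[OF n]] by blast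
    show "pcplx ?K (W n) (dims_of Ps ?e) h"
    proof (rule pcplx_transition[OF pR Pb_D(1)[OF P.trans_props(1)[OF en(1)[OF n] eI en(2)[OF n]]]])
      fix X assume X: "X \<in> W n"
      have "h X = U (etype n) ?e (Res (Y X))" using rpY[OF X] X unfolding h_def W_def by simp
      moreover have "Res (Y X) \<in> Pb Q R Ps (etype n)" using etype_props(3) Y WZ X by blast
      ultimately show "h X \<in> Cb Q R (dims_of Ps ?e) \<and> cplx_iso_via Q g (cplx_dsum (Res (Y X)) (N (etype n) ?e)) (h X)" using g Pb_D(1) by auto
    qed
  qed
  have "constructible_map ?K ?S (cplx_coords Q (dims_of Ps ?e)) (Pb Q R Ps ?e) h"
    unfolding constructible_map_def
  proof (intro conjI exI[of _ "W ` A"] ballI)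
    show "h \<in> ?S \<rightarrow> Pb Q R Ps ?e" using h(1) by blast
    show "finite (W ` A)" using finA by blast
    show "disjoint (W ` A)" unfolding disjoint_def W_def by auto
    show "\<Union> (W ` A) = ?S" using srcA unfolding W_def by auto
    fix S' assume "S' \<in> W ` A"
    then obtain n where n: "n \<in> A" "S' = W n" by blast
    show "constructible_in ?K ?S S'" unfolding n(2) W_eq[OF n(1)]
      by (intro closed_diff_constructible closed_UN) (use strat n finA in auto)
    show "k \<in> cplx_coords Q (dims_of Ps ?e) \<Longrightarrow> regular_on ?K S' (\<lambda>x. k (h x))" for k
      unfolding n(2) using pfun_regular[OF pcplx_coords] strat[OF n(1)] by blast
  qed
  then show ?thesis unfolding constructible_into_Pb_limit_def to_Pb_limit_def using eI h(2) by blast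
qed

lemma psi_qis:
  assumes i: "i \<in> I" "X \<in> Cb Q R i"
  shows "\<exists>e Y. e \<in> proj_fibre Q R Ps d \<and> Y \<in> Pb Q R Ps e \<and> psi (C.to i X) = P.to e Y \<and> quasi_isomorphic Q R X Y"
proof -
  note p = C.to_in[OF i]
  have "quasi_isomorphic Q R (rp (C.to i X)) X" using C.to_eq[OF rp(1,2)[OF p] i] rp(3)[OF p] C.L_qis by simp
  moreover have "quasi_isomorphic Q R (Res (rp (C.to i X))) (rp (C.to i X))" by (rule Res_qis[OF CbD(1)[OF rp(2)[OF p]]])
  ultimately show ?thesis using etype_fibre[OF rp(1)[OF p]] etype_props(3)[OF rp(2)[OF p]] qis_trans qis_sym unfolding psi_def by blast
qed

text \<open>\<open>natural_embedding\<close> may use any representing complex of the point; all of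
  them are quasi-isomorphic by \<open>L_qis\<close>.\<close>

lemma embedding_qis:
  assumes "natural_embedding Q R Ps d T U \<phi>" and e: "e \<in> proj_fibre Q R Ps d" "X \<in> Pb Q R Ps e"
  shows "\<exists>i Y. i \<in> I \<and> Y \<in> Cb Q R i \<and> \<phi> (P.to e X) = C.to i Y \<and> quasi_isomorphic Q R X Y"
proof -
  have "P.to e X \<in> Pb_limit Q R Ps d U" unfolding Pb_limit_def by (rule P.to_in[OF e])
  then have "\<exists>(e', Y)\<in>P.to e X. \<phi> (P.to e X) = to_Cb_limit Q R d T (dims_of Ps e') Y"
    using assms(1) unfolding natural_embedding_def by (rule bspec[rotated])
  then obtain e' Y where Y: "(e', Y) \<in> P.to e X" "\<phi> (P.to e X) = C.to (dims_of Ps e') Y" unfolding to_Cb_limit_def by blast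
  then have L: "((e, X), (e', Y)) \<in> P.L" unfolding to_limit_def by simp
  then have "e' \<in> proj_fibre Q R Ps d" "Y \<in> Pb Q R Ps e'" unfolding P.L_iff by auto
  then have "dims_of Ps e' \<in> I" "Y \<in> Cb Q R (dims_of Ps e')" using Pb_D(1) unfolding proj_fibre_def by auto
  then show ?thesis using Y(2) P.L_qis[OF L] by blast
qed

text \<open>Both maps replace a representing complex by a quasi-isomorphic one, so they respect the
  equivalence relations and both composites fix every class.\<close>

lemma inverse:
  assumes "natural_embedding Q R Ps d T U \<phi>"
  shows "inverse_on_quotients P.lim (limit_qis Q R P.lim) C.lim (limit_qis Q R C.lim) \<phi> psi"
proof (rule inverse_on_quotientsI[OF P.limit_qis_equiv C.limit_qis_equiv])
  note E = embedding_qis[OF assms]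
  have \<phi>: "\<phi> p \<in> C.lim" if "p \<in> P.lim" for p
    using that by (rule P.lim_rep) (use E C.to_in in metis)
  show "\<phi> \<in> P.lim \<rightarrow> C.lim" "psi \<in> C.lim \<rightarrow> P.lim" using \<phi> psi_in by auto
  show "\<forall>(x, x')\<in>limit_qis Q R P.lim. (\<phi> x, \<phi> x') \<in> limit_qis Q R C.lim"
  proof clarify
    fix p q assume pq: "(p, q) \<in> limit_qis Q R P.lim"
    then have "p \<in> P.lim" "q \<in> P.lim" unfolding limit_qis_def by auto
    then obtain e X e' X' where e: "e \<in> proj_fibre Q R Ps d" "X \<in> Pb Q R Ps e" "p = P.to e X" "e' \<in> proj_fibre Q R Ps d" "X' \<in> Pb Q R Ps e'" "q = P.to e' X'"
      by (metis P.lim_rep)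
    obtain i Y where Y: "i \<in> I" "Y \<in> Cb Q R i" "\<phi> p = C.to i Y" "quasi_isomorphic Q R X Y" using E[OF e(1,2)] e(3) by blast
    obtain i' Y' where Y': "i' \<in> I" "Y' \<in> Cb Q R i'" "\<phi> q = C.to i' Y'" "quasi_isomorphic Q R X' Y'" using E[OF e(4,5)] e(6) by blast
    have "quasi_isomorphic Q R X X'" using pq P.limit_qis_to[OF e(1,2,4,5)] e(3,6) by simp
    then have "quasi_isomorphic Q R Y Y'" using Y(4) Y'(4) qis_trans qis_sym by blast
    then show "(\<phi> p, \<phi> q) \<in> limit_qis Q R C.lim" unfolding Y(3) Y'(3) using C.limit_qis_to[OF Y(1,2) Y'(1,2)] by simp
  qed
  show "\<forall>(y, y')\<in>limit_qis Q R C.lim. (psi y, psi y') \<in> limit_qis Q R P.lim"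
  proof clarify
    fix p q assume pq: "(p, q) \<in> limit_qis Q R C.lim"
    then have "p \<in> C.lim" "q \<in> C.lim" unfolding limit_qis_def by auto
    then obtain i X i' X' where i: "i \<in> I" "X \<in> Cb Q R i" "p = C.to i X" "i' \<in> I" "X' \<in> Cb Q R i'" "q = C.to i' X'"
      by (metis C.lim_rep)
    obtain e Y where Y: "e \<in> proj_fibre Q R Ps d" "Y \<in> Pb Q R Ps e" "psi p = P.to e Y" "quasi_isomorphic Q R X Y" using psi_qis[OF i(1,2)] i(3) by blast
    obtain e' Y' where Y': "e' \<in> proj_fibre Q R Ps d" "Y' \<in> Pb Q R Ps e'" "psi q = P.to e' Y'" "quasi_isomorphic Q R X' Y'" using psi_qis[OF i(4,5)] i(6) by blast
    have "quasi_isomorphic Q R X X'" using pq C.limit_qis_to[OF i(1,2,4,5)] i(3,6) by simp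
    then have "quasi_isomorphic Q R Y Y'" using Y(4) Y'(4) qis_trans qis_sym by blast
    then show "(psi p, psi q) \<in> limit_qis Q R P.lim" unfolding Y(3) Y'(3) using P.limit_qis_to[OF Y(1,2) Y'(1,2)] by simp
  qed
  show "(psi (\<phi> p), p) \<in> limit_qis Q R P.lim" if p: "p \<in> P.lim" for p
  proof -
    obtain e X where e: "e \<in> proj_fibre Q R Ps d" "X \<in> Pb Q R Ps e" "p = P.to e X" using P.lim_rep[OF p] .
    obtain i Y where Y: "i \<in> I" "Y \<in> Cb Q R i" "\<phi> p = C.to i Y" "quasi_isomorphic Q R X Y" using E[OF e(1,2)] e(3) by blast
    obtain e' Z where Z: "e' \<in> proj_fibre Q R Ps d" "Z \<in> Pb Q R Ps e'" "psi (\<phi> p) = P.to e' Z" "quasi_isomorphic Q R Y Z" using psi_qis[OF Y(1,2)] Y(3) by auto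
    have "quasi_isomorphic Q R Z X" using Y(4) Z(4) qis_trans qis_sym by blast
    then show ?thesis unfolding Z(3) e(3)[symmetric] using P.limit_qis_to[OF Z(1,2) e(1,2)] e(3) by simp
  qed
  show "(\<phi> (psi p), p) \<in> limit_qis Q R C.lim" if p: "p \<in> C.lim" for p
  proof -
    obtain i X where i: "i \<in> I" "X \<in> Cb Q R i" "p = C.to i X" using C.lim_rep[OF p] .
    obtain e Y where Y: "e \<in> proj_fibre Q R Ps d" "Y \<in> Pb Q R Ps e" "psi p = P.to e Y" "quasi_isomorphic Q R X Y" using psi_qis[OF i(1,2)] i(3) by blast
    obtain i' Z where Z: "i' \<in> I" "Z \<in> Cb Q R i'" "\<phi> (psi p) = C.to i' Z" "quasi_isomorphic Q R Y Z" using E[OF Y(1,2)] Y(3) by auto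
    have "quasi_isomorphic Q R Z X" using Y(4) Z(4) qis_trans qis_sym by blast
    then show ?thesis unfolding Z(3) using C.limit_qis_to[OF Z(1,2) i(1,2)] i(3) by simp
  qed
qed

end

theorem theoremA:
  fixes Q :: "('v, 'a) pre_digraph"
    and R :: "('v \<times> 'a list \<Rightarrow> complex) set"
    and Ps :: "('v, 'a) rep list"
    and d :: "(('v, 'a) cplx \<Rightarrow>\<^sub>0 int) set"
    and M :: "(int \<Rightarrow> 'v \<Rightarrow> nat) \<Rightarrow> (int \<Rightarrow> 'v \<Rightarrow> nat) \<Rightarrow> ('v, 'a) cplx"
    and T :: "(int \<Rightarrow> 'v \<Rightarrow> nat) \<Rightarrow> (int \<Rightarrow> 'v \<Rightarrow> nat) \<Rightarrow> ('v, 'a) cplx \<Rightarrow> ('v, 'a) cplx"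
    and N :: "(int \<Rightarrow> nat \<Rightarrow> nat) \<Rightarrow> (int \<Rightarrow> nat \<Rightarrow> nat) \<Rightarrow> ('v, 'a) cplx"
    and U :: "(int \<Rightarrow> nat \<Rightarrow> nat) \<Rightarrow> (int \<Rightarrow> nat \<Rightarrow> nat) \<Rightarrow> ('v, 'a) cplx \<Rightarrow> ('v, 'a) cplx"
    and \<phi> :: "((int \<Rightarrow> nat \<Rightarrow> nat) \<times> ('v, 'a) cplx) set \<Rightarrow> ((int \<Rightarrow> 'v \<Rightarrow> nat) \<times> ('v, 'a) cplx) set"
  assumes "bound_quiver Q R"
    and "finite_global_dimension Q R"
    and "complete_indec_projectives Q R Ps"
    and "d \<in> carrier (K0 Q R)"
    and "transition_system Q (dim_fibre Q R d) (Cb Q R) (simple_disk_sum Q R) M T"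
    and "transition_system Q (proj_fibre Q R Ps d) (Pb Q R Ps) acyclic_cplx N U"
    and "natural_embedding Q R Ps d T U \<phi>"
  shows "\<exists>\<phi>'. \<phi>' \<in> Cb_limit Q R d T \<rightarrow> Pb_limit Q R Ps d U \<and>
      (\<forall>dd\<in>dim_fibre Q R d.
         constructible_into_Pb_limit Q R Ps d U dd (\<lambda>X. \<phi>' (to_Cb_limit Q R d T dd X))) \<and>
      inverse_on_quotients
        (Pb_limit Q R Ps d U) (limit_qis Q R (Pb_limit Q R Ps d U))
        (Cb_limit Q R d T) (limit_qis Q R (Cb_limit Q R d T)) \<phi> \<phi>'"
proof -
  interpret fgd_quiver Q R Ps using assms(1-3) by (intro fgd_quiver.intro fgd_quiver_axioms.intro)
  interpret limit_pair Q R Ps d M T N U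
    by (intro limit_pair.intro fgd_quiver_axioms limit_system_Cb[OF assms(5)] limit_system_Pb[OF assms(6)])
  show ?thesis unfolding Cb_limit_def Pb_limit_def to_Cb_limit_def
    using psi_in constructible inverse[OF assms(7)] by (intro exI[of _ psi]) auto
qed

end
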